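(* Let $\mathbf{Q}=(Q_1,Q_2)$ be a pair of real quadratic forms in three variables with $\mathfrak{d}_{3,2}(\mathbf{Q})=3$. For any $R\ge1$, any ball $B_R\subset\mathbb{R}^5$ of radius $R$, any $\epsilon>0$ and any $f\in L^2([0,1]^3)$ the following hold, with implied constants independent of $R$ and $f$. (1) If $(\mathfrak{d}_{3,1}(\mathbf{Q}),\mathfrak{d}_{2,2}(\mathbf{Q}))\in\{(1,1),(1,2),(2,0)\}$, then $$\|E^{\mathbf{Q}}f\|_{L^6(B_R)}\lesssim_\epsilon R^\epsilon\|f\|_{L^2}.$$ (2) (Case $\mathfrak{d}_{3,1}(\mathbf{Q})=2$, $\mathfrak{d}_{2,2}(\mathbf{Q})=1$.) If $\mathbf{Q}=(\xi_1\xi_2,\ \xi_2^2+\xi_1\xi_3)$, then $$\|E^{\mathbf{Q}}f\|_{L^{16/3}(B_R)}\lesssim_\epsilon R^\epsilon\|f\|_{L^2};$$ if $\mathbf{Q}=(\xi_1\xi_2,\ \xi_1^2\pm\xi_3^2)$ (either sign), then $$\|E^{\mathbf{Q}}f\|_{L^5(B_R)}\lesssim_\epsilon R^\epsilon\|f\|_{L^2}.$$ (3) If $\mathfrak{d}_{3,1}(\mathbf{Q})=2$ and $\mathfrak{d}_{2,2}(\mathbf{Q})=2$, then $$\|E^{\mathbf{Q}}f\|_{L^{14/3}(B_R)}\lesssim\|f\|_{L^2}.$$ Moreover, the estimates in (1) and (2) are sharp up to the endpoints, and the estimate in (3) is sharp. That is: in (1) and (2), with $q_0$ the stated exponent ($6$,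 $16/3$, $5$ respectively), for any $1\le q<q_0$ the inequality $\|E^{\mathbf{Q}}f\|_{L^q(B_R)}\lesssim_\epsilon R^\epsilon\|f\|_{L^2}$ does not hold for all $\epsilon>0$, $R\ge1$ and $f$; and in (3) for any $1\le q<14/3$ the inequality $\|E^{\mathbf{Q}}f\|_{L^q(B_R)}\lesssim\|f\|_{L^2}$ does not hold for all $R\ge1$ and $f$.
   Context: For an $n$-tuple $\mathbf{Q}=(Q_1,\dots,Q_n)$ of real quadratic forms in $d$ variables, $\mathrm{NV}(\mathbf{Q})$ is the number of indices $1\le d'\le d$ such that $\partial_{\xi_{d'}}Q_{n'}\not\equiv0$ for some $1\le n'\le n$. For $0\le d'\le d$ and $0\le n'\le n$, $$\mathfrak{d}_{d',n'}(\mathbf{Q}):=\inf_{M\in\mathbb{R}^{d\times d},\ \mathrm{rank}(M)=d'}\ \ \inf_{M'\in\mathbb{R}^{n'\times n},\ \mathrm{rank}(M')=n'}\mathrm{NV}\big(M'\cdot(\mathbf{Q}\circ M)\big),$$ where $(\mathbf{Q}\circ M)(\xi)=\mathbf{Q}(M\xi)$ and $M'\cdot(\mathbf{Q}\circ M)$ is the $n'$-tuple of forms obtained by applying $M'$ to the column vector of the components of $\mathbf{Q}\circ M$. Here $d=3$, $n=2$. The extension operator is $$E^{\mathbf{Q}}f(x,y)=\int_{[0,1]^3}e^{2\pi i(x\cdot\xi+y\cdot\mathbf{Q}(\xi))}f(\xi)\,d\xi,\qquad(x,y)\in\mathbb{R}^3\times\mathbb{R}^2.$$ *)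

theory Defs
  imports "HOL-Analysis.Analysis"
begin

text \<open>A tuple of \<open>n\<close> forms in \<open>d\<close> variables is a map \<^typ>\<open>real^'d \<Rightarrow> real^'n\<close>.\<close>

definition quadratic_form :: "(real^'d \<Rightarrow> real) \<Rightarrow> bool" where
  "quadratic_form q \<longleftrightarrow>
     (\<exists>a :: 'd \<Rightarrow> 'd \<Rightarrow> real. \<forall>\<xi>. q \<xi> = (\<Sum>i\<in>UNIV. \<Sum>j\<in>UNIV. a i j * \<xi> $ i * \<xi> $ j))"

definition partial_derivative :: "'d \<Rightarrow> (real^'d \<Rightarrow> real) \<Rightarrow> real^'d \<Rightarrow> real" where
  "partial_derivative i q \<xi> = deriv (\<lambda>t. q (\<xi> + t *\<^sub>R axis i 1)) 0"

definition NV :: "(real^'d \<Rightarrow> real^'n) \<Rightarrow> nat" where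
  "NV Q = card {i. \<exists>j. \<exists>\<xi>. partial_derivative i (\<lambda>\<eta>. Q \<eta> $ j) \<xi> \<noteq> 0}"

text \<open>
  The number \<open>n'\<close> of rows of \<open>M'\<close> is given by the index type: \<open>frak_d TYPE('m) d' Q\<close> is
  \<open>\<dd>\<^bsub>d',n'\<^esub>(Q)\<close> with \<open>n' = CARD('m) \<ge> 1\<close>. For \<open>d' \<le> CARD('d)\<close> and \<open>n' \<le> CARD('n)\<close> both
  infima are over nonempty sets of natural numbers, hence are minima.
\<close>

definition frak_d :: "'m::finite itself \<Rightarrow> nat \<Rightarrow> (real^'d \<Rightarrow> real^'n) \<Rightarrow> nat" where
  "frak_d _ d' Q =
     (INF M \<in> {M :: real^'d^'d. rank M = d'}.
        INF M' \<in> {M' :: real^'n^'m. rank M' = CARD('m)}.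
          NV (\<lambda>\<xi>. M' *v Q (M *v \<xi>)))"

definition unit_cube :: "(real^'d) set" where
  "unit_cube = cbox 0 1"

text \<open>The extended value \<open>\<infinity>\<close> avoids the convention that a divergent Bochner integral is \<open>0\<close>.\<close>

definition Lp_norm :: "real \<Rightarrow> 'a::euclidean_space set \<Rightarrow> ('a \<Rightarrow> complex) \<Rightarrow> ennreal" where
  "Lp_norm p S g =
     (let I = (\<integral>\<^sup>+ x. ennreal (norm (g x) powr p) \<partial>lebesgue_on S)
      in if I = \<infinity> then \<infinity> else ennreal (enn2real I powr (1 / p)))"

definition Lp_space :: "real \<Rightarrow> 'a::euclidean_space set \<Rightarrow> ('a \<Rightarrow> complex) set" where
  "Lp_space p S = {g \<in> borel_measurable (lebesgue_on S). Lp_norm p S g < \<infinity>}"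

definition extension_op ::
  "(real^'d \<Rightarrow> real^'n) \<Rightarrow> (real^'d \<Rightarrow> complex) \<Rightarrow> (real^'d) \<times> (real^'n) \<Rightarrow> complex" where
  "extension_op Q f = (\<lambda>(x, y).
     LINT \<xi>|lebesgue_on unit_cube.
       exp (2 * of_real pi * \<i> * of_real (x \<bullet> \<xi> + y \<bullet> Q \<xi>)) * f \<xi>)"

text \<open>
  The product type carries the Euclidean norm, so \<open>ball z R\<close> is a Euclidean ball of
  \<open>\<real>\<^sup>d \<times> \<real>\<^sup>n\<close>. The implied constant may depend on \<open>Q\<close>, \<open>q\<close> (and \<open>\<epsilon>\<close>), but not on the radius,
  the centre of the ball, or \<open>f\<close>.
\<close>

definition extension_estimate_eps :: "(real^'d \<Rightarrow> real^'n) \<Rightarrow> real \<Rightarrow> bool" where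
  "extension_estimate_eps Q q \<longleftrightarrow>
     (\<forall>\<epsilon>>0. \<exists>C::real. \<forall>R\<ge>1. \<forall>z. \<forall>f \<in> Lp_space 2 unit_cube.
        Lp_norm q (ball z R) (extension_op Q f) \<le> ennreal (C * R powr \<epsilon>) * Lp_norm 2 unit_cube f)"

definition extension_estimate :: "(real^'d \<Rightarrow> real^'n) \<Rightarrow> real \<Rightarrow> bool" where
  "extension_estimate Q q \<longleftrightarrow>
     (\<exists>C::real. \<forall>R\<ge>1. \<forall>z. \<forall>f \<in> Lp_space 2 unit_cube.
        Lp_norm q (ball z R) (extension_op Q f) \<le> ennreal C * Lp_norm 2 unit_cube f)"

end

theory Submission
  imports Defs "HOL-Probability.Probability"
begin

text \<open>
  Upper bounds: by the \<open>TT\<^sup>*\<close> method, \<open>E\<close> is bounded from \<open>L\<^sup>2\<close> to \<open>L\<^sup>q\<close> as soon as the Gaussian-weighted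
  oscillatory kernel \<open>K\<close> satisfies \<open>\<bar>K (x, y)\<bar> \<le> \<kappa> y\<close> with \<open>\<kappa>\<^bsup>(q - 2) / 2\<^esup>\<close> in weak \<open>L\<^sup>1\<close>: interpolate in \<open>x\<close>
  for fixed \<open>y\<close>, then apply Hardy--Littlewood--Sobolev in the two variables \<open>y\<close>; a logarithmic loss in the
  weak norm costs \<open>R\<^bsup>\<epsilon>\<^esup>\<close>. The kernel is controlled by determinants built from the Gram matrix
  of \<open>y \<bullet> Q\<close>. If \<open>\<dd>\<^bsub>3,1\<^esub> = 1\<close> or \<open>\<dd>\<^bsub>2,2\<^esub> = 0\<close>, suitable minors are products of two independent linear forms in \<open>y\<close>.
  If \<open>\<dd>\<^bsub>3,1\<^esub> = \<dd>\<^bsub>2,2\<^esub> = 2\<close>, the full determinant is a binary cubic whose real roots are simple, hence its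
  sublevel sets \<open>{\<bar>det\<bar> < \<mu>}\<close> have measure \<open>O(\<mu>\<^bsup>2 / 3\<^esup>)\<close> and no loss occurs.

  Lower bounds: Knapp examples on anisotropic boxes adapted to the forms.
\<close>

section \<open>Gaussian integrals\<close>

text \<open>The exponent \<open>(q - 2) / 2\<close> arises as follows. Interpolating |K| \<le>
  \<kappa> with the L^2 bound turns \<kappa> into \<kappa>^(1 - 2/q), and the diagonal
  Hardy-Littlewood-Sobolev inequality, from the conjugate exponent to L^q, needs this function in
  weak L^(q/2). As |K|^2 times a minor is bounded, two independent linear factors l1, l2 give
  \<kappa>^2 of size 1/|l1 l2|, which is in weak L^1 up to a logarithm exactly at q = 6; the full
  determinant gives \<kappa> of size |det|^(-1/2), and |det|^(-2/3) corresponds to q = 14/3. The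
  Gaussian weight is bounded below on the cube, so it costs a constant, and it makes the kernel
  absolutely convergent. The obstacle in the generic case is a multiple real root of the
  determinant. It would produce a nonzero member of the pencil of rank at most one, or independent
  u, u' with P u u = P u u' = 0, where P is the polarisation of the pair; the values 2 and 2 of the
  two invariants exclude these. The invariants are therefore translated into statements about
  vectors and P, on which upper and lower bounds both rest.\<close>

lemma integral_lborel_translation:
  fixes f :: "'a::euclidean_space \<Rightarrow> 'b::{banach, second_countable_topology}"
  assumes [measurable]: "f \<in> borel_measurable borel"
  shows "integral\<^sup>L lborel (\<lambda>x. f (c + x)) = integral\<^sup>L lborel f"
proof -
  have "integral\<^sup>L lborel f = integral\<^sup>L (distr lborel borel ((+) c)) f"
    by (simp add: lborel_distr_plus)
  also have "\<dots> = integral\<^sup>L lborel (\<lambda>x. f (c + x))"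
    by (subst integral_distr) auto
  finally show ?thesis ..
qed

lemma nn_integral_lborel_translation:
  fixes f :: "'a::euclidean_space \<Rightarrow> ennreal"
  assumes [measurable]: "f \<in> borel_measurable borel"
  shows "(\<integral>\<^sup>+x. f (c + x) \<partial>lborel) = integral\<^sup>N lborel f"
proof -
  have "integral\<^sup>N lborel f = integral\<^sup>N (distr lborel borel ((+) c)) f"
    by (simp add: lborel_distr_plus)
  also have "\<dots> = (\<integral>\<^sup>+x. f (c + x) \<partial>lborel)"
    by (subst nn_integral_distr) auto
  finally show ?thesis ..
qed

lemma cis_borel_measurable [measurable]: "cis \<in> borel_measurable borel"
  by (intro borel_measurable_continuous_onI continuous_intros)

lemma cnj_borel_measurable [measurable]: "cnj \<in> borel_measurable borel"
  by (intro borel_measurable_continuous_onI continuous_intros)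

lemma gaussian_fourier_real:
  fixes s b :: real
  assumes s: "s > 0"
  shows "(\<integral>x. complex_of_real (exp (- (s * x\<^sup>2))) * cis (b * x) \<partial>lborel) =
    complex_of_real (sqrt (pi / s) * exp (- (b\<^sup>2 / (4 * s))))"
    and "integrable lborel (\<lambda>x. complex_of_real (exp (- (s * x\<^sup>2))) * cis (b * x))"
proof -
  \<comment> \<open>Scaling by \<open>c\<close> carries exp(-x^2/2) to exp(-s x^2), so the
    characteristic function of the standard normal law gives the integral.\<close>
  define c where "c = sqrt (2 * s)"
  have c: "c > 0" "c\<^sup>2 = 2 * s" using s by (auto simp: c_def)
  let ?f = "\<lambda>x. std_normal_density x *\<^sub>R iexp ((b / c) * x)"
  have 1: "integral\<^sup>L lborel ?f = complex_of_real (exp (- ((b / c)\<^sup>2) / 2))"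
    using char_std_normal_distribution[THEN fun_cong, of "b / c"] unfolding char_def
    by (subst (asm) integral_density) auto
  have fc: "?f (0 + c * x) = complex_of_real (1 / sqrt (2 * pi)) * (complex_of_real (exp (- (s * x\<^sup>2))) * cis (b * x))" for x
    using c by (simp add: std_normal_density_def power_mult_distrib scaleR_conv_of_real cis_conv_exp)
  have "integral\<^sup>L lborel ?f = \<bar>c\<bar> *\<^sub>R (\<integral>x. ?f (0 + c * x) \<partial>lborel)"
    using c by (intro lborel_integral_real_affine) auto
  then have 2: "integral\<^sup>L lborel ?f = complex_of_real (c / sqrt (2 * pi)) *
      (\<integral>x. complex_of_real (exp (- (s * x\<^sup>2))) * cis (b * x) \<partial>lborel)"
    unfolding fc using c by (simp add: scaleR_conv_of_real)
  have e: "(b / c)\<^sup>2 / 2 = b\<^sup>2 / (4 * s)" using c s by (simp add: power_divide)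
  have k: "sqrt (pi / s) * (c / sqrt (2 * pi)) = 1"
    using s by (simp add: c_def real_sqrt_divide real_sqrt_mult field_simps)
  have "(\<integral>x. complex_of_real (exp (- (s * x\<^sup>2))) * cis (b * x) \<partial>lborel) =
     complex_of_real (sqrt (pi / s) * (c / sqrt (2 * pi))) * (\<integral>x. complex_of_real (exp (- (s * x\<^sup>2))) * cis (b * x) \<partial>lborel)"
    unfolding k by simp
  also have "\<dots> = complex_of_real (sqrt (pi / s)) * integral\<^sup>L lborel ?f"
    unfolding 2 by simp
  also have "\<dots> = complex_of_real (sqrt (pi / s) * exp (- (b\<^sup>2 / (4 * s))))"
    unfolding 1 using e by simp
  finally show "(\<integral>x. complex_of_real (exp (- (s * x\<^sup>2))) * cis (b * x) \<partial>lborel) =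
    complex_of_real (sqrt (pi / s) * exp (- (b\<^sup>2 / (4 * s))))" .
  \<comment> \<open>The integral of a non-integrable function is 0 by convention, so a nonzero value
    already proves integrability.\<close>
  then show "integrable lborel (\<lambda>x. complex_of_real (exp (- (s * x\<^sup>2))) * cis (b * x))"
    using s not_integrable_integral_eq by fastforce
qed

text \<open>Gaussian and character both factor over an orthonormal basis, and Lebesgue measure is
  the image of the product measure over that basis.\<close>

lemma gaussian_fourier:
  fixes b :: "'a::euclidean_space" and s :: real
  assumes s: "s > 0"
  shows "(\<integral>w. complex_of_real (exp (- (s * (norm w)\<^sup>2))) * cis (b \<bullet> w) \<partial>lborel) =
    complex_of_real (sqrt (pi / s) ^ DIM('a) * exp (- ((norm b)\<^sup>2 / (4 * s))))"
proof -
  interpret product_sigma_finite "\<lambda>_::'a. lborel :: real measure" ..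
  let ?g = "\<lambda>i x. complex_of_real (exp (- (s * x\<^sup>2))) * cis ((b \<bullet> i) * x)"
  have n2: "(norm v)\<^sup>2 = (\<Sum>i\<in>Basis. (v \<bullet> i)\<^sup>2)" for v :: 'a
    by (subst power2_norm_eq_inner, subst euclidean_inner) (simp add: power2_eq_square)
  have cisum: "cis (\<Sum>i\<in>A. g i) = (\<Prod>i\<in>A. cis (g i))" if "finite A" for A and g :: "'a \<Rightarrow> real"
    using that by (induction A rule: finite_induct) (auto simp: cis_mult[symmetric])
  have exsum: "exp (- (s * (\<Sum>i\<in>A. g i))) = (\<Prod>i\<in>A. exp (- (s * g i)))" if "finite A" for A and g :: "'a \<Rightarrow> real"
    using that by (simp add: exp_sum[symmetric] sum_distrib_left sum_negf)
  have "complex_of_real (exp (- (s * (norm w)\<^sup>2))) * cis (b \<bullet> w) = (\<Prod>i\<in>Basis. ?g i (w \<bullet> i))" for w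
    unfolding n2 by (subst euclidean_inner) (simp add: cisum exsum prod.distrib)
  then have "(\<integral>w. complex_of_real (exp (- (s * (norm w)\<^sup>2))) * cis (b \<bullet> w) \<partial>lborel) =
     (\<integral>w. (\<Prod>i\<in>Basis. ?g i (w \<bullet> i)) \<partial>(lborel :: 'a measure))" by simp
  also have "\<dots> = (\<integral>f. (\<Prod>i\<in>Basis. ?g i ((\<Sum>b\<in>Basis. f b *\<^sub>R b) \<bullet> i)) \<partial>(\<Pi>\<^sub>M b\<in>Basis. lborel))"
    by (subst lborel_eq, subst integral_distr) auto
  also have "\<dots> = (\<integral>f. (\<Prod>i\<in>Basis. ?g i (f i)) \<partial>(\<Pi>\<^sub>M b\<in>Basis. lborel))"
    by (intro Bochner_Integration.integral_cong prod.cong refl)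
       (simp add: inner_sum_left inner_Basis if_distrib cong: if_cong)
  also have "\<dots> = (\<Prod>i\<in>Basis. integral\<^sup>L lborel (?g i))"
    using gaussian_fourier_real(2)[OF s] by (intro product_integral_prod) auto
  also have "\<dots> = (\<Prod>i\<in>(Basis::'a set). complex_of_real (sqrt (pi / s) * exp (- ((b \<bullet> i)\<^sup>2 / (4 * s)))))"
    by (simp add: gaussian_fourier_real(1)[OF s])
  also have "\<dots> = complex_of_real (sqrt (pi / s) ^ DIM('a) * exp (- ((norm b)\<^sup>2 / (4 * s))))"
    unfolding n2 by (simp add: prod.distrib exp_sum[symmetric] sum_negf sum_divide_distrib flip: of_real_prod)
  finally show ?thesis .
qed

lemma gaussian_integrable:
  fixes s :: real
  assumes s: "s > 0"
  shows "integrable lborel (\<lambda>w::'a::euclidean_space. exp (- (s * (norm w)\<^sup>2)))"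
    and "integral\<^sup>L lborel (\<lambda>w::'a. exp (- (s * (norm w)\<^sup>2))) = sqrt (pi / s) ^ DIM('a)"
proof -
  have *: "integral\<^sup>L lborel (\<lambda>w::'a. complex_of_real (exp (- (s * (norm w)\<^sup>2)))) = complex_of_real (sqrt (pi / s) ^ DIM('a))"
    using gaussian_fourier[OF s, of "0::'a"] by simp
  then have "integrable lborel (\<lambda>w::'a. complex_of_real (exp (- (s * (norm w)\<^sup>2))))"
    using s not_integrable_integral_eq by fastforce
  then show "integrable lborel (\<lambda>w::'a. exp (- (s * (norm w)\<^sup>2)))"
    using complex_of_real_integrable_eq by blast
  show "integral\<^sup>L lborel (\<lambda>w::'a. exp (- (s * (norm w)\<^sup>2))) = sqrt (pi / s) ^ DIM('a)"
    using * by (simp flip: of_real_power)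
qed

lemma nn_integral_gaussian:
  fixes s :: real
  assumes s: "s > 0"
  shows "integral\<^sup>N lborel (\<lambda>w::'a::euclidean_space. ennreal (exp (- (s * (norm w)\<^sup>2)))) = ennreal (sqrt (pi / s) ^ DIM('a))"
  using gaussian_integrable[OF s, where 'a='a] by (subst nn_integral_eq_integral) auto

section \<open>Fubini's theorem under product majorants\<close>

lemma integrable_pair_prod_bound:
  fixes \<phi> :: "'a::euclidean_space \<times> 'b::euclidean_space \<Rightarrow> 'c::{banach, second_countable_topology}"
    and a :: "'a \<Rightarrow> real" and b :: "'b \<Rightarrow> real"
  assumes a: "integrable lborel a" and b: "integrable lborel b"
    and [measurable]: "\<phi> \<in> borel_measurable borel"
    and le: "\<And>x y. norm (\<phi> (x, y)) \<le> a x * b y"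
  shows "integrable (lborel \<Otimes>\<^sub>M lborel) \<phi>"
proof -
  have [measurable]: "a \<in> borel_measurable borel" "b \<in> borel_measurable borel" using a b by auto
  have "integrable (lborel \<Otimes>\<^sub>M lborel) (\<lambda>(x, y). a x * b y)"
  proof (rule lborel_pair.Fubini_integrable)
    have "(\<lambda>p. a (fst p) * b (snd p)) \<in> borel_measurable (borel \<Otimes>\<^sub>M borel)" by measurable
    then show "(\<lambda>(x, y). a x * b y) \<in> borel_measurable (lborel \<Otimes>\<^sub>M lborel)"
      by (simp add: case_prod_beta')
    show "integrable lborel (\<lambda>x. LINT y|lborel. norm (case (x, y) of (x, y) \<Rightarrow> a x * b y))"
      using a by (simp add: abs_mult)
    show "AE x in lborel. integrable lborel (\<lambda>y. case (x, y) of (x, y) \<Rightarrow> a x * b y)"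
      using b by simp
  qed
  then show ?thesis
  proof (rule Bochner_Integration.integrable_bound)
    show "\<phi> \<in> borel_measurable (lborel \<Otimes>\<^sub>M lborel)" unfolding lborel_prod by simp
    show "AE x in lborel \<Otimes>\<^sub>M lborel. norm (\<phi> x) \<le> norm (case x of (x, y) \<Rightarrow> a x * b y)"
      using le by (auto intro!: always_eventually order_trans[OF le])
  qed
qed

text \<open>Most interchanges of complex integrals below take this form: the integrand is dominated
  by a product of two integrable functions, one in each variable.\<close>

lemma lborel_Fubini_bound:
  fixes \<phi> :: "'a::euclidean_space \<Rightarrow> 'b::euclidean_space \<Rightarrow> complex"
    and a :: "'a \<Rightarrow> real" and b :: "'b \<Rightarrow> real"
  assumes a: "integrable lborel a" and b: "integrable lborel b"
    and m: "(\<lambda>p. \<phi> (fst p) (snd p)) \<in> borel_measurable borel"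
    and le: "\<And>x y. norm (\<phi> x y) \<le> a x * b y"
  shows "(\<integral>x. (\<integral>y. \<phi> x y \<partial>lborel) \<partial>lborel) = (\<integral>y. (\<integral>x. \<phi> x y \<partial>lborel) \<partial>lborel)"
    and "integrable lborel (\<lambda>x. \<integral>y. \<phi> x y \<partial>lborel)"
    and "integrable lborel (\<lambda>y. \<integral>x. \<phi> x y \<partial>lborel)"
proof -
  have i: "integrable (lborel \<Otimes>\<^sub>M lborel) (\<lambda>(x, y). \<phi> x y)"
    using m le by (intro integrable_pair_prod_bound[OF a b]) (auto simp: case_prod_beta')
  show "(\<integral>x. (\<integral>y. \<phi> x y \<partial>lborel) \<partial>lborel) = (\<integral>y. (\<integral>x. \<phi> x y \<partial>lborel) \<partial>lborel)"
    using lborel_pair.Fubini_integral[OF i] by simp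
  show "integrable lborel (\<lambda>x. \<integral>y. \<phi> x y \<partial>lborel)"
    using lborel_pair.integrable_fst[OF i] by simp
  show "integrable lborel (\<lambda>y. \<integral>x. \<phi> x y \<partial>lborel)"
    using lborel_pair.integrable_snd[OF i] by simp
qed

text \<open>Squaring the oscillatory integral and substituting \<open>\<xi> = w + u/2\<close>, \<open>\<eta> = w - u/2\<close> makes the
  phase linear in \<open>w\<close>, so no diagonalisation of the quadratic form is needed.\<close>

lemma gaussian_quadratic_phase:
  fixes x :: "'a::euclidean_space" and \<psi> :: "'a \<Rightarrow> real" and L :: "'a \<Rightarrow> 'a"
  assumes [measurable]: "\<psi> \<in> borel_measurable borel" "L \<in> borel_measurable borel"
    and \<psi>: "\<And>w u. \<psi> (w + u /\<^sub>R 2) - \<psi> (w - u /\<^sub>R 2) = 2 * (w \<bullet> L u)"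
  shows "(norm (\<integral>\<xi>. complex_of_real (exp (- (norm \<xi>)\<^sup>2)) * cis (2 * pi * (x \<bullet> \<xi> + \<psi> \<xi>)) \<partial>lborel))\<^sup>2
    \<le> sqrt (pi / 2) ^ DIM('a) * (\<integral>u. exp (- ((norm u)\<^sup>2 / 2) - 2 * pi\<^sup>2 * (norm (L u))\<^sup>2) \<partial>lborel)"
proof -
  define \<phi> where "\<phi> \<xi> = complex_of_real (exp (- (norm \<xi>)\<^sup>2)) * cis (2 * pi * (x \<bullet> \<xi> + \<psi> \<xi>))" for \<xi>
  have \<phi>m[measurable]: "\<phi> \<in> borel_measurable borel" unfolding \<phi>_def[abs_def] by measurable
  have n\<phi>: "norm (\<phi> \<xi>) = exp (- (norm \<xi>)\<^sup>2)" for \<xi> unfolding \<phi>_def by (simp add: norm_mult)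
  let ?K = "integral\<^sup>L lborel \<phi>"
  have par: "(norm (w + u /\<^sub>R 2))\<^sup>2 + (norm (w - u /\<^sub>R 2))\<^sup>2 = 2 * (norm w)\<^sup>2 + (norm u)\<^sup>2 / 2" for w u :: 'a
    by (simp add: power2_norm_eq_inner algebra_simps inner_commute)
  \<comment> \<open>The weights 1/2 and 1/4 give something away so that the majorant splits into a
    factor in \<eta> and a factor in \<open>u\<close>, as Fubini requires.\<close>
  have par2: "(norm (\<eta> + u))\<^sup>2 + (norm \<eta>)\<^sup>2 \<ge> (norm \<eta>)\<^sup>2 / 2 + (norm u)\<^sup>2 / 4" for \<eta> u :: 'a
  proof -
    have "0 \<le> (norm (3 *\<^sub>R u + 4 *\<^sub>R \<eta>))\<^sup>2" by simp
    then have "0 \<le> 9 * (u \<bullet> u) + 16 * (\<eta> \<bullet> \<eta>) + 24 * (\<eta> \<bullet> u)"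
      by (simp add: power2_norm_eq_inner algebra_simps inner_commute)
    moreover have "(norm (\<eta> + u))\<^sup>2 = \<eta> \<bullet> \<eta> + 2 * (\<eta> \<bullet> u) + u \<bullet> u"
      by (simp add: power2_norm_eq_inner algebra_simps inner_commute)
    ultimately show ?thesis
      using inner_ge_zero[of \<eta>] unfolding power2_norm_eq_inner[of \<eta>] power2_norm_eq_inner[of u] by linarith
  qed
  have g: "integrable lborel (\<lambda>w::'a. exp (- (s * (norm w)\<^sup>2)))" if "s > 0" for s :: real
    using gaussian_integrable(1)[OF that] .
  have "complex_of_real ((norm ?K)\<^sup>2) = ?K * cnj ?K"
    by (rule complex_norm_square)
  also have "\<dots> = (\<integral>\<eta>. ?K * cnj (\<phi> \<eta>) \<partial>lborel)"
    by (simp add: integral_cnj)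
  also have "\<dots> = (\<integral>\<eta>. (\<integral>u. \<phi> (\<eta> + u) \<partial>lborel) * cnj (\<phi> \<eta>) \<partial>lborel)"
    by (subst integral_lborel_translation) auto
  also have "\<dots> = (\<integral>\<eta>. (\<integral>u. \<phi> (\<eta> + u) * cnj (\<phi> \<eta>) \<partial>lborel) \<partial>lborel)"
    by simp
  also have "\<dots> = (\<integral>u. (\<integral>\<eta>. \<phi> (\<eta> + u) * cnj (\<phi> \<eta>) \<partial>lborel) \<partial>lborel)"
  proof (rule lborel_Fubini_bound(1)[OF g[of "1/2"] g[of "1/4"]])
    have "(\<lambda>p. \<phi> (fst p + snd p) * cnj (\<phi> (fst p))) \<in> borel_measurable (borel \<Otimes>\<^sub>M borel)"
      by measurable
    then show "(\<lambda>p. \<phi> (fst p + snd p) * cnj (\<phi> (fst p))) \<in> borel_measurable borel"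
      by (simp add: borel_prod)
    show "norm (\<phi> (\<eta> + u) * cnj (\<phi> \<eta>)) \<le> exp (- (1 / 2 * (norm \<eta>)\<^sup>2)) * exp (- (1 / 4 * (norm u)\<^sup>2))" for \<eta> u
      using par2[of \<eta> u] by (simp add: norm_mult n\<phi> flip: exp_add)
  qed simp_all
  also have "\<dots> = (\<integral>u. complex_of_real (sqrt (pi / 2) ^ DIM('a) * exp (- ((norm u)\<^sup>2 / 2) - 2 * pi\<^sup>2 * (norm (L u))\<^sup>2)) * cis (2 * pi * (x \<bullet> u)) \<partial>lborel)"
  proof (rule Bochner_Integration.integral_cong[OF refl])
    fix u
    have "(\<integral>\<eta>. \<phi> (\<eta> + u) * cnj (\<phi> \<eta>) \<partial>lborel) = (\<integral>w. \<phi> ((- (u /\<^sub>R 2) + w) + u) * cnj (\<phi> (- (u /\<^sub>R 2) + w)) \<partial>lborel)"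
      by (rule integral_lborel_translation[symmetric]) measurable
    also have "\<dots> = (\<integral>w. \<phi> (w + u /\<^sub>R 2) * cnj (\<phi> (w - u /\<^sub>R 2)) \<partial>lborel)"
    proof -
      have 1: "- (u /\<^sub>R 2) + w = w - u /\<^sub>R 2" for w by simp
      have "u - u /\<^sub>R 2 = u /\<^sub>R 2"
        by (metis scaleR_half_double add_diff_cancel_left' divideR_right inverse_eq_divide scaleR_right_distrib)
      then have 2: "w - u /\<^sub>R 2 + u = w + u /\<^sub>R 2" for w
        by (metis add_diff_eq add.commute diff_add_eq)
      show ?thesis by (simp only: 1 2)
    qed
    also have "\<dots> = (\<integral>w. (complex_of_real (exp (- ((norm u)\<^sup>2 / 2))) * cis (2 * pi * (x \<bullet> u))) *
         (complex_of_real (exp (- (2 * (norm w)\<^sup>2))) * cis ((4 * pi) *\<^sub>R L u \<bullet> w)) \<partial>lborel)"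
    proof (rule Bochner_Integration.integral_cong[OF refl])
      fix w :: 'a
      have ex: "exp (- (2 * (norm w)\<^sup>2 + (norm u)\<^sup>2 / 2)) = exp (- ((norm u)\<^sup>2 / 2)) * exp (- (2 * (norm w)\<^sup>2))"
        by (simp flip: exp_add)
      have "\<phi> (w + u /\<^sub>R 2) * cnj (\<phi> (w - u /\<^sub>R 2)) =
        complex_of_real (exp (- ((norm (w + u /\<^sub>R 2))\<^sup>2 + (norm (w - u /\<^sub>R 2))\<^sup>2))) *
        cis (2 * pi * (x \<bullet> (w + u /\<^sub>R 2) + \<psi> (w + u /\<^sub>R 2)) - 2 * pi * (x \<bullet> (w - u /\<^sub>R 2) + \<psi> (w - u /\<^sub>R 2)))"
        unfolding \<phi>_def by (simp add: cis_cnj exp_add[symmetric] cis_mult mult_ac flip: of_real_mult)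
      also have "2 * pi * (x \<bullet> (w + u /\<^sub>R 2) + \<psi> (w + u /\<^sub>R 2)) - 2 * pi * (x \<bullet> (w - u /\<^sub>R 2) + \<psi> (w - u /\<^sub>R 2))
         = 2 * pi * (x \<bullet> u) + 2 * pi * (\<psi> (w + u /\<^sub>R 2) - \<psi> (w - u /\<^sub>R 2))"
        by (simp add: algebra_simps)
      also have "\<dots> = 2 * pi * (x \<bullet> u) + (4 * pi) *\<^sub>R L u \<bullet> w"
        unfolding \<psi> by (simp add: inner_commute)
      finally show "\<phi> (w + u /\<^sub>R 2) * cnj (\<phi> (w - u /\<^sub>R 2)) = (complex_of_real (exp (- ((norm u)\<^sup>2 / 2))) * cis (2 * pi * (x \<bullet> u))) *
         (complex_of_real (exp (- (2 * (norm w)\<^sup>2))) * cis ((4 * pi) *\<^sub>R L u \<bullet> w))"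
        unfolding par ex by (simp only: of_real_mult cis_mult[symmetric] mult_ac)
    qed
    also have "\<dots> = complex_of_real (exp (- ((norm u)\<^sup>2 / 2))) * cis (2 * pi * (x \<bullet> u)) *
        complex_of_real (sqrt (pi / 2) ^ DIM('a) * exp (- ((norm ((4 * pi) *\<^sub>R L u))\<^sup>2 / (4 * 2))))"
      by (subst integral_mult_right_zero) (simp only: gaussian_fourier[OF zero_less_numeral])
    also have "\<dots> = complex_of_real (sqrt (pi / 2) ^ DIM('a) * exp (- ((norm u)\<^sup>2 / 2) - 2 * pi\<^sup>2 * (norm (L u))\<^sup>2)) * cis (2 * pi * (x \<bullet> u))"
    proof -
      have n: "(norm ((4 * pi) *\<^sub>R L u))\<^sup>2 / (4 * 2) = 2 * pi\<^sup>2 * (norm (L u))\<^sup>2"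
        by (simp add: power_mult_distrib)
      have "exp (- ((norm u)\<^sup>2 / 2) - 2 * pi\<^sup>2 * (norm (L u))\<^sup>2) =
          exp (- ((norm u)\<^sup>2 / 2)) * exp (- (2 * pi\<^sup>2 * (norm (L u))\<^sup>2))"
        by (simp flip: exp_add)
      then show ?thesis unfolding n by (simp only: of_real_mult mult_ac)
    qed
    finally show "(\<integral>\<eta>. \<phi> (\<eta> + u) * cnj (\<phi> \<eta>) \<partial>lborel) = \<dots>" .
  qed
  finally have "(norm ?K)\<^sup>2 = norm (\<integral>u. complex_of_real (sqrt (pi / 2) ^ DIM('a) * exp (- ((norm u)\<^sup>2 / 2) - 2 * pi\<^sup>2 * (norm (L u))\<^sup>2)) * cis (2 * pi * (x \<bullet> u)) \<partial>lborel)"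
    by (metis norm_of_real abs_power2)
  \<comment> \<open>The only trace of \<open>x\<close> left is a unimodular factor; the triangle
    inequality removes it, which is why the bound is uniform in \<open>x\<close>.\<close>
  also have "\<dots> \<le> (\<integral>u. sqrt (pi / 2) ^ DIM('a) * exp (- ((norm u)\<^sup>2 / 2) - 2 * pi\<^sup>2 * (norm (L u))\<^sup>2) \<partial>lborel)"
    by (rule order_trans[OF integral_norm_bound]) (simp add: norm_mult norm_power)
  finally show ?thesis unfolding \<phi>_def[abs_def] by simp
qed

section \<open>Weak Young inequality\<close>

text \<open>Lebesgue measure is determined by its values on boxes. The preimage of a box under
  \<open>N\<close> is its image under the inverse matrix, so its volume carries the factor 1/|det N|
  that the density cancels.\<close>

lemma lborel_linear_image:
  fixes N :: "real^'n::{finite,wellorder}^'n::_"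
  assumes N: "det N \<noteq> 0"
  shows "lborel = density (distr lborel borel ((*v) N)) (\<lambda>_. ennreal \<bar>det N\<bar>)"
proof (rule lborel_eqI)
  obtain N' where N': "N ** N' = mat 1" "N' ** N = mat 1"
    using N invertible_det_nz[of N] unfolding invertible_def by blast
  have [measurable]: "(*v) N \<in> borel_measurable borel"
    by (intro borel_measurable_continuous_onI linear_continuous_on) simp
  fix l u :: "real^'n::_" assume le: "\<And>b. b \<in> Basis \<Longrightarrow> l \<bullet> b \<le> u \<bullet> b"
  have pre: "(*v) N -` box l u = (*v) N' ` box l u"
  proof -
    have "N *v (N' *v v) = v" "N' *v (N *v v) = v" for v
      using N' by (simp_all add: matrix_vector_mul_assoc)
    then show ?thesis
      by (intro equalityI subsetI) (metis image_eqI vimageD, auto)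
  qed
  have d: "det N * det N' = 1" using N' by (metis det_mul det_I)
  have m: "box l u \<in> lmeasurable" by simp
  have lin: "linear ((*v) N')" by simp
  have "emeasure lborel ((*v) N -` box l u) = emeasure lebesgue ((*v) N' ` box l u)"
    unfolding pre[symmetric] using measurable_sets[of "(*v) N" borel borel "box l u"]
    by simp
  also have "\<dots> = ennreal (measure lebesgue ((*v) N' ` box l u))"
    using measurable_linear_image[OF lin m] by (simp add: emeasure_eq_measure2)
  also have "\<dots> = ennreal (\<bar>det N'\<bar> * (\<Prod>b\<in>Basis. (u - l) \<bullet> b))"
    using measure_linear_image[OF lin m] le by (simp add: measure_lborel_box)
  finally have e: "emeasure lborel ((*v) N -` box l u) = ennreal (\<bar>det N'\<bar> * (\<Prod>b\<in>Basis. (u - l) \<bullet> b))" .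
  have "emeasure (density (distr lborel borel ((*v) N)) (\<lambda>_. ennreal \<bar>det N\<bar>)) (box l u) =
    ennreal \<bar>det N\<bar> * emeasure lborel ((*v) N -` box l u)"
    by (simp add: emeasure_density emeasure_distr nn_integral_cmult)
  also have "\<dots> = ennreal ((\<bar>det N\<bar> * \<bar>det N'\<bar>) * (\<Prod>b\<in>Basis. (u - l) \<bullet> b))"
    unfolding e by (simp add: ennreal_mult'[symmetric] mult.assoc)
  also have "\<bar>det N\<bar> * \<bar>det N'\<bar> = 1" using d by (simp flip: abs_mult)
  finally show "emeasure (density (distr lborel borel ((*v) N)) (\<lambda>_. ennreal \<bar>det N\<bar>)) (box l u) = (\<Prod>b\<in>Basis. (u - l) \<bullet> b)"
    by simp
qed simp

lemma nn_integral_linear_image: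
  fixes N :: "real^'n::{finite,wellorder}^'n::_" and f :: "real^'n::_ \<Rightarrow> ennreal"
  assumes N: "det N \<noteq> 0" and [measurable]: "f \<in> borel_measurable borel"
  shows "(\<integral>\<^sup>+u. f (N *v u) \<partial>lborel) = ennreal (1 / \<bar>det N\<bar>) * integral\<^sup>N lborel f"
proof -
  have [measurable]: "(*v) N \<in> borel_measurable borel"
    by (intro borel_measurable_continuous_onI linear_continuous_on) simp
  have "integral\<^sup>N lborel f = ennreal \<bar>det N\<bar> * (\<integral>\<^sup>+u. f (N *v u) \<partial>lborel)"
    by (subst lborel_linear_image[OF N]) (simp add: nn_integral_density nn_integral_distr nn_integral_cmult)
  moreover have "ennreal (1 / \<bar>det N\<bar>) * ennreal \<bar>det N\<bar> = 1"
    using N by (simp add: ennreal_mult'[symmetric])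
  ultimately show ?thesis by (metis mult.assoc mult_1)
qed

lemma emeasure_linear_vimage:
  fixes N :: "real^'n::{finite,wellorder}^'n::_" and A :: "(real^'n::_) set"
  assumes N: "det N \<noteq> 0" and [measurable]: "A \<in> sets borel"
  shows "emeasure lborel {u. N *v u \<in> A} = ennreal (1 / \<bar>det N\<bar>) * emeasure lborel A"
proof -
  have [measurable]: "(*v) N \<in> borel_measurable borel"
    by (intro borel_measurable_continuous_onI linear_continuous_on) simp
  have "{u. N *v u \<in> A} = (*v) N -` A" by auto
  then have [measurable]: "{u. N *v u \<in> A} \<in> sets borel"
    using measurable_sets[of "(*v) N" borel borel A] by simp
  have "emeasure lborel {u. N *v u \<in> A} = (\<integral>\<^sup>+u. indicator A (N *v u) \<partial>lborel)"
  proof -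
    have "emeasure lborel {u. N *v u \<in> A} = (\<integral>\<^sup>+u. indicator {u. N *v u \<in> A} u \<partial>lborel)" by simp
    then show ?thesis by (simp add: indicator_def)
  qed
  also have "\<dots> = ennreal (1 / \<bar>det N\<bar>) * emeasure lborel A"
    by (subst nn_integral_linear_image[OF N]) auto
  finally show ?thesis .
qed

section \<open>Layers, tails and weak-type bounds\<close>

lemma nn_integral_powr_layer:
  fixes r T :: real
  assumes "r > -1" "T \<ge> 0"
  shows "(\<integral>\<^sup>+s. ennreal (s powr r) * indicator {0<..<T} s \<partial>lborel) = ennreal (T powr (r + 1) / (r + 1))"
proof (cases "T = 0")
  case False
  then have T: "T > 0" using assms by simp
  have "((\<lambda>s. s powr r) has_integral (T powr (r+1) / (r+1))) {0..T}"
    using has_integral_powr_from_0[of r T] assms by simp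
  then have hi: "((\<lambda>s. s powr r) has_integral (T powr (r+1) / (r+1))) {0<..<T}"
    using has_integral_open_interval[of "\<lambda>s. s powr r" _ 0 T] by simp
  show ?thesis by (rule nn_integral_has_integral_lebesgue'[OF _ hi]) simp
qed simp

lemma nn_integral_powr_tail:
  fixes r c :: real
  assumes "r < -1" "c > 0"
  shows "(\<integral>\<^sup>+s. ennreal (s powr r) * indicator {c..} s \<partial>lborel) = ennreal (c powr (r + 1) / (- r - 1))"
proof -
  have hi: "((\<lambda>s. s powr r) has_integral (- (c powr (r+1)) / (r+1))) {c..}"
    using has_integral_powr_to_inf[of r c] assms by simp
  have "(\<integral>\<^sup>+s. ennreal (s powr r) * indicator {c..} s \<partial>lborel) = ennreal (- (c powr (r + 1)) / (r + 1))"
    by (rule nn_integral_has_integral_lebesgue'[OF _ hi]) simp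
  moreover have "- (c powr (r + 1)) / (r + 1) = c powr (r + 1) / (- r - 1)" using assms by (simp add: field_simps)
  ultimately show ?thesis by simp
qed

lemma nn_integral_lborel_reflect:
  fixes f :: "'a::euclidean_space \<Rightarrow> ennreal"
  assumes [measurable]: "f \<in> borel_measurable borel"
  shows "(\<integral>\<^sup>+x. f (c - x) \<partial>lborel) = integral\<^sup>N lborel f"
proof -
  have "integral\<^sup>N lborel f = integral\<^sup>N (density (distr lborel borel (\<lambda>x. c + (-1) *\<^sub>R x)) (\<lambda>_. ennreal (\<bar>-1\<bar> ^ DIM('a)))) f"
    by (subst lborel_affine[of "-1" c]) auto
  also have "\<dots> = (\<integral>\<^sup>+x. f (c - x) \<partial>lborel)"
    by (simp add: nn_integral_density nn_integral_distr)
  finally show ?thesis ..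
qed

lemma ennreal_eq_layer:
  "0 \<le> x \<Longrightarrow> ennreal x = (\<integral>\<^sup>+c. indicator {0<..<x} c \<partial>lborel)"
  by simp

lemma emeasure_Chebyshev_powr:
  fixes u :: "'b::euclidean_space \<Rightarrow> real"
  assumes [measurable]: "u \<in> borel_measurable borel" and u: "\<And>y. 0 \<le> u y"
    and p: "p > 0" and s: "s > 0" and N: "(\<integral>\<^sup>+y. ennreal (u y powr p) \<partial>lborel) \<le> ennreal N" "N \<ge> 0"
  shows "emeasure lborel {y. s < u y} \<le> ennreal (N * s powr - p)"
proof -
  have "emeasure lborel {y. s < u y} = (\<integral>\<^sup>+y. indicator {y. s < u y} y \<partial>lborel)"
    by (subst nn_integral_indicator) auto
  also have "\<dots> \<le> (\<integral>\<^sup>+y. ennreal (s powr - p) * ennreal (u y powr p) \<partial>lborel)"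
  proof (rule nn_integral_mono)
    fix y
    show "indicator {y. s < u y} y \<le> ennreal (s powr - p) * ennreal (u y powr p)"
    proof (cases "s < u y")
      case True
      then have "1 \<le> s powr - p * u y powr p"
        using s p powr_mono2[of p s "u y"] by (simp add: powr_minus field_simps)
      then show ?thesis using True by (simp add: ennreal_mult'[symmetric] ennreal_leI flip: ennreal_1)
    qed simp
  qed
  also have "\<dots> = ennreal (s powr - p) * (\<integral>\<^sup>+y. ennreal (u y powr p) \<partial>lborel)"
    by (rule nn_integral_cmult) measurable
  also have "\<dots> \<le> ennreal (s powr - p) * ennreal N"
    using N by (intro mult_left_mono) auto
  also have "\<dots> = ennreal (N * s powr - p)"
    using N by (simp add: ennreal_mult'[symmetric] mult.commute)
  finally show ?thesis .
qed

text \<open>Integrating over the layers of \<open>k\<close>, the low layers meet \<open>F\<close> in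
  measure at most \<open>m\<close> and the high layers are controlled by the weak bound; \<rho> > 1
  makes the tail integrable.\<close>

lemma nn_integral_kernel_indicator:
  fixes k :: "'b::euclidean_space \<Rightarrow> real"
  assumes [measurable]: "k \<in> borel_measurable borel" and k0: "\<And>y. 0 \<le> k y"
    and \<rho>: "\<rho> > 1" and W: "W > 0"
    and weak: "\<And>c. c > 0 \<Longrightarrow> emeasure lborel {y. k y > c} \<le> ennreal (W * c powr - \<rho>)"
    and [measurable]: "F \<in> sets borel" and m: "emeasure lborel F \<le> ennreal m" "m > 0"
  shows "(\<integral>\<^sup>+y'. ennreal (k (y - y')) * indicator F y' \<partial>lborel)
    \<le> ennreal (\<rho> / (\<rho> - 1) * W powr (1 / \<rho>) * m powr (1 - 1 / \<rho>))"
proof -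
  \<comment> \<open>The height at which the two bounds agree:
    \<open>W * c0 powr - \<rho> = m\<close>.\<close>
  define c0 where "c0 = (W / m) powr (1 / \<rho>)"
  have c0: "c0 > 0" using W m by (simp add: c0_def)
  have 1: "c0 * m = W powr (1 / \<rho>) * m powr (1 - 1 / \<rho>)"
    using W m \<rho> by (simp add: c0_def powr_divide powr_diff)
  have "c0 powr \<rho> = W / m" using W m \<rho> by (simp add: c0_def powr_powr)
  then have 2: "W * c0 powr (1 - \<rho>) = c0 * m"
    using W m c0 by (simp add: powr_diff)
  have "(\<integral>\<^sup>+y'. ennreal (k (y - y')) * indicator F y' \<partial>lborel)
     = (\<integral>\<^sup>+y'. (\<integral>\<^sup>+c. indicator {0<..<k (y - y')} c * indicator F y' \<partial>lborel) \<partial>lborel)"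
    using k0 by (subst ennreal_eq_layer) (auto simp: nn_integral_multc)
  also have "\<dots> = (\<integral>\<^sup>+c. (\<integral>\<^sup>+y'. indicator {0<..<k (y - y')} c * indicator F y' \<partial>lborel) \<partial>lborel)"
  proof (rule lborel_pair.Fubini'[symmetric])
    have "(\<lambda>(y', c). (if 0 < c \<and> c < k (y - y') then 1 else 0) * indicator F y' :: ennreal) \<in> borel_measurable (borel \<Otimes>\<^sub>M borel)"
      by measurable
    then show "(\<lambda>(y', c). indicator {0<..<k (y - y')} c * indicator F y' :: ennreal) \<in> borel_measurable (lborel \<Otimes>\<^sub>M lborel)"
      by (simp add: indicator_def of_bool_def cong: if_cong)
  qed
  also have "\<dots> \<le> (\<integral>\<^sup>+c. ennreal m * indicator {0<..<c0} c + ennreal W * (ennreal (c powr - \<rho>) * indicator {c0..} c) \<partial>lborel)"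
  proof (rule nn_integral_mono)
    fix c :: real
    let ?I = "\<integral>\<^sup>+y'. indicator {0<..<k (y - y')} c * indicator F y' \<partial>lborel"
    have "?I \<le> (\<integral>\<^sup>+y'. indicator F y' \<partial>lborel)"
      by (intro nn_integral_mono) (auto simp: indicator_def)
    then have A: "?I \<le> ennreal m" using m by simp
    have B: "?I \<le> ennreal (W * c powr - \<rho>)" if "c > 0"
    proof -
      have "?I \<le> (\<integral>\<^sup>+y'. indicator {y. k y > c} (y - y') \<partial>lborel)"
        by (intro nn_integral_mono) (auto simp: indicator_def)
      also have "\<dots> = emeasure lborel {y. k y > c}"
        by (subst nn_integral_lborel_reflect) auto
      finally show ?thesis using weak[OF that] by simp
    qed
    show "?I \<le> ennreal m * indicator {0<..<c0} c + ennreal W * (ennreal (c powr - \<rho>) * indicator {c0..} c)"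
    proof (cases "c > 0")
      case True
      then show ?thesis using A B W by (cases "c < c0") (auto simp: ennreal_mult')
    next
      case False
      then show ?thesis by (simp add: indicator_def)
    qed
  qed
  also have "\<dots> = ennreal m * ennreal c0 + ennreal W * ennreal (c0 powr (- \<rho> + 1) / (\<rho> - 1))"
    using c0 \<rho> by (simp add: nn_integral_add nn_integral_cmult nn_integral_powr_tail)
  also have "\<dots> = ennreal (c0 * m + W * c0 powr (1 - \<rho>) / (\<rho> - 1))"
    using c0 m W \<rho> by (simp add: ennreal_mult'[symmetric] ennreal_plus[symmetric] algebra_simps del: ennreal_plus)
  also have "c0 * m + W * c0 powr (1 - \<rho>) / (\<rho> - 1) = \<rho> / (\<rho> - 1) * (c0 * m)"
    unfolding 2 using \<rho> by (simp add: field_simps)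
  finally show ?thesis unfolding 1 by (simp add: mult.assoc)
qed

text \<open>Layer-cake proof of the diagonal case of the weak Young (Hardy--Littlewood--Sobolev) inequality;
  after splitting according to the larger of \<open>u y\<close>, \<open>u y'\<close>, Chebyshev's inequality suffices.\<close>

lemma weak_young:
  fixes k u :: "'b::euclidean_space \<Rightarrow> real"
  assumes km[measurable]: "k \<in> borel_measurable borel" and k0: "\<And>y. 0 \<le> k y" and even: "\<And>y. k (- y) = k y"
    and q: "q > 2" and p: "p = q / (q - 1)" and W: "W > 0"
    and weak: "\<And>c. c > 0 \<Longrightarrow> emeasure lborel {y. k y > c} \<le> ennreal (W * c powr - (q / 2))"
    and um[measurable]: "u \<in> borel_measurable borel" and u0: "\<And>y. 0 \<le> u y"
    and N: "(\<integral>\<^sup>+y. ennreal (u y powr p) \<partial>lborel) \<le> ennreal N" "N > 0"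
  shows "(\<integral>\<^sup>+y. \<integral>\<^sup>+y'. ennreal (k (y - y') * u y * u y') \<partial>lborel \<partial>lborel)
    \<le> ennreal (2 * (q - 1) * (q / (q - 2)) * W powr (2 / q) * N powr (2 - 2 / q))"
proof -
  define a where "a = 2 / q"
  define C where "C = q / (q - 2) * W powr a * N powr (1 - a)"
  have p0: "p > 1" using q unfolding p by (simp add: less_divide_eq)
  have a: "0 < a" "a < 1" using q by (auto simp: a_def)
  \<comment> \<open>Chebyshev's inequality for the level sets of \<open>u\<close> produces s to the
    power -p (1 - a). This identity shows that the power is p - 2, which exceeds -1, so the layers
    can be integrated down to 0.\<close>
  have pa: "p * (1 - a) = 1 - (p - 1)" using q by (simp add: p a_def field_simps)
  have C: "C \<ge> 0" using q by (simp add: C_def)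
  \<comment> \<open>Counts the pairs whose larger value is \<open>u y\<close>. As \<open>k\<close>
    is even, \<open>A y' y\<close> covers the opposite pairs; ties are counted twice.\<close>
  define A where "A y y' = ennreal (k (y - y')) * (ennreal (u y) * (ennreal (u y') * (if u y' \<le> u y then 1 else 0)))" for y y'
  have Am: "(\<lambda>(y, y'). A y y') \<in> borel_measurable (lborel \<Otimes>\<^sub>M lborel)" 
  proof -
    have "(\<lambda>(y, y'). A y y') \<in> borel_measurable (borel \<Otimes>\<^sub>M borel)" unfolding A_def by measurable
    then show ?thesis by simp
  qed
  then have Am': "(\<lambda>(y', y). A y y') \<in> borel_measurable (lborel \<Otimes>\<^sub>M lborel)"
    using measurable_pair_swap by fastforce
  have [measurable]: "(\<lambda>y'. A y y') \<in> borel_measurable borel" "(\<lambda>y'. A y' y) \<in> borel_measurable borel" for y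
    unfolding A_def by measurable
  \<comment> \<open>With T = \<open>u y\<close> as a cap, the layers s < T of \<open>u y'\<close>
    contribute C T^(p-1)/(p-1). The outer factor T raises this to the power p, and 1/(p - 1) = q -
    1.\<close>
  have inner: "(\<integral>\<^sup>+y'. A y y' \<partial>lborel) \<le> ennreal ((q - 1) * C) * ennreal (u y powr p)" for y
  proof (cases "u y = 0")
    case True then show ?thesis by (simp add: A_def)
  next
    case False
    define T where "T = u y"
    have T: "T > 0" using False u0[of y] by (simp add: T_def)
    have TA: "(\<integral>\<^sup>+y'. A y y' \<partial>lborel) = ennreal T * (\<integral>\<^sup>+y'. ennreal (k (y - y')) * (ennreal (u y') * (if u y' \<le> T then 1 else 0)) \<partial>lborel)"
      unfolding A_def T_def by (subst nn_integral_cmult[symmetric]) (auto simp: mult_ac)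
    have "(\<integral>\<^sup>+y'. ennreal (k (y - y')) * (ennreal (u y') * (if u y' \<le> T then 1 else 0)) \<partial>lborel)
       \<le> (\<integral>\<^sup>+y'. \<integral>\<^sup>+s. ennreal (k (y - y')) * (indicator {0<..<T} s * (if s < u y' then 1 else 0)) \<partial>lborel \<partial>lborel)"
    proof (rule nn_integral_mono)
      fix y'
      have "ennreal (u y') * (if u y' \<le> T then 1 else 0) \<le> (\<integral>\<^sup>+s. indicator {0<..<T} s * (if s < u y' then 1 else 0) \<partial>lborel)"
      proof (cases "u y' \<le> T")
        case True
        have "ennreal (u y') = (\<integral>\<^sup>+s. indicator {0<..<u y'} s \<partial>lborel)" by (rule ennreal_eq_layer[OF u0])
        also have "\<dots> \<le> (\<integral>\<^sup>+s. indicator {0<..<T} s * (if s < u y' then 1 else 0) \<partial>lborel)"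
          using True by (intro nn_integral_mono) (auto simp: indicator_def)
        finally show ?thesis using True by simp
      qed simp
      then show "ennreal (k (y - y')) * (ennreal (u y') * (if u y' \<le> T then 1 else 0)) \<le>
        (\<integral>\<^sup>+s. ennreal (k (y - y')) * (indicator {0<..<T} s * (if s < u y' then 1 else 0)) \<partial>lborel)"
        by (subst nn_integral_cmult) (auto intro: mult_left_mono)
    qed
    also have "\<dots> = (\<integral>\<^sup>+s. \<integral>\<^sup>+y'. ennreal (k (y - y')) * (indicator {0<..<T} s * (if s < u y' then 1 else 0)) \<partial>lborel \<partial>lborel)"
    proof (rule lborel_pair.Fubini'[symmetric])
      have "(\<lambda>(y', s). ennreal (k (y - y')) * ((if 0 < s \<and> s < T then 1 else 0) * (if s < u y' then 1 else 0))) \<in> borel_measurable (borel \<Otimes>\<^sub>M borel)"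
        by measurable
      then show "(\<lambda>(y', s). ennreal (k (y - y')) * (indicator {0<..<T} s * (if s < u y' then 1 else 0))) \<in> borel_measurable (lborel \<Otimes>\<^sub>M lborel)"
        by (simp add: indicator_def of_bool_def cong: if_cong)
    qed
    also have "\<dots> \<le> (\<integral>\<^sup>+s. ennreal C * (ennreal (s powr (p - 2)) * indicator {0<..<T} s) \<partial>lborel)"
    proof (rule nn_integral_mono)
      fix s :: real
      show "(\<integral>\<^sup>+y'. ennreal (k (y - y')) * (indicator {0<..<T} s * (if s < u y' then 1 else 0)) \<partial>lborel) \<le> ennreal C * (ennreal (s powr (p - 2)) * indicator {0<..<T} s)"
      proof (cases "s \<in> {0<..<T}")
        case True
        then have s: "s > 0" by simp
        have "(\<integral>\<^sup>+y'. ennreal (k (y - y')) * indicator {y'. s < u y'} y' \<partial>lborel)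
           \<le> ennreal ((q/2) / (q/2 - 1) * W powr (1 / (q/2)) * (N * s powr - p) powr (1 - 1 / (q/2)))"
        proof (rule nn_integral_kernel_indicator[OF km k0 _ W weak])
          show "emeasure lborel {y'. s < u y'} \<le> ennreal (N * s powr - p)"
            using p0 N(2) by (intro emeasure_Chebyshev_powr[OF um u0 _ s N(1)]) auto
        qed (use q N(2) s in auto)
        also have "(q/2) / (q/2 - 1) * W powr (1 / (q/2)) * (N * s powr - p) powr (1 - 1 / (q/2)) = C * s powr (p - 2)"
        proof -
          have "(N * s powr - p) powr (1 - a) = N powr (1 - a) * s powr (- (p * (1 - a)))"
            using N s by (simp add: powr_mult powr_powr)
          also have "- (p * (1 - a)) = p - 2" unfolding pa by simp
          finally have "(N * s powr - p) powr (1 - a) = N powr (1 - a) * s powr (p - 2)" .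
          moreover have "(q/2) / (q/2 - 1) = q / (q - 2)" using q by (simp add: field_simps)
          ultimately show ?thesis by (simp add: C_def a_def)
        qed
        finally show ?thesis using True C by (simp add: indicator_def of_bool_def ennreal_mult')
      qed simp
    qed
    also have "\<dots> = ennreal C * ennreal (T powr (p - 1) / (p - 1))"
      using T p0 nn_integral_powr_layer[of "p - 2" T] by (simp add: nn_integral_cmult)
    finally have "(\<integral>\<^sup>+y'. A y y' \<partial>lborel) \<le> ennreal T * (ennreal C * ennreal (T powr (p - 1) / (p - 1)))"
      unfolding TA by (intro mult_left_mono) auto
    also have "\<dots> = ennreal (T * (C * (T powr (p - 1) / (p - 1))))"
      using T C p0 by (simp add: ennreal_mult'[symmetric])
    also have "T * (C * (T powr (p - 1) / (p - 1))) = (q - 1) * C * T powr p"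
    proof -
      have "p - 1 = 1 / (q - 1)" using q unfolding p by (simp add: field_simps)
      then have "1 / (p - 1) = q - 1" by simp
      then have "T * (C * (T powr (p - 1) / (p - 1))) = T * (C * (T powr (p - 1) * (q - 1)))"
        by (metis times_divide_eq_right mult.right_neutral)
      also have "\<dots> = (q - 1) * C * (T powr 1 * T powr (p - 1))"
        using T by simp
      also have "T powr 1 * T powr (p - 1) = T powr p"
        by (simp only: powr_add[symmetric]) simp
      finally show ?thesis .
    qed
    also have "ennreal ((q - 1) * C * T powr p) = ennreal ((q - 1) * C) * ennreal (u y powr p)"
      using C q unfolding T_def by (intro ennreal_mult') simp
    finally show ?thesis .
  qed
  have "(\<integral>\<^sup>+y. \<integral>\<^sup>+y'. ennreal (k (y - y') * u y * u y') \<partial>lborel \<partial>lborel) \<le> (\<integral>\<^sup>+y. (\<integral>\<^sup>+y'. A y y' + A y' y \<partial>lborel) \<partial>lborel)"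
  proof (intro nn_integral_mono)
    fix y y'
    have e: "k (y' - y) = k (y - y')" using even[of "y - y'"] by simp
    show "ennreal (k (y - y') * u y * u y') \<le> A y y' + A y' y"
      unfolding A_def e using k0 u0 by (cases "u y' \<le> u y") (auto simp: ennreal_mult' mult_ac)
  qed
  also have "\<dots> = (\<integral>\<^sup>+y. \<integral>\<^sup>+y'. A y y' \<partial>lborel \<partial>lborel) + (\<integral>\<^sup>+y. \<integral>\<^sup>+y'. A y' y \<partial>lborel \<partial>lborel)"
    using lborel.borel_measurable_nn_integral[OF Am] lborel.borel_measurable_nn_integral[OF Am']
    by (simp add: nn_integral_add)
  also have "(\<integral>\<^sup>+y. \<integral>\<^sup>+y'. A y' y \<partial>lborel \<partial>lborel) = (\<integral>\<^sup>+y. \<integral>\<^sup>+y'. A y y' \<partial>lborel \<partial>lborel)"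
    by (rule lborel_pair.Fubini'[OF Am])
  also have "(\<integral>\<^sup>+y. \<integral>\<^sup>+y'. A y y' \<partial>lborel \<partial>lborel) + (\<integral>\<^sup>+y. \<integral>\<^sup>+y'. A y y' \<partial>lborel \<partial>lborel) = 2 * (\<integral>\<^sup>+y. \<integral>\<^sup>+y'. A y y' \<partial>lborel \<partial>lborel)"
    by (simp add: mult_2)
  finally have I: "(\<integral>\<^sup>+y. \<integral>\<^sup>+y'. ennreal (k (y - y') * u y * u y') \<partial>lborel \<partial>lborel) \<le> 2 * (\<integral>\<^sup>+y. \<integral>\<^sup>+y'. A y y' \<partial>lborel \<partial>lborel)" .
  have "(\<integral>\<^sup>+y. \<integral>\<^sup>+y'. A y y' \<partial>lborel \<partial>lborel) \<le> (\<integral>\<^sup>+y. ennreal ((q - 1) * C) * ennreal (u y powr p) \<partial>lborel)"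
    by (intro nn_integral_mono inner)
  also have "\<dots> = ennreal ((q - 1) * C) * (\<integral>\<^sup>+y. ennreal (u y powr p) \<partial>lborel)"
    by (rule nn_integral_cmult) measurable
  also have "\<dots> \<le> ennreal ((q - 1) * C) * ennreal N"
    using N by (intro mult_left_mono) auto
  finally have "(\<integral>\<^sup>+y. \<integral>\<^sup>+y'. ennreal (k (y - y') * u y * u y') \<partial>lborel \<partial>lborel) \<le> 2 * (ennreal ((q - 1) * C) * ennreal N)"
    by (intro order_trans[OF I] mult_left_mono) auto
  also have "\<dots> = ennreal (2 * ((q - 1) * (C * N)))"
    using C q N by (simp add: ennreal_mult' mult.assoc)
  also have "C * N = q / (q - 2) * W powr a * N powr (2 - a)"
  proof -
    have "N powr (1 - a) * N = N powr (2 - a)"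
      using N powr_add[of N "1 - a" 1] by simp
    then show ?thesis by (simp add: C_def)
  qed
  finally show ?thesis by (simp only: a_def mult.assoc)
qed

section \<open>Interpolation\<close>

text \<open>A class closed under truncation by height, as Marcinkiewicz interpolation requires,
  whose members lie in every L^s, s > 0, so that the integrals below converge absolutely.\<close>

definition test_function :: "('a::euclidean_space \<Rightarrow> complex) \<Rightarrow> bool" where
  "test_function g \<longleftrightarrow> g \<in> borel_measurable borel \<and> (\<exists>B. \<forall>x. norm (g x) \<le> B) \<and> (\<exists>r. \<forall>x. norm x > r \<longrightarrow> g x = 0)"

lemma test_functionI:
  assumes "g \<in> borel_measurable borel" "\<And>x. norm (g x) \<le> B" "\<And>x. norm x > r \<Longrightarrow> g x = 0"
  shows "test_function g"
  using assms unfolding test_function_def by blast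

lemma test_function_measurable: "test_function g \<Longrightarrow> g \<in> borel_measurable borel"
  by (simp add: test_function_def)

lemma test_function_dominated:
  fixes g h :: "'a::euclidean_space \<Rightarrow> complex"
  assumes g: "test_function g" and h: "h \<in> borel_measurable borel" and le: "\<And>x. norm (h x) \<le> C * norm (g x)"
  shows "test_function h"
proof -
  obtain B r where Br: "\<And>x. norm (g x) \<le> B" "\<And>x. norm x > r \<Longrightarrow> g x = 0"
    using g unfolding test_function_def by blast
  have "norm (h x) \<le> \<bar>C\<bar> * B" for x
  proof -
    have "C * norm (g x) \<le> \<bar>C\<bar> * norm (g x)" by (simp add: mult_right_mono)
    also have "\<dots> \<le> \<bar>C\<bar> * B" using Br(1) by (simp add: mult_left_mono)
    finally show ?thesis using le[of x] by linarith
  qed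
  moreover have "h x = 0" if "norm x > r" for x using le[of x] Br(2)[OF that] by simp
  ultimately show ?thesis using h by (intro test_functionI) auto
qed

lemma test_function_powr_integrable:
  fixes g :: "'a::euclidean_space \<Rightarrow> complex"
  assumes g: "test_function g" and s: "s > 0"
  shows "integrable lborel (\<lambda>x. norm (g x) powr s)"
proof -
  obtain B r where B: "\<And>x. norm (g x) \<le> B" and r: "\<And>x. norm x > r \<Longrightarrow> g x = 0"
    using g unfolding test_function_def by blast
  have [measurable]: "g \<in> borel_measurable borel" using g by (rule test_function_measurable)
  have fin: "emeasure lborel (cball 0 r :: 'a set) < \<infinity>" by (intro emeasure_bounded_finite) simp
  have "integrable lborel (\<lambda>x. (B powr s) * indicator (cball 0 r :: 'a set) x)"
    using fin by (intro integrable_mult_right integrable_real_indicator) (auto simp: less_top[symmetric])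
  then show ?thesis
  proof (rule Bochner_Integration.integrable_bound)
    show "AE x in lborel. norm (norm (g x) powr s) \<le> norm (B powr s * indicator (cball 0 r) x)"
    proof (intro AE_I2)
      fix x :: 'a
      show "norm (norm (g x) powr s) \<le> norm (B powr s * indicator (cball 0 r) x)"
        using B[of x] r[of x] s by (cases "norm x \<le> r") (auto intro!: powr_mono2)
    qed
  qed measurable
qed

lemma test_function_integrable:
  assumes g: "test_function g"
  shows "integrable lborel g" "integrable lborel (\<lambda>x. norm (g x))" "integrable lborel (\<lambda>x. (norm (g x))\<^sup>2)"
proof -
  show 1: "integrable lborel (\<lambda>x. norm (g x))" 
    using test_function_powr_integrable[OF g, of 1] by simp
  show "integrable lborel g"
    by (rule Bochner_Integration.integrable_bound[OF 1]) (use g in \<open>auto dest: test_function_measurable\<close>)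
  have "norm (g x) powr 2 = (norm (g x))\<^sup>2" for x by (cases "g x = 0") (auto simp: powr_numeral)
  then show "integrable lborel (\<lambda>x. (norm (g x))\<^sup>2)" 
    using test_function_powr_integrable[OF g, of 2] by simp
qed

text \<open>Marcinkiewicz interpolation between \<open>L\<^sup>1 \<rightarrow> L\<^sup>\<infinity>\<close> and \<open>L\<^sup>2 \<rightarrow> L\<^sup>2\<close>: the height at
  which \<open>h\<close> is cut is chosen such that the tall part contributes at most \<open>\<lambda>/2\<close> pointwise.\<close>

lemma interpolation_L1_L2:
  fixes T :: "('a::euclidean_space \<Rightarrow> complex) \<Rightarrow> 'b::euclidean_space \<Rightarrow> complex"
  assumes add: "\<And>h1 h2 x. test_function h1 \<Longrightarrow> test_function h2 \<Longrightarrow> T (\<lambda>x. h1 x + h2 x) x = T h1 x + T h2 x"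
    and T1: "\<And>h x. test_function h \<Longrightarrow> norm (T h x) \<le> \<kappa> * (\<integral>x. norm (h x) \<partial>lborel)"
    and T2: "\<And>h. test_function h \<Longrightarrow> (\<integral>\<^sup>+x\<in>X. ennreal ((norm (T h x))\<^sup>2) \<partial>lborel) \<le> (\<integral>\<^sup>+x. ennreal ((norm (h x))\<^sup>2) \<partial>lborel)"
    and meas: "\<And>h. test_function h \<Longrightarrow> T h \<in> borel_measurable borel"
    and X[measurable]: "X \<in> sets borel"
    and h: "test_function h"
    and q: "q > 2" and p: "p = q / (q - 1)" and \<kappa>: "\<kappa> > 0"
    and N: "(\<integral>\<^sup>+x. ennreal (norm (h x) powr p) \<partial>lborel) \<le> ennreal N" "N > 0"
  shows "(\<integral>\<^sup>+x\<in>X. ennreal (norm (T h x) powr q) \<partial>lborel)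
     \<le> ennreal (4 * q / (q - 2) * 2 powr (q - 2) * \<kappa> powr (q - 2) * N powr (q - 1))"
proof -
  note [measurable] = test_function_measurable[OF h] meas[OF h]
  have p1: "p > 1" using q unfolding p by (simp add: less_divide_eq)
  have pq: "p - 1 = 1 / (q - 1)" using q unfolding p by (simp add: field_simps)
  \<comment> \<open>The solution of \<open>\<kappa> * (t powr (1 - p) * N) = l / 2\<close>; the
    power q - 1 appears because p - 1 = 1/(q - 1).\<close>
  define t where "t l = (2 * \<kappa> * N / l) powr (q - 1)" for l :: real
  define h1 where "h1 l x = (if norm (h x) < t l then h x else 0)" for l x
  define h2 where "h2 l x = (if norm (h x) < t l then 0 else h x)" for l x
  have [measurable]: "h1 l \<in> borel_measurable borel" "h2 l \<in> borel_measurable borel" for l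
    unfolding h1_def[abs_def] h2_def[abs_def] by measurable
  have tf1: "test_function (h1 l)" for l
    by (rule test_function_dominated[OF h, where C = 1]) (auto simp: h1_def)
  have tf2: "test_function (h2 l)" for l
    by (rule test_function_dominated[OF h, where C = 1]) (auto simp: h2_def)
  have T_split: "T h x = T (h1 l) x + T (h2 l) x" for l x
  proof -
    have "h = (\<lambda>x. h1 l x + h2 l x)" by (auto simp: h1_def h2_def)
    then show ?thesis using add[OF tf1 tf2, of l l x] by simp
  qed
  have N': "(\<integral>x. norm (h x) powr p \<partial>lborel) \<le> N"
  proof -
    have "ennreal (\<integral>x. norm (h x) powr p \<partial>lborel) = (\<integral>\<^sup>+x. ennreal (norm (h x) powr p) \<partial>lborel)"
      using test_function_powr_integrable[OF h, of p] p1 by (subst nn_integral_eq_integral) auto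
    then show ?thesis using N by (metis ennreal_le_iff less_imp_le)
  qed
  have tall: "norm (T (h2 l) x) \<le> l / 2" if l: "l > 0" for l x
  proof -
    have t: "t l > 0" using l \<kappa> N(2) by (simp add: t_def)
    have tp: "t l powr (1 - p) = l / (2 * \<kappa> * N)"
    proof -
      have "1 - p = - (1 / (q - 1))" using pq by simp
      then have "t l powr (1 - p) = (2 * \<kappa> * N / l) powr ((q - 1) * - (1 / (q - 1)))"
        unfolding t_def powr_powr by simp
      also have "(q - 1) * - (1 / (q - 1)) = -1" using q by simp
      finally show ?thesis using l \<kappa> N(2) by (simp add: powr_minus_divide)
    qed
    \<comment> \<open>Where |h| is at least \<open>t l\<close>, the negative power |h|^(1-p) is at
      most t^(1-p). This trades the L^1 norm of the tall part for the p-th power integral of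
      \<open>h\<close>.\<close>
    have "norm (h2 l x) \<le> t l powr (1 - p) * norm (h x) powr p" for x
    proof (cases "norm (h x) < t l")
      case False
      then have hx: "norm (h x) > 0" "t l \<le> norm (h x)" using t by auto
      have "norm (h x) = norm (h x) powr (1 - p) * norm (h x) powr p"
        using hx by (simp flip: powr_add)
      also have "\<dots> \<le> t l powr (1 - p) * norm (h x) powr p"
        using hx t p1 by (intro mult_right_mono powr_mono2') auto
      finally show ?thesis using False by (simp add: h2_def)
    qed (simp add: h2_def)
    then have "(\<integral>x. norm (h2 l x) \<partial>lborel) \<le> (\<integral>x. t l powr (1 - p) * norm (h x) powr p \<partial>lborel)"
      using test_function_powr_integrable[OF h, of p] p1 test_function_integrable(2)[OF tf2]
      by (intro integral_mono) auto
    also have "\<dots> \<le> t l powr (1 - p) * N"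
      using N' by (simp add: mult_left_mono)
    finally have "\<kappa> * (\<integral>x. norm (h2 l x) \<partial>lborel) \<le> \<kappa> * (t l powr (1 - p) * N)"
      using \<kappa> by (intro mult_left_mono) auto
    also have "\<dots> = l / 2" unfolding tp using \<kappa> N(2) by (simp add: field_simps)
    finally show ?thesis using T1[OF tf2, of l x] by linarith
  qed
  \<comment> \<open>If |T h| exceeds l, the short part alone contributes at least l/2, and
    Chebyshev's inequality applies to its L^2 bound.\<close>
  have level: "(\<integral>\<^sup>+x\<in>X. (if l < norm (T h x) then 1 else 0) \<partial>lborel)
      \<le> ennreal (4 / l\<^sup>2) * (\<integral>\<^sup>+x. ennreal ((norm (h x))\<^sup>2) * (if norm (h x) < t l then 1 else 0) \<partial>lborel)" if l: "l > 0" for l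
  proof -
    note [measurable] = meas[OF tf1]
    have "(\<integral>\<^sup>+x\<in>X. (if l < norm (T h x) then 1 else 0) \<partial>lborel) \<le> (\<integral>\<^sup>+x. ennreal (4 / l\<^sup>2) * (ennreal ((norm (T (h1 l) x))\<^sup>2) * indicator X x) \<partial>lborel)"
    proof (rule nn_integral_mono)
      fix x
      have "1 \<le> 4 / l\<^sup>2 * (norm (T (h1 l) x))\<^sup>2" if "l < norm (T h x)"
      proof -
        have "l / 2 \<le> norm (T (h1 l) x)"
          using tall[OF l, of x] norm_triangle_ineq[of "T (h1 l) x" "T (h2 l) x"] that unfolding T_split[of x l] by linarith
        then have "(l / 2)\<^sup>2 \<le> (norm (T (h1 l) x))\<^sup>2" using l by (intro power_mono) auto
        then show ?thesis using l by (simp add: field_simps power_divide)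
      qed
      then show "(if l < norm (T h x) then 1 else 0) * indicator X x \<le> ennreal (4 / l\<^sup>2) * (ennreal ((norm (T (h1 l) x))\<^sup>2) * indicator X x)"
        using l by (auto simp: indicator_def ennreal_mult'[symmetric] ennreal_leI simp flip: ennreal_1)
    qed
    also have "\<dots> = ennreal (4 / l\<^sup>2) * (\<integral>\<^sup>+x\<in>X. ennreal ((norm (T (h1 l) x))\<^sup>2) \<partial>lborel)"
      by (rule nn_integral_cmult) measurable
    also have "\<dots> \<le> ennreal (4 / l\<^sup>2) * (\<integral>\<^sup>+x. ennreal ((norm (h1 l x))\<^sup>2) \<partial>lborel)"
      by (intro mult_left_mono T2 tf1) simp
    also have "(\<integral>\<^sup>+x. ennreal ((norm (h1 l x))\<^sup>2) \<partial>lborel) = (\<integral>\<^sup>+x. ennreal ((norm (h x))\<^sup>2) * (if norm (h x) < t l then 1 else 0) \<partial>lborel)"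
      by (intro nn_integral_cong) (simp add: h1_def)
    finally show ?thesis .
  qed
  have "(\<integral>\<^sup>+x\<in>X. ennreal (norm (T h x) powr q) \<partial>lborel) =
     (\<integral>\<^sup>+x. \<integral>\<^sup>+l. ennreal q * (ennreal (l powr (q - 1)) * (if 0 < l \<and> l < norm (T h x) then 1 else 0) * indicator X x) \<partial>lborel \<partial>lborel)"
  proof (rule nn_integral_cong)
    fix x
    have "ennreal q * (\<integral>\<^sup>+l. ennreal (l powr (q - 1)) * (if 0 < l \<and> l < norm (T h x) then 1 else 0) \<partial>lborel) = ennreal (norm (T h x) powr q)"
    proof -
      have "(\<integral>\<^sup>+l. ennreal (l powr (q - 1)) * (if 0 < l \<and> l < norm (T h x) then 1 else 0) \<partial>lborel) =
         (\<integral>\<^sup>+l. ennreal (l powr (q - 1)) * indicator {0<..<norm (T h x)} l \<partial>lborel)"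
        by (intro nn_integral_cong) (auto simp: indicator_def)
      also have "\<dots> = ennreal (norm (T h x) powr q / q)"
        using q by (subst nn_integral_powr_layer) auto
      finally show ?thesis using q by (simp add: ennreal_mult'[symmetric])
    qed
    then show "ennreal (norm (T h x) powr q) * indicator X x = (\<integral>\<^sup>+l. ennreal q * (ennreal (l powr (q - 1)) * (if 0 < l \<and> l < norm (T h x) then 1 else 0) * indicator X x) \<partial>lborel)"
      by (subst nn_integral_cmult, measurable, subst nn_integral_multc, measurable) (simp add: mult.assoc[symmetric])
  qed
  also have "\<dots> = (\<integral>\<^sup>+l. \<integral>\<^sup>+x. ennreal q * (ennreal (l powr (q - 1)) * (if 0 < l \<and> l < norm (T h x) then 1 else 0) * indicator X x) \<partial>lborel \<partial>lborel)"
  proof (rule lborel_pair.Fubini'[symmetric])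
    have "(\<lambda>(x, l). ennreal q * (ennreal (l powr (q - 1)) * (if 0 < l \<and> l < norm (T h x) then 1 else 0) * indicator X x)) \<in> borel_measurable (borel \<Otimes>\<^sub>M borel)"
      by measurable
    then show "(\<lambda>(x, l). ennreal q * (ennreal (l powr (q - 1)) * (if 0 < l \<and> l < norm (T h x) then 1 else 0) * indicator X x)) \<in> borel_measurable (lborel \<Otimes>\<^sub>M lborel)"
      by simp
  qed
  also have "\<dots> \<le> (\<integral>\<^sup>+l. \<integral>\<^sup>+x. ennreal (4 * q) * (ennreal ((norm (h x))\<^sup>2) * (ennreal (l powr (q - 3)) * (if 0 < l \<and> norm (h x) < t l then 1 else 0))) \<partial>lborel \<partial>lborel)"
  proof (rule nn_integral_mono)
    fix l :: real
    show "(\<integral>\<^sup>+x. ennreal q * (ennreal (l powr (q - 1)) * (if 0 < l \<and> l < norm (T h x) then 1 else 0) * indicator X x) \<partial>lborel)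
      \<le> (\<integral>\<^sup>+x. ennreal (4 * q) * (ennreal ((norm (h x))\<^sup>2) * (ennreal (l powr (q - 3)) * (if 0 < l \<and> norm (h x) < t l then 1 else 0))) \<partial>lborel)"
    proof (cases "l > 0")
      case True
      have "(\<integral>\<^sup>+x. ennreal q * (ennreal (l powr (q - 1)) * (if 0 < l \<and> l < norm (T h x) then 1 else 0) * indicator X x) \<partial>lborel)
         = (\<integral>\<^sup>+x. ennreal (q * l powr (q - 1)) * ((if l < norm (T h x) then 1 else 0) * indicator X x) \<partial>lborel)"
        using True q by (intro nn_integral_cong) (simp add: ennreal_mult' mult.assoc)
      also have "\<dots> = ennreal (q * l powr (q - 1)) * (\<integral>\<^sup>+x\<in>X. (if l < norm (T h x) then 1 else 0) \<partial>lborel)"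
        by (rule nn_integral_cmult) measurable
      also have "\<dots> \<le> ennreal (q * l powr (q - 1)) * (ennreal (4 / l\<^sup>2) * (\<integral>\<^sup>+x. ennreal ((norm (h x))\<^sup>2) * (if norm (h x) < t l then 1 else 0) \<partial>lborel))"
        by (intro mult_left_mono level True) simp
      also have "\<dots> = ennreal (q * l powr (q - 1) * (4 / l\<^sup>2)) * (\<integral>\<^sup>+x. ennreal ((norm (h x))\<^sup>2) * (if norm (h x) < t l then 1 else 0) \<partial>lborel)"
      proof -
        have "ennreal (q * l powr (q - 1) * (4 / l\<^sup>2)) = ennreal (q * l powr (q - 1)) * ennreal (4 / l\<^sup>2)"
          using q by (intro ennreal_mult') simp
        then show ?thesis by (simp only: mult.assoc)
      qed
      also have "q * l powr (q - 1) * (4 / l\<^sup>2) = 4 * q * l powr (q - 3)"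
      proof -
        have "l powr (q - 1) = l powr (q - 3) * l powr 2" by (simp flip: powr_add)
        also have "l powr 2 = l\<^sup>2" using True by (simp add: powr_numeral)
        finally show ?thesis using True by simp
      qed
      also have "ennreal (4 * q * l powr (q - 3)) * (\<integral>\<^sup>+x. ennreal ((norm (h x))\<^sup>2) * (if norm (h x) < t l then 1 else 0) \<partial>lborel)
        = (\<integral>\<^sup>+x. ennreal (4 * q * l powr (q - 3)) * (ennreal ((norm (h x))\<^sup>2) * (if norm (h x) < t l then 1 else 0)) \<partial>lborel)"
        by (rule nn_integral_cmult[symmetric]) measurable
      also have "\<dots> = (\<integral>\<^sup>+x. ennreal (4 * q) * (ennreal ((norm (h x))\<^sup>2) * (ennreal (l powr (q - 3)) * (if 0 < l \<and> norm (h x) < t l then 1 else 0))) \<partial>lborel)"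
        using True q by (intro nn_integral_cong) (simp add: ennreal_mult' mult.assoc mult.left_commute)
      finally show ?thesis .
    qed simp
  qed
  also have "\<dots> = (\<integral>\<^sup>+x. \<integral>\<^sup>+l. ennreal (4 * q) * (ennreal ((norm (h x))\<^sup>2) * (ennreal (l powr (q - 3)) * (if 0 < l \<and> norm (h x) < t l then 1 else 0))) \<partial>lborel \<partial>lborel)"
  proof (rule lborel_pair.Fubini'[symmetric])
    have "(\<lambda>(l, x). ennreal (4 * q) * (ennreal ((norm (h x))\<^sup>2) * (ennreal (l powr (q - 3)) * (if 0 < l \<and> norm (h x) < t l then 1 else 0)))) \<in> borel_measurable (borel \<Otimes>\<^sub>M borel)"
      unfolding t_def by measurable
    then show "(\<lambda>(l, x). ennreal (4 * q) * (ennreal ((norm (h x))\<^sup>2) * (ennreal (l powr (q - 3)) * (if 0 < l \<and> norm (h x) < t l then 1 else 0)))) \<in> borel_measurable (lborel \<Otimes>\<^sub>M lborel)"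
      by simp
  qed
  also have "\<dots> \<le> (\<integral>\<^sup>+x. ennreal (4 * q / (q - 2) * (2 * \<kappa> * N) powr (q - 2)) * ennreal (norm (h x) powr p) \<partial>lborel)"
  proof (rule nn_integral_mono)
    fix x
    define H where "H = norm (h x)"
    \<comment> \<open>The height l at which \<open>t l = H\<close>. The condition
      \<open>H < t l\<close> thus confines l to the interval (0, \<Lambda>), on which l^(q-3) is
      integrable because q > 2.\<close>
    define \<Lambda> where "\<Lambda> = 2 * \<kappa> * N * H powr (- (1 / (q - 1)))"
    have tm: "(\<lambda>l. if 0 < l \<and> H < t l then 1 else 0 :: ennreal) \<in> borel_measurable borel"
      unfolding t_def by measurable
    show "(\<integral>\<^sup>+l. ennreal (4 * q) * (ennreal ((norm (h x))\<^sup>2) * (ennreal (l powr (q - 3)) * (if 0 < l \<and> norm (h x) < t l then 1 else 0))) \<partial>lborel)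
      \<le> ennreal (4 * q / (q - 2) * (2 * \<kappa> * N) powr (q - 2)) * ennreal (norm (h x) powr p)"
    proof (cases "H = 0")
      case True then show ?thesis by (simp add: H_def)
    next
      case False
      then have H: "H > 0" by (simp add: H_def)
      have \<Lambda>: "\<Lambda> > 0" using H \<kappa> N(2) by (simp add: \<Lambda>_def)
      have less: "l < \<Lambda>" if "0 < l" "H < t l" for l
      proof -
        have "H powr (1 / (q - 1)) < t l powr (1 / (q - 1))"
          using that H q by (intro powr_less_mono2) auto
        also have "\<dots> = 2 * \<kappa> * N / l" unfolding t_def powr_powr using q that \<kappa> N(2) by simp
        finally show ?thesis using that H by (simp add: \<Lambda>_def powr_minus field_simps)
      qed
      have "(\<integral>\<^sup>+l. ennreal (4 * q) * (ennreal (H\<^sup>2) * (ennreal (l powr (q - 3)) * (if 0 < l \<and> H < t l then 1 else 0))) \<partial>lborel)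
         \<le> (\<integral>\<^sup>+l. ennreal (4 * q) * (ennreal (H\<^sup>2) * (ennreal (l powr (q - 3)) * indicator {0<..<\<Lambda>} l)) \<partial>lborel)"
        using less by (intro nn_integral_mono mult_left_mono) (auto simp: indicator_def)
      also have "\<dots> = ennreal (4 * q) * (ennreal (H\<^sup>2) * ennreal (\<Lambda> powr (q - 2) / (q - 2)))"
        using \<Lambda> q nn_integral_powr_layer[of "q - 3" \<Lambda>] by (simp add: nn_integral_cmult)
      also have "\<dots> = ennreal (4 * q * (H\<^sup>2 * (\<Lambda> powr (q - 2) / (q - 2))))"
        using q by (simp add: ennreal_mult'[symmetric])
      also have "4 * q * (H\<^sup>2 * (\<Lambda> powr (q - 2) / (q - 2))) = 4 * q / (q - 2) * (2 * \<kappa> * N) powr (q - 2) * H powr p"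
      proof -
        have "\<Lambda> powr (q - 2) = (2 * \<kappa> * N) powr (q - 2) * H powr (- (1 / (q - 1)) * (q - 2))"
          unfolding \<Lambda>_def using \<kappa> N(2) H by (simp add: powr_mult powr_powr)
        moreover have "H\<^sup>2 * H powr (- (1 / (q - 1)) * (q - 2)) = H powr p"
        proof -
          have "H\<^sup>2 * H powr (- (1 / (q - 1)) * (q - 2)) = H powr (2 + - (1 / (q - 1)) * (q - 2))"
            using H by (subst powr_add) (simp add: powr_numeral)
          also have "2 + - (1 / (q - 1)) * (q - 2) = p" using q unfolding p by (simp add: field_simps)
          finally show ?thesis .
        qed
        ultimately show ?thesis by simp
      qed
      finally show ?thesis using q unfolding H_def[symmetric] by (subst ennreal_mult'[symmetric]) auto
    qed
  qed
  also have "\<dots> = ennreal (4 * q / (q - 2) * (2 * \<kappa> * N) powr (q - 2)) * (\<integral>\<^sup>+x. ennreal (norm (h x) powr p) \<partial>lborel)"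
    by (rule nn_integral_cmult) measurable
  also have "\<dots> \<le> ennreal (4 * q / (q - 2) * (2 * \<kappa> * N) powr (q - 2)) * ennreal N"
    using N by (intro mult_left_mono) auto
  also have "\<dots> = ennreal (4 * q / (q - 2) * (2 * \<kappa> * N) powr (q - 2) * N)"
    using q by (subst ennreal_mult') auto
  also have "4 * q / (q - 2) * (2 * \<kappa> * N) powr (q - 2) * N = 4 * q / (q - 2) * 2 powr (q - 2) * \<kappa> powr (q - 2) * N powr (q - 1)"
  proof -
    have "N powr (q - 2) * N = N powr (q - 1)" using N(2) powr_add[of N "q - 2" 1] by simp
    then show ?thesis using \<kappa> N(2) by (simp add: powr_mult)
  qed
  finally show ?thesis .
qed

section \<open>Oscillatory convolution at a fixed time\<close>

text \<open>True without integrability, since the left-hand side is then 0; many integrability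
  checks are saved by passing to nonnegative integrals through it.\<close>

lemma norm_integral_le_nn_integral:
  fixes f :: "'a \<Rightarrow> 'b::{banach, second_countable_topology}"
  shows "ennreal (norm (integral\<^sup>L M f)) \<le> (\<integral>\<^sup>+x. ennreal (norm (f x)) \<partial>M)"
proof (cases "integrable M f")
  case True
  then show ?thesis by (rule integral_norm_bound_ennreal)
qed (simp add: not_integrable_integral_eq)

abbreviation gauss :: "'a::euclidean_space \<Rightarrow> real" where
  "gauss \<xi> \<equiv> exp (- (norm \<xi>)\<^sup>2)"

definition fhat :: "('a::euclidean_space \<Rightarrow> complex) \<Rightarrow> 'a \<Rightarrow> complex" where
  "fhat g \<xi> = (\<integral>x. cis (2 * pi * (x \<bullet> \<xi>)) * g x \<partial>lborel)"

definition phase_kernel :: "('a::euclidean_space \<Rightarrow> real) \<Rightarrow> 'a \<Rightarrow> complex" where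
  "phase_kernel \<psi> v = (\<integral>\<xi>. complex_of_real (gauss \<xi>) * cis (2 * pi * (v \<bullet> \<xi> + \<psi> \<xi>)) \<partial>lborel)"

text \<open>In physical space this is the convolution of \<open>cnj h\<close> with
  \<open>phase_kernel \<psi>\<close>. It is defined on the frequency side, where the Gaussian makes
  the integral converge as soon as \<open>fhat h\<close> is bounded.\<close>

definition phase_op :: "('a::euclidean_space \<Rightarrow> real) \<Rightarrow> ('a \<Rightarrow> complex) \<Rightarrow> 'a \<Rightarrow> complex" where
  "phase_op \<psi> h x = (\<integral>\<xi>. complex_of_real (gauss \<xi>) * cis (2 * pi * (x \<bullet> \<xi> + \<psi> \<xi>)) * cnj (fhat h \<xi>) \<partial>lborel)"

text \<open>The contribution of one pair of slices \<open>y\<close>, \<open>y'\<close> to the square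
  of the dual operator, where \<psi> is the quadratic form obtained by pairing \<open>y - y'\<close>
  with \<open>Q\<close>.\<close>

definition phase_form :: "('a::euclidean_space \<Rightarrow> real) \<Rightarrow> ('a \<Rightarrow> complex) \<Rightarrow> ('a \<Rightarrow> complex) \<Rightarrow> complex" where
  "phase_form \<psi> g h = (\<integral>\<xi>. complex_of_real (gauss \<xi>) * cis (2 * pi * \<psi> \<xi>) * fhat g \<xi> * cnj (fhat h \<xi>) \<partial>lborel)"

lemma gauss_integrable: "integrable lborel (gauss :: 'a::euclidean_space \<Rightarrow> real)"
  using gaussian_integrable(1)[of 1, where 'a='a] by simp

lemma fhat_measurable [measurable]:
  assumes [measurable]: "g \<in> borel_measurable borel"
  shows "fhat g \<in> borel_measurable borel"
  unfolding fhat_def[abs_def] by measurable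

lemma phase_op_measurable:
  assumes [measurable]: "h \<in> borel_measurable borel" "\<psi> \<in> borel_measurable borel"
  shows "phase_op \<psi> h \<in> borel_measurable borel"
  unfolding phase_op_def[abs_def] by measurable

lemma norm_fhat_le: "norm (fhat g \<xi>) \<le> (\<integral>x. norm (g x) \<partial>lborel)"
  unfolding fhat_def by (rule order_trans[OF integral_norm_bound]) (simp add: norm_mult)

lemma cis_mult_integrable:
  assumes "integrable lborel g" and [measurable]: "r \<in> borel_measurable borel"
  shows "integrable lborel (\<lambda>x. cis (r x) * g x)"
proof -
  have [measurable]: "g \<in> borel_measurable borel" using assms(1) by simp
  show ?thesis by (rule Bochner_Integration.integrable_bound[OF assms(1)]) (auto simp: norm_mult)
qed

lemma borel_measurable_pairI:
  fixes f :: "'a::euclidean_space \<times> 'b::euclidean_space \<Rightarrow> 'c::topological_space"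
  shows "f \<in> borel_measurable (borel \<Otimes>\<^sub>M borel) \<Longrightarrow> f \<in> borel_measurable borel"
  by (simp add: borel_prod)

lemma phase_op_conv:
  fixes h :: "'a::euclidean_space \<Rightarrow> complex"
  assumes h: "integrable lborel h" and [measurable]: "\<psi> \<in> borel_measurable borel"
  shows "phase_op \<psi> h x = (\<integral>x'. cnj (h x') * phase_kernel \<psi> (x - x') \<partial>lborel)"
proof -
  have [measurable]: "h \<in> borel_measurable borel" using h by simp
  have "phase_op \<psi> h x = (\<integral>\<xi>. \<integral>x'. complex_of_real (gauss \<xi>) * cis (2 * pi * (x \<bullet> \<xi> + \<psi> \<xi>)) * (cis (- (2 * pi * (x' \<bullet> \<xi>))) * cnj (h x')) \<partial>lborel \<partial>lborel)"
  proof -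
    have "cnj (fhat h \<xi>) = (\<integral>x'. cis (- (2 * pi * (x' \<bullet> \<xi>))) * cnj (h x') \<partial>lborel)" for \<xi>
    proof -
      have "(\<integral>x'. cis (- (2 * pi * (x' \<bullet> \<xi>))) * cnj (h x') \<partial>lborel) = (\<integral>x'. cnj (cis (2 * pi * (x' \<bullet> \<xi>)) * h x') \<partial>lborel)"
        by (simp add: cis_cnj)
      also have "\<dots> = cnj (fhat h \<xi>)" unfolding fhat_def by (rule Bochner_Integration.integral_cnj)
      finally show ?thesis ..
    qed
    then show ?thesis unfolding phase_op_def by simp
  qed
  also have "\<dots> = (\<integral>x'. \<integral>\<xi>. complex_of_real (gauss \<xi>) * cis (2 * pi * (x \<bullet> \<xi> + \<psi> \<xi>)) * (cis (- (2 * pi * (x' \<bullet> \<xi>))) * cnj (h x')) \<partial>lborel \<partial>lborel)"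
    by (rule lborel_Fubini_bound(1)[OF gauss_integrable integrable_norm[OF h]], rule borel_measurable_pairI, measurable)
       (simp add: norm_mult)
  also have "\<dots> = (\<integral>x'. cnj (h x') * phase_kernel \<psi> (x - x') \<partial>lborel)"
  proof (rule Bochner_Integration.integral_cong[OF refl])
    fix x'
    have eq: "complex_of_real (gauss \<xi>) * cis (2 * pi * (x \<bullet> \<xi> + \<psi> \<xi>)) * (cis (- (2 * pi * (x' \<bullet> \<xi>))) * cnj (h x'))
       = cnj (h x') * (complex_of_real (gauss \<xi>) * cis (2 * pi * ((x - x') \<bullet> \<xi> + \<psi> \<xi>)))" for \<xi>
    proof -
      have "2 * pi * ((x - x') \<bullet> \<xi> + \<psi> \<xi>) = 2 * pi * (x \<bullet> \<xi> + \<psi> \<xi>) + - (2 * pi * (x' \<bullet> \<xi>))"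
        by (simp add: algebra_simps)
      then show ?thesis by (simp only: cis_mult[symmetric] mult_ac)
    qed
    show "(\<integral>\<xi>. complex_of_real (gauss \<xi>) * cis (2 * pi * (x \<bullet> \<xi> + \<psi> \<xi>)) * (cis (- (2 * pi * (x' \<bullet> \<xi>))) * cnj (h x')) \<partial>lborel) = cnj (h x') * phase_kernel \<psi> (x - x')"
      unfolding phase_kernel_def eq by (rule integral_mult_right_zero)
  qed
  finally show ?thesis .
qed

lemma norm_phase_op_le:
  fixes h :: "'a::euclidean_space \<Rightarrow> complex"
  assumes h: "integrable lborel h" and \<psi>: "\<psi> \<in> borel_measurable borel"
    and \<kappa>: "\<And>v. norm (phase_kernel \<psi> v) \<le> \<kappa>"
  shows "norm (phase_op \<psi> h x) \<le> \<kappa> * (\<integral>x. norm (h x) \<partial>lborel)"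
proof -
  have "norm (phase_op \<psi> h x) \<le> (\<integral>x'. norm (cnj (h x') * phase_kernel \<psi> (x - x')) \<partial>lborel)"
    unfolding phase_op_conv[OF h \<psi>] by (rule integral_norm_bound)
  also have "\<dots> \<le> (\<integral>x'. \<kappa> * norm (h x') \<partial>lborel)"
  proof (rule integral_mono')
    show "integrable lborel (\<lambda>x'. \<kappa> * norm (h x'))" using h by simp
    show "norm (cnj (h x') * phase_kernel \<psi> (x - x')) \<le> \<kappa> * norm (h x')" for x'
      using mult_right_mono[OF \<kappa>[of "x - x'"], of "norm (h x')"] by (simp add: norm_mult mult.commute)
    show "0 \<le> \<kappa> * norm (h x')" for x' using order_trans[OF norm_ge_zero \<kappa>] by simp
  qed
  finally show ?thesis by simp
qed

text \<open>In physical space the form is a pairing of \<open>g\<close> with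
  \<open>phase_op \<psi> h\<close>, to which Hoelder's inequality applies.\<close>

lemma phase_form_conv:
  fixes g h :: "'a::euclidean_space \<Rightarrow> complex"
  assumes g: "integrable lborel g" and h: "integrable lborel h" and [measurable]: "\<psi> \<in> borel_measurable borel"
  shows "phase_form \<psi> g h = (\<integral>x. g x * phase_op \<psi> h x \<partial>lborel)"
proof -
  have [measurable]: "g \<in> borel_measurable borel" "h \<in> borel_measurable borel" using g h by simp_all
  let ?H = "\<integral>x. norm (h x) \<partial>lborel"
  have "phase_form \<psi> g h = (\<integral>\<xi>. \<integral>x. complex_of_real (gauss \<xi>) * cis (2 * pi * \<psi> \<xi>) * (cis (2 * pi * (x \<bullet> \<xi>)) * g x) * cnj (fhat h \<xi>) \<partial>lborel \<partial>lborel)"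
    unfolding phase_form_def fhat_def[of g] by simp
  also have "\<dots> = (\<integral>x. \<integral>\<xi>. complex_of_real (gauss \<xi>) * cis (2 * pi * \<psi> \<xi>) * (cis (2 * pi * (x \<bullet> \<xi>)) * g x) * cnj (fhat h \<xi>) \<partial>lborel \<partial>lborel)"
  proof (rule lborel_Fubini_bound(1)[OF gauss_integrable integrable_mult_left[OF integrable_norm[OF g], of ?H]])
    show "(\<lambda>p. complex_of_real (gauss (fst p)) * cis (2 * pi * \<psi> (fst p)) * (cis (2 * pi * (snd p \<bullet> fst p)) * g (snd p)) * cnj (fhat h (fst p))) \<in> borel_measurable borel"
      by (rule borel_measurable_pairI) measurable
    show "norm (complex_of_real (gauss \<xi>) * cis (2 * pi * \<psi> \<xi>) * (cis (2 * pi * (x \<bullet> \<xi>)) * g x) * cnj (fhat h \<xi>)) \<le> gauss \<xi> * (norm (g x) * ?H)" for \<xi> x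
      using mult_left_mono[OF norm_fhat_le[of h \<xi>], of "gauss \<xi> * norm (g x)"] by (simp add: norm_mult mult.assoc)
  qed
  also have "\<dots> = (\<integral>x. g x * phase_op \<psi> h x \<partial>lborel)"
  proof (rule Bochner_Integration.integral_cong[OF refl])
    fix x
    have eq: "complex_of_real (gauss \<xi>) * cis (2 * pi * \<psi> \<xi>) * (cis (2 * pi * (x \<bullet> \<xi>)) * g x) * cnj (fhat h \<xi>) =
      g x * (complex_of_real (gauss \<xi>) * cis (2 * pi * (x \<bullet> \<xi> + \<psi> \<xi>)) * cnj (fhat h \<xi>))" for \<xi>
      by (simp only: distrib_left cis_mult[symmetric] mult_ac)
    show "(\<integral>\<xi>. complex_of_real (gauss \<xi>) * cis (2 * pi * \<psi> \<xi>) * (cis (2 * pi * (x \<bullet> \<xi>)) * g x) * cnj (fhat h \<xi>) \<partial>lborel) = g x * phase_op \<psi> h x"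
      unfolding phase_op_def eq by (rule integral_mult_right_zero)
  qed
  finally show ?thesis .
qed

lemma phase_kernel_zero: "phase_kernel (\<lambda>_. 0) v = complex_of_real (sqrt pi ^ DIM('a) * exp (- (pi\<^sup>2 * (norm v)\<^sup>2)))"
  for v :: "'a::euclidean_space"
proof -
  have "phase_kernel (\<lambda>_. 0) v = (\<integral>w. complex_of_real (exp (- (1 * (norm w)\<^sup>2))) * cis (((2 * pi) *\<^sub>R v) \<bullet> w) \<partial>lborel)"
    unfolding phase_kernel_def by (simp add: mult.assoc)
  also have "\<dots> = complex_of_real (sqrt (pi / 1) ^ DIM('a) * exp (- ((norm ((2 * pi) *\<^sub>R v))\<^sup>2 / (4 * 1))))"
    by (rule gaussian_fourier) simp
  finally show ?thesis by (simp add: power_mult_distrib)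
qed

text \<open>Half of Plancherel's theorem, with a Gaussian weight; the transform of the weight is again a
  Gaussian, of integral \<open>1\<close>, and Schur's test applies.\<close>

lemma fhat_L2:
  fixes g :: "'a::euclidean_space \<Rightarrow> complex"
  assumes g: "test_function g"
  shows "(\<integral>\<xi>. gauss \<xi> * (norm (fhat g \<xi>))\<^sup>2 \<partial>lborel) \<le> (\<integral>x. (norm (g x))\<^sup>2 \<partial>lborel)"
    and "integrable lborel (\<lambda>\<xi>. gauss \<xi> * (norm (fhat g \<xi>))\<^sup>2)"
proof -
  note gi = test_function_integrable[OF g]
  have [measurable]: "g \<in> borel_measurable borel" using g by (rule test_function_measurable)
  let ?H = "\<integral>x. norm (g x) \<partial>lborel"
  show int: "integrable lborel (\<lambda>\<xi>. gauss \<xi> * (norm (fhat g \<xi>))\<^sup>2)"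
  proof (rule Bochner_Integration.integrable_bound[OF integrable_mult_left[OF gauss_integrable, of "?H\<^sup>2"]])
    show "AE \<xi> in lborel. norm (gauss \<xi> * (norm (fhat g \<xi>))\<^sup>2) \<le> norm (gauss \<xi> * ?H\<^sup>2)"
      using norm_fhat_le[of g] by (intro AE_I2) (auto simp: abs_mult intro!: mult_left_mono power_mono)
  qed measurable
  define \<Gamma> where "\<Gamma> v = sqrt pi ^ DIM('a) * exp (- (pi\<^sup>2 * (norm v)\<^sup>2))" for v :: 'a
  have \<Gamma>0: "\<Gamma> v \<ge> 0" for v by (simp add: \<Gamma>_def)
  have \<Gamma>m[measurable]: "\<Gamma> \<in> borel_measurable borel" unfolding \<Gamma>_def[abs_def] by measurable
  have \<Gamma>1: "(\<integral>\<^sup>+v. ennreal (\<Gamma> v) \<partial>lborel) = 1"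
  proof -
    have "(\<integral>\<^sup>+v. ennreal (\<Gamma> v) \<partial>lborel) = ennreal (sqrt pi ^ DIM('a)) * integral\<^sup>N lborel (\<lambda>v::'a. ennreal (exp (- (pi\<^sup>2 * (norm v)\<^sup>2))))"
      unfolding \<Gamma>_def by (subst nn_integral_cmult[symmetric]) (auto simp: ennreal_mult')
    also have "\<dots> = ennreal (sqrt pi ^ DIM('a) * sqrt (pi / pi\<^sup>2) ^ DIM('a))"
      by (subst nn_integral_gaussian) (auto simp: ennreal_mult')
    also have "sqrt pi ^ DIM('a) * sqrt (pi / pi\<^sup>2) ^ DIM('a) = 1"
      by (simp add: power_mult_distrib[symmetric] real_sqrt_mult[symmetric] power2_eq_square)
    finally show ?thesis by simp
  qed
  have "complex_of_real (\<integral>\<xi>. gauss \<xi> * (norm (fhat g \<xi>))\<^sup>2 \<partial>lborel) = phase_form (\<lambda>_. 0) g g"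
    unfolding phase_form_def
    by (subst integral_complex_of_real[symmetric]) (auto intro!: Bochner_Integration.integral_cong simp: complex_norm_square mult.assoc simp del: of_real_power)
  also have "\<dots> = (\<integral>x. g x * (\<integral>x'. cnj (g x') * phase_kernel (\<lambda>_. 0) (x - x') \<partial>lborel) \<partial>lborel)"
    using gi by (simp add: phase_form_conv phase_op_conv)
  finally have eq: "complex_of_real (\<integral>\<xi>. gauss \<xi> * (norm (fhat g \<xi>))\<^sup>2 \<partial>lborel) =
     (\<integral>x. (\<integral>x'. g x * (cnj (g x') * complex_of_real (\<Gamma> (x - x'))) \<partial>lborel) \<partial>lborel)"
    unfolding \<Gamma>_def phase_kernel_zero by simp
  have "ennreal (\<integral>\<xi>. gauss \<xi> * (norm (fhat g \<xi>))\<^sup>2 \<partial>lborel) = ennreal (norm (complex_of_real (\<integral>\<xi>. gauss \<xi> * (norm (fhat g \<xi>))\<^sup>2 \<partial>lborel)))"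
    by simp
  also have "\<dots> \<le> (\<integral>\<^sup>+x. \<integral>\<^sup>+x'. ennreal (norm (g x * (cnj (g x') * complex_of_real (\<Gamma> (x - x'))))) \<partial>lborel \<partial>lborel)"
    unfolding eq by (rule order_trans[OF norm_integral_le_nn_integral nn_integral_mono]) (rule norm_integral_le_nn_integral)
  also have "\<dots> \<le> (\<integral>\<^sup>+x. \<integral>\<^sup>+x'. ennreal ((norm (g x))\<^sup>2 / 2) * ennreal (\<Gamma> (x - x')) + ennreal ((norm (g x'))\<^sup>2 / 2) * ennreal (\<Gamma> (x - x')) \<partial>lborel \<partial>lborel)"
  proof (intro nn_integral_mono)
    fix x x'
    have "norm (g x) * norm (g x') \<le> (norm (g x))\<^sup>2 / 2 + (norm (g x'))\<^sup>2 / 2"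
      using sum_squares_bound[of "norm (g x)" "norm (g x')"] by simp
    then have "norm (g x) * norm (g x') * \<Gamma> (x - x') \<le> ((norm (g x))\<^sup>2 / 2 + (norm (g x'))\<^sup>2 / 2) * \<Gamma> (x - x')"
      by (rule mult_right_mono) (rule \<Gamma>0)
    then show "ennreal (norm (g x * (cnj (g x') * complex_of_real (\<Gamma> (x - x'))))) \<le> ennreal ((norm (g x))\<^sup>2 / 2) * ennreal (\<Gamma> (x - x')) + ennreal ((norm (g x'))\<^sup>2 / 2) * ennreal (\<Gamma> (x - x'))"
      using \<Gamma>0 by (simp add: norm_mult ennreal_mult'[symmetric] ennreal_plus[symmetric] ennreal_leI distrib_right mult.assoc del: ennreal_plus)
  qed
  also have "\<dots> = (\<integral>\<^sup>+x. \<integral>\<^sup>+x'. ennreal ((norm (g x))\<^sup>2 / 2) * ennreal (\<Gamma> (x - x')) \<partial>lborel \<partial>lborel) + (\<integral>\<^sup>+x. \<integral>\<^sup>+x'. ennreal ((norm (g x'))\<^sup>2 / 2) * ennreal (\<Gamma> (x - x')) \<partial>lborel \<partial>lborel)"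
    by (simp add: nn_integral_add)
  also have "(\<integral>\<^sup>+x. \<integral>\<^sup>+x'. ennreal ((norm (g x'))\<^sup>2 / 2) * ennreal (\<Gamma> (x - x')) \<partial>lborel \<partial>lborel) = (\<integral>\<^sup>+x'. \<integral>\<^sup>+x. ennreal ((norm (g x'))\<^sup>2 / 2) * ennreal (\<Gamma> (x - x')) \<partial>lborel \<partial>lborel)"
  proof (rule lborel_pair.Fubini'[symmetric])
    have "(\<lambda>(x, x'). ennreal ((norm (g x'))\<^sup>2 / 2) * ennreal (\<Gamma> (x - x'))) \<in> borel_measurable (borel \<Otimes>\<^sub>M borel)" by measurable
    then show "(\<lambda>(x, x'). ennreal ((norm (g x'))\<^sup>2 / 2) * ennreal (\<Gamma> (x - x'))) \<in> borel_measurable (lborel \<Otimes>\<^sub>M lborel)" by simp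
  qed
  also have "(\<lambda>x'. \<integral>\<^sup>+x. ennreal ((norm (g x'))\<^sup>2 / 2) * ennreal (\<Gamma> (x - x')) \<partial>lborel) = (\<lambda>x'. ennreal ((norm (g x'))\<^sup>2 / 2))"
  proof
    fix x'
    have "(\<integral>\<^sup>+x. ennreal (\<Gamma> (x - x')) \<partial>lborel) = 1"
      using nn_integral_lborel_translation[of "\<lambda>v. ennreal (\<Gamma> v)" "- x'"] \<Gamma>1 by simp
    then show "(\<integral>\<^sup>+x. ennreal ((norm (g x'))\<^sup>2 / 2) * ennreal (\<Gamma> (x - x')) \<partial>lborel) = ennreal ((norm (g x'))\<^sup>2 / 2)"
      by (simp add: nn_integral_cmult)
  qed
  also have "(\<lambda>x. \<integral>\<^sup>+x'. ennreal ((norm (g x))\<^sup>2 / 2) * ennreal (\<Gamma> (x - x')) \<partial>lborel) = (\<lambda>x. ennreal ((norm (g x))\<^sup>2 / 2))"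
  proof
    fix x
    have "(\<integral>\<^sup>+x'. ennreal (\<Gamma> (x - x')) \<partial>lborel) = 1"
      using nn_integral_lborel_reflect[of "\<lambda>v. ennreal (\<Gamma> v)" x] \<Gamma>1 by simp
    then show "(\<integral>\<^sup>+x'. ennreal ((norm (g x))\<^sup>2 / 2) * ennreal (\<Gamma> (x - x')) \<partial>lborel) = ennreal ((norm (g x))\<^sup>2 / 2)"
      by (simp add: nn_integral_cmult)
  qed
  also have "(\<integral>\<^sup>+x. ennreal ((norm (g x))\<^sup>2 / 2) \<partial>lborel) + (\<integral>\<^sup>+x. ennreal ((norm (g x))\<^sup>2 / 2) \<partial>lborel) = ennreal (\<integral>x. (norm (g x))\<^sup>2 \<partial>lborel)"
    using gi(3) by (subst (1 2) nn_integral_eq_integral) (auto simp: ennreal_plus[symmetric] simp del: ennreal_plus)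
  finally show "(\<integral>\<xi>. gauss \<xi> * (norm (fhat g \<xi>))\<^sup>2 \<partial>lborel) \<le> (\<integral>x. (norm (g x))\<^sup>2 \<partial>lborel)"
    by (subst (asm) ennreal_le_iff) (auto intro!: integral_nonneg_AE)
qed

text \<open>Duality and absorption. For \<open>g\<close> the conjugate of
  \<open>phase_op \<psi> h\<close> cut off to \<open>X\<close>, the squared norm of \<open>g\<close>
  equals \<open>phase_form \<psi> g h\<close>, which \<open>fhat_L2\<close> bounds by half the sum
  of the squared norms of \<open>g\<close> and \<open>h\<close>. Boundedness of \<open>X\<close> and
  the kernel bound \<kappa> make \<open>g\<close> a test function, so its norm is finite and half of
  it can be absorbed.\<close>

lemma phase_op_L2:
  fixes h :: "'a::euclidean_space \<Rightarrow> complex"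
  assumes h: "test_function h" and \<psi>[measurable]: "\<psi> \<in> borel_measurable borel"
    and \<kappa>: "\<And>v. norm (phase_kernel \<psi> v) \<le> \<kappa>"
    and X[measurable]: "X \<in> sets borel" "bounded X"
  shows "(\<integral>\<^sup>+x\<in>X. ennreal ((norm (phase_op \<psi> h x))\<^sup>2) \<partial>lborel) \<le> (\<integral>\<^sup>+x. ennreal ((norm (h x))\<^sup>2) \<partial>lborel)"
proof -
  note hi = test_function_integrable[OF h]
  have [measurable]: "h \<in> borel_measurable borel" using h by (rule test_function_measurable)
  note [measurable] = phase_op_measurable[OF \<open>h \<in> borel_measurable borel\<close> \<psi>]
  define g where "g x = indicator X x * cnj (phase_op \<psi> h x)" for x
  have [measurable]: "g \<in> borel_measurable borel" unfolding g_def[abs_def] by measurable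
  obtain r where r: "\<And>x. x \<in> X \<Longrightarrow> norm x \<le> r" using X(2) unfolding bounded_iff by blast
  have g: "test_function g"
  proof (rule test_functionI)
    show "norm (g x) \<le> \<kappa> * (\<integral>x. norm (h x) \<partial>lborel)" for x
      using norm_phase_op_le[OF hi(1) \<psi> \<kappa>, of x] order_trans[OF norm_ge_zero norm_phase_op_le[OF hi(1) \<psi> \<kappa>]]
      by (simp add: g_def indicator_def norm_mult)
    show "g x = 0" if "norm x > r" for x using r[of x] that by (auto simp: g_def indicator_def)
  qed measurable
  note gi = test_function_integrable[OF g]
  have sq: "complex_of_real ((norm (g x))\<^sup>2) = g x * phase_op \<psi> h x" for x
  proof (cases "x \<in> X")
    case True
    then have "g x = cnj (phase_op \<psi> h x)" by (simp add: g_def)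
    then show ?thesis using complex_norm_square[of "cnj (phase_op \<psi> h x)"] by (simp only: complex_cnj_cnj)
  qed (simp add: g_def)
  have pf: "complex_of_real (\<integral>x. (norm (g x))\<^sup>2 \<partial>lborel) = phase_form \<psi> g h"
    by (subst phase_form_conv[OF gi(1) hi(1) \<psi>], subst integral_complex_of_real[symmetric]) (simp only: sq)
  have "(\<integral>x. (norm (g x))\<^sup>2 \<partial>lborel) \<ge> 0" by (intro integral_nonneg_AE) auto
  then have "(\<integral>x. (norm (g x))\<^sup>2 \<partial>lborel) = norm (phase_form \<psi> g h)"
    unfolding pf[symmetric] norm_of_real by (rule abs_of_nonneg[symmetric])
  also have "\<dots> \<le> (\<integral>\<xi>. norm (complex_of_real (gauss \<xi>) * cis (2 * pi * \<psi> \<xi>) * fhat g \<xi> * cnj (fhat h \<xi>)) \<partial>lborel)"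
    unfolding phase_form_def by (rule integral_norm_bound)
  also have "\<dots> \<le> (\<integral>\<xi>. (gauss \<xi> * (norm (fhat g \<xi>))\<^sup>2) / 2 + (gauss \<xi> * (norm (fhat h \<xi>))\<^sup>2) / 2 \<partial>lborel)"
  proof (rule integral_mono')
    show "integrable lborel (\<lambda>\<xi>. (gauss \<xi> * (norm (fhat g \<xi>))\<^sup>2) / 2 + (gauss \<xi> * (norm (fhat h \<xi>))\<^sup>2) / 2)"
      using fhat_L2(2)[OF g] fhat_L2(2)[OF h] by simp
    show "norm (complex_of_real (gauss \<xi>) * cis (2 * pi * \<psi> \<xi>) * fhat g \<xi> * cnj (fhat h \<xi>)) \<le> (gauss \<xi> * (norm (fhat g \<xi>))\<^sup>2) / 2 + (gauss \<xi> * (norm (fhat h \<xi>))\<^sup>2) / 2" for \<xi>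
    proof -
      have "norm (fhat g \<xi>) * norm (fhat h \<xi>) \<le> (norm (fhat g \<xi>))\<^sup>2 / 2 + (norm (fhat h \<xi>))\<^sup>2 / 2"
        using sum_squares_bound[of "norm (fhat g \<xi>)" "norm (fhat h \<xi>)"] by simp
      then have "gauss \<xi> * (norm (fhat g \<xi>) * norm (fhat h \<xi>)) \<le> gauss \<xi> * ((norm (fhat g \<xi>))\<^sup>2 / 2 + (norm (fhat h \<xi>))\<^sup>2 / 2)"
        by (rule mult_left_mono) simp
      then show ?thesis by (simp add: norm_mult distrib_left mult.assoc)
    qed
  qed simp
  also have "\<dots> \<le> (\<integral>x. (norm (g x))\<^sup>2 \<partial>lborel) / 2 + (\<integral>x. (norm (h x))\<^sup>2 \<partial>lborel) / 2"
    using fhat_L2[OF g] fhat_L2[OF h] by simp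
  finally have "(\<integral>x. (norm (g x))\<^sup>2 \<partial>lborel) \<le> (\<integral>x. (norm (h x))\<^sup>2 \<partial>lborel)" by simp
  moreover have "(\<integral>\<^sup>+x\<in>X. ennreal ((norm (phase_op \<psi> h x))\<^sup>2) \<partial>lborel) = ennreal (\<integral>x. (norm (g x))\<^sup>2 \<partial>lborel)"
    using gi(3) by (subst nn_integral_eq_integral[symmetric]) (auto intro!: nn_integral_cong simp: g_def indicator_def)
  moreover have "(\<integral>\<^sup>+x. ennreal ((norm (h x))\<^sup>2) \<partial>lborel) = ennreal (\<integral>x. (norm (h x))\<^sup>2 \<partial>lborel)"
    using hi(3) by (subst nn_integral_eq_integral) auto
  ultimately show ?thesis by (simp add: ennreal_leI)
qed

lemma phase_op_add:
  fixes h1 h2 :: "'a::euclidean_space \<Rightarrow> complex"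
  assumes h1: "integrable lborel h1" and h2: "integrable lborel h2" and \<psi>[measurable]: "\<psi> \<in> borel_measurable borel"
  shows "phase_op \<psi> (\<lambda>x. h1 x + h2 x) x = phase_op \<psi> h1 x + phase_op \<psi> h2 x"
proof -
  have [measurable]: "h1 \<in> borel_measurable borel" "h2 \<in> borel_measurable borel" using h1 h2 by simp_all
  have "fhat (\<lambda>x. h1 x + h2 x) \<xi> = fhat h1 \<xi> + fhat h2 \<xi>" for \<xi>
    unfolding fhat_def distrib_left using h1 h2 by (intro Bochner_Integration.integral_add cis_mult_integrable) measurable
  moreover have "integrable lborel (\<lambda>\<xi>. complex_of_real (gauss \<xi>) * cis (2 * pi * (x \<bullet> \<xi> + \<psi> \<xi>)) * cnj (fhat h \<xi>))"
    if [measurable]: "h \<in> borel_measurable borel" for h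
  proof (rule Bochner_Integration.integrable_bound[OF integrable_mult_left[OF gauss_integrable, of "\<integral>x. norm (h x) \<partial>lborel"]])
    show "AE \<xi> in lborel. norm (complex_of_real (gauss \<xi>) * cis (2 * pi * (x \<bullet> \<xi> + \<psi> \<xi>)) * cnj (fhat h \<xi>)) \<le> norm (gauss \<xi> * (\<integral>x. norm (h x) \<partial>lborel))"
      using norm_fhat_le[of h] by (intro AE_I2) (auto simp: norm_mult abs_mult intro!: mult_left_mono order_trans[OF norm_fhat_le])
  qed measurable
  ultimately show ?thesis unfolding phase_op_def by (simp add: distrib_left)
qed

text \<open>Young's inequality without the sharp constants: according to whether \<open>b\<close> is
  at most a^(1/(q-1)), the first or the second summand alone dominates the product.\<close>

lemma mult_le_powr_conjugate:
  fixes a b q :: real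
  assumes "a \<ge> 0" "b \<ge> 0" "q > 1"
  shows "a * b \<le> a powr (q / (q - 1)) + b powr q"
proof (cases "a = 0 \<or> b = 0")
  case False
  then have ab: "a > 0" "b > 0" using assms by auto
  show ?thesis
  proof (cases "b \<le> a powr (1 / (q - 1))")
    case True
    then have "a * b \<le> a powr 1 * a powr (1 / (q - 1))" using ab by simp
    also have "\<dots> = a powr (1 + 1 / (q - 1))" by (simp only: powr_add)
    also have "1 + 1 / (q - 1) = q / (q - 1)" using assms(3) by (simp add: field_simps)
    finally show ?thesis by (smt (verit) powr_ge_zero)
  next
    case False
    then have "(a powr (1 / (q - 1))) powr (q - 1) \<le> b powr (q - 1)" using ab assms(3) by (intro powr_mono2) auto
    then have "a \<le> b powr (q - 1)" using ab assms(3) by (simp add: powr_powr)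
    then have "a * b \<le> b powr (q - 1) * b powr 1" using ab by simp
    also have "\<dots> = b powr q" by (simp only: powr_add[symmetric]) simp
    finally show ?thesis by (smt (verit) powr_ge_zero)
  qed
qed auto

text \<open>Hoelder's inequality, by normalising both functions by \<alpha> and \<beta>; the factor
  2 is the price of the crude Young inequality.\<close>

lemma nn_integral_mult_le_powr:
  fixes f g :: "'a \<Rightarrow> real"
  assumes [measurable]: "f \<in> borel_measurable M" "g \<in> borel_measurable M"
    and f0: "\<And>x. f x \<ge> 0" and g0: "\<And>x. g x \<ge> 0" and q: "q > 1" and p: "p = q / (q - 1)"
    and F: "(\<integral>\<^sup>+x. ennreal (f x powr p) \<partial>M) \<le> ennreal F" "F > 0"
    and G: "(\<integral>\<^sup>+x. ennreal (g x powr q) \<partial>M) \<le> ennreal G" "G > 0"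
  shows "(\<integral>\<^sup>+x. ennreal (f x * g x) \<partial>M) \<le> ennreal (2 * F powr (1 / p) * G powr (1 / q))"
proof -
  define \<alpha> where "\<alpha> = F powr (1 / p)"
  define \<beta> where "\<beta> = G powr (1 / q)"
  have p0: "p > 0" using q by (simp add: p)
  have pos: "\<alpha> > 0" "\<beta> > 0" using F G by (auto simp: \<alpha>_def \<beta>_def)
  have \<alpha>p: "\<alpha> powr p = F" using F p0 by (simp add: \<alpha>_def powr_powr)
  have \<beta>q: "\<beta> powr q = G" using G q by (simp add: \<beta>_def powr_powr)
  have "(\<integral>\<^sup>+x. ennreal (f x * g x) \<partial>M) \<le> (\<integral>\<^sup>+x. ennreal (\<alpha> * \<beta>) * (ennreal (1 / F) * ennreal (f x powr p) + ennreal (1 / G) * ennreal (g x powr q)) \<partial>M)"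
  proof (rule nn_integral_mono)
    fix x
    have "f x / \<alpha> * (g x / \<beta>) \<le> (f x / \<alpha>) powr p + (g x / \<beta>) powr q"
      unfolding p using f0 g0 pos q by (intro mult_le_powr_conjugate) auto
    also have "\<dots> = 1 / F * f x powr p + 1 / G * g x powr q"
      using f0 g0 pos by (simp add: powr_divide \<alpha>p \<beta>q)
    finally have "f x * g x \<le> \<alpha> * \<beta> * (1 / F * f x powr p + 1 / G * g x powr q)"
      using pos by (simp add: field_simps)
    then show "ennreal (f x * g x) \<le> ennreal (\<alpha> * \<beta>) * (ennreal (1 / F) * ennreal (f x powr p) + ennreal (1 / G) * ennreal (g x powr q))"
      using F G pos by (simp add: ennreal_mult'[symmetric] ennreal_plus[symmetric] ennreal_leI del: ennreal_plus)
  qed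
  also have "\<dots> = ennreal (\<alpha> * \<beta>) * (ennreal (1 / F) * (\<integral>\<^sup>+x. ennreal (f x powr p) \<partial>M) + ennreal (1 / G) * (\<integral>\<^sup>+x. ennreal (g x powr q) \<partial>M))"
    by (simp add: nn_integral_cmult nn_integral_add)
  also have "\<dots> \<le> ennreal (\<alpha> * \<beta>) * (ennreal (1 / F) * ennreal F + ennreal (1 / G) * ennreal G)"
    using F G by (intro mult_left_mono add_mono) auto
  also have "\<dots> = ennreal (\<alpha> * \<beta>) * ennreal 2"
    using F G by (simp add: ennreal_mult'[symmetric])
  also have "\<dots> = ennreal (2 * \<alpha> * \<beta>)"
    using pos by (subst ennreal_mult'[symmetric]) (auto simp: mult_ac)
  finally show ?thesis by (simp add: \<alpha>_def \<beta>_def)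
qed

text \<open>The factor 2 comes from Hoelder's inequality above, the rest is the q-th root of the
  constant in \<open>interpolation_L1_L2\<close>.\<close>

definition interp_const :: "real \<Rightarrow> real" where
  "interp_const q = 2 * (4 * q / (q - 2) * 2 powr (q - 2)) powr (1 / q)"

text \<open>Hoelder's inequality pairs \<open>g\<close> in L^p with \<open>phase_op \<psi> h\<close>
  in L^q; interpolation bounds the latter with the power (q - 2)/q of \<kappa>.\<close>

lemma norm_phase_form_le:
  fixes g h :: "'a::euclidean_space \<Rightarrow> complex"
  assumes g: "test_function g" and h: "test_function h" and \<psi>[measurable]: "\<psi> \<in> borel_measurable borel"
    and \<kappa>: "\<And>v. norm (phase_kernel \<psi> v) \<le> \<kappa>" "\<kappa> > 0"
    and q: "q > 2" and p: "p = q / (q - 1)"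
  shows "norm (phase_form \<psi> g h) \<le> interp_const q * \<kappa> powr (1 - 2 / q) *
     ((\<integral>x. norm (g x) powr p \<partial>lborel) powr (1 / p) * (\<integral>x. norm (h x) powr p \<partial>lborel) powr (1 / p))"
proof -
  note gi = test_function_integrable[OF g] and hi = test_function_integrable[OF h]
  have gm[measurable]: "g \<in> borel_measurable borel" and hm[measurable]: "h \<in> borel_measurable borel" 
    using g h by (auto dest: test_function_measurable)
  note [measurable] = phase_op_measurable[OF hm \<psi>]
  have p1: "p > 1" using q unfolding p by (simp add: less_divide_eq)
  define F where "F = (\<integral>x. norm (g x) powr p \<partial>lborel)"
  define N where "N = (\<integral>x. norm (h x) powr p \<partial>lborel)"
  have F: "(\<integral>\<^sup>+x. ennreal (norm (g x) powr p) \<partial>lborel) = ennreal F" "F \<ge> 0"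
    using test_function_powr_integrable[OF g, of p] p1 unfolding F_def by (auto simp: nn_integral_eq_integral intro!: integral_nonneg_AE)
  have N: "(\<integral>\<^sup>+x. ennreal (norm (h x) powr p) \<partial>lborel) = ennreal N" "N \<ge> 0"
    using test_function_powr_integrable[OF h, of p] p1 unfolding N_def by (auto simp: nn_integral_eq_integral intro!: integral_nonneg_AE)
  \<comment> \<open>Interpolation and Hoelder's inequality are stated for positive norms. A function
    of p-norm zero vanishes almost everywhere, hence so does its transform, identically.\<close>
  have zero: "fhat u \<xi> = 0" if "(\<integral>\<^sup>+x. ennreal (norm (u x) powr p) \<partial>lborel) = 0" and [measurable]: "u \<in> borel_measurable borel" for u :: "'a \<Rightarrow> complex" and \<xi>
  proof -
    have "AE x in lborel. ennreal (norm (u x) powr p) = 0" using that(1) by (subst (asm) nn_integral_0_iff_AE) auto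
    then have "AE x in lborel. cis (2 * pi * (x \<bullet> \<xi>)) * u x = 0" by eventually_elim (auto simp: ennreal_eq_0_iff)
    then have "fhat u \<xi> = (\<integral>x. 0 \<partial>(lborel :: 'a measure))" unfolding fhat_def by (intro integral_cong_AE) auto
    then show ?thesis by simp
  qed
  show ?thesis
  proof (cases "F = 0 \<or> N = 0")
    case True
    then have "phase_form \<psi> g h = 0"
      unfolding phase_form_def using zero[of g] zero[of h] F N by auto
    then show ?thesis using q by (simp add: interp_const_def)
  next
    case False
    then have pos: "F > 0" "N > 0" using F N by auto
    obtain r where r: "\<And>x. norm x > r \<Longrightarrow> g x = 0" using g unfolding test_function_def by blast
    \<comment> \<open>The L^2 bound for \<open>phase_op\<close> is available on bounded sets;
      \<open>g\<close> vanishes off \<open>X\<close>, so restricting to it changes nothing in the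
      pairing.\<close>
    define X where "X = cball (0::'a) r"
    have X[measurable]: "X \<in> sets borel" "bounded X" by (auto simp: X_def)
    let ?C = "4 * q / (q - 2) * 2 powr (q - 2)"
    have "(\<integral>\<^sup>+x\<in>X. ennreal (norm (phase_op \<psi> h x) powr q) \<partial>lborel) \<le> ennreal (?C * \<kappa> powr (q - 2) * N powr (q - 1))"
    proof (rule interpolation_L1_L2[where T = "phase_op \<psi>" and p = p])
      show "phase_op \<psi> (\<lambda>x. h1 x + h2 x) x = phase_op \<psi> h1 x + phase_op \<psi> h2 x" if "test_function h1" "test_function h2" for h1 h2 x
        using that by (intro phase_op_add test_function_integrable \<psi>)
      show "norm (phase_op \<psi> h x) \<le> \<kappa> * (\<integral>x. norm (h x) \<partial>lborel)" if "test_function h" for h x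
        using that by (intro norm_phase_op_le test_function_integrable \<psi> \<kappa>)
      show "(\<integral>\<^sup>+x\<in>X. ennreal ((norm (phase_op \<psi> h x))\<^sup>2) \<partial>lborel) \<le> (\<integral>\<^sup>+x. ennreal ((norm (h x))\<^sup>2) \<partial>lborel)" if "test_function h" for h
        using that by (intro phase_op_L2[OF _ \<psi> \<kappa>(1)] X)
      show "phase_op \<psi> h \<in> borel_measurable borel" if "test_function h" for h
        using that by (intro phase_op_measurable test_function_measurable \<psi>)
      show "X \<in> sets borel" by (rule X)
    qed (use h q p \<kappa> N pos in auto)
    also have "(\<integral>\<^sup>+x\<in>X. ennreal (norm (phase_op \<psi> h x) powr q) \<partial>lborel) = (\<integral>\<^sup>+x. ennreal ((indicator X x * norm (phase_op \<psi> h x)) powr q) \<partial>lborel)"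
      by (intro nn_integral_cong) (auto simp: indicator_def)
    finally have T: "(\<integral>\<^sup>+x. ennreal ((indicator X x * norm (phase_op \<psi> h x)) powr q) \<partial>lborel) \<le> ennreal (?C * \<kappa> powr (q - 2) * N powr (q - 1))" .
    have "ennreal (norm (phase_form \<psi> g h)) \<le> (\<integral>\<^sup>+x. ennreal (norm (g x * phase_op \<psi> h x)) \<partial>lborel)"
      unfolding phase_form_conv[OF gi(1) hi(1) \<psi>] by (rule norm_integral_le_nn_integral)
    also have "\<dots> = (\<integral>\<^sup>+x. ennreal (norm (g x) * (indicator X x * norm (phase_op \<psi> h x))) \<partial>lborel)"
      using r by (intro nn_integral_cong) (auto simp: indicator_def norm_mult X_def not_le)
    also have "\<dots> \<le> ennreal (2 * F powr (1 / p) * (?C * \<kappa> powr (q - 2) * N powr (q - 1)) powr (1 / q))"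
      by (rule nn_integral_mult_le_powr[where q = q]) (use F T pos \<kappa>(2) q p in auto)
    finally have "norm (phase_form \<psi> g h) \<le> 2 * F powr (1 / p) * (?C * \<kappa> powr (q - 2) * N powr (q - 1)) powr (1 / q)"
      by (subst (asm) ennreal_le_iff) auto
    also have "(?C * \<kappa> powr (q - 2) * N powr (q - 1)) powr (1 / q) = ?C powr (1 / q) * \<kappa> powr ((q - 2) / q) * N powr ((q - 1) / q)"
    proof -
      have "(c * \<kappa> powr (q - 2) * N powr (q - 1)) powr (1 / q) = c powr (1 / q) * \<kappa> powr ((q - 2) / q) * N powr ((q - 1) / q)"
        if "c > 0" for c
        using that pos \<kappa>(2) by (simp add: powr_mult powr_powr)
      moreover have "?C > 0" using q by simp
      ultimately show ?thesis by blast
    qed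
    also have "(q - 1) / q = 1 / p" by (simp add: p)
    also have "(q - 2) / q = 1 - 2 / q" using q by (simp add: field_simps)
    finally show ?thesis unfolding interp_const_def F_def[symmetric] N_def[symmetric] by (simp only: mult_ac)
  qed
qed

section \<open>The Strichartz estimate\<close>

text \<open>The transpose of the extension operator, not its adjoint: the phase keeps its sign and
  the duality pairing below is bilinear.\<close>

definition ext_dual :: "('a::euclidean_space \<Rightarrow> 'b::euclidean_space) \<Rightarrow> ('a \<times> 'b \<Rightarrow> complex) \<Rightarrow> 'a \<Rightarrow> complex" where
  "ext_dual Q G \<xi> = (\<integral>z. cis (2 * pi * (fst z \<bullet> \<xi> + snd z \<bullet> Q \<xi>)) * G z \<partial>lborel)"

lemma test_function_slice:
  fixes G :: "'a::euclidean_space \<times> 'b::euclidean_space \<Rightarrow> complex"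
  assumes "test_function G"
  shows "test_function (\<lambda>x. G (x, y))"
proof -
  obtain B r where B: "\<And>z. norm (G z) \<le> B" and r: "\<And>z. norm z > r \<Longrightarrow> G z = 0"
    using assms unfolding test_function_def by blast
  have [measurable]: "G \<in> borel_measurable (borel \<Otimes>\<^sub>M borel)"
    using test_function_measurable[OF assms] by (simp add: borel_prod)
  show ?thesis
  proof (rule test_functionI)
    show "G (x, y) = 0" if "norm x > r" for x
      using that norm_fst_le[of x y] by (intro r) linarith
  qed (use B in auto)
qed

lemma ext_dual_slices:
  fixes G :: "'a::euclidean_space \<times> 'b::euclidean_space \<Rightarrow> complex"
  assumes G: "test_function G"
  shows "ext_dual Q G \<xi> = (\<integral>y. cis (2 * pi * (y \<bullet> Q \<xi>)) * fhat (\<lambda>x. G (x, y)) \<xi> \<partial>lborel)"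
proof -
  have m[measurable]: "G \<in> borel_measurable (borel \<Otimes>\<^sub>M borel)"
    using test_function_measurable[OF G] by (simp add: borel_prod)
  have Gi: "integrable lborel G" by (rule test_function_integrable[OF G])
  have "integrable lborel (\<lambda>z. cis (2 * pi * (fst z \<bullet> \<xi> + snd z \<bullet> Q \<xi>)) * G z)"
    by (rule cis_mult_integrable[OF Gi], rule borel_measurable_pairI) measurable
  then have i: "integrable (lborel \<Otimes>\<^sub>M lborel) (\<lambda>(x, y). cis (2 * pi * (x \<bullet> \<xi> + y \<bullet> Q \<xi>)) * G (x, y))"
    by (simp add: lborel_prod case_prod_beta')
  have "ext_dual Q G \<xi> = integral\<^sup>L (lborel \<Otimes>\<^sub>M lborel) (\<lambda>(x, y). cis (2 * pi * (x \<bullet> \<xi> + y \<bullet> Q \<xi>)) * G (x, y))"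
    unfolding ext_dual_def lborel_prod by (simp add: case_prod_beta')
  also have "\<dots> = (\<integral>y. \<integral>x. cis (2 * pi * (x \<bullet> \<xi> + y \<bullet> Q \<xi>)) * G (x, y) \<partial>lborel \<partial>lborel)"
    by (rule lborel_pair.integral_snd[OF i, symmetric])
  also have "\<dots> = (\<integral>y. cis (2 * pi * (y \<bullet> Q \<xi>)) * fhat (\<lambda>x. G (x, y)) \<xi> \<partial>lborel)"
  proof (rule Bochner_Integration.integral_cong[OF refl])
    fix y
    have eq: "cis (2 * pi * (x \<bullet> \<xi> + y \<bullet> Q \<xi>)) * G (x, y) = cis (2 * pi * (y \<bullet> Q \<xi>)) * (cis (2 * pi * (x \<bullet> \<xi>)) * G (x, y))" for x
      by (simp only: distrib_left cis_mult[symmetric] mult_ac)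
    show "(\<integral>x. cis (2 * pi * (x \<bullet> \<xi> + y \<bullet> Q \<xi>)) * G (x, y) \<partial>lborel) = cis (2 * pi * (y \<bullet> Q \<xi>)) * fhat (\<lambda>x. G (x, y)) \<xi>"
      unfolding fhat_def eq by (rule integral_mult_right_zero)
  qed
  finally show ?thesis .
qed

lemma ext_dual_measurable:
  fixes G :: "'a::euclidean_space \<times> 'b::euclidean_space \<Rightarrow> complex"
  assumes [measurable]: "G \<in> borel_measurable borel" "Q \<in> borel_measurable borel"
  shows "ext_dual Q G \<in> borel_measurable borel"
proof -
  have [measurable]: "G \<in> borel_measurable (borel \<Otimes>\<^sub>M borel)" using assms(1) by (simp add: borel_prod)
  have "(\<lambda>\<xi>. \<integral>z. cis (2 * pi * (fst z \<bullet> \<xi> + snd z \<bullet> Q \<xi>)) * G z \<partial>(lborel \<Otimes>\<^sub>M lborel)) \<in> borel_measurable borel"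
    by measurable
  then show ?thesis unfolding ext_dual_def[abs_def] lborel_prod .
qed

lemma norm_ext_dual_le: "norm (ext_dual Q G \<xi>) \<le> (\<integral>z. norm (G z) \<partial>lborel)"
  unfolding ext_dual_def by (rule order_trans[OF integral_norm_bound]) (simp add: norm_mult)

text \<open>The square is expanded over pairs of slices in \<open>y\<close>. Multiplying one phase
  by the conjugate of the other leaves only \<open>y - y'\<close>, so the result has the shape of a
  convolution in \<open>y\<close>. The L^1 norms \<open>b\<close> of the slices provide the
  majorants for both interchanges.\<close>

lemma ext_dual_square:
  fixes G :: "'a::euclidean_space \<times> 'b::euclidean_space \<Rightarrow> complex" and Q :: "'a \<Rightarrow> 'b"
  assumes G: "test_function G" and Q[measurable]: "Q \<in> borel_measurable borel"
  shows "complex_of_real (\<integral>\<xi>. gauss \<xi> * (norm (ext_dual Q G \<xi>))\<^sup>2 \<partial>lborel) =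
    (\<integral>y'. \<integral>y. phase_form (\<lambda>\<xi>. (y - y') \<bullet> Q \<xi>) (\<lambda>x. G (x, y)) (\<lambda>x. G (x, y')) \<partial>lborel \<partial>lborel)"
proof -
  have m[measurable]: "G \<in> borel_measurable (borel \<Otimes>\<^sub>M borel)"
    using test_function_measurable[OF G] by (simp add: borel_prod)
  have [measurable]: "ext_dual Q G \<in> borel_measurable borel"
    by (rule ext_dual_measurable[OF test_function_measurable[OF G] Q])
  have Gi: "integrable lborel G" by (rule test_function_integrable[OF G])
  define b where "b y = (\<integral>x. norm (G (x, y)) \<partial>lborel)" for y
  define H where "H = (\<integral>z. norm (G z) \<partial>lborel)"
  have b: "integrable lborel b"
    unfolding b_def[abs_def] using integrable_norm[OF Gi] by (intro lborel_pair.integrable_snd) (simp add: lborel_prod case_prod_beta')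
  have b0: "b y \<ge> 0" for y by (simp add: b_def)
  have fb: "norm (fhat (\<lambda>x. G (x, y)) \<xi>) \<le> b y" for y \<xi> unfolding b_def by (rule norm_fhat_le)
  have fm[measurable]: "(\<lambda>p. fhat (\<lambda>x. G (x, snd p)) (fst p)) \<in> borel_measurable (borel \<Otimes>\<^sub>M borel)"
    unfolding fhat_def by measurable
  have [measurable]: "fhat (\<lambda>x. G (x, y)) \<in> borel_measurable borel" for y
    by (intro fhat_measurable) measurable
  define P where "P \<xi> y = cis (2 * pi * (y \<bullet> Q \<xi>)) * fhat (\<lambda>x. G (x, y)) \<xi>" for \<xi> y
  have Pm[measurable]: "(\<lambda>p. P (fst p) (snd p)) \<in> borel_measurable (borel \<Otimes>\<^sub>M borel)"
    unfolding P_def by measurable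
  have Py[measurable]: "(\<lambda>\<xi>. P \<xi> y) \<in> borel_measurable borel" for y
    unfolding P_def by measurable
  have Pb: "norm (P \<xi> y) \<le> b y" for \<xi> y using fb by (simp add: P_def norm_mult)
  have EP: "ext_dual Q G \<xi> = (\<integral>y. P \<xi> y \<partial>lborel)" for \<xi>
    unfolding P_def by (rule ext_dual_slices[OF G])
  have EH: "norm (ext_dual Q G \<xi>) \<le> H" for \<xi> unfolding H_def by (rule norm_ext_dual_le)
  have "complex_of_real (\<integral>\<xi>. gauss \<xi> * (norm (ext_dual Q G \<xi>))\<^sup>2 \<partial>lborel) =
     (\<integral>\<xi>. complex_of_real (gauss \<xi>) * ext_dual Q G \<xi> * cnj (ext_dual Q G \<xi>) \<partial>lborel)"
    by (subst integral_complex_of_real[symmetric]) (simp add: complex_norm_square mult.assoc del: of_real_power)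
  also have "\<dots> = (\<integral>\<xi>. \<integral>y'. complex_of_real (gauss \<xi>) * ext_dual Q G \<xi> * cnj (P \<xi> y') \<partial>lborel \<partial>lborel)"
  proof (rule Bochner_Integration.integral_cong[OF refl])
    fix \<xi>
    have "cnj (ext_dual Q G \<xi>) = (\<integral>y'. cnj (P \<xi> y') \<partial>lborel)" unfolding EP by (rule Bochner_Integration.integral_cnj[symmetric])
    then show "complex_of_real (gauss \<xi>) * ext_dual Q G \<xi> * cnj (ext_dual Q G \<xi>) = (\<integral>y'. complex_of_real (gauss \<xi>) * ext_dual Q G \<xi> * cnj (P \<xi> y') \<partial>lborel)"
      by (simp only: integral_mult_right_zero)
  qed
  also have "\<dots> = (\<integral>y'. \<integral>\<xi>. complex_of_real (gauss \<xi>) * ext_dual Q G \<xi> * cnj (P \<xi> y') \<partial>lborel \<partial>lborel)"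
  proof (rule lborel_Fubini_bound(1)[OF integrable_mult_left[OF gauss_integrable, of H] b])
    show "(\<lambda>p. complex_of_real (gauss (fst p)) * ext_dual Q G (fst p) * cnj (P (fst p) (snd p))) \<in> borel_measurable borel"
      by (rule borel_measurable_pairI) measurable
    show "norm (complex_of_real (gauss \<xi>) * ext_dual Q G \<xi> * cnj (P \<xi> y)) \<le> gauss \<xi> * H * b y" for \<xi> y
      using EH[of \<xi>] Pb[of \<xi> y] order_trans[OF norm_ge_zero EH[of \<xi>]] by (auto simp: norm_mult intro!: mult_mono)
  qed
  also have "\<dots> = (\<integral>y'. \<integral>\<xi>. \<integral>y. complex_of_real (gauss \<xi>) * P \<xi> y * cnj (P \<xi> y') \<partial>lborel \<partial>lborel \<partial>lborel)"
    unfolding EP by (simp add: mult.assoc)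
  also have "\<dots> = (\<integral>y'. \<integral>y. \<integral>\<xi>. complex_of_real (gauss \<xi>) * P \<xi> y * cnj (P \<xi> y') \<partial>lborel \<partial>lborel \<partial>lborel)"
  proof (rule Bochner_Integration.integral_cong[OF refl])
    fix y'
    show "(\<integral>\<xi>. \<integral>y. complex_of_real (gauss \<xi>) * P \<xi> y * cnj (P \<xi> y') \<partial>lborel \<partial>lborel) = (\<integral>y. \<integral>\<xi>. complex_of_real (gauss \<xi>) * P \<xi> y * cnj (P \<xi> y') \<partial>lborel \<partial>lborel)"
    proof (rule lborel_Fubini_bound(1)[OF gauss_integrable integrable_mult_left[OF b, of "b y'"]])
      show "(\<lambda>p. complex_of_real (gauss (fst p)) * P (fst p) (snd p) * cnj (P (fst p) y')) \<in> borel_measurable borel"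
        by (rule borel_measurable_pairI) measurable
      show "norm (complex_of_real (gauss \<xi>) * P \<xi> y * cnj (P \<xi> y')) \<le> gauss \<xi> * (b y * b y')" for \<xi> y
        using Pb[of \<xi> y] Pb[of \<xi> y'] b0 by (auto simp: norm_mult mult.assoc intro!: mult_mono)
    qed
  qed
  also have "\<dots> = (\<integral>y'. \<integral>y. phase_form (\<lambda>\<xi>. (y - y') \<bullet> Q \<xi>) (\<lambda>x. G (x, y)) (\<lambda>x. G (x, y')) \<partial>lborel \<partial>lborel)"
  proof -
    have "complex_of_real (gauss \<xi>) * P \<xi> y * cnj (P \<xi> y') =
       complex_of_real (gauss \<xi>) * cis (2 * pi * ((y - y') \<bullet> Q \<xi>)) * fhat (\<lambda>x. G (x, y)) \<xi> * cnj (fhat (\<lambda>x. G (x, y')) \<xi>)" for y y' \<xi>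
    proof -
      have "2 * pi * ((y - y') \<bullet> Q \<xi>) = 2 * pi * (y \<bullet> Q \<xi>) + - (2 * pi * (y' \<bullet> Q \<xi>))" by (simp add: inner_diff_left algebra_simps)
      then show ?thesis unfolding P_def by (simp only: complex_cnj_mult cis_cnj cis_mult[symmetric] mult_ac)
    qed
    then show ?thesis unfolding phase_form_def by (simp only:)
  qed
  finally show ?thesis .
qed

definition strichartz_const :: "real \<Rightarrow> real" where
  "strichartz_const q = interp_const q * (2 * (q - 1) * (q / (q - 2)))"

lemma strichartz_const_pos: "q > 2 \<Longrightarrow> strichartz_const q > 0"
  unfolding strichartz_const_def interp_const_def by (intro mult_pos_pos) auto

text \<open>The p-norm of \<open>G\<close> is the p-norm of the slice norms \<open>U\<close>, and
  the fixed-time bound dominates each pair of slices by \<open>k (y - y') * U y * U y'\<close>. What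
  remains is a scalar convolution inequality in \<open>y\<close>, supplied by
  \<open>weak_young\<close>.\<close>

lemma ext_dual_bound:
  fixes G :: "'a::euclidean_space \<times> 'b::euclidean_space \<Rightarrow> complex" and Q :: "'a \<Rightarrow> 'b" and \<kappa> :: "'b \<Rightarrow> real"
  assumes G: "test_function G" and Q[measurable]: "Q \<in> borel_measurable borel"
    and \<kappa>m[measurable]: "\<kappa> \<in> borel_measurable borel" and \<kappa>0: "\<And>y. \<kappa> y > 0" and \<kappa>e: "\<And>y. \<kappa> (- y) = \<kappa> y"
    and \<kappa>: "\<And>x y. norm (phase_kernel (\<lambda>\<xi>. y \<bullet> Q \<xi>) x) \<le> \<kappa> y"
    and q: "q > 2" and p: "p = q / (q - 1)" and W: "W > 0"
    and weak: "\<And>c. c > 0 \<Longrightarrow> emeasure lborel {y \<in> ball 0 (2 * R). \<kappa> y powr ((q - 2) / 2) > c} \<le> ennreal (W / c)"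
    and supp: "\<And>x y. G (x, y) \<noteq> 0 \<Longrightarrow> y \<in> ball c R"
    and N: "(\<integral>\<^sup>+z. ennreal (norm (G z) powr p) \<partial>lborel) \<le> ennreal N" "N > 0"
  shows "(\<integral>\<xi>. gauss \<xi> * (norm (ext_dual Q G \<xi>))\<^sup>2 \<partial>lborel) \<le> strichartz_const q * W powr (2 / q) * N powr (2 - 2 / q)"
proof -
  have m[measurable]: "G \<in> borel_measurable (borel \<Otimes>\<^sub>M borel)"
    using test_function_measurable[OF G] by (simp add: borel_prod)
  have p1: "p > 1" using q unfolding p by (simp add: less_divide_eq)
  define U where "U y = (\<integral>x. norm (G (x, y)) powr p \<partial>lborel) powr (1 / p)" for y
  have U0: "U y \<ge> 0" for y by (simp add: U_def)
  have Um[measurable]: "U \<in> borel_measurable borel" unfolding U_def[abs_def] by measurable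
  have Up: "ennreal (U y powr p) = (\<integral>\<^sup>+x. ennreal (norm (G (x, y)) powr p) \<partial>lborel)" for y
  proof -
    have "U y powr p = (\<integral>x. norm (G (x, y)) powr p \<partial>lborel)"
      unfolding U_def using p1 by (simp add: powr_powr)
    then show ?thesis using test_function_powr_integrable[OF test_function_slice[OF G, of y], of p] p1
      by (subst nn_integral_eq_integral) auto
  qed
  have UN: "(\<integral>\<^sup>+y. ennreal (U y powr p) \<partial>lborel) \<le> ennreal N"
  proof -
    have "(\<integral>\<^sup>+y. ennreal (U y powr p) \<partial>lborel) = (\<integral>\<^sup>+z. ennreal (norm (G z) powr p) \<partial>(lborel \<Otimes>\<^sub>M lborel))"
      unfolding Up by (rule lborel_pair.nn_integral_snd) measurable
    then show ?thesis using N by (simp add: lborel_prod)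
  qed
  \<comment> \<open>Two slices inside a ball of radius R differ by less than 2R, so \<kappa> may be
    cut off there. As (1 - 2/q)(q/2) = (q - 2)/2, the weak L^(q/2) bound for \<open>k\<close> is the
    weak L^1 bound assumed for the power of \<kappa>.\<close>
  define k where "k y = \<kappa> y powr (1 - 2 / q) * indicator (ball 0 (2 * R)) y" for y
  have [measurable]: "ball (0::'b) (2 * R) \<in> sets borel" by simp
  have km[measurable]: "k \<in> borel_measurable borel" unfolding k_def[abs_def] by measurable
  have k0: "k y \<ge> 0" for y by (simp add: k_def)
  have ke: "k (- y) = k y" for y by (simp add: k_def \<kappa>e indicator_def)
  have kw: "emeasure lborel {y. k y > c} \<le> ennreal (W * c powr - (q / 2))" if c: "c > 0" for c
  proof -
    have "{y. k y > c} \<subseteq> {y \<in> ball 0 (2 * R). \<kappa> y powr ((q - 2) / 2) > c powr (q / 2)}"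
    proof (intro subsetI CollectI conjI)
      fix y assume "y \<in> {y. k y > c}"
      then have y: "k y > c" by simp
      then show yb: "y \<in> ball 0 (2 * R)" using c by (cases "y \<in> ball 0 (2 * R)") (simp_all add: k_def)
      have "c < \<kappa> y powr (1 - 2 / q)" using y yb by (simp add: k_def)
      then have "c powr (q / 2) < (\<kappa> y powr (1 - 2 / q)) powr (q / 2)" using c q by (intro powr_less_mono2) auto
      also have "\<dots> = \<kappa> y powr ((1 - 2 / q) * (q / 2))" by (simp add: powr_powr)
      also have "(1 - 2 / q) * (q / 2) = (q - 2) / 2" using q by (simp add: field_simps)
      finally show "c powr (q / 2) < \<kappa> y powr ((q - 2) / 2)" .
    qed
    then have "emeasure lborel {y. k y > c} \<le> emeasure lborel {y \<in> ball 0 (2 * R). \<kappa> y powr ((q - 2) / 2) > c powr (q / 2)}"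
      by (rule emeasure_mono) measurable
    also have "\<dots> \<le> ennreal (W / c powr (q / 2))" using c by (intro weak) simp
    finally show ?thesis by (simp add: powr_minus_divide)
  qed
  have ic: "interp_const q \<ge> 0" using q by (simp add: interp_const_def)
  have point: "ennreal (norm (phase_form (\<lambda>\<xi>. (y - y') \<bullet> Q \<xi>) (\<lambda>x. G (x, y)) (\<lambda>x. G (x, y')))) \<le> ennreal (interp_const q) * ennreal (k (y - y') * U y * U y')" for y y'
  proof -
    have 1: "norm (phase_form (\<lambda>\<xi>. (y - y') \<bullet> Q \<xi>) (\<lambda>x. G (x, y)) (\<lambda>x. G (x, y'))) \<le> interp_const q * \<kappa> (y - y') powr (1 - 2 / q) * (U y * U y')"
      unfolding U_def by (rule norm_phase_form_le[OF test_function_slice[OF G] test_function_slice[OF G] _ \<kappa> \<kappa>0 q p]) measurable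
    have 2: "\<kappa> (y - y') powr (1 - 2 / q) * (U y * U y') \<le> k (y - y') * (U y * U y')"
    proof (cases "y \<in> ball c R \<and> y' \<in> ball c R")
      case True
      then have "dist y y' < 2 * R" using dist_triangle2[of y y' c] by (auto simp: dist_commute)
      then have "y - y' \<in> ball 0 (2 * R)" by (simp add: dist_norm norm_minus_commute)
      then show ?thesis by (simp add: k_def)
    next
      case False
      have "U v = 0" if "v \<notin> ball c R" for v
      proof -
        have "G (x, v) = 0" for x using supp that by blast
        then show ?thesis by (simp add: U_def)
      qed
      then have "U y = 0 \<or> U y' = 0" using False by auto
      then show ?thesis by (elim disjE) simp_all
    qed
    have "norm (phase_form (\<lambda>\<xi>. (y - y') \<bullet> Q \<xi>) (\<lambda>x. G (x, y)) (\<lambda>x. G (x, y'))) \<le> interp_const q * (k (y - y') * U y * U y')"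
      using order_trans[OF 1[unfolded mult.assoc] mult_left_mono[OF 2 ic]] by (simp add: mult.assoc)
    then show ?thesis using ic by (subst ennreal_mult'[symmetric]) (auto intro: ennreal_leI)
  qed
  have [measurable]: "(\<lambda>(y', y). ennreal (k (y - y') * U y * U y')) \<in> borel_measurable (lborel \<Otimes>\<^sub>M lborel)"
  proof -
    have "(\<lambda>(y', y). ennreal (k (y - y') * U y * U y')) \<in> borel_measurable (borel \<Otimes>\<^sub>M borel)" by measurable
    then show ?thesis by simp
  qed
  have "(\<integral>\<xi>. gauss \<xi> * (norm (ext_dual Q G \<xi>))\<^sup>2 \<partial>lborel) \<ge> 0" by (intro integral_nonneg_AE) auto
  then have "ennreal (\<integral>\<xi>. gauss \<xi> * (norm (ext_dual Q G \<xi>))\<^sup>2 \<partial>lborel) =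
     ennreal (norm (complex_of_real (\<integral>\<xi>. gauss \<xi> * (norm (ext_dual Q G \<xi>))\<^sup>2 \<partial>lborel)))" by (simp only: norm_of_real abs_of_nonneg)
  also have "\<dots> \<le> (\<integral>\<^sup>+y'. \<integral>\<^sup>+y. ennreal (norm (phase_form (\<lambda>\<xi>. (y - y') \<bullet> Q \<xi>) (\<lambda>x. G (x, y)) (\<lambda>x. G (x, y')))) \<partial>lborel \<partial>lborel)"
    unfolding ext_dual_square[OF G Q] by (rule order_trans[OF norm_integral_le_nn_integral nn_integral_mono]) (rule norm_integral_le_nn_integral)
  also have "\<dots> \<le> (\<integral>\<^sup>+y'. \<integral>\<^sup>+y. ennreal (interp_const q) * ennreal (k (y - y') * U y * U y') \<partial>lborel \<partial>lborel)"
    by (intro nn_integral_mono point)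
  also have "\<dots> = ennreal (interp_const q) * (\<integral>\<^sup>+y'. \<integral>\<^sup>+y. ennreal (k (y - y') * U y * U y') \<partial>lborel \<partial>lborel)"
    by (subst nn_integral_cmult, measurable)+
  also have "(\<integral>\<^sup>+y'. \<integral>\<^sup>+y. ennreal (k (y - y') * U y * U y') \<partial>lborel \<partial>lborel) = (\<integral>\<^sup>+y'. \<integral>\<^sup>+y. ennreal (k (y' - y) * U y' * U y) \<partial>lborel \<partial>lborel)"
  proof -
    have "k (y - y') * U y * U y' = k (y' - y) * U y' * U y" for y y' using ke[of "y - y'"] by simp
    then show ?thesis by (intro nn_integral_cong arg_cong[where f = ennreal])
  qed
  finally have I: "ennreal (\<integral>\<xi>. gauss \<xi> * (norm (ext_dual Q G \<xi>))\<^sup>2 \<partial>lborel) \<le> ennreal (interp_const q) * (\<integral>\<^sup>+y'. \<integral>\<^sup>+y. ennreal (k (y' - y) * U y' * U y) \<partial>lborel \<partial>lborel)" .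
  also have "\<dots> \<le> ennreal (interp_const q) * ennreal (2 * (q - 1) * (q / (q - 2)) * W powr (2 / q) * N powr (2 - 2 / q))"
    by (intro mult_left_mono weak_young[OF km k0 ke q p W kw Um U0 UN N(2)]) simp_all
  also have "\<dots> = ennreal (strichartz_const q * W powr (2 / q) * N powr (2 - 2 / q))"
    unfolding strichartz_const_def using ic by (subst ennreal_mult'[symmetric]) (simp_all add: mult.assoc)
  finally show ?thesis using strichartz_const_pos[OF q] by (subst (asm) ennreal_le_iff) auto
qed

text \<open>The \<open>TT\<^sup>*\<close> argument: the extension of \<open>f\<close> is tested against the dual function
  \<open>\<bar>F\<bar>\<^bsup>q - 2\<^esup> cnj F\<close> on the ball.\<close>

lemma extension_strichartz:
  fixes f :: "'a::euclidean_space \<Rightarrow> complex" and Q :: "'a \<Rightarrow> 'b::euclidean_space" and \<kappa> :: "'b \<Rightarrow> real"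
  assumes Q[measurable]: "Q \<in> borel_measurable borel"
    and \<kappa>m[measurable]: "\<kappa> \<in> borel_measurable borel" and \<kappa>0: "\<And>y. \<kappa> y > 0" and \<kappa>e: "\<And>y. \<kappa> (- y) = \<kappa> y"
    and \<kappa>: "\<And>x y. norm (phase_kernel (\<lambda>\<xi>. y \<bullet> Q \<xi>) x) \<le> \<kappa> y"
    and q: "q > 2" and W: "W > 0"
    and weak: "\<And>c. c > 0 \<Longrightarrow> emeasure lborel {y \<in> ball 0 (2 * R). \<kappa> y powr ((q - 2) / 2) > c} \<le> ennreal (W / c)"
    and f: "integrable lborel f" "integrable lborel (\<lambda>\<xi>. (norm (f \<xi>))\<^sup>2)" and supp: "\<And>\<xi>. f \<xi> \<noteq> 0 \<Longrightarrow> (norm \<xi>)\<^sup>2 \<le> D"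
  defines "F \<equiv> \<lambda>z. \<integral>\<xi>. cis (2 * pi * (fst z \<bullet> \<xi> + snd z \<bullet> Q \<xi>)) * f \<xi> \<partial>lborel"
  shows "(\<integral>\<^sup>+z\<in>ball z0 R. ennreal (norm (F z) powr q) \<partial>lborel)
     \<le> ennreal ((exp D * strichartz_const q * W powr (2 / q) * (\<integral>\<xi>. (norm (f \<xi>))\<^sup>2 \<partial>lborel)) powr (q / 2))"
proof -
  have fm[measurable]: "f \<in> borel_measurable borel" using f(1) by simp
  define A where "A = (\<integral>\<xi>. (norm (f \<xi>))\<^sup>2 \<partial>lborel)"
  define H where "H = (\<integral>\<xi>. norm (f \<xi>) \<partial>lborel)"
  define p where "p = q / (q - 1)"
  have p1: "p > 1" using q unfolding p_def by (simp add: less_divide_eq)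
  have FH: "norm (F z) \<le> H" for z
    unfolding F_def H_def by (rule order_trans[OF integral_norm_bound]) (simp add: norm_mult)
  have H0: "H \<ge> 0" by (simp add: H_def)
  have Fm': "F \<in> borel_measurable (borel \<Otimes>\<^sub>M borel)" unfolding F_def by measurable
  then have Fm[measurable]: "F \<in> borel_measurable borel" by (simp add: borel_prod)
  define G where "G z = indicator (ball z0 R) z * (complex_of_real (norm (F z) powr (q - 2)) * cnj (F z))" for z
  have [measurable]: "ball z0 R \<in> sets borel" by simp
  have Gm[measurable]: "G \<in> borel_measurable borel" unfolding G_def[abs_def] by measurable
  have nG: "norm (G z) = indicator (ball z0 R) z * norm (F z) powr (q - 1)" for z
  proof -
    have "norm (F z) powr (q - 2) * norm (F z) = norm (F z) powr (q - 1)"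
      using powr_add[of "norm (F z)" "q - 2" 1] by (cases "F z = 0") auto
    then show ?thesis by (simp add: G_def norm_mult indicator_def)
  qed
  have G: "test_function G"
  proof (rule test_functionI[OF Gm])
    show "norm (G z) \<le> H powr (q - 1)" for z
      unfolding nG using FH[of z] q by (auto simp: indicator_def intro!: powr_mono2)
    show "G z = 0" if "norm z > norm z0 + R" for z
    proof -
      have "z \<notin> ball z0 R" using that norm_triangle_ineq2[of z z0] by (auto simp: dist_norm norm_minus_commute)
      then show ?thesis by (simp add: G_def)
    qed
  qed
  note Gi = test_function_integrable[OF G]
  have GF: "G z * F z = complex_of_real (indicator (ball z0 R) z * norm (F z) powr q)" for z
  proof -
    have "complex_of_real (norm (F z) powr (q - 2)) * (cnj (F z) * F z) = complex_of_real (norm (F z) powr (q - 2)) * complex_of_real ((norm (F z))\<^sup>2)"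
      by (simp only: complex_norm_square mult.commute)
    also have "\<dots> = complex_of_real (norm (F z) powr (q - 2) * norm (F z) powr 2)"
      by (cases "F z = 0") (auto simp: powr_numeral)
    also have "norm (F z) powr (q - 2) * norm (F z) powr 2 = norm (F z) powr (q - 2 + 2)" by (rule powr_add[symmetric])
    finally show ?thesis by (simp add: G_def indicator_def mult.assoc)
  qed
  \<comment> \<open>Finiteness is known a priori, since \<open>F\<close> is bounded and the ball has
    finite measure; a power of \<open>V\<close> can therefore be cancelled at the end.\<close>
  have Vi: "integrable lborel (\<lambda>z. indicator (ball z0 R) z * norm (F z) powr q)"
  proof -
    have "integrable lborel (\<lambda>z. norm (G z) powr p)" using p1 by (intro test_function_powr_integrable[OF G]) simp
    also have "(\<lambda>z. norm (G z) powr p) = (\<lambda>z. indicator (ball z0 R) z * norm (F z) powr q)"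
      unfolding nG using q by (auto simp: indicator_def p_def powr_powr)
    finally show ?thesis .
  qed
  define V where "V = (\<integral>z. indicator (ball z0 R) z * norm (F z) powr q \<partial>lborel)"
  have V0: "V \<ge> 0" unfolding V_def by (intro integral_nonneg_AE) auto
  have Vnn: "(\<integral>\<^sup>+z\<in>ball z0 R. ennreal (norm (F z) powr q) \<partial>lborel) = ennreal V"
    unfolding V_def using Vi by (subst nn_integral_eq_integral[symmetric]) (auto intro!: nn_integral_cong simp: indicator_def)
  have GV: "(\<integral>\<^sup>+z. ennreal (norm (G z) powr p) \<partial>lborel) = ennreal V"
    unfolding Vnn[symmetric] nG using q by (intro nn_integral_cong) (auto simp: indicator_def p_def powr_powr)
  have "V \<le> (exp D * strichartz_const q * W powr (2 / q) * A) powr (q / 2)"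
  proof (cases "V = 0")
    case False
    then have V: "V > 0" using V0 by simp
    define B where "B = strichartz_const q * W powr (2 / q)"
    have B: "B > 0" unfolding B_def using strichartz_const_pos[OF q] W by simp
    have dual: "(\<integral>\<xi>. gauss \<xi> * (norm (ext_dual Q G \<xi>))\<^sup>2 \<partial>lborel) \<le> B * V powr (2 - 2 / q)"
      unfolding B_def
    proof (rule ext_dual_bound[OF G Q \<kappa>m \<kappa>0 \<kappa>e \<kappa> q p_def W weak, where c = "snd z0"])
      show "y \<in> ball (snd z0) R" if "G (x, y) \<noteq> 0" for x y
      proof -
        have "(x, y) \<in> ball z0 R" using that by (auto simp: G_def indicator_def split: if_splits)
        then show ?thesis using dist_snd_le[of z0 "(x, y)"] by simp
      qed
    qed (use GV V in auto)
    have em: "ext_dual Q G \<in> borel_measurable borel" by (rule ext_dual_measurable[OF Gm Q])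
    note [measurable] = em
    have di: "integrable lborel (\<lambda>\<xi>. gauss \<xi> * (norm (ext_dual Q G \<xi>))\<^sup>2)"
    proof (rule Bochner_Integration.integrable_bound[OF integrable_mult_left[OF gauss_integrable, of "(\<integral>z. norm (G z) \<partial>lborel)\<^sup>2"]])
      show "AE \<xi> in lborel. norm (gauss \<xi> * (norm (ext_dual Q G \<xi>))\<^sup>2) \<le> norm (gauss \<xi> * (\<integral>z. norm (G z) \<partial>lborel)\<^sup>2)"
        using norm_ext_dual_le[of Q G] by (intro AE_I2) (auto simp: abs_mult intro!: mult_left_mono power_mono)
    qed measurable
    have "complex_of_real V = (\<integral>z. G z * F z \<partial>lborel)"
      unfolding V_def GF by (rule integral_complex_of_real[symmetric])
    also have "\<dots> = (\<integral>z. \<integral>\<xi>. G z * (cis (2 * pi * (fst z \<bullet> \<xi> + snd z \<bullet> Q \<xi>)) * f \<xi>) \<partial>lborel \<partial>lborel)"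
      unfolding F_def by (simp only: integral_mult_right_zero)
    also have "\<dots> = (\<integral>\<xi>. \<integral>z. G z * (cis (2 * pi * (fst z \<bullet> \<xi> + snd z \<bullet> Q \<xi>)) * f \<xi>) \<partial>lborel \<partial>lborel)"
    proof (rule lborel_Fubini_bound(1)[OF Gi(2) integrable_norm[OF f(1)]])
      have [measurable]: "G \<in> borel_measurable (borel \<Otimes>\<^sub>M borel)" using Gm by (simp add: borel_prod)
      have "(\<lambda>p. G (fst p) * (cis (2 * pi * (fst (fst p) \<bullet> snd p + snd (fst p) \<bullet> Q (snd p))) * f (snd p))) \<in> borel_measurable ((borel \<Otimes>\<^sub>M borel) \<Otimes>\<^sub>M borel)"
        by measurable
      then show "(\<lambda>p. G (fst p) * (cis (2 * pi * (fst (fst p) \<bullet> snd p + snd (fst p) \<bullet> Q (snd p))) * f (snd p))) \<in> borel_measurable borel"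
        by (simp add: borel_prod)
    qed (simp add: norm_mult)
    also have "\<dots> = (\<integral>\<xi>. f \<xi> * ext_dual Q G \<xi> \<partial>lborel)"
    proof (rule Bochner_Integration.integral_cong[OF refl])
      fix \<xi>
      have eq: "G z * (cis (2 * pi * (fst z \<bullet> \<xi> + snd z \<bullet> Q \<xi>)) * f \<xi>) = f \<xi> * (cis (2 * pi * (fst z \<bullet> \<xi> + snd z \<bullet> Q \<xi>)) * G z)" for z
        by (simp only: mult_ac)
      show "(\<integral>z. G z * (cis (2 * pi * (fst z \<bullet> \<xi> + snd z \<bullet> Q \<xi>)) * f \<xi>) \<partial>lborel) = f \<xi> * ext_dual Q G \<xi>"
        unfolding eq ext_dual_def by (rule integral_mult_right_zero)
    qed
    finally have "complex_of_real V = (\<integral>\<xi>. f \<xi> * ext_dual Q G \<xi> \<partial>lborel)" .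
    then have "V = norm (\<integral>\<xi>. f \<xi> * ext_dual Q G \<xi> \<partial>lborel)" using V0 by (metis norm_of_real abs_of_nonneg)
    also have "\<dots> \<le> (\<integral>\<xi>. norm (f \<xi> * ext_dual Q G \<xi>) \<partial>lborel)" by (rule integral_norm_bound)
    finally have V1: "V \<le> (\<integral>\<xi>. norm (f \<xi> * ext_dual Q G \<xi>) \<partial>lborel)" .
    \<comment> \<open>The arithmetic-geometric mean with a free weight \<open>s\<close> serves as
      Cauchy-Schwarz. On the support of \<open>f\<close> one has
      \<open>1 \<le> exp D * gauss \<xi>\<close>, which brings in the Gaussian weight of
      \<open>dual\<close>.\<close>
    have V2: "2 * V \<le> s * A + exp D * (B * V powr (2 - 2 / q)) / s" if s: "s > 0" for s
    proof -
      have "(\<integral>\<xi>. norm (f \<xi> * ext_dual Q G \<xi>) \<partial>lborel) \<le> (\<integral>\<xi>. (s / 2) * (norm (f \<xi>))\<^sup>2 + (exp D / (2 * s)) * (gauss \<xi> * (norm (ext_dual Q G \<xi>))\<^sup>2) \<partial>lborel)"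
      proof (rule integral_mono')
        show "integrable lborel (\<lambda>\<xi>. (s / 2) * (norm (f \<xi>))\<^sup>2 + (exp D / (2 * s)) * (gauss \<xi> * (norm (ext_dual Q G \<xi>))\<^sup>2))"
          using f(2) di by simp
        fix \<xi>
        show "norm (f \<xi> * ext_dual Q G \<xi>) \<le> (s / 2) * (norm (f \<xi>))\<^sup>2 + (exp D / (2 * s)) * (gauss \<xi> * (norm (ext_dual Q G \<xi>))\<^sup>2)"
        proof (cases "f \<xi> = 0")
          case True
          then show ?thesis using s by simp
        next
          case False
          let ?a = "norm (f \<xi>)" and ?e = "norm (ext_dual Q G \<xi>)"
          have "0 \<le> (s * ?a - ?e)\<^sup>2" by simp
          then have "2 * s * (?a * ?e) \<le> s\<^sup>2 * ?a\<^sup>2 + ?e\<^sup>2" by (simp add: power2_diff power_mult_distrib)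
          then have "?a * ?e \<le> (s / 2) * ?a\<^sup>2 + ?e\<^sup>2 / (2 * s)" using s by (simp add: field_simps power2_eq_square)
          also have "?e\<^sup>2 / (2 * s) \<le> (exp D / (2 * s)) * (gauss \<xi> * ?e\<^sup>2)"
          proof -
            have "1 \<le> exp D * gauss \<xi>" using supp[OF False] by (simp flip: exp_add)
            then have "1 * ?e\<^sup>2 \<le> exp D * gauss \<xi> * ?e\<^sup>2" by (rule mult_right_mono) simp
            then show ?thesis using s by (simp add: field_simps)
          qed
          finally show ?thesis by (simp add: norm_mult)
        qed
      next
        show "0 \<le> (s / 2) * (norm (f \<xi>))\<^sup>2 + (exp D / (2 * s)) * (gauss \<xi> * (norm (ext_dual Q G \<xi>))\<^sup>2)" for \<xi> using s by simp
      qed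
      also have "\<dots> = (s / 2) * A + (exp D / (2 * s)) * (\<integral>\<xi>. gauss \<xi> * (norm (ext_dual Q G \<xi>))\<^sup>2 \<partial>lborel)"
        unfolding A_def using f(2) di by simp
      also have "\<dots> \<le> (s / 2) * A + (exp D / (2 * s)) * (B * V powr (2 - 2 / q))"
        using dual s by (intro add_left_mono mult_left_mono) auto
      finally have "V \<le> (s / 2) * A + (exp D / (2 * s)) * (B * V powr (2 - 2 / q))" using V1 by simp
      then show ?thesis using s by (simp add: field_simps)
    qed
    have A0: "A \<ge> 0" by (simp add: A_def)
    \<comment> \<open>\<open>V2\<close> with s = V/A turns into V^2 \<le> A X. If A = 0, the choice
      s = X/V gives 2V \<le> V, impossible for positive V.\<close>
    define X where "X = exp D * (B * V powr (2 - 2 / q))"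
    have X: "X > 0" using B V by (simp add: X_def)
    have "V\<^sup>2 \<le> A * X"
    proof (cases "A = 0")
      case True
      have "2 * V \<le> X / (X / V)" using V2[of "X / V"] True X V by (simp add: X_def)
      then show ?thesis using X V by simp
    next
      case False
      then have A: "A > 0" using A0 by simp
      have "2 * V \<le> V / A * A + X / (V / A)" using V2[of "V / A"] V A by (simp add: X_def)
      then have "V \<le> X * A / V" using A by simp
      then show ?thesis using V by (simp add: field_simps power2_eq_square)
    qed
    then have "V powr 2 \<le> (exp D * B * A) * V powr (2 - 2 / q)"
      using V by (simp add: X_def powr_numeral mult_ac)
    also have "V powr 2 = V powr (2 / q) * V powr (2 - 2 / q)" by (simp flip: powr_add)
    finally have "V powr (2 / q) \<le> exp D * B * A" using V by simp
    then have "(V powr (2 / q)) powr (q / 2) \<le> (exp D * B * A) powr (q / 2)" using q by (intro powr_mono2) auto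
    then show ?thesis using q V by (simp add: powr_powr B_def mult.assoc)
  qed simp
  then show ?thesis unfolding Vnn A_def by (rule ennreal_leI)
qed

section \<open>From Borel functions to the extension operator and the given norms\<close>

lemma borel_representative:
  fixes f :: "'a::euclidean_space \<Rightarrow> complex"
  assumes "f \<in> borel_measurable lebesgue"
  obtains g where "g \<in> borel_measurable borel" "AE x in lborel. f x = g x"
proof -
  have "(\<lambda>x. Re (f x)) \<in> borel_measurable lebesgue" "(\<lambda>x. Im (f x)) \<in> borel_measurable lebesgue"
    using assms by (auto intro: borel_measurable_Re borel_measurable_Im)
  then obtain a b where ab: "a \<in> borel_measurable lborel" "AE x in lborel. Re (f x) = a x"
      "b \<in> borel_measurable lborel" "AE x in lborel. Im (f x) = b x"
    using completion_ex_borel_measurable_real by metis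
  show thesis
  proof
    show "(\<lambda>x. Complex (a x) (b x)) \<in> borel_measurable borel"
      using ab by (simp add: borel_measurable_complex_iff)
    show "AE x in lborel. f x = Complex (a x) (b x)"
      using ab(2,4) by eventually_elim (simp add: complex_eq_iff)
  qed
qed

lemma unit_cube_norm_le: "\<xi> \<in> unit_cube \<Longrightarrow> (norm \<xi>)\<^sup>2 \<le> real CARD('d)" for \<xi> :: "real^'d"
proof -
  assume "\<xi> \<in> unit_cube"
  then have b: "0 \<le> \<xi> $ i \<and> \<xi> $ i \<le> 1" for i by (auto simp: unit_cube_def mem_box_cart)
  have "(norm \<xi>)\<^sup>2 = (\<Sum>i\<in>UNIV. \<xi> $ i * \<xi> $ i)" by (simp add: power2_norm_eq_inner inner_vec_def)
  also have "\<dots> \<le> (\<Sum>i\<in>(UNIV::'d set). 1)" using b by (intro sum_mono mult_le_one) auto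
  finally show ?thesis by simp
qed

text \<open>An element of \<open>Lp_space\<close> is only Lebesgue measurable on the cube. Replacing
  it by a Borel function vanishing off the cube changes neither its extension nor its norm. On the
  cube the squared norm of \<xi> is at most the dimension, which becomes the exponent of
  \<open>exp\<close>.\<close>

lemma extension_op_bound:
  fixes Q :: "real^'d \<Rightarrow> real^'n" and \<kappa> :: "real^'n \<Rightarrow> real"
  assumes Q[measurable]: "Q \<in> borel_measurable borel"
    and \<kappa>m[measurable]: "\<kappa> \<in> borel_measurable borel" and \<kappa>0: "\<And>y. \<kappa> y > 0" and \<kappa>e: "\<And>y. \<kappa> (- y) = \<kappa> y"
    and \<kappa>: "\<And>x y. norm (phase_kernel (\<lambda>\<xi>. y \<bullet> Q \<xi>) x) \<le> \<kappa> y"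
    and q: "q > 2" and W: "W > 0"
    and weak: "\<And>c. c > 0 \<Longrightarrow> emeasure lborel {y \<in> ball 0 (2 * R). \<kappa> y powr ((q - 2) / 2) > c} \<le> ennreal (W / c)"
    and f: "f \<in> Lp_space 2 unit_cube"
  shows "Lp_norm q (ball z R) (extension_op Q f) \<le>
    ennreal (sqrt (exp (real CARD('d)) * strichartz_const q) * W powr (1 / q)) * Lp_norm 2 unit_cube f"
proof -
  have cube[measurable]: "(unit_cube :: (real^'d) set) \<in> sets borel" by (simp add: unit_cube_def)
  have fin: "emeasure lborel (unit_cube :: (real^'d) set) < \<infinity>"
    unfolding unit_cube_def by (intro emeasure_bounded_finite) simp
  define f0 where "f0 \<xi> = indicator unit_cube \<xi> *\<^sub>R f \<xi>" for \<xi>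
  have "f \<in> borel_measurable (lebesgue_on unit_cube)" using f by (simp add: Lp_space_def)
  then have f0m: "f0 \<in> borel_measurable lebesgue"
    unfolding f0_def[abs_def] by (subst (asm) borel_measurable_restrict_space_iff) auto
  obtain f1 where f1: "f1 \<in> borel_measurable borel" "AE \<xi> in lborel. f0 \<xi> = f1 \<xi>"
    using borel_representative[OF f0m] by blast
  define g where "g \<xi> = indicator unit_cube \<xi> *\<^sub>R f1 \<xi>" for \<xi>
  have gm[measurable]: "g \<in> borel_measurable borel" using f1(1) unfolding g_def[abs_def] by measurable
  have ae: "AE \<xi> in lborel. f0 \<xi> = g \<xi>"
    using f1(2) by eventually_elim (auto simp: g_def f0_def indicator_def split: if_splits)
  have aec: "AE \<xi> in lebesgue. f0 \<xi> = g \<xi>" using ae by (rule AE_completion)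
  have I2: "(\<integral>\<^sup>+\<xi>. ennreal (norm (f \<xi>) powr 2) \<partial>lebesgue_on unit_cube) = (\<integral>\<^sup>+\<xi>. ennreal ((norm (g \<xi>))\<^sup>2) \<partial>lborel)"
  proof -
    have "(\<integral>\<^sup>+\<xi>. ennreal (norm (f \<xi>) powr 2) \<partial>lebesgue_on unit_cube) = (\<integral>\<^sup>+\<xi>. ennreal (norm (f \<xi>) powr 2) * indicator unit_cube \<xi> \<partial>lebesgue)"
      by (rule nn_integral_restrict_space) (simp add: unit_cube_def)
    also have "\<dots> = (\<integral>\<^sup>+\<xi>. ennreal ((norm (g \<xi>))\<^sup>2) \<partial>lebesgue)"
    proof (rule nn_integral_cong_AE)
      show "AE \<xi> in lebesgue. ennreal (norm (f \<xi>) powr 2) * indicator unit_cube \<xi> = ennreal ((norm (g \<xi>))\<^sup>2)"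
        using aec
      proof eventually_elim
        case (elim \<xi>)
        have "norm (f \<xi>) powr 2 = (norm (f \<xi>))\<^sup>2" by (cases "f \<xi> = 0") (auto simp: powr_numeral)
        then show ?case unfolding elim[symmetric] f0_def by (simp add: indicator_def)
      qed
    qed
    also have "\<dots> = (\<integral>\<^sup>+\<xi>. ennreal ((norm (g \<xi>))\<^sup>2) \<partial>lborel)"
      by (rule nn_integral_completion)
    finally show ?thesis .
  qed
  have I2fin: "(\<integral>\<^sup>+\<xi>. ennreal ((norm (g \<xi>))\<^sup>2) \<partial>lborel) < \<infinity>"
    using f unfolding I2[symmetric] by (auto simp: Lp_space_def Lp_norm_def Let_def less_top split: if_splits)
  have g2: "integrable lborel (\<lambda>\<xi>. (norm (g \<xi>))\<^sup>2)"
    using I2fin by (intro integrableI_bounded) auto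
  have g1: "integrable lborel g"
  proof (rule Bochner_Integration.integrable_bound)
    show "integrable lborel (\<lambda>\<xi>. indicator (unit_cube :: (real^'d) set) \<xi> + (norm (g \<xi>))\<^sup>2)"
      using g2 fin by (intro Bochner_Integration.integrable_add integrable_real_indicator) auto
    show "AE \<xi> in lborel. norm (g \<xi>) \<le> norm (indicator (unit_cube :: (real^'d) set) \<xi> + (norm (g \<xi>))\<^sup>2)"
    proof (intro AE_I2)
      fix \<xi>
      have "t \<le> 1 + t\<^sup>2" if "t \<ge> 0" for t :: real
        using sum_squares_bound[of t 1] that by (smt (verit) one_power2 zero_le_power2)
      then show "norm (g \<xi>) \<le> norm (indicator (unit_cube :: (real^'d) set) \<xi> + (norm (g \<xi>))\<^sup>2)"
        by (auto simp: g_def indicator_def)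
    qed
  qed measurable
  define A where "A = (\<integral>\<xi>. (norm (g \<xi>))\<^sup>2 \<partial>lborel)"
  have A0: "A \<ge> 0" by (simp add: A_def)
  have nf: "Lp_norm 2 unit_cube f = ennreal (sqrt A)"
  proof -
    have e: "(\<integral>\<^sup>+\<xi>. ennreal ((norm (g \<xi>))\<^sup>2) \<partial>lborel) = ennreal A"
      unfolding A_def using g2 by (intro nn_integral_eq_integral) auto
    then show ?thesis
      unfolding Lp_norm_def Let_def I2 e using A0 by (simp add: powr_half_sqrt)
  qed
  define F where "F z = (\<integral>\<xi>. cis (2 * pi * (fst z \<bullet> \<xi> + snd z \<bullet> Q \<xi>)) * g \<xi> \<partial>lborel)" for z
  have EF: "extension_op Q f = F"
  proof
    fix z :: "(real^'d) \<times> (real^'n)"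
    obtain x y where z: "z = (x, y)" by (cases z)
    have ex: "exp (2 * of_real pi * \<i> * of_real (x \<bullet> \<xi> + y \<bullet> Q \<xi>)) = cis (2 * pi * (x \<bullet> \<xi> + y \<bullet> Q \<xi>))" for \<xi>
      by (simp add: cis_conv_exp mult_ac)
    have cm: "(\<lambda>\<xi>. cis (2 * pi * (x \<bullet> \<xi> + y \<bullet> Q \<xi>))) \<in> borel_measurable lborel" by measurable
    have "extension_op Q f z = (\<integral>\<xi>. cis (2 * pi * (x \<bullet> \<xi> + y \<bullet> Q \<xi>)) * f \<xi> \<partial>lebesgue_on unit_cube)"
      unfolding z extension_op_def prod.case ex ..
    also have "\<dots> = (\<integral>\<xi>. indicator unit_cube \<xi> *\<^sub>R (cis (2 * pi * (x \<bullet> \<xi> + y \<bullet> Q \<xi>)) * f \<xi>) \<partial>lebesgue)"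
      by (rule integral_restrict_space) (simp add: unit_cube_def)
    also have "\<dots> = (\<integral>\<xi>. cis (2 * pi * (x \<bullet> \<xi> + y \<bullet> Q \<xi>)) * f0 \<xi> \<partial>lebesgue)"
      by (simp add: f0_def)
    also have "\<dots> = (\<integral>\<xi>. cis (2 * pi * (x \<bullet> \<xi> + y \<bullet> Q \<xi>)) * g \<xi> \<partial>lebesgue)"
    proof (rule integral_cong_AE)
      show "AE \<xi> in lebesgue. cis (2 * pi * (x \<bullet> \<xi> + y \<bullet> Q \<xi>)) * f0 \<xi> = cis (2 * pi * (x \<bullet> \<xi> + y \<bullet> Q \<xi>)) * g \<xi>"
        using aec by eventually_elim simp
      show "(\<lambda>\<xi>. cis (2 * pi * (x \<bullet> \<xi> + y \<bullet> Q \<xi>)) * f0 \<xi>) \<in> borel_measurable lebesgue"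
        using f0m measurable_completion[OF cm] by (rule borel_measurable_times[rotated])
      show "(\<lambda>\<xi>. cis (2 * pi * (x \<bullet> \<xi> + y \<bullet> Q \<xi>)) * g \<xi>) \<in> borel_measurable lebesgue"
        by (intro borel_measurable_times measurable_completion cm) simp
    qed
    also have "\<dots> = F z"
      unfolding F_def z fst_conv snd_conv by (rule integral_completion) measurable
    finally show "extension_op Q f z = F z" .
  qed
  have Fm: "F \<in> borel_measurable borel"
    by (rule borel_measurable_pairI) (unfold F_def, measurable)
  define B where "B = exp (real CARD('d)) * strichartz_const q * W powr (2 / q) * A"
  have B0: "B \<ge> 0" unfolding B_def using A0 strichartz_const_pos[OF q] by simp
  have "(\<integral>\<^sup>+z. ennreal (norm (F z) powr q) \<partial>lebesgue_on (ball z R)) = (\<integral>\<^sup>+w. ennreal (norm (F w) powr q) * indicator (ball z R) w \<partial>lebesgue)"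
    by (rule nn_integral_restrict_space) simp
  also have "\<dots> = (\<integral>\<^sup>+w\<in>ball z R. ennreal (norm (F w) powr q) \<partial>lborel)"
    by (rule nn_integral_completion)
  also have "\<dots> \<le> ennreal (B powr (q / 2))"
    unfolding F_def B_def A_def
  proof (rule extension_strichartz[OF Q \<kappa>m \<kappa>0 \<kappa>e \<kappa> q W weak g1 g2])
    show "(norm \<xi>)\<^sup>2 \<le> real CARD('d)" if "g \<xi> \<noteq> 0" for \<xi>
      using that by (intro unit_cube_norm_le) (auto simp: g_def indicator_def split: if_splits)
  qed
  finally have V: "(\<integral>\<^sup>+z. ennreal (norm (F z) powr q) \<partial>lebesgue_on (ball z R)) \<le> ennreal (B powr (q / 2))" .
  then have Vtop: "(\<integral>\<^sup>+z. ennreal (norm (F z) powr q) \<partial>lebesgue_on (ball z R)) \<noteq> \<infinity>"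
    by (auto simp: top_unique)
  have "Lp_norm q (ball z R) (extension_op Q f) = ennreal (enn2real (\<integral>\<^sup>+z. ennreal (norm (F z) powr q) \<partial>lebesgue_on (ball z R)) powr (1 / q))"
    unfolding EF Lp_norm_def Let_def using Vtop by simp
  also have "\<dots> \<le> ennreal ((B powr (q / 2)) powr (1 / q))"
    using V q by (intro ennreal_leI powr_mono2) (auto intro: enn2real_leI)
  also have "(B powr (q / 2)) powr (1 / q) = sqrt B"
  proof -
    have "(B powr (q / 2)) powr (1 / q) = B powr (q / 2 * (1 / q))" by (rule powr_powr)
    also have "q / 2 * (1 / q) = 1 / 2" using q by simp
    finally show ?thesis using powr_half_sqrt[OF B0] by (simp only:)
  qed
  also have "sqrt B = sqrt (exp (real CARD('d)) * strichartz_const q) * W powr (1 / q) * sqrt A"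
  proof -
    have "W powr (1 / q + 1 / q) = W powr (1 / q) * W powr (1 / q)" by (rule powr_add)
    then have "W powr (2 / q) = (W powr (1 / q))\<^sup>2" unfolding power2_eq_square by simp
    then have "sqrt (W powr (2 / q)) = W powr (1 / q)" by simp
    then show ?thesis unfolding B_def real_sqrt_mult by (simp only:)
  qed
  also have "ennreal \<dots> = ennreal (sqrt (exp (real CARD('d)) * strichartz_const q) * W powr (1 / q)) * ennreal (sqrt A)"
  proof (rule ennreal_mult')
    have "0 \<le> strichartz_const q" using strichartz_const_pos[OF q] by (rule less_imp_le)
    then show "0 \<le> sqrt (exp (real CARD('d)) * strichartz_const q) * W powr (1 / q)"
      by (intro mult_nonneg_nonneg real_sqrt_ge_zero) (auto intro: mult_nonneg_nonneg)
  qed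
  finally show ?thesis by (simp only: nf)
qed

lemma extension_estimateI:
  fixes Q :: "real^'d \<Rightarrow> real^'n" and \<kappa> :: "real^'n \<Rightarrow> real"
  assumes Q: "Q \<in> borel_measurable borel"
    and \<kappa>m: "\<kappa> \<in> borel_measurable borel" and \<kappa>0: "\<And>y. \<kappa> y > 0" and \<kappa>e: "\<And>y. \<kappa> (- y) = \<kappa> y"
    and \<kappa>: "\<And>x y. norm (phase_kernel (\<lambda>\<xi>. y \<bullet> Q \<xi>) x) \<le> \<kappa> y"
    and q: "q > 2" and W: "W > 0"
    and weak: "\<And>c. c > 0 \<Longrightarrow> emeasure lborel {y. \<kappa> y powr ((q - 2) / 2) > c} \<le> ennreal (W / c)"
  shows "extension_estimate Q q"
  unfolding extension_estimate_def
proof (intro exI allI impI ballI)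
  fix R :: real and z f
  assume f: "f \<in> Lp_space 2 (unit_cube :: (real^'d) set)"
  show "Lp_norm q (ball z R) (extension_op Q f) \<le> ennreal (sqrt (exp (real CARD('d)) * strichartz_const q) * W powr (1 / q)) * Lp_norm 2 unit_cube f"
  proof (rule extension_op_bound[OF Q \<kappa>m \<kappa>0 \<kappa>e \<kappa> q W _ f])
    fix c :: real assume "c > 0"
    have "emeasure lborel {y \<in> ball 0 (2 * R). \<kappa> y powr ((q - 2) / 2) > c} \<le> emeasure lborel {y. \<kappa> y powr ((q - 2) / 2) > c}"
    proof (rule emeasure_mono)
      note [measurable] = \<kappa>m
      have "{y. \<kappa> y powr ((q - 2) / 2) > c} \<in> sets borel" by measurable
      then show "{y. \<kappa> y powr ((q - 2) / 2) > c} \<in> sets lborel" by simp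
    qed blast
    then show "emeasure lborel {y \<in> ball 0 (2 * R). \<kappa> y powr ((q - 2) / 2) > c} \<le> ennreal (W / c)"
      using weak[OF \<open>c > 0\<close>] by (rule order_trans)
  qed
qed

lemma extension_estimate_epsI:
  fixes Q :: "real^'d \<Rightarrow> real^'n" and \<kappa> :: "real^'n \<Rightarrow> real"
  assumes Q: "Q \<in> borel_measurable borel"
    and \<kappa>m: "\<kappa> \<in> borel_measurable borel" and \<kappa>0: "\<And>y. \<kappa> y > 0" and \<kappa>e: "\<And>y. \<kappa> (- y) = \<kappa> y"
    and \<kappa>: "\<And>x y. norm (phase_kernel (\<lambda>\<xi>. y \<bullet> Q \<xi>) x) \<le> \<kappa> y"
    and q: "q > 2"
    and weak: "\<And>\<delta>. \<delta> > 0 \<Longrightarrow> \<exists>W>0. \<forall>R\<ge>1. \<forall>c>0.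
      emeasure lborel {y \<in> ball 0 (2 * R). \<kappa> y powr ((q - 2) / 2) > c} \<le> ennreal (W * R powr \<delta> / c)"
  shows "extension_estimate_eps Q q"
  unfolding extension_estimate_eps_def
proof (intro allI impI)
  fix \<epsilon> :: real assume "\<epsilon> > 0"
  \<comment> \<open>The weak constant enters the estimate with power 1/q, so a loss R^(\<epsilon> q)
    there amounts to R^\<epsilon>.\<close>
  then have "\<epsilon> * q > 0" using q by simp
  from weak[OF this] obtain W where W: "W > 0" and weak: "\<And>R c. R \<ge> 1 \<Longrightarrow> c > 0 \<Longrightarrow>
      emeasure lborel {y \<in> ball 0 (2 * R). \<kappa> y powr ((q - 2) / 2) > c} \<le> ennreal (W * R powr (\<epsilon> * q) / c)"
    by blast
  let ?C = "sqrt (exp (real CARD('d)) * strichartz_const q) * W powr (1 / q)"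
  show "\<exists>C. \<forall>R\<ge>1. \<forall>z. \<forall>f\<in>Lp_space 2 unit_cube. Lp_norm q (ball z R) (extension_op Q f) \<le> ennreal (C * R powr \<epsilon>) * Lp_norm 2 unit_cube f"
  proof (intro exI allI impI ballI)
    fix R :: real and z f
    assume R: "R \<ge> 1" and f: "f \<in> Lp_space 2 (unit_cube :: (real^'d) set)"
    have "Lp_norm q (ball z R) (extension_op Q f) \<le> ennreal (sqrt (exp (real CARD('d)) * strichartz_const q) * (W * R powr (\<epsilon> * q)) powr (1 / q)) * Lp_norm 2 unit_cube f"
    proof (rule extension_op_bound[OF Q \<kappa>m \<kappa>0 \<kappa>e \<kappa> q _ weak[OF R] f])
      show "W * R powr (\<epsilon> * q) > 0" using R W by simp
    qed
    also have "(W * R powr (\<epsilon> * q)) powr (1 / q) = W powr (1 / q) * R powr \<epsilon>"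
    proof -
      have "(W * R powr (\<epsilon> * q)) powr (1 / q) = W powr (1 / q) * (R powr (\<epsilon> * q)) powr (1 / q)"
        by (rule powr_mult)
      also have "(R powr (\<epsilon> * q)) powr (1 / q) = R powr (\<epsilon> * q * (1 / q))" by (rule powr_powr)
      also have "\<epsilon> * q * (1 / q) = \<epsilon>" using q by simp
      finally show ?thesis .
    qed
    finally show "Lp_norm q (ball z R) (extension_op Q f) \<le> ennreal (?C * R powr \<epsilon>) * Lp_norm 2 unit_cube f"
      by (simp only: mult.assoc)
  qed
qed

section \<open>Determinant bounds for the kernel\<close>

lemma quadratic_polarization:
  fixes Q :: "real^'d \<Rightarrow> real^'n"
  assumes "\<And>j. quadratic_form (\<lambda>\<xi>. Q \<xi> $ j)"
  obtains P where "bilinear P" "\<And>u v. P u v = P v u" "\<And>u. Q u = P u u"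
proof -
  have "\<forall>j. \<exists>a :: 'd \<Rightarrow> 'd \<Rightarrow> real. \<forall>\<xi>. Q \<xi> $ j = (\<Sum>i\<in>UNIV. \<Sum>k\<in>UNIV. a i k * \<xi> $ i * \<xi> $ k)"
    using assms unfolding quadratic_form_def by blast
  from choice[OF this] obtain a :: "'n \<Rightarrow> 'd \<Rightarrow> 'd \<Rightarrow> real"
    where a: "\<And>j \<xi>. Q \<xi> $ j = (\<Sum>i\<in>UNIV. \<Sum>k\<in>UNIV. a j i k * \<xi> $ i * \<xi> $ k)" by blast
  define b where "b j u v = (\<Sum>i\<in>UNIV. \<Sum>k\<in>UNIV. a j i k * u $ i * v $ k)" for j and u v :: "real^'d"
  define P where "P u v = (\<chi> j. (b j u v + b j v u) / 2)" for u v
  have badd: "b j (u + u') v = b j u v + b j u' v" "b j u (v + v') = b j u v + b j u v'" for j u u' v v'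
    unfolding b_def by (simp_all add: distrib_left distrib_right sum.distrib)
  have bscale: "b j (c *\<^sub>R u) v = c * b j u v" "b j u (c *\<^sub>R v) = c * b j u v" for j c u v
    unfolding b_def by (simp_all add: sum_distrib_left mult_ac)
  show thesis
  proof
    show "bilinear P"
      unfolding bilinear_def
      by (auto intro!: linearI simp: P_def vec_eq_iff badd bscale field_simps)
    show "P u v = P v u" for u v by (simp add: P_def add.commute)
    show "Q u = P u u" for u by (simp add: P_def vec_eq_iff a b_def)
  qed
qed

text \<open>The Riesz vector of the functional \<open>\<lambda>v. y \<bullet> P u v\<close>. As a
  function of \<open>u\<close> it is the linear map \<open>L\<close> of
  \<open>gaussian_quadratic_phase\<close>.\<close>

lemma bilinear_inner_rep:
  fixes P :: "real^'d \<Rightarrow> real^'d \<Rightarrow> real^'n"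
  assumes "bilinear P"
  shows "(\<chi> i. y \<bullet> P u (axis i 1)) \<bullet> v = y \<bullet> P u v"
proof -
  have lin: "linear (P u)" using assms by (simp add: bilinear_def)
  have "v = (\<Sum>i\<in>UNIV. (v $ i) *\<^sub>R axis i 1)"
    by (simp add: basis_expansion[of v, unfolded scalar_mult_eq_scaleR])
  then have "P u v = P u (\<Sum>i\<in>UNIV. (v $ i) *\<^sub>R axis i 1)" by (rule arg_cong)
  also have "\<dots> = (\<Sum>i\<in>UNIV. (v $ i) *\<^sub>R P u (axis i 1))"
    by (simp add: linear_sum[OF lin] linear_cmul[OF lin])
  finally show ?thesis by (simp add: inner_vec_def[of "vec_lambda _"] inner_sum_right mult.commute)
qed

lemma phase_kernel_square_le:
  fixes P :: "real^'d \<Rightarrow> real^'d \<Rightarrow> real^'n" and Q :: "real^'d \<Rightarrow> real^'n"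
  assumes P: "bilinear P" "\<And>u v. P u v = P v u" "\<And>u. Q u = P u u"
  shows "(norm (phase_kernel (\<lambda>\<xi>. y \<bullet> Q \<xi>) x))\<^sup>2 \<le>
    sqrt (pi / 2) ^ CARD('d) * (\<integral>u. exp (- ((norm u)\<^sup>2 / 2) - 2 * pi\<^sup>2 * (norm (\<chi> i. y \<bullet> P u (axis i 1)))\<^sup>2) \<partial>lborel)"
proof -
  define L where "L u = (\<chi> i. y \<bullet> P u (axis i 1))" for u
  have bb: "bounded_bilinear P" using P(1) by (simp add: bilinear_conv_bounded_bilinear)
  have Lin: "linear L"
    by (intro linearI) (simp_all add: L_def vec_eq_iff bilinear_ladd[OF P(1)] bilinear_lmul[OF P(1)] inner_add_right)
  have 1: "(\<lambda>\<xi>. y \<bullet> Q \<xi>) \<in> borel_measurable borel"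
    unfolding P(3) by (intro borel_measurable_continuous_onI continuous_intros bounded_bilinear.continuous_on[OF bb])
  have 2: "L \<in> borel_measurable borel"
    using Lin by (intro borel_measurable_continuous_onI linear_continuous_on) (simp add: linear_conv_bounded_linear)
  have 3: "y \<bullet> Q (w + u /\<^sub>R 2) - y \<bullet> Q (w - u /\<^sub>R 2) = 2 * (w \<bullet> L u)" for w u
  proof -
    have "w \<bullet> L u = y \<bullet> P u w"
      unfolding L_def by (subst inner_commute) (rule bilinear_inner_rep[OF P(1)])
    moreover have "Q (w + u /\<^sub>R 2) - Q (w - u /\<^sub>R 2) = 2 *\<^sub>R P u w"
      unfolding P(3) using P(2)[of w u]
      by (simp add: bounded_bilinear.add_left[OF bb] bounded_bilinear.add_right[OF bb] bounded_bilinear.diff_left[OF bb]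
          bounded_bilinear.diff_right[OF bb] bounded_bilinear.scaleR_left[OF bb] bounded_bilinear.scaleR_right[OF bb] scaleR_2 flip: scaleR_add_left)
         (simp add: vec_eq_iff field_simps)
    ultimately show ?thesis by (simp flip: inner_diff_right)
  qed
  show ?thesis
    using gaussian_quadratic_phase[OF 1 2 3, of x] unfolding phase_kernel_def L_def by simp
qed

lemma gaussian_linear_image:
  fixes N :: "real^'d::{finite,wellorder}^'d::_"
  assumes N: "det N \<noteq> 0" and s: "s > 0"
  shows "(\<integral>\<^sup>+u. ennreal (exp (- (s * (norm (N *v u))\<^sup>2))) \<partial>lborel) = ennreal (sqrt (pi / s) ^ CARD('d) / \<bar>det N\<bar>)"
proof -
  have "(\<integral>\<^sup>+u. ennreal (exp (- (s * (norm (N *v u))\<^sup>2))) \<partial>lborel) = ennreal (1 / \<bar>det N\<bar>) * (\<integral>\<^sup>+u. ennreal (exp (- (s * (norm (u :: real^'d::_))\<^sup>2))) \<partial>lborel)"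
    by (rule nn_integral_linear_image[OF N, of "\<lambda>u. ennreal (exp (- (s * (norm u)\<^sup>2)))"]) measurable
  also have "\<dots> = ennreal (1 / \<bar>det N\<bar>) * ennreal (sqrt (pi / s) ^ CARD('d))"
    by (subst nn_integral_gaussian[OF s]) simp
  finally show ?thesis by (simp add: ennreal_mult'[symmetric])
qed

text \<open>Every matrix obtained from the Gram matrix of \<open>y \<bullet> P\<close> in the basis of columns of \<open>M\<close> by replacing some
  rows by the corresponding rows of the identity gives a bound for the kernel.\<close>

definition mixed_gram :: "(real^'d \<Rightarrow> real^'d \<Rightarrow> real^'n) \<Rightarrow> real^'d^'d \<Rightarrow> ('d \<Rightarrow> bool) \<Rightarrow> real^'n \<Rightarrow> real^'d^'d" where
  "mixed_gram P M \<sigma> y = (\<chi> i j. if \<sigma> i then y \<bullet> P (column i M) (column j M) else if i = j then 1 else 0)"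

text \<open>Each component of N u, for N = \<open>mixed_gram P M \<sigma> y ** M'\<close>, is either
  the inner product of L u with a column of \<open>M\<close> or a coordinate of u in the basis of
  columns. Both are controlled by the exponent in \<open>phase_kernel_square_le\<close>, so that
  integral is at most a Gaussian integral in N u, of size 1/|det N|. The determinant of
  \<open>mixed_gram\<close> is the principal minor of the Gram matrix on the rows selected by
  \<sigma>, and \<open>C\<close> depends on neither \<sigma> nor \<open>y\<close>: all principal
  minors may be combined.\<close>

lemma phase_kernel_det_bound:
  fixes P :: "real^'d::{finite,wellorder} \<Rightarrow> real^'d::_ \<Rightarrow> real^'n" and Q :: "real^'d::_ \<Rightarrow> real^'n"
  assumes P: "bilinear P" "\<And>u v. P u v = P v u" "\<And>u. Q u = P u u" and M: "det M \<noteq> 0"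
  obtains C where "C > 0"
    "\<And>\<sigma> y x. (norm (phase_kernel (\<lambda>\<xi>. y \<bullet> Q \<xi>) x))\<^sup>2 * \<bar>det (mixed_gram P M \<sigma> y)\<bar> \<le> C"
proof -
  obtain M' where M': "M ** M' = mat 1" "M' ** M = mat 1"
    using M invertible_det_nz[of M] unfolding invertible_def by blast
  obtain b where b: "b > 0" "\<And>u. norm (M' *v u) \<le> b * norm u"
    using linear_bounded_pos[of "(*v) M'"] by auto
  define m where "m = (\<Sum>i\<in>UNIV. norm (column i M))"
  \<comment> \<open>The term with 2 b^2 pays for the coordinates against |u|^2/2, the term with m^2
    for the inner products against 2 pi^2 |L u|^2; the summand 1 makes \<open>K\<close>
    positive.\<close>
  define K where "K = 1 + real CARD('d) * (2 * b\<^sup>2 + m\<^sup>2)"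
  have K: "K > 0" unfolding K_def by (smt (verit) mult_nonneg_nonneg of_nat_0_le_iff zero_le_power2)
  define C where "C = sqrt (pi / 2) ^ CARD('d) * (sqrt (pi / (1 / K)) ^ CARD('d) * \<bar>det M\<bar>)"
  have C: "C > 0" using K M by (simp add: C_def)
  have main: "(norm (phase_kernel (\<lambda>\<xi>. y \<bullet> Q \<xi>) x))\<^sup>2 * \<bar>det (mixed_gram P M \<sigma> y)\<bar> \<le> C" for \<sigma> y x
  proof (cases "det (mixed_gram P M \<sigma> y) = 0")
    case True
    then show ?thesis using C by simp
  next
    case False
    define L where "L u = (\<chi> i. y \<bullet> P u (axis i 1))" for u
    define N where "N = mixed_gram P M \<sigma> y ** M'"
    have dM': "det M' = 1 / det M" using M'(2) M by (metis det_mul det_I nonzero_eq_divide_eq)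
    have dN: "det N = det (mixed_gram P M \<sigma> y) / det M" by (simp add: N_def det_mul dM')
    then have dN0: "det N \<noteq> 0" using False M by simp
    have rows: "(N *v u) $ i = (if \<sigma> i then L u \<bullet> column i M else (M' *v u) $ i)" for u i
    proof -
      define t where "t = M' *v u"
      have u: "u = M *v t" unfolding t_def by (simp add: matrix_vector_mul_assoc M')
      have "N *v u = mixed_gram P M \<sigma> y *v t" by (simp add: N_def t_def matrix_vector_mul_assoc)
      moreover have "(mixed_gram P M \<sigma> y *v t) $ i = (if \<sigma> i then L u \<bullet> column i M else t $ i)"
      proof (cases "\<sigma> i")
        case True
        have lin: "linear (P (column i M))" using P(1) by (simp add: bilinear_def)
        have "u = (\<Sum>j\<in>UNIV. (t $ j) *\<^sub>R column j M)"
          unfolding u by (simp add: matrix_mult_sum scalar_mult_eq_scaleR)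
        then have "P (column i M) u = P (column i M) (\<Sum>j\<in>UNIV. (t $ j) *\<^sub>R column j M)" by (rule arg_cong)
        also have "\<dots> = (\<Sum>j\<in>UNIV. (t $ j) *\<^sub>R P (column i M) (column j M))"
          by (simp add: linear_sum[OF lin] linear_cmul[OF lin])
        finally have Pu: "P (column i M) u = \<dots>" .
        have "L u \<bullet> column i M = y \<bullet> P (column i M) u"
          unfolding L_def bilinear_inner_rep[OF P(1)] by (simp only: P(2)[of u])
        then show ?thesis using True
          by (simp add: mixed_gram_def matrix_vector_mult_def Pu inner_sum_right mult.commute)
      next
        case False
        then show ?thesis by (simp add: mixed_gram_def matrix_vector_mult_def if_distrib[of "\<lambda>c. c * _"] cong: if_cong)
      qed
      ultimately show ?thesis by (simp add: t_def)
    qed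
    have sq: "(norm (N *v u))\<^sup>2 \<le> K * ((norm u)\<^sup>2 / 2 + 2 * pi\<^sup>2 * (norm (L u))\<^sup>2)" for u
    proof -
      have "((N *v u) $ i)\<^sup>2 \<le> b\<^sup>2 * (norm u)\<^sup>2 + m\<^sup>2 * (norm (L u))\<^sup>2" for i
      proof -
        have "\<bar>L u \<bullet> column i M\<bar> \<le> norm (L u) * m"
        proof -
          have "norm (column i M) \<le> m" unfolding m_def by (rule member_le_sum) auto
          then have "norm (L u) * norm (column i M) \<le> norm (L u) * m" by (rule mult_left_mono) simp
          then show ?thesis using Cauchy_Schwarz_ineq2[of "L u" "column i M"] by simp
        qed
        then have "\<bar>L u \<bullet> column i M\<bar>\<^sup>2 \<le> (norm (L u) * m)\<^sup>2" by (rule power_mono) simp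
        then have 1: "(L u \<bullet> column i M)\<^sup>2 \<le> m\<^sup>2 * (norm (L u))\<^sup>2" by (simp add: power_mult_distrib mult.commute)
        have "\<bar>(M' *v u) $ i\<bar> \<le> b * norm u" using b(2)[of u] component_le_norm_cart[of "M' *v u" i] by simp
        then have "\<bar>(M' *v u) $ i\<bar>\<^sup>2 \<le> (b * norm u)\<^sup>2" by (rule power_mono) simp
        then have 2: "((M' *v u) $ i)\<^sup>2 \<le> b\<^sup>2 * (norm u)\<^sup>2" by (simp add: power_mult_distrib)
        have "0 \<le> m\<^sup>2 * (norm (L u))\<^sup>2" "0 \<le> b\<^sup>2 * (norm u)\<^sup>2" by simp_all
        moreover have "((N *v u) $ i)\<^sup>2 = (L u \<bullet> column i M)\<^sup>2 \<or> ((N *v u) $ i)\<^sup>2 = ((M' *v u) $ i)\<^sup>2"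
          unfolding rows by simp
        ultimately show ?thesis using 1 2 by linarith
      qed
      then have "(\<Sum>i\<in>UNIV. ((N *v u) $ i)\<^sup>2) \<le> (\<Sum>i\<in>(UNIV :: 'd set). b\<^sup>2 * (norm u)\<^sup>2 + m\<^sup>2 * (norm (L u))\<^sup>2)"
        by (rule sum_mono)
      then have "(norm (N *v u))\<^sup>2 \<le> real CARD('d) * (b\<^sup>2 * (norm u)\<^sup>2 + m\<^sup>2 * (norm (L u))\<^sup>2)"
      proof -
        have "(norm (N *v u))\<^sup>2 = (\<Sum>i\<in>UNIV. ((N *v u) $ i)\<^sup>2)"
          unfolding power2_norm_eq_inner inner_vec_def by (simp add: power2_eq_square)
        moreover have "(\<Sum>i\<in>(UNIV :: 'd set). b\<^sup>2 * (norm u)\<^sup>2 + m\<^sup>2 * (norm (L u))\<^sup>2) = real CARD('d) * (b\<^sup>2 * (norm u)\<^sup>2 + m\<^sup>2 * (norm (L u))\<^sup>2)"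
          by simp
        ultimately show ?thesis using \<open>(\<Sum>i\<in>UNIV. ((N *v u) $ i)\<^sup>2) \<le> _\<close> by linarith
      qed
      also have "\<dots> \<le> K * ((norm u)\<^sup>2 / 2 + 2 * pi\<^sup>2 * (norm (L u))\<^sup>2)"
      proof -
        have c: "real CARD('d) * (2 * b\<^sup>2) \<le> K" "real CARD('d) * m\<^sup>2 \<le> K"
          unfolding K_def by (simp_all add: distrib_left)
        have "real CARD('d) * (2 * b\<^sup>2) * ((norm u)\<^sup>2 / 2) \<le> K * ((norm u)\<^sup>2 / 2)"
          by (rule mult_right_mono[OF c(1)]) simp
        moreover have "real CARD('d) * m\<^sup>2 * (norm (L u))\<^sup>2 \<le> K * (2 * pi\<^sup>2 * (norm (L u))\<^sup>2)"
        proof -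
          have "1 \<le> pi\<^sup>2" using pi_gt3 by (intro one_le_power) simp
          then have "1 \<le> 2 * pi\<^sup>2" by linarith
          then have "1 * (norm (L u))\<^sup>2 \<le> 2 * pi\<^sup>2 * (norm (L u))\<^sup>2" by (rule mult_right_mono) simp
          then have "K * (norm (L u))\<^sup>2 \<le> K * (2 * pi\<^sup>2 * (norm (L u))\<^sup>2)" using K by simp
          moreover have "real CARD('d) * m\<^sup>2 * (norm (L u))\<^sup>2 \<le> K * (norm (L u))\<^sup>2"
            by (rule mult_right_mono[OF c(2)]) simp
          ultimately show ?thesis by linarith
        qed
        ultimately show ?thesis by (simp add: algebra_simps)
      qed
      finally show ?thesis .
    qed
    have "ennreal (\<integral>u. exp (- ((norm u)\<^sup>2 / 2) - 2 * pi\<^sup>2 * (norm (L u))\<^sup>2) \<partial>lborel) \<le>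
       (\<integral>\<^sup>+u. ennreal (norm (exp (- ((norm u)\<^sup>2 / 2) - 2 * pi\<^sup>2 * (norm (L u))\<^sup>2))) \<partial>lborel)"
      by (rule order_trans[OF ennreal_leI norm_integral_le_nn_integral]) simp
    also have "\<dots> \<le> (\<integral>\<^sup>+u. ennreal (exp (- (1 / K * (norm (N *v u))\<^sup>2))) \<partial>lborel)"
    proof (intro nn_integral_mono ennreal_leI)
      fix u
      have "1 / K * (norm (N *v u))\<^sup>2 \<le> (norm u)\<^sup>2 / 2 + 2 * pi\<^sup>2 * (norm (L u))\<^sup>2"
        using sq[of u] K by (simp add: pos_divide_le_eq mult.commute)
      then show "norm (exp (- ((norm u)\<^sup>2 / 2) - 2 * pi\<^sup>2 * (norm (L u))\<^sup>2)) \<le> exp (- (1 / K * (norm (N *v u))\<^sup>2))" by simp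
    qed
    also have "\<dots> = ennreal (sqrt (pi / (1 / K)) ^ CARD('d) / \<bar>det N\<bar>)"
      using K by (intro gaussian_linear_image dN0) simp
    finally have I: "(\<integral>u. exp (- ((norm u)\<^sup>2 / 2) - 2 * pi\<^sup>2 * (norm (L u))\<^sup>2) \<partial>lborel) \<le> sqrt (pi / (1 / K)) ^ CARD('d) / \<bar>det N\<bar>"
      using K by (subst (asm) ennreal_le_iff) auto
    have "(norm (phase_kernel (\<lambda>\<xi>. y \<bullet> Q \<xi>) x))\<^sup>2 \<le> sqrt (pi / 2) ^ CARD('d) * (sqrt (pi / (1 / K)) ^ CARD('d) / \<bar>det N\<bar>)"
      by (rule order_trans[OF phase_kernel_square_le[OF P] mult_left_mono[OF I[unfolded L_def]]]) simp
    also have "\<dots> = C / \<bar>det (mixed_gram P M \<sigma> y)\<bar>"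
      unfolding dN C_def by (simp add: abs_divide)
    finally show ?thesis using False by (simp add: pos_le_divide_eq)
  qed
  show thesis by (rule that[OF C main])
qed

section \<open>Level sets in the plane\<close>

lemma lborel_real2: "lborel = distr (lborel \<Otimes>\<^sub>M lborel) borel (\<lambda>(a, b). vector [a, b] :: real^2)"
proof (rule lborel_eqI)
  have [measurable]: "(\<lambda>(a, b). vector [a, b] :: real^2) \<in> borel_measurable borel"
  proof (rule borel_measurable_continuous_onI)
    have "(\<lambda>p. vector [fst p, snd p] :: real^2) = (\<lambda>p. fst p *\<^sub>R axis 1 1 + snd p *\<^sub>R axis 2 1)"
      by (auto simp: vec_eq_iff forall_2 axis_def)
    then show "continuous_on UNIV (\<lambda>(a, b). vector [a, b] :: real^2)"
      unfolding case_prod_beta' by (simp only:) (intro continuous_intros)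
  qed
  have B: "(Basis :: (real^2) set) = {axis 1 1, axis 2 1}"
    by (auto simp: Basis_vec_def UNIV_2)
  have ne: "(axis 1 1 :: real^2) \<noteq> axis 2 1" by (simp add: axis_eq_axis)
  fix l u :: "real^2" assume le: "\<And>b. b \<in> Basis \<Longrightarrow> l \<bullet> b \<le> u \<bullet> b"
  have le': "l $ 1 \<le> u $ 1" "l $ 2 \<le> u $ 2" using le[of "axis 1 1"] le[of "axis 2 1"] by (auto simp: B inner_axis)
  have pre: "(\<lambda>(a, b). vector [a, b] :: real^2) -` box l u = box (l $ 1) (u $ 1) \<times> box (l $ 2) (u $ 2)"
    by (auto simp: mem_box_cart forall_2)
  have "emeasure (distr (lborel \<Otimes>\<^sub>M lborel) borel (\<lambda>(a, b). vector [a, b] :: real^2)) (box l u) =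
     emeasure (lborel \<Otimes>\<^sub>M lborel) (box (l $ 1) (u $ 1) \<times> box (l $ 2) (u $ 2))"
    by (subst emeasure_distr) (auto simp: pre lborel_prod space_pair_measure)
  also have "\<dots> = ennreal (u $ 1 - l $ 1) * ennreal (u $ 2 - l $ 2)"
    using le' by (subst lborel.emeasure_pair_measure_Times) auto
  also have "\<dots> = (\<Prod>b\<in>Basis. (u - l) \<bullet> b)"
    using le' ne by (simp add: B inner_axis ennreal_mult)
  finally show "emeasure (distr (lborel \<Otimes>\<^sub>M lborel) borel (\<lambda>(a, b). vector [a, b] :: real^2)) (box l u) = (\<Prod>b\<in>Basis. (u - l) \<bullet> b)" .
qed simp

lemma emeasure_real2:
  fixes A :: "(real^2) set"
  assumes A[measurable]: "A \<in> sets borel"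
  shows "emeasure lborel A = (\<integral>\<^sup>+b. emeasure lborel {a. vector [a, b] \<in> A} \<partial>lborel)"
    and "emeasure lborel A = (\<integral>\<^sup>+a. emeasure lborel {b. vector [a, b] \<in> A} \<partial>lborel)"
proof -
  have vm[measurable]: "(\<lambda>p. vector [fst p, snd p] :: real^2) \<in> borel_measurable (borel \<Otimes>\<^sub>M borel)"
  proof -
    have "(\<lambda>p. vector [fst p, snd p] :: real^2) = (\<lambda>p. fst p *\<^sub>R axis 1 1 + snd p *\<^sub>R axis 2 1)"
      by (auto simp: vec_eq_iff forall_2 axis_def)
    then show ?thesis by simp
  qed
  have S: "{p. vector [fst p, snd p] \<in> A} \<in> sets (borel \<Otimes>\<^sub>M borel :: (real \<times> real) measure)"
    using measurable_sets[OF vm A] by (simp add: vimage_def space_pair_measure)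
  then have S': "{p. vector [fst p, snd p] \<in> A} \<in> sets (lborel \<Otimes>\<^sub>M lborel :: (real \<times> real) measure)" by simp
  have m2: "(\<lambda>(a, b). vector [a, b] :: real^2) \<in> (lborel \<Otimes>\<^sub>M lborel) \<rightarrow>\<^sub>M borel"
  proof -
    have "(\<lambda>p. vector [fst p, snd p] :: real^2) \<in> borel_measurable (borel \<Otimes>\<^sub>M borel)" by measurable
    then show ?thesis by (simp add: case_prod_beta')
  qed
  have "emeasure lborel A = emeasure (lborel \<Otimes>\<^sub>M lborel) {p. vector [fst p, snd p] \<in> A}"
    by (subst lborel_real2, subst emeasure_distr[OF m2 A])
       (auto simp: space_pair_measure vimage_def case_prod_beta')
  moreover have "emeasure (lborel \<Otimes>\<^sub>M lborel) {p. vector [fst p, snd p] \<in> A} = (\<integral>\<^sup>+b. emeasure lborel {a. vector [a, b] \<in> A} \<partial>lborel)"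
    by (subst lborel_pair.emeasure_pair_measure_alt2[OF S']) (simp add: vimage_def)
  moreover have "emeasure (lborel \<Otimes>\<^sub>M lborel) {p. vector [fst p, snd p] \<in> A} = (\<integral>\<^sup>+a. emeasure lborel {b. vector [a, b] \<in> A} \<partial>lborel)"
    by (subst lborel.emeasure_pair_measure_alt[OF S']) (simp add: vimage_def)
  ultimately show "emeasure lborel A = (\<integral>\<^sup>+b. emeasure lborel {a. vector [a, b] \<in> A} \<partial>lborel)"
     "emeasure lborel A = (\<integral>\<^sup>+a. emeasure lborel {b. vector [a, b] \<in> A} \<partial>lborel)" by simp_all
qed

section \<open>Sublevel sets of products of linear forms and of binary cubics\<close>

lemma nn_integral_symmetric_powr:
  fixes T r :: real
  assumes "r > -1" "T \<ge> 0"
  shows "(\<integral>\<^sup>+s. ennreal (\<bar>s\<bar> powr r) * indicator {-T<..<T} s \<partial>lborel) \<le> ennreal (2 * T powr (r + 1) / (r + 1))"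
proof -
  let ?f = "\<lambda>s. ennreal (s powr r) * indicator {0<..<T} s"
  have "(\<integral>\<^sup>+s. ennreal (\<bar>s\<bar> powr r) * indicator {-T<..<T} s \<partial>lborel) \<le> (\<integral>\<^sup>+s. ?f s + ?f (0 - s) \<partial>lborel)"
    by (rule nn_integral_mono) (auto simp: indicator_def abs_if)
  also have "\<dots> = integral\<^sup>N lborel ?f + (\<integral>\<^sup>+s. ?f (0 - s) \<partial>lborel)"
    by (rule nn_integral_add) measurable
  also have "(\<integral>\<^sup>+s. ?f (0 - s) \<partial>lborel) = integral\<^sup>N lborel ?f"
    by (rule nn_integral_lborel_reflect) measurable
  also have "integral\<^sup>N lborel ?f = ennreal (T powr (r + 1) / (r + 1))"
    using assms by (rule nn_integral_powr_layer)
  finally show ?thesis using assms by (simp add: ennreal_plus[symmetric] del: ennreal_plus)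
qed

lemma nn_integral_symmetric_powr_tail:
  fixes T r :: real
  assumes "r < -1" "T > 0"
  shows "(\<integral>\<^sup>+s. ennreal (\<bar>s\<bar> powr r) * indicator (- {-T<..<T}) s \<partial>lborel) \<le> ennreal (2 * T powr (r + 1) / (- r - 1))"
proof -
  let ?f = "\<lambda>s. ennreal (s powr r) * indicator {T..} s"
  have "(\<integral>\<^sup>+s. ennreal (\<bar>s\<bar> powr r) * indicator (- {-T<..<T}) s \<partial>lborel) \<le> (\<integral>\<^sup>+s. ?f s + ?f (0 - s) \<partial>lborel)"
    by (rule nn_integral_mono) (use assms in \<open>auto simp: indicator_def abs_if\<close>)
  also have "\<dots> = integral\<^sup>N lborel ?f + (\<integral>\<^sup>+s. ?f (0 - s) \<partial>lborel)"
    by (rule nn_integral_add) measurable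
  also have "(\<integral>\<^sup>+s. ?f (0 - s) \<partial>lborel) = integral\<^sup>N lborel ?f"
    by (rule nn_integral_lborel_reflect) measurable
  also have "integral\<^sup>N lborel ?f = ennreal (T powr (r + 1) / (- r - 1))"
    using assms by (rule nn_integral_powr_tail)
  finally show ?thesis using assms by (simp add: ennreal_plus[symmetric] del: ennreal_plus)
qed

text \<open>In the coordinates N y, the slice at first coordinate a has length at most 2K/(c (1 +
  |a|)). Integration over |a| < 2bR costs a logarithm of R, estimated here by a power
  R^\<delta>.\<close>

lemma level_set_product:
  fixes N :: "real^2^2"
  assumes N: "det N \<noteq> 0" and K: "K > 0" and \<delta>: "\<delta> > 0"
  obtains W where "W > 0" "\<And>R c. R \<ge> 1 \<Longrightarrow> c > 0 \<Longrightarrow>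
    emeasure lborel {y \<in> ball 0 (2 * R). K / ((1 + \<bar>(N *v y) $ 1\<bar>) * (1 + \<bar>(N *v y) $ 2\<bar>)) > c} \<le> ennreal (W * R powr \<delta> / c)"
proof -
  \<comment> \<open>\<open>d < 1\<close> makes the exponent d - 1 negative, so 1/(1 + |a|) \<le>
    |a|^(d-1); \<open>d > 0\<close> keeps this integrable at 0, and \<open>d \<le> \<delta>\<close>
    yields the stated loss.\<close>
  define d where "d = min \<delta> (1 / 2)"
  have d: "0 < d" "d < 1" "d \<le> \<delta>" using \<delta> by (auto simp: d_def)
  obtain b where b: "b > 0" "\<And>u. norm (N *v u) \<le> b * norm u"
    using linear_bounded_pos[of "(*v) N"] by auto
  define W where "W = 1 / \<bar>det N\<bar> * (2 * K * (2 * (2 * b) powr d / d))"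
  have W: "W > 0" using N K b d by (simp add: W_def)
  show thesis
  proof (rule that[OF W])
    fix R c :: real assume R: "R \<ge> 1" and c: "c > 0"
    define \<rho> where "\<rho> = 2 * b * R"
    have \<rho>: "\<rho> > 0" using b R by (simp add: \<rho>_def)
    define A where "A = {v :: real^2. \<bar>v $ 1\<bar> < \<rho> \<and> K / ((1 + \<bar>v $ 1\<bar>) * (1 + \<bar>v $ 2\<bar>)) > c}"
    have Am[measurable]: "A \<in> sets borel"
      unfolding A_def by measurable
    have "{y \<in> ball 0 (2 * R). K / ((1 + \<bar>(N *v y) $ 1\<bar>) * (1 + \<bar>(N *v y) $ 2\<bar>)) > c} \<subseteq> {y. N *v y \<in> A}"
    proof
      fix y assume y: "y \<in> {y \<in> ball 0 (2 * R). K / ((1 + \<bar>(N *v y) $ 1\<bar>) * (1 + \<bar>(N *v y) $ 2\<bar>)) > c}"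
      then have "norm y < 2 * R" by simp
      then have "b * norm y < b * (2 * R)" using b(1) by simp
      then have "\<bar>(N *v y) $ 1\<bar> < \<rho>"
        using b(2)[of y] component_le_norm_cart[of "N *v y" 1] unfolding \<rho>_def by linarith
      then show "y \<in> {y. N *v y \<in> A}" using y by (simp add: A_def)
    qed
    then have "emeasure lborel {y \<in> ball 0 (2 * R). K / ((1 + \<bar>(N *v y) $ 1\<bar>) * (1 + \<bar>(N *v y) $ 2\<bar>)) > c} \<le> emeasure lborel {y. N *v y \<in> A}"
    proof (rule emeasure_mono)
      have "(*v) N \<in> borel_measurable borel"
        by (intro borel_measurable_continuous_onI linear_continuous_on) simp
      from measurable_sets[OF this Am] show "{y. N *v y \<in> A} \<in> sets lborel" by (simp add: vimage_def)
    qed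
    also have "\<dots> = ennreal (1 / \<bar>det N\<bar>) * emeasure lborel A"
      by (rule emeasure_linear_vimage[OF N Am])
    also have "emeasure lborel A \<le> ennreal (2 * K / c * (2 * \<rho> powr d / d))"
    proof -
      have "emeasure lborel A = (\<integral>\<^sup>+a. emeasure lborel {b. vector [a, b] \<in> A} \<partial>lborel)"
        by (rule emeasure_real2(2)[OF Am])
      also have "\<dots> \<le> (\<integral>\<^sup>+a. ennreal (2 * K / c) * (ennreal (\<bar>a\<bar> powr (d - 1)) * indicator {-\<rho><..<\<rho>} a) \<partial>lborel)"
      proof (rule nn_integral_mono_AE)
        have "AE a in lborel. (a::real) \<noteq> 0" by (rule AE_lborel_singleton)
        then show "AE a in lborel. emeasure lborel {b. vector [a, b] \<in> A} \<le> ennreal (2 * K / c) * (ennreal (\<bar>a\<bar> powr (d - 1)) * indicator {-\<rho><..<\<rho>} a)"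
        proof eventually_elim
          case (elim a)
          show ?case
          proof (cases "\<bar>a\<bar> < \<rho>")
            case False
            then have "{b. vector [a, b] \<in> A} = {}" by (auto simp: A_def)
            then show ?thesis by simp
          next
            case True
            define h where "h = K / (c * (1 + \<bar>a\<bar>))"
            have h: "h > 0" using K c unfolding h_def by (smt (verit) divide_pos_pos mult_pos_pos)
            have "{b. vector [a, b] \<in> A} \<subseteq> {-h..h}"
            proof
              fix b assume "b \<in> {b. vector [a, b] \<in> A}"
              then have "c < K / ((1 + \<bar>a\<bar>) * (1 + \<bar>b\<bar>))" by (simp add: A_def)
              moreover have "0 < (1 + \<bar>a\<bar>) * (1 + \<bar>b\<bar>)" by (smt (verit) mult_pos_pos)
              ultimately have "c * ((1 + \<bar>a\<bar>) * (1 + \<bar>b\<bar>)) < K" by (simp add: pos_less_divide_eq)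
              then have "(1 + \<bar>b\<bar>) * (c * (1 + \<bar>a\<bar>)) < K" by (simp only: mult_ac)
              moreover have "0 < c * (1 + \<bar>a\<bar>)" using c by (smt (verit) mult_pos_pos)
              ultimately have "1 + \<bar>b\<bar> < h" unfolding h_def by (simp add: pos_less_divide_eq)
              then show "b \<in> {-h..h}" by auto
            qed
            then have "emeasure lborel {b. vector [a, b] \<in> A} \<le> emeasure lborel {-h..h}"
              by (rule emeasure_mono) simp
            also have "\<dots> = ennreal (2 * h)" using h by simp
            also have "\<dots> \<le> ennreal (2 * K / c * \<bar>a\<bar> powr (d - 1))"
            proof (rule ennreal_leI)
              have "1 / (1 + \<bar>a\<bar>) = (1 + \<bar>a\<bar>) powr (-1)" by (simp add: powr_minus_divide)
              also have "\<dots> \<le> (1 + \<bar>a\<bar>) powr (d - 1)" using d by (intro powr_mono) auto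
              also have "\<dots> \<le> \<bar>a\<bar> powr (d - 1)" using d elim by (intro powr_mono2') auto
              finally have "2 * K / c * (1 / (1 + \<bar>a\<bar>)) \<le> 2 * K / c * \<bar>a\<bar> powr (d - 1)"
                using K c by (intro mult_left_mono) auto
              then show "2 * h \<le> 2 * K / c * \<bar>a\<bar> powr (d - 1)" by (simp add: h_def)
            qed
            also have "\<dots> = ennreal (2 * K / c) * (ennreal (\<bar>a\<bar> powr (d - 1)) * indicator {-\<rho><..<\<rho>} a)"
            proof -
              have "a \<in> {-\<rho><..<\<rho>}" using True by auto
              then show ?thesis using K c by (subst ennreal_mult') auto
            qed
            finally show ?thesis .
          qed
        qed
      qed
      also have "\<dots> = ennreal (2 * K / c) * (\<integral>\<^sup>+a. ennreal (\<bar>a\<bar> powr (d - 1)) * indicator {-\<rho><..<\<rho>} a \<partial>lborel)"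
        by (rule nn_integral_cmult) measurable
      also have "\<dots> \<le> ennreal (2 * K / c) * ennreal (2 * \<rho> powr d / d)"
        using nn_integral_symmetric_powr[of "d - 1" \<rho>] d \<rho> by (intro mult_left_mono) auto
      also have "\<dots> = ennreal (2 * K / c * (2 * \<rho> powr d / d))"
        using K c by (intro ennreal_mult'[symmetric]) auto
      finally show ?thesis .
    qed
    then have "ennreal (1 / \<bar>det N\<bar>) * emeasure lborel A \<le> ennreal (1 / \<bar>det N\<bar>) * ennreal (2 * K / c * (2 * \<rho> powr d / d))"
      by (rule mult_left_mono) simp
    also have "\<dots> = ennreal (1 / \<bar>det N\<bar> * (2 * K / c * (2 * \<rho> powr d / d)))"
      by (intro ennreal_mult'[symmetric]) auto
    also have "\<dots> \<le> ennreal (W * R powr \<delta> / c)"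
    proof (rule ennreal_leI)
      have "\<rho> powr d = (2 * b) powr d * R powr d" unfolding \<rho>_def by (rule powr_mult)
      also have "\<dots> \<le> (2 * b) powr d * R powr \<delta>" using R d by (intro mult_left_mono powr_mono) auto
      finally have "1 / \<bar>det N\<bar> * (2 * K / c * (2 / d)) * \<rho> powr d \<le> 1 / \<bar>det N\<bar> * (2 * K / c * (2 / d)) * ((2 * b) powr d * R powr \<delta>)"
        using K c d by (intro mult_left_mono) auto
      then show "1 / \<bar>det N\<bar> * (2 * K / c * (2 * \<rho> powr d / d)) \<le> W * R powr \<delta> / c"
        unfolding W_def by (simp add: mult_ac)
    qed
    finally show "emeasure lborel {y \<in> ball 0 (2 * R). K / ((1 + \<bar>(N *v y) $ 1\<bar>) * (1 + \<bar>(N *v y) $ 2\<bar>)) > c} \<le> ennreal (W * R powr \<delta> / c)" .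
  qed
qed

text \<open>The set lies in two intervals of length hi - lo with hi^2 - lo^2 \<le> 2h. Since hi + lo
  is at least hi - lo, the length is O(sqrt h). If E < 0, then hi is at least sqrt |E|, which gives
  h / sqrt |E|; if E > 0, a positive \<open>hi\<close> requires E < h, and hi \<le> sqrt h
  suffices.\<close>

lemma emeasure_quadratic_level:
  fixes E h :: real
  assumes h: "h > 0" and E: "E \<noteq> 0"
  shows "emeasure lborel {r::real. \<bar>r\<^sup>2 + E\<bar> < h} \<le> ennreal (4 * min (sqrt h) (h / sqrt \<bar>E\<bar>))"
proof -
  define lo where "lo = sqrt (max 0 (- E - h))"
  define hi where "hi = sqrt (max 0 (h - E))"
  have lo0: "0 \<le> lo" and lohi: "lo \<le> hi" using h by (auto simp: lo_def hi_def)
  have "{r. \<bar>r\<^sup>2 + E\<bar> < h} \<subseteq> {lo..hi} \<union> {-hi..-lo}"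
  proof
    fix r assume "r \<in> {r. \<bar>r\<^sup>2 + E\<bar> < h}"
    then have r: "- E - h < r\<^sup>2" "r\<^sup>2 < h - E" by auto
    have "lo \<le> sqrt (r\<^sup>2)" unfolding lo_def using r by (intro real_sqrt_le_mono) auto
    moreover have "sqrt (r\<^sup>2) \<le> hi" unfolding hi_def using r by (intro real_sqrt_le_mono) auto
    ultimately show "r \<in> {lo..hi} \<union> {-hi..-lo}" by (auto simp: abs_if split: if_splits)
  qed
  then have "emeasure lborel {r. \<bar>r\<^sup>2 + E\<bar> < h} \<le> emeasure lborel ({lo..hi} \<union> {-hi..-lo})"
    by (rule emeasure_mono) simp
  also have "\<dots> \<le> emeasure lborel {lo..hi} + emeasure lborel {-hi..-lo}"
    by (rule emeasure_subadditive) auto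
  also have "\<dots> = ennreal (2 * (hi - lo))"
    using lohi by (simp add: ennreal_plus[symmetric] del: ennreal_plus)
  also have "\<dots> \<le> ennreal (4 * min (sqrt h) (h / sqrt \<bar>E\<bar>))"
  proof (rule ennreal_leI)
    have sqs: "hi\<^sup>2 = max 0 (h - E)" "lo\<^sup>2 = max 0 (- E - h)" by (auto simp: hi_def lo_def)
    have d2: "(hi - lo) * (hi + lo) \<le> 2 * h"
    proof -
      have "(hi - lo) * (hi + lo) = hi\<^sup>2 - lo\<^sup>2" by (simp add: algebra_simps power2_eq_square)
      also have "\<dots> \<le> 2 * h" unfolding sqs using h by auto
      finally show ?thesis .
    qed
    have dd: "(hi - lo)\<^sup>2 \<le> 2 * h"
    proof -
      have "(hi - lo) * (hi - lo) \<le> (hi - lo) * (hi + lo)" using lo0 lohi by (intro mult_left_mono) auto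
      then show ?thesis using d2 by (simp add: power2_eq_square)
    qed
    have 1: "hi - lo \<le> 2 * sqrt h"
    proof (rule power2_le_imp_le)
      show "(hi - lo)\<^sup>2 \<le> (2 * sqrt h)\<^sup>2" using dd h by (simp add: power_mult_distrib)
    qed (use h in simp)
    have 2: "hi - lo \<le> 2 * (h / sqrt \<bar>E\<bar>)"
    proof (cases "hi = 0")
      case True
      then have "hi - lo \<le> 0" using lo0 by simp
      also have "0 \<le> 2 * (h / sqrt \<bar>E\<bar>)" using h by simp
      finally show ?thesis .
    next
      case False
      then have hE: "h - E > 0" "hi\<^sup>2 = h - E" using sqs by (auto simp: max_def hi_def split: if_splits)
      have Epos: "sqrt \<bar>E\<bar> > 0" using E by simp
      show ?thesis
      proof (cases "E < 0")
        case True
        have "sqrt \<bar>E\<bar> \<le> hi" unfolding hi_def using True h by (intro real_sqrt_le_mono) auto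
        then have "(hi - lo) * sqrt \<bar>E\<bar> \<le> (hi - lo) * (hi + lo)" using lo0 lohi by (intro mult_left_mono) auto
        then have "(hi - lo) * sqrt \<bar>E\<bar> \<le> 2 * h" using d2 by simp
        then show ?thesis using Epos by (simp add: field_simps)
      next
        case False
        then have E0: "E > 0" using E by simp
        have "hi \<le> sqrt h" unfolding hi_def using E0 h by (intro real_sqrt_le_mono) auto
        moreover have "sqrt \<bar>E\<bar> \<le> sqrt h" using E0 hE by (intro real_sqrt_le_mono) auto
        ultimately have "(hi - lo) * sqrt \<bar>E\<bar> \<le> sqrt h * sqrt h" using lo0 lohi by (intro mult_mono) auto
        also have "\<dots> \<le> 2 * h" using h by simp
        finally show ?thesis using Epos by (simp add: field_simps)
      qed
    qed
    show "2 * (hi - lo) \<le> 4 * min (sqrt h) (h / sqrt \<bar>E\<bar>)" using 1 2 by (auto simp: min_def)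
  qed
  finally show ?thesis .
qed

text \<open>At fixed s = \<open>v $ 2\<close> the condition is a quadratic one with h = \<mu>/|s|
  and E = e s^2. The bound sqrt h is integrable at s = 0 and the bound h / sqrt |E|, of order
  |s|^(-2), at infinity. The latter needs e \<noteq> 0: for e = 0 the cubic has a double
  root.\<close>

lemma emeasure_cubic_level:
  fixes e \<mu> :: real
  assumes e: "e \<noteq> 0" and \<mu>: "\<mu> > 0"
  shows "emeasure lborel {v :: real^2. \<bar>v $ 2 * ((v $ 1)\<^sup>2 + e * (v $ 2)\<^sup>2)\<bar> < \<mu>} \<le> ennreal ((16 + 8 / sqrt \<bar>e\<bar>) * \<mu> powr (2 / 3))"
proof -
  let ?A = "{v :: real^2. \<bar>v $ 2 * ((v $ 1)\<^sup>2 + e * (v $ 2)\<^sup>2)\<bar> < \<mu>}"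
  have A: "?A \<in> sets borel" by measurable
  \<comment> \<open>The length scale of a cubic of size \<mu>; cutting there makes both pieces of
    order \<mu>^(2/3).\<close>
  define T where "T = \<mu> powr (1 / 3)"
  have T: "T > 0" using \<mu> by (simp add: T_def)
  have "emeasure lborel ?A = (\<integral>\<^sup>+s. emeasure lborel {r. vector [r, s] \<in> ?A} \<partial>lborel)"
    by (rule emeasure_real2(1)[OF A])
  also have "\<dots> \<le> (\<integral>\<^sup>+s. ennreal (4 * sqrt \<mu>) * (ennreal (\<bar>s\<bar> powr (-1/2)) * indicator {-T<..<T} s) +
      ennreal (4 * \<mu> / sqrt \<bar>e\<bar>) * (ennreal (\<bar>s\<bar> powr (-2)) * indicator (- {-T<..<T}) s) \<partial>lborel)"
  proof (rule nn_integral_mono_AE)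
    have "AE s in lborel. (s::real) \<noteq> 0" by (rule AE_lborel_singleton)
    then show "AE s in lborel. emeasure lborel {r. vector [r, s] \<in> ?A} \<le> ennreal (4 * sqrt \<mu>) * (ennreal (\<bar>s\<bar> powr (-1/2)) * indicator {-T<..<T} s) +
      ennreal (4 * \<mu> / sqrt \<bar>e\<bar>) * (ennreal (\<bar>s\<bar> powr (-2)) * indicator (- {-T<..<T}) s)"
    proof eventually_elim
      case (elim s)
      have eq: "{r. vector [r, s] \<in> ?A} = {r. \<bar>r\<^sup>2 + e * s\<^sup>2\<bar> < \<mu> / \<bar>s\<bar>}"
        using elim by (auto simp: abs_mult pos_less_divide_eq mult.commute)
      have lev: "emeasure lborel {r. vector [r, s] \<in> ?A} \<le> ennreal (4 * min (sqrt (\<mu> / \<bar>s\<bar>)) (\<mu> / \<bar>s\<bar> / sqrt \<bar>e * s\<^sup>2\<bar>))"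
        unfolding eq using elim \<mu> e by (intro emeasure_quadratic_level) auto
      have 1: "4 * sqrt (\<mu> / \<bar>s\<bar>) = 4 * sqrt \<mu> * \<bar>s\<bar> powr (-1/2)"
      proof -
        have "\<bar>s\<bar> powr (-1/2) = 1 / sqrt \<bar>s\<bar>"
          using powr_minus_divide[of "\<bar>s\<bar>" "1/2"] powr_half_sqrt[of "\<bar>s\<bar>"] by simp
        then show ?thesis by (simp add: real_sqrt_divide)
      qed
      have 2: "4 * (\<mu> / \<bar>s\<bar> / sqrt \<bar>e * s\<^sup>2\<bar>) = 4 * \<mu> / sqrt \<bar>e\<bar> * \<bar>s\<bar> powr (-2)"
      proof -
        have "\<bar>s\<bar> powr (-2) = 1 / \<bar>s\<bar>\<^sup>2"
          using elim powr_minus_divide[of "\<bar>s\<bar>" 2] by (simp add: powr_numeral)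
        moreover have "sqrt \<bar>e * s\<^sup>2\<bar> = sqrt \<bar>e\<bar> * \<bar>s\<bar>" by (simp add: abs_mult real_sqrt_mult)
        ultimately show ?thesis by (simp add: power2_eq_square)
      qed
      show ?case
      proof (cases "s \<in> {-T<..<T}")
        case True
        have "ennreal (4 * min (sqrt (\<mu> / \<bar>s\<bar>)) (\<mu> / \<bar>s\<bar> / sqrt \<bar>e * s\<^sup>2\<bar>)) \<le> ennreal (4 * sqrt (\<mu> / \<bar>s\<bar>))"
          by (intro ennreal_leI) simp
        also have "\<dots> = ennreal (4 * sqrt \<mu>) * ennreal (\<bar>s\<bar> powr (-1/2))"
          unfolding 1 using \<mu> by (intro ennreal_mult') simp
        finally show ?thesis using lev True by simp
      next
        case False
        have "ennreal (4 * min (sqrt (\<mu> / \<bar>s\<bar>)) (\<mu> / \<bar>s\<bar> / sqrt \<bar>e * s\<^sup>2\<bar>)) \<le> ennreal (4 * (\<mu> / \<bar>s\<bar> / sqrt \<bar>e * s\<^sup>2\<bar>))"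
          by (intro ennreal_leI) simp
        also have "\<dots> = ennreal (4 * \<mu> / sqrt \<bar>e\<bar>) * ennreal (\<bar>s\<bar> powr (-2))"
          unfolding 2 using \<mu> by (intro ennreal_mult') simp
        finally show ?thesis using lev False by simp
      qed
    qed
  qed
  also have "\<dots> = ennreal (4 * sqrt \<mu>) * (\<integral>\<^sup>+s. ennreal (\<bar>s\<bar> powr (-1/2)) * indicator {-T<..<T} s \<partial>lborel) +
      ennreal (4 * \<mu> / sqrt \<bar>e\<bar>) * (\<integral>\<^sup>+s. ennreal (\<bar>s\<bar> powr (-2)) * indicator (- {-T<..<T}) s \<partial>lborel)"
    by (subst nn_integral_add, measurable, subst nn_integral_cmult, measurable, subst nn_integral_cmult, measurable)
  also have "\<dots> \<le> ennreal (4 * sqrt \<mu>) * ennreal (2 * T powr (-1/2 + 1) / (-1/2 + 1)) +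
      ennreal (4 * \<mu> / sqrt \<bar>e\<bar>) * ennreal (2 * T powr (-2 + 1) / (- (-2) - 1))"
    using T by (intro add_mono mult_left_mono nn_integral_symmetric_powr nn_integral_symmetric_powr_tail) auto
  also have "\<dots> = ennreal (4 * sqrt \<mu> * (2 * T powr (-1/2 + 1) / (-1/2 + 1)) + 4 * \<mu> / sqrt \<bar>e\<bar> * (2 * T powr (-2 + 1) / (- (-2) - 1)))"
    using \<mu> by (simp add: ennreal_mult'[symmetric] ennreal_plus[symmetric] del: ennreal_plus)
  also have "4 * sqrt \<mu> * (2 * T powr (-1/2 + 1) / (-1/2 + 1)) + 4 * \<mu> / sqrt \<bar>e\<bar> * (2 * T powr (-2 + 1) / (- (-2) - 1)) = (16 + 8 / sqrt \<bar>e\<bar>) * \<mu> powr (2 / 3)"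
  proof -
    have "sqrt \<mu> * T powr (1/2) = \<mu> powr (1/2) * \<mu> powr (1/3 * (1/2))"
      unfolding T_def powr_powr using \<mu> by (simp add: powr_half_sqrt)
    also have "\<dots> = \<mu> powr (1/2 + 1/3 * (1/2))" by (rule powr_add[symmetric])
    finally have a: "sqrt \<mu> * T powr (1/2) = \<mu> powr (2 / 3)" by simp
    have "\<mu> * T powr (-1) = \<mu> powr 1 * \<mu> powr (1/3 * (-1))"
      unfolding T_def powr_powr using \<mu> by simp
    also have "\<dots> = \<mu> powr (1 + 1/3 * (-1))" by (rule powr_add[symmetric])
    finally have b: "\<mu> * T powr (-1) = \<mu> powr (2 / 3)" by simp
    have "4 * sqrt \<mu> * (2 * T powr (-1/2 + 1) / (-1/2 + 1)) = 16 * (sqrt \<mu> * T powr (1/2))" by simp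
    moreover have "4 * \<mu> / sqrt \<bar>e\<bar> * (2 * T powr (-2 + 1) / (- (-2) - 1)) = 8 / sqrt \<bar>e\<bar> * (\<mu> * T powr (-1))" by simp
    ultimately show ?thesis unfolding a b by (simp add: distrib_right)
  qed
  finally show ?thesis .
qed

section \<open>Forms with a loss\<close>

text \<open>A statement about the pair rather than the set {u, v}, so that u = v counts as
  dependent.\<close>

definition indep2 :: "'a::real_vector \<Rightarrow> 'a \<Rightarrow> bool" where
  "indep2 u v \<longleftrightarrow> (\<forall>\<alpha> \<beta>. \<alpha> *\<^sub>R u + \<beta> *\<^sub>R v = 0 \<longrightarrow> \<alpha> = 0 \<and> \<beta> = 0)"

lemma indep2D: "indep2 u v \<Longrightarrow> \<alpha> *\<^sub>R u + \<beta> *\<^sub>R v = 0 \<Longrightarrow> \<alpha> = 0 \<and> \<beta> = 0"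
  by (simp add: indep2_def)

lemma det2_indep2:
  fixes p r :: "real^2"
  shows "det (vector [p, r] :: real^2^2) \<noteq> 0 \<longleftrightarrow> indep2 p r"
proof
  assume d: "det (vector [p, r] :: real^2^2) \<noteq> 0"
  then have d: "p $ 1 * r $ 2 - p $ 2 * r $ 1 \<noteq> 0" by (simp add: det_2)
  show "indep2 p r"
    unfolding indep2_def
  proof (intro allI impI)
    fix \<alpha> \<beta> assume "\<alpha> *\<^sub>R p + \<beta> *\<^sub>R r = 0"
    then have e: "\<alpha> * p $ 1 + \<beta> * r $ 1 = 0" "\<alpha> * p $ 2 + \<beta> * r $ 2 = 0"
      by (simp_all add: vec_eq_iff forall_2)
    define D where "D = p $ 1 * r $ 2 - p $ 2 * r $ 1"
    have "\<alpha> * D = (\<alpha> * p $ 1 + \<beta> * r $ 1) * r $ 2 - (\<alpha> * p $ 2 + \<beta> * r $ 2) * r $ 1"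
      by (simp add: D_def algebra_simps)
    then have "\<alpha> * D = 0" unfolding e by simp
    moreover have "\<beta> * D = (\<alpha> * p $ 2 + \<beta> * r $ 2) * p $ 1 - (\<alpha> * p $ 1 + \<beta> * r $ 1) * p $ 2"
      by (simp add: D_def algebra_simps)
    then have "\<beta> * D = 0" unfolding e by simp
    moreover have "D \<noteq> 0" using d by (simp add: D_def)
    ultimately show "\<alpha> = 0 \<and> \<beta> = 0" by simp
  qed
next
  assume i: "indep2 p r"
  show "det (vector [p, r] :: real^2^2) \<noteq> 0"
  proof
    assume "det (vector [p, r] :: real^2^2) = 0"
    then have d: "p $ 1 * r $ 2 = p $ 2 * r $ 1" by (simp add: det_2)
    have 1: "r $ 1 *\<^sub>R p + (- p $ 1) *\<^sub>R r = 0" and 2: "r $ 2 *\<^sub>R p + (- p $ 2) *\<^sub>R r = 0"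
      using d by (simp_all add: vec_eq_iff forall_2 mult.commute)
    have "r $ 1 = 0" "r $ 2 = 0" using indep2D[OF i 1] indep2D[OF i 2] by blast+
    then have "0 *\<^sub>R p + 1 *\<^sub>R r = 0" by (simp add: vec_eq_iff forall_2)
    from indep2D[OF i this] show False by simp
  qed
qed

section \<open>Bases of three-space given by their columns\<close>

definition columns3 :: "real^3 \<Rightarrow> real^3 \<Rightarrow> real^3 \<Rightarrow> real^3^3" where
  "columns3 u v w = transpose (vector [u, v, w])"

lemma column_columns3 [simp]:
  "column 1 (columns3 u v w) = u" "column 2 (columns3 u v w) = v" "column 3 (columns3 u v w) = w"
  by (simp_all add: columns3_def row_def vec_eq_iff)

text \<open>The cross product completes the pair: the determinant is then its squared length, which
  is zero only for dependent vectors.\<close>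

lemma indep2_complete:
  fixes u v :: "real^3"
  assumes "indep2 u v"
  obtains w where "det (columns3 u v w) \<noteq> 0"
proof -
  define w where "w = cross3 u v"
  have "w \<noteq> 0"
  proof
    assume "w = 0"
    then have "collinear {0, u, v}" by (simp add: w_def cross_eq_0)
    then consider "u = 0" | "v = 0" | c where "v = c *\<^sub>R u"
      unfolding collinear_lemma by blast
    then show False
    proof cases
      case 1
      then show False using indep2D[OF assms, of 1 0] by simp
    next
      case 2
      then show False using indep2D[OF assms, of 0 1] by simp
    next
      case 3
      then show False using indep2D[OF assms, of "- c" 1] by simp
    qed
  qed
  moreover have "det (columns3 u v w) = w \<bullet> w"
  proof -
    have "det (columns3 u v w) = det (vector [u, v, w] :: real^3^3)"
      unfolding columns3_def by (rule det_transpose)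
    also have "\<dots> = w \<bullet> w" unfolding w_def by (simp add: cross3_simps)
    finally show ?thesis .
  qed
  ultimately show thesis using that[of w] by simp
qed

lemma columns3_expand:
  assumes "det (columns3 u v w) \<noteq> 0"
  obtains a b c where "x = a *\<^sub>R u + b *\<^sub>R v + c *\<^sub>R w"
proof -
  obtain M' where M': "columns3 u v w ** M' = mat 1"
    using assms invertible_det_nz[of "columns3 u v w"] unfolding invertible_def by blast
  define t where "t = M' *v x"
  have "x = columns3 u v w *v t" unfolding t_def by (simp add: matrix_vector_mul_assoc M')
  also have "\<dots> = t $ 1 *\<^sub>R u + t $ 2 *\<^sub>R v + t $ 3 *\<^sub>R w"
    by (simp add: matrix_mult_sum scalar_mult_eq_scaleR sum_3)
  finally show thesis by (rule that)
qed

text \<open>In terms of the polarised form, restricting to a subspace and combining the two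
  components both become conditions \<open>y \<bullet> P u v = 0\<close>, independent of
  coordinates.\<close>

locale symmetric_bilinear =
  fixes P :: "real^3 \<Rightarrow> real^3 \<Rightarrow> real^2" and Q :: "real^3 \<Rightarrow> real^2"
  assumes bil: "bilinear P" and sym: "P u v = P v u" and diag: "Q u = P u u"
begin

lemmas P_simps = bilinear_ladd[OF bil] bilinear_radd[OF bil] bilinear_lmul[OF bil] bilinear_rmul[OF bil]
  bilinear_lzero[OF bil] bilinear_rzero[OF bil] bilinear_lneg[OF bil] bilinear_rneg[OF bil]
  bilinear_lsub[OF bil] bilinear_rsub[OF bil]

lemma Q_measurable: "Q \<in> borel_measurable borel"
proof -
  have "bounded_bilinear P" using bil by (simp add: bilinear_conv_bounded_bilinear)
  then have "continuous_on UNIV (\<lambda>u. P u u)"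
    by (rule bounded_bilinear.continuous_on[OF _ continuous_on_id continuous_on_id])
  then have "(\<lambda>u. P u u) \<in> borel_measurable borel" by (rule borel_measurable_continuous_onI)
  moreover have "Q = (\<lambda>u. P u u)" using diag by (rule ext)
  ultimately show ?thesis by simp
qed

lemma P_eq_0I:
  assumes "det (columns3 u v w) \<noteq> 0" "y \<bullet> P z u = 0" "y \<bullet> P z v = 0" "y \<bullet> P z w = 0"
  shows "y \<bullet> P z x = 0"
proof -
  obtain a b c where "x = a *\<^sub>R u + b *\<^sub>R v + c *\<^sub>R w" by (rule columns3_expand[OF assms(1)])
  then show ?thesis using assms by (simp add: P_simps inner_add_right)
qed

text \<open>The power 4/(q - 2) on the square of the kernel is the one for which \<kappa>^((q-2)/2)
  equals the reciprocal product itself, the borderline function of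
  \<open>level_set_product\<close>.\<close>

lemma eps_estimate_product:
  fixes N :: "real^2^2"
  assumes N: "det N \<noteq> 0" and K: "K > 0" and q: "q > 2"
    and le: "\<And>y x. (norm (phase_kernel (\<lambda>\<xi>. y \<bullet> Q \<xi>) x))\<^sup>2 \<le> (K / ((1 + \<bar>(N *v y) $ 1\<bar>) * (1 + \<bar>(N *v y) $ 2\<bar>))) powr (4 / (q - 2))"
  shows "extension_estimate_eps Q q"
proof -
  define h where "h y = K / ((1 + \<bar>(N *v y) $ 1\<bar>) * (1 + \<bar>(N *v y) $ 2\<bar>))" for y
  have h0: "h y > 0" for y unfolding h_def using K by (intro divide_pos_pos mult_pos_pos) auto
  have [measurable]: "(\<lambda>y. (N *v y) $ i) \<in> borel_measurable borel" for i
    unfolding matrix_vector_mul_component by measurable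
  have hm[measurable]: "h \<in> borel_measurable borel" unfolding h_def[abs_def] by measurable
  have he: "h (- y) = h y" for y
  proof -
    have "N *v (- y) = - (N *v y)" by (rule linear_neg) simp
    then show ?thesis by (simp add: h_def)
  qed
  define \<kappa> where "\<kappa> y = h y powr (2 / (q - 2))" for y
  have \<kappa>h: "\<kappa> y powr ((q - 2) / 2) = h y" for y
  proof -
    have "\<kappa> y powr ((q - 2) / 2) = h y powr (2 / (q - 2) * ((q - 2) / 2))"
      unfolding \<kappa>_def by (rule powr_powr)
    also have "2 / (q - 2) * ((q - 2) / 2) = 1" using q by simp
    finally show ?thesis using h0[of y] by simp
  qed
  show ?thesis
  proof (rule extension_estimate_epsI[where \<kappa> = \<kappa>])
    show "Q \<in> borel_measurable borel" by (rule Q_measurable)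
    show "\<kappa> \<in> borel_measurable borel" unfolding \<kappa>_def[abs_def] by measurable
    show "\<kappa> y > 0" for y using h0[of y] by (simp add: \<kappa>_def)
    show "\<kappa> (- y) = \<kappa> y" for y by (simp add: \<kappa>_def he)
    show "norm (phase_kernel (\<lambda>\<xi>. y \<bullet> Q \<xi>) x) \<le> \<kappa> y" for x y
    proof (rule power2_le_imp_le)
      have "(\<kappa> y)\<^sup>2 = h y powr (2 / (q - 2) + 2 / (q - 2))"
        unfolding \<kappa>_def power2_eq_square by (rule powr_add[symmetric])
      also have "2 / (q - 2) + 2 / (q - 2) = 4 / (q - 2)" by simp
      finally show "(norm (phase_kernel (\<lambda>\<xi>. y \<bullet> Q \<xi>) x))\<^sup>2 \<le> (\<kappa> y)\<^sup>2"
        using le[of y x] by (simp add: h_def)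
    qed (simp add: \<kappa>_def)
    show "q > 2" by (rule q)
    fix \<delta> :: real assume "\<delta> > 0"
    from level_set_product[OF N K this] obtain W where "W > 0"
      "\<And>R c. R \<ge> 1 \<Longrightarrow> c > 0 \<Longrightarrow> emeasure lborel {y \<in> ball 0 (2 * R). h y > c} \<le> ennreal (W * R powr \<delta> / c)"
      unfolding h_def by blast
    then show "\<exists>W>0. \<forall>R\<ge>1. \<forall>c>0. emeasure lborel {y \<in> ball 0 (2 * R). c < \<kappa> y powr ((q - 2) / 2)} \<le> ennreal (W * R powr \<delta> / c)"
      unfolding \<kappa>h by blast
  qed
qed

lemma vector2_mult: "((vector [p, r] :: real^2^2) *v y) $ 1 = p \<bullet> y" "((vector [p, r] :: real^2^2) *v y) $ 2 = r \<bullet> y"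
  for p r y :: "real^2"
  by (simp_all add: matrix_vector_mult_def inner_vec_def)

text \<open>Because \<open>P u v = 0\<close>, the principal minors on the index sets {}, {1}, {2}
  and {1, 2} have absolute values 1, a, b and ab, and these add up to (1 + a)(1 + b).\<close>

lemma L6_estimate_orthogonal:
  assumes uv: "indep2 u v" and orth: "P u v = 0" and ind: "indep2 (P u u) (P v v)"
  shows "extension_estimate_eps Q 6"
proof -
  obtain w where M: "det (columns3 u v w) \<noteq> 0" by (rule indep2_complete[OF uv])
  obtain C where C: "C > 0"
    "\<And>\<sigma> y x. (norm (phase_kernel (\<lambda>\<xi>. y \<bullet> Q \<xi>) x))\<^sup>2 * \<bar>det (mixed_gram P (columns3 u v w) \<sigma> y)\<bar> \<le> C"
    by (rule phase_kernel_det_bound[OF bil sym diag M], rule that)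
  have orth': "P v u = 0" using orth sym[of v u] by simp
  show ?thesis
  proof (rule eps_estimate_product[where N = "vector [P u u, P v v]" and K = "4 * C"])
    show "det (vector [P u u, P v v] :: real^2^2) \<noteq> 0" using ind by (simp add: det2_indep2)
    show "4 * C > 0" "(6::real) > 2" using C by simp_all
    fix x y
    define G where "G = (norm (phase_kernel (\<lambda>\<xi>. y \<bullet> Q \<xi>) x))\<^sup>2"
    define a where "a = \<bar>y \<bullet> P u u\<bar>"
    define b where "b = \<bar>y \<bullet> P v v\<bar>"
    have 0: "G \<le> C" using C(2)[of y x "\<lambda>i. False"] by (simp add: G_def mixed_gram_def det_3)
    have 1: "G * a \<le> C" using C(2)[of y x "\<lambda>i. i = 1"] by (simp add: G_def a_def mixed_gram_def det_3)
    have 2: "G * b \<le> C" using C(2)[of y x "\<lambda>i. i = 2"] by (simp add: G_def b_def mixed_gram_def det_3)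
    have 3: "G * (a * b) \<le> C" using C(2)[of y x "\<lambda>i. i = 1 \<or> i = 2"] by (simp add: G_def a_def b_def mixed_gram_def det_3 orth orth' abs_mult)
    have "G * ((1 + a) * (1 + b)) = G + G * a + G * b + G * (a * b)" by (simp add: algebra_simps)
    then have "G * ((1 + a) * (1 + b)) \<le> 4 * C" using 0 1 2 3 by linarith
    moreover have pos: "(1 + a) * (1 + b) > 0" unfolding a_def b_def by (intro mult_pos_pos) auto
    ultimately have "G \<le> 4 * C / ((1 + a) * (1 + b))" by (simp add: pos_le_divide_eq)
    moreover have "4 * C / ((1 + a) * (1 + b)) \<ge> 0" using C pos by simp
    ultimately show "(norm (phase_kernel (\<lambda>\<xi>. y \<bullet> Q \<xi>) x))\<^sup>2 \<le> (4 * C / ((1 + \<bar>((vector [P u u, P v v] :: real^2^2) *v y) $ 1\<bar>) * (1 + \<bar>((vector [P u u, P v v] :: real^2^2) *v y) $ 2\<bar>))) powr (4 / (6 - 2))"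
      using C(1) by (simp add: vector2_mult G_def a_def b_def inner_commute)
  qed
qed

text \<open>The Gram matrix vanishes on the plane of \<open>u\<close> and \<open>v\<close>, so its
  minors on {1, 3} and {2, 3} are minus the squares of the linear forms given by
  \<open>P u w\<close> and \<open>P v w\<close>. A dependence between these would give a vector in
  the common kernel of both forms. The geometric mean of the two bounds has the required product
  shape, realised by (1 + a)(1 + b) \<le> 2 + a^2 + b^2.\<close>

lemma L6_estimate_isotropic:
  assumes uv: "indep2 u v" and iso: "P u u = 0" "P u v = 0" "P v v = 0"
    and nondeg: "\<And>z. z \<noteq> 0 \<Longrightarrow> \<exists>x. P z x \<noteq> 0"
  shows "extension_estimate_eps Q 6"
proof -
  obtain w where M: "det (columns3 u v w) \<noteq> 0" by (rule indep2_complete[OF uv])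
  obtain C where C: "C > 0"
    "\<And>\<sigma> y x. (norm (phase_kernel (\<lambda>\<xi>. y \<bullet> Q \<xi>) x))\<^sup>2 * \<bar>det (mixed_gram P (columns3 u v w) \<sigma> y)\<bar> \<le> C"
    by (rule phase_kernel_det_bound[OF bil sym diag M], rule that)
  have iso': "P v u = 0" using iso(2) sym[of v u] by simp
  have wuv: "P w u = P u w" "P w v = P v w" by (rule sym)+
  have ind: "indep2 (P u w) (P v w)"
    unfolding indep2_def
  proof (intro allI impI)
    fix \<alpha> \<beta> assume e: "\<alpha> *\<^sub>R P u w + \<beta> *\<^sub>R P v w = 0"
    define z where "z = \<alpha> *\<^sub>R u + \<beta> *\<^sub>R v"
    have zw: "P z w = 0" "P z u = 0" "P z v = 0" using e iso iso' by (simp_all add: z_def P_simps)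
    have "P z x = 0" for x
    proof -
      obtain a b c where "x = a *\<^sub>R u + b *\<^sub>R v + c *\<^sub>R w" by (rule columns3_expand[OF M])
      then show ?thesis using zw by (simp add: P_simps)
    qed
    then have "z = 0" using nondeg by blast
    then show "\<alpha> = 0 \<and> \<beta> = 0" unfolding z_def by (rule indep2D[OF uv])
  qed
  show ?thesis
  proof (rule eps_estimate_product[where N = "vector [P u w, P v w]" and K = "4 * C"])
    show "det (vector [P u w, P v w] :: real^2^2) \<noteq> 0" using ind by (simp add: det2_indep2)
    show "4 * C > 0" "(6::real) > 2" using C by simp_all
    fix x y
    define G where "G = (norm (phase_kernel (\<lambda>\<xi>. y \<bullet> Q \<xi>) x))\<^sup>2"
    have G0: "G \<ge> 0" by (simp add: G_def)
    define a where "a = \<bar>y \<bullet> P u w\<bar>"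
    define b where "b = \<bar>y \<bullet> P v w\<bar>"
    have 0: "G \<le> C" using C(2)[of y x "\<lambda>i. False"] by (simp add: G_def mixed_gram_def det_3)
    have 1: "G * (a * a) \<le> C" using C(2)[of y x "\<lambda>i. i = 1 \<or> i = 3"]
      by (simp add: G_def a_def mixed_gram_def det_3 iso iso' wuv abs_mult)
    have 2: "G * (b * b) \<le> C" using C(2)[of y x "\<lambda>i. i = 2 \<or> i = 3"]
      by (simp add: G_def b_def mixed_gram_def det_3 iso iso' wuv abs_mult)
    have "0 \<le> (a - b)\<^sup>2 + (a - 1)\<^sup>2 + (b - 1)\<^sup>2" by simp
    then have "(1 + a) * (1 + b) \<le> 2 + a * a + b * b" by (simp add: power2_eq_square algebra_simps)
    then have "G * ((1 + a) * (1 + b)) \<le> G * (2 + a * a + b * b)" using G0 by (rule mult_left_mono)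
    also have "\<dots> = 2 * G + G * (a * a) + G * (b * b)" by (simp add: algebra_simps)
    also have "\<dots> \<le> 4 * C" using 0 1 2 by linarith
    finally have "G * ((1 + a) * (1 + b)) \<le> 4 * C" .
    moreover have pos: "(1 + a) * (1 + b) > 0" unfolding a_def b_def by (intro mult_pos_pos) auto
    ultimately have "G \<le> 4 * C / ((1 + a) * (1 + b))" by (simp add: pos_le_divide_eq)
    moreover have "4 * C / ((1 + a) * (1 + b)) \<ge> 0" using C pos by simp
    ultimately show "(norm (phase_kernel (\<lambda>\<xi>. y \<bullet> Q \<xi>) x))\<^sup>2 \<le> (4 * C / ((1 + \<bar>((vector [P u w, P v w] :: real^2^2) *v y) $ 1\<bar>) * (1 + \<bar>((vector [P u w, P v w] :: real^2^2) *v y) $ 2\<bar>))) powr (4 / (6 - 2))"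
      using C(1) by (simp add: vector2_mult G_def a_def b_def inner_commute)
  qed
qed

end

section \<open>The two exceptional pairs of forms\<close>

lemma le_powr_interpolate:
  fixes G X Y \<theta> :: real
  assumes "0 \<le> G" "G \<le> X" "G \<le> Y" "0 < \<theta>" "\<theta> < 1"
  shows "G \<le> X powr \<theta> * Y powr (1 - \<theta>)"
proof (cases "G = 0")
  case False
  then have "G = G powr \<theta> * G powr (1 - \<theta>)" using assms by (simp flip: powr_add)
  also have "\<dots> \<le> X powr \<theta> * Y powr (1 - \<theta>)" using assms by (intro mult_mono powr_mono2) auto
  finally show ?thesis .
qed simp

text \<open>A weighted geometric mean of two bounds. The equations on the exponents say that
  \<open>A\<close> and \<open>B\<close> both end up with power \<open>e\<close>; the constant is
  moved inside that power to match \<open>eps_estimate_product\<close>.\<close>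

lemma le_powr_interpolate_product:
  fixes G A B K :: real
  assumes G: "0 \<le> G" and pos: "A > 0" "B > 0" "K > 0" and \<theta>: "0 < \<theta>" "\<theta> < 1"
    and 1: "G * (A powr m * B powr l) \<le> K" and 2: "G * B powr n \<le> K"
    and e: "m * \<theta> = e" "l * \<theta> + n * (1 - \<theta>) = e" "e > 0"
  shows "G \<le> (K powr (1 / e) / (A * B)) powr e"
proof -
  have "G \<le> K / (A powr m * B powr l)" using 1 pos by (simp add: pos_le_divide_eq)
  moreover have "G \<le> K / B powr n" using 2 pos by (simp add: pos_le_divide_eq)
  ultimately have "G \<le> (K / (A powr m * B powr l)) powr \<theta> * (K / B powr n) powr (1 - \<theta>)"
    using G \<theta> by (intro le_powr_interpolate) auto
  also have "\<dots> = (K powr \<theta> * K powr (1 - \<theta>)) / (A powr (m * \<theta>) * (B powr (l * \<theta>) * B powr (n * (1 - \<theta>))))"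
    by (simp add: powr_divide powr_mult powr_powr)
  also have "K powr \<theta> * K powr (1 - \<theta>) = K powr (\<theta> + (1 - \<theta>))" by (rule powr_add[symmetric])
  also have "B powr (l * \<theta>) * B powr (n * (1 - \<theta>)) = B powr e" unfolding e(2)[symmetric] by (rule powr_add[symmetric])
  also have "K powr (\<theta> + (1 - \<theta>)) / (A powr (m * \<theta>) * B powr e) = (K powr (1 / e)) powr e / (A * B) powr e"
    using pos e by (simp add: powr_powr powr_mult)
  also have "\<dots> = (K powr (1 / e) / (A * B)) powr e" by (simp add: powr_divide)
  finally show ?thesis .
qed

lemma column_mat_1: "column i (mat 1 :: real^'n^'n) = axis i 1"
  by (simp add: column_def mat_def axis_def vec_eq_iff)

text \<open>In the two exceptional cases two bounds are combined with weights \<open>3/5, 2/5\<close> and \<open>2/3, 1/3\<close>,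
  the ones that produce equal powers of \<open>1 + \<bar>y $ 1\<bar>\<close> and \<open>1 + \<bar>y $ 2\<bar>\<close>.\<close>

lemma L16_3_estimate:
  "extension_estimate_eps (\<lambda>\<xi> :: real^3. vector [\<xi> $ 1 * \<xi> $ 2, (\<xi> $ 2)\<^sup>2 + \<xi> $ 1 * \<xi> $ 3] :: real^2) (16 / 3)"
proof -
  define Q where "Q = (\<lambda>\<xi> :: real^3. vector [\<xi> $ 1 * \<xi> $ 2, (\<xi> $ 2)\<^sup>2 + \<xi> $ 1 * \<xi> $ 3] :: real^2)"
  define P where "P u v = (vector [(u $ 1 * v $ 2 + u $ 2 * v $ 1) / 2, u $ 2 * v $ 2 + (u $ 1 * v $ 3 + u $ 3 * v $ 1) / 2] :: real^2)"
    for u v :: "real^3"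
  interpret symmetric_bilinear P Q
  proof
    show "bilinear P" unfolding bilinear_def
      by (auto intro!: linearI simp: P_def vec_eq_iff forall_2 field_simps)
    show "P u v = P v u" "Q u = P u u" for u v
      by (simp_all add: P_def Q_def vec_eq_iff forall_2 power2_eq_square algebra_simps)
  qed
  obtain C where C: "C > 0"
    "\<And>\<sigma> y x. (norm (phase_kernel (\<lambda>\<xi>. y \<bullet> Q \<xi>) x))\<^sup>2 * \<bar>det (mixed_gram P (mat 1) \<sigma> y)\<bar> \<le> C"
    by (rule phase_kernel_det_bound[OF bil sym diag, of "mat 1"], simp, rule that)
  have S: "y \<bullet> P (axis 1 1) (axis 1 1) = 0" "y \<bullet> P (axis 1 1) (axis 2 1) = y $ 1 / 2" "y \<bullet> P (axis 1 1) (axis 3 1) = y $ 2 / 2"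
    "y \<bullet> P (axis 2 1) (axis 1 1) = y $ 1 / 2" "y \<bullet> P (axis 2 1) (axis 2 1) = y $ 2" "y \<bullet> P (axis 2 1) (axis 3 1) = 0"
    "y \<bullet> P (axis 3 1) (axis 1 1) = y $ 2 / 2" "y \<bullet> P (axis 3 1) (axis 2 1) = 0" "y \<bullet> P (axis 3 1) (axis 3 1) = 0" for y
    by (simp_all add: P_def inner_vec_def sum_2 axis_def)
  have "extension_estimate_eps Q (16 / 3)"
  \<comment> \<open>6/5 is 4/(q - 2) at q = 16/3, and it equals both 2 (3/5) and 3 (2/5). The number
    20 majorises the constants of both bounds below.\<close>
  proof (rule eps_estimate_product[where N = "mat 1" and K = "(20 * C) powr (1 / (6 / 5))"])
    show "det (mat 1 :: real^2^2) \<noteq> 0" "(20 * C) powr (1 / (6 / 5)) > 0" "(16 / 3 :: real) > 2" using C(1) by simp_all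
    fix x and y :: "real^2"
    define G where "G = (norm (phase_kernel (\<lambda>\<xi>. y \<bullet> Q \<xi>) x))\<^sup>2"
    have G0: "G \<ge> 0" by (simp add: G_def)
    define a where "a = \<bar>y $ 1\<bar>"
    define b where "b = \<bar>y $ 2\<bar>"
    have ab: "a \<ge> 0" "b \<ge> 0" by (simp_all add: a_def b_def)
    have 0: "G \<le> C" using C(2)[of y x "\<lambda>i. False"] by (simp add: G_def mixed_gram_def det_3)
    \<comment> \<open>The minor on the first two coordinates is -(y1)^2/4 and the full determinant
      is -(y2)^3/4.\<close>
    have 1: "G * a\<^sup>2 \<le> 4 * C" using C(2)[of y x "\<lambda>i. i = 1 \<or> i = 2"]
      by (simp add: G_def a_def mixed_gram_def det_3 column_mat_1 S abs_mult power2_eq_square)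
    have 2: "G * b ^ 3 \<le> 4 * C" using C(2)[of y x "\<lambda>i. True"]
      by (simp add: G_def b_def mixed_gram_def det_3 column_mat_1 S abs_mult power3_eq_cube)
    have "(1 + a)\<^sup>2 \<le> 2 + 2 * a\<^sup>2" using sum_squares_bound[of a 1] by (simp add: power2_sum)
    then have "G * (1 + a)\<^sup>2 \<le> G * (2 + 2 * a\<^sup>2)" using G0 by (rule mult_left_mono)
    also have "\<dots> = 2 * G + 2 * (G * a\<^sup>2)" by (simp add: algebra_simps)
    also have "\<dots> \<le> 20 * C" using 0 1 C(1) by linarith
    finally have A: "G * (1 + a)\<^sup>2 \<le> 20 * C" .
    have "(1 + b) ^ 3 \<le> 4 + 4 * b ^ 3"
    proof -
      have "0 \<le> 3 * (1 + b) * (1 - b)\<^sup>2" using ab by simp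
      then show ?thesis by (simp add: power3_eq_cube power2_eq_square algebra_simps)
    qed
    then have "G * (1 + b) ^ 3 \<le> G * (4 + 4 * b ^ 3)" using G0 by (rule mult_left_mono)
    also have "\<dots> = 4 * G + 4 * (G * b ^ 3)" by (simp add: algebra_simps)
    also have "\<dots> \<le> 20 * C" using 0 2 by linarith
    finally have B: "G * (1 + b) ^ 3 \<le> 20 * C" .
    have "G \<le> ((20 * C) powr (1 / (6 / 5)) / ((1 + a) * (1 + b))) powr (6 / 5)"
    proof (rule le_powr_interpolate_product[where \<theta> = "3/5" and m = 2 and l = 0 and n = 3])
      show "G * ((1 + a) powr 2 * (1 + b) powr 0) \<le> 20 * C" "G * (1 + b) powr 3 \<le> 20 * C"
        using A B ab by (simp_all add: powr_numeral)
    qed (use G0 ab C(1) in auto)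
    then show "(norm (phase_kernel (\<lambda>\<xi>. y \<bullet> Q \<xi>) x))\<^sup>2 \<le> ((20 * C) powr (1 / (6 / 5)) / ((1 + \<bar>(mat 1 *v y) $ 1\<bar>) * (1 + \<bar>(mat 1 *v y) $ 2\<bar>))) powr (4 / (16 / 3 - 2))"
      by (simp add: G_def a_def b_def)
  qed
  then show ?thesis by (simp only: Q_def)
qed

text \<open>The full determinant is -e y1^2 y2/4, whose powers of the two variables are unbalanced;
  the minor on coordinates 1 and 3, equal to e y2^2, corrects this. Only |e| enters, so both signs
  are treated at once. Here 4/(q - 2) = 4/3, which equals 2 (2/3) and 2/3 + 2 (1/3).\<close>

lemma L5_estimate:
  fixes e :: real
  assumes e: "\<bar>e\<bar> = 1"
  shows "extension_estimate_eps (\<lambda>\<xi> :: real^3. vector [\<xi> $ 1 * \<xi> $ 2, (\<xi> $ 1)\<^sup>2 + e * (\<xi> $ 3)\<^sup>2] :: real^2) 5"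
proof -
  define Q where "Q = (\<lambda>\<xi> :: real^3. vector [\<xi> $ 1 * \<xi> $ 2, (\<xi> $ 1)\<^sup>2 + e * (\<xi> $ 3)\<^sup>2] :: real^2)"
  define P where "P u v = (vector [(u $ 1 * v $ 2 + u $ 2 * v $ 1) / 2, u $ 1 * v $ 1 + e * (u $ 3 * v $ 3)] :: real^2)"
    for u v :: "real^3"
  interpret symmetric_bilinear P Q
  proof
    show "bilinear P" unfolding bilinear_def
      by (auto intro!: linearI simp: P_def vec_eq_iff forall_2 field_simps)
    show "P u v = P v u" "Q u = P u u" for u v
      by (simp_all add: P_def Q_def vec_eq_iff forall_2 power2_eq_square algebra_simps)
  qed
  obtain C where C: "C > 0"
    "\<And>\<sigma> y x. (norm (phase_kernel (\<lambda>\<xi>. y \<bullet> Q \<xi>) x))\<^sup>2 * \<bar>det (mixed_gram P (mat 1) \<sigma> y)\<bar> \<le> C"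
    by (rule phase_kernel_det_bound[OF bil sym diag, of "mat 1"], simp, rule that)
  have S: "y \<bullet> P (axis 1 1) (axis 1 1) = y $ 2" "y \<bullet> P (axis 1 1) (axis 2 1) = y $ 1 / 2" "y \<bullet> P (axis 1 1) (axis 3 1) = 0"
    "y \<bullet> P (axis 2 1) (axis 1 1) = y $ 1 / 2" "y \<bullet> P (axis 2 1) (axis 2 1) = 0" "y \<bullet> P (axis 2 1) (axis 3 1) = 0"
    "y \<bullet> P (axis 3 1) (axis 1 1) = 0" "y \<bullet> P (axis 3 1) (axis 2 1) = 0" "y \<bullet> P (axis 3 1) (axis 3 1) = e * y $ 2" for y
    by (simp_all add: P_def inner_vec_def sum_2 axis_def)
  have "extension_estimate_eps Q 5"
  proof (rule eps_estimate_product[where N = "mat 1" and K = "(22 * C) powr (1 / (4 / 3))"])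
    show "det (mat 1 :: real^2^2) \<noteq> 0" "(22 * C) powr (1 / (4 / 3)) > 0" "(5 :: real) > 2" using C(1) by simp_all
    fix x and y :: "real^2"
    define G where "G = (norm (phase_kernel (\<lambda>\<xi>. y \<bullet> Q \<xi>) x))\<^sup>2"
    have G0: "G \<ge> 0" by (simp add: G_def)
    define a where "a = \<bar>y $ 1\<bar>"
    define b where "b = \<bar>y $ 2\<bar>"
    have ab: "a \<ge> 0" "b \<ge> 0" by (simp_all add: a_def b_def)
    have 0: "G \<le> C" using C(2)[of y x "\<lambda>i. False"] by (simp add: G_def mixed_gram_def det_3)
    have 1: "G * a\<^sup>2 \<le> 4 * C" using C(2)[of y x "\<lambda>i. i = 1 \<or> i = 2"]
      by (simp add: G_def a_def mixed_gram_def det_3 column_mat_1 S abs_mult power2_eq_square)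
    have 2: "G * b\<^sup>2 \<le> C" using C(2)[of y x "\<lambda>i. i = 1 \<or> i = 3"] e
      by (simp add: G_def b_def mixed_gram_def det_3 column_mat_1 S abs_mult power2_eq_square)
    have 3: "G * (a\<^sup>2 * b) \<le> 4 * C" using C(2)[of y x "\<lambda>i. True"] e
      by (simp add: G_def a_def b_def mixed_gram_def det_3 column_mat_1 S abs_mult power2_eq_square mult_ac)
    have "b \<le> 1 + b\<^sup>2" using sum_squares_bound[of b 1] ab(2) by simp
    then have "G * b \<le> G * (1 + b\<^sup>2)" using G0 by (rule mult_left_mono)
    then have 4: "G * b \<le> 2 * C" using 0 2 by (simp add: distrib_left)
    have sq: "(1 + t)\<^sup>2 \<le> 2 + 2 * t\<^sup>2" for t :: real using sum_squares_bound[of t 1] by (simp add: power2_sum)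
    have "(1 + a)\<^sup>2 * (1 + b) \<le> (2 + 2 * a\<^sup>2) * (1 + b)" using ab by (intro mult_right_mono sq) simp
    then have "G * ((1 + a)\<^sup>2 * (1 + b)) \<le> G * ((2 + 2 * a\<^sup>2) * (1 + b))" using G0 by (rule mult_left_mono)
    also have "\<dots> = 2 * G + 2 * (G * a\<^sup>2) + 2 * (G * b) + 2 * (G * (a\<^sup>2 * b))" by (simp add: algebra_simps)
    also have "\<dots> \<le> 22 * C" using 0 1 3 4 by linarith
    finally have A: "G * ((1 + a)\<^sup>2 * (1 + b)) \<le> 22 * C" .
    have "G * (1 + b)\<^sup>2 \<le> G * (2 + 2 * b\<^sup>2)" using G0 by (intro mult_left_mono sq)
    also have "\<dots> = 2 * G + 2 * (G * b\<^sup>2)" by (simp add: algebra_simps)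
    also have "\<dots> \<le> 22 * C" using 0 2 C(1) by linarith
    finally have B: "G * (1 + b)\<^sup>2 \<le> 22 * C" .
    have "G \<le> ((22 * C) powr (1 / (4 / 3)) / ((1 + a) * (1 + b))) powr (4 / 3)"
    proof (rule le_powr_interpolate_product[where \<theta> = "2/3" and m = 2 and l = 1 and n = 2])
      show "G * ((1 + a) powr 2 * (1 + b) powr 1) \<le> 22 * C" "G * (1 + b) powr 2 \<le> 22 * C"
        using A B ab by (simp_all add: powr_numeral)
    qed (use G0 ab C(1) in auto)
    then show "(norm (phase_kernel (\<lambda>\<xi>. y \<bullet> Q \<xi>) x))\<^sup>2 \<le> ((22 * C) powr (1 / (4 / 3)) / ((1 + \<bar>(mat 1 *v y) $ 1\<bar>) * (1 + \<bar>(mat 1 *v y) $ 2\<bar>))) powr (4 / (5 - 2))"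
      by (simp add: G_def a_def b_def)
  qed
  then show ?thesis by (simp only: Q_def)
qed

section \<open>The generic case\<close>

text \<open>With the coefficients hidden behind an existential, the closure rules show that a 3 by 3
  determinant is a binary cubic without computing them.\<close>

definition binary_cubic :: "(real \<Rightarrow> real \<Rightarrow> real) \<Rightarrow> bool" where
  "binary_cubic f \<longleftrightarrow> (\<exists>d0 d1 d2 d3. \<forall>r s. f r s = d0 * r ^ 3 + d1 * r\<^sup>2 * s + d2 * r * s\<^sup>2 + d3 * s ^ 3)"

lemma binary_cubic_add:
  assumes "binary_cubic f" "binary_cubic g"
  shows "binary_cubic (\<lambda>r s. f r s + g r s)"
proof -
  obtain a0 a1 a2 a3 where f: "\<And>r s. f r s = a0 * r ^ 3 + a1 * r\<^sup>2 * s + a2 * r * s\<^sup>2 + a3 * s ^ 3"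
    using assms(1) unfolding binary_cubic_def by blast
  obtain b0 b1 b2 b3 where g: "\<And>r s. g r s = b0 * r ^ 3 + b1 * r\<^sup>2 * s + b2 * r * s\<^sup>2 + b3 * s ^ 3"
    using assms(2) unfolding binary_cubic_def by blast
  have "f r s + g r s = (a0 + b0) * r ^ 3 + (a1 + b1) * r\<^sup>2 * s + (a2 + b2) * r * s\<^sup>2 + (a3 + b3) * s ^ 3" for r s
    unfolding f g by (simp add: algebra_simps)
  then show ?thesis unfolding binary_cubic_def by blast
qed

lemma binary_cubic_minus:
  assumes "binary_cubic f"
  shows "binary_cubic (\<lambda>r s. - f r s)"
proof -
  obtain a0 a1 a2 a3 where f: "\<And>r s. f r s = a0 * r ^ 3 + a1 * r\<^sup>2 * s + a2 * r * s\<^sup>2 + a3 * s ^ 3"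
    using assms unfolding binary_cubic_def by blast
  have "- f r s = (- a0) * r ^ 3 + (- a1) * r\<^sup>2 * s + (- a2) * r * s\<^sup>2 + (- a3) * s ^ 3" for r s
    unfolding f by simp
  then show ?thesis unfolding binary_cubic_def by blast
qed

lemma binary_cubic_diff:
  assumes "binary_cubic f" "binary_cubic g"
  shows "binary_cubic (\<lambda>r s. f r s - g r s)"
  using binary_cubic_add[OF assms(1) binary_cubic_minus[OF assms(2)]] by simp

lemma binary_cubic_prod:
  "binary_cubic (\<lambda>r s. (r * x1 + s * y1) * (r * x2 + s * y2) * (r * x3 + s * y3))"
proof -
  have "(r * x1 + s * y1) * (r * x2 + s * y2) * (r * x3 + s * y3) =
    (x1 * x2 * x3) * r ^ 3 + (x1 * x2 * y3 + x1 * y2 * x3 + y1 * x2 * x3) * r\<^sup>2 * s +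
    (x1 * y2 * y3 + y1 * x2 * y3 + y1 * y2 * x3) * r * s\<^sup>2 + (y1 * y2 * y3) * s ^ 3" for r s
    by (simp add: power2_eq_square power3_eq_cube algebra_simps)
  then show ?thesis unfolding binary_cubic_def by blast
qed

lemma exists_indep2:
  fixes u :: "real^3"
  assumes "u \<noteq> 0"
  obtains v where "indep2 u v"
proof -
  obtain v where v: "v \<noteq> 0" "orthogonal u v"
    using vector_in_orthogonal_basis[of u] orthogonal_to_vector_exists[of u] by auto
  have "indep2 u v"
    unfolding indep2_def
  proof (intro allI impI)
    fix \<alpha> \<beta> assume e: "\<alpha> *\<^sub>R u + \<beta> *\<^sub>R v = 0"
    have "u \<bullet> (\<alpha> *\<^sub>R u + \<beta> *\<^sub>R v) = \<alpha> * (u \<bullet> u)" "v \<bullet> (\<alpha> *\<^sub>R u + \<beta> *\<^sub>R v) = \<beta> * (v \<bullet> v)"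
      using v(2) by (simp_all add: orthogonal_def inner_add_right inner_commute)
    then show "\<alpha> = 0 \<and> \<beta> = 0" using e assms v(1) by simp
  qed
  then show thesis by (rule that)
qed

lemma columns3_indep2:
  fixes u v w :: "real^3"
  assumes M: "det (columns3 u v w) \<noteq> 0" and pr: "p \<noteq> 0 \<or> r \<noteq> 0"
  shows "indep2 u (p *\<^sub>R v + r *\<^sub>R w)"
  unfolding indep2_def
proof (intro allI impI)
  fix \<alpha> \<beta> assume e: "\<alpha> *\<^sub>R u + \<beta> *\<^sub>R (p *\<^sub>R v + r *\<^sub>R w) = 0"
  define t :: "real^3" where "t = vector [\<alpha>, \<beta> * p, \<beta> * r]"
  have "columns3 u v w *v t = \<alpha> *\<^sub>R u + (\<beta> * p) *\<^sub>R v + (\<beta> * r) *\<^sub>R w"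
    by (simp add: matrix_mult_sum scalar_mult_eq_scaleR sum_3 t_def)
  also have "\<dots> = 0" using e by (simp add: scaleR_add_right add.assoc)
  finally have "t = 0" using M by (simp add: invertible_det_nz[symmetric] invertible_def matrix_left_invertible_ker) (metis matrix_left_invertible_ker)
  then have "\<alpha> = 0" "\<beta> * p = 0" "\<beta> * r = 0" by (simp_all add: t_def vec_eq_iff forall_3)
  then show "\<alpha> = 0 \<and> \<beta> = 0" using pr by auto
qed

section \<open>The determinant of the pencil and the simplicity of its real roots\<close>

context symmetric_bilinear
begin

definition disc :: "real^2 \<Rightarrow> real" where
  "disc y = det (mixed_gram P (mat 1) (\<lambda>_. True) y)"

text \<open>The Gram matrix in another basis is a congruent matrix, so its determinant changes by a
  square. This permits computing with a basis adapted to a kernel vector.\<close>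

lemma disc_gram:
  "det (mixed_gram P M (\<lambda>_. True) y) = (det M)\<^sup>2 * disc y"
proof -
  have col: "column i M = M $ 1 $ i *\<^sub>R axis 1 1 + M $ 2 $ i *\<^sub>R axis 2 1 + M $ 3 $ i *\<^sub>R axis 3 1" for i
    by (simp add: column_def vec_eq_iff forall_3 axis_def)
  have "mixed_gram P M (\<lambda>_. True) y = transpose M ** (mixed_gram P (mat 1) (\<lambda>_. True) y ** M)"
    unfolding vec_eq_iff
  proof (intro allI)
    fix i j
    show "mixed_gram P M (\<lambda>_. True) y $ i $ j = (transpose M ** (mixed_gram P (mat 1) (\<lambda>_. True) y ** M)) $ i $ j"
      by (simp add: mixed_gram_def matrix_matrix_mult_def transpose_def sum_3 column_mat_1 col P_simps inner_add_right algebra_simps)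
  qed
  then show ?thesis by (simp add: det_mul det_transpose disc_def power2_eq_square)
qed

lemma disc_expand:
  "disc y = (let g = \<lambda>i j. y \<bullet> P (axis i 1) (axis j 1) in
     g 1 1 * g 2 2 * g 3 3 + g 1 2 * g 2 3 * g 3 1 + g 1 3 * g 2 1 * g 3 2 - g 1 1 * g 2 3 * g 3 2 - g 1 2 * g 2 1 * g 3 3 - g 1 3 * g 2 2 * g 3 1)"
  by (simp add: disc_def det_3 mixed_gram_def column_mat_1)

lemma disc_binary_cubic: "binary_cubic (\<lambda>r s. disc (r *\<^sub>R a + s *\<^sub>R b))"
  unfolding disc_expand Let_def inner_add_left inner_scaleR_left
  by (intro binary_cubic_add binary_cubic_diff binary_cubic_prod)

text \<open>At a root \<open>a\<close> the form a . P has a kernel vector \<open>u\<close>. In a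
  basis u, v, w the first row of the Gram matrix of a + s b is divisible by s, so the derivative at
  s = 0 is, up to a nonzero factor, b . P u u times the minor of a . P on v, w. If it vanishes,
  either P u u = 0, which contradicts \<open>iso\<close>, or a . P has rank at most one, which
  contradicts \<open>rank2\<close>.\<close>

lemma disc_simple_root:
  assumes rank2: "\<And>y u u'. y \<noteq> 0 \<Longrightarrow> indep2 u u' \<Longrightarrow> \<forall>x. y \<bullet> P u x = 0 \<Longrightarrow> \<forall>x. y \<bullet> P u' x = 0 \<Longrightarrow> False"
    and iso: "\<And>u u'. indep2 u u' \<Longrightarrow> P u u = 0 \<Longrightarrow> P u u' = 0 \<Longrightarrow> False"
    and ab: "indep2 a b" and D: "\<And>r s. disc (r *\<^sub>R a + s *\<^sub>R b) = s * (\<alpha> * r\<^sup>2 + \<beta> * r * s + \<gamma> * s\<^sup>2)"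
  shows "\<alpha> \<noteq> 0"
proof
  assume \<alpha>: "\<alpha> = 0"
  have a0: "a \<noteq> 0" using indep2D[OF ab, of 1 0] by auto
  have zero: "z = 0" if "a \<bullet> z = 0" "b \<bullet> z = 0" for z :: "real^2"
  proof -
    have "det (vector [a, b] :: real^2^2) \<noteq> 0" using ab by (simp add: det2_indep2)
    then obtain N' where "N' ** (vector [a, b] :: real^2^2) = mat 1"
      using invertible_det_nz[of "vector [a, b] :: real^2^2"] unfolding invertible_def by blast
    then have "z = N' *v ((vector [a, b] :: real^2^2) *v z)" by (simp add: matrix_vector_mul_assoc)
    also have "(vector [a, b] :: real^2^2) *v z = 0" using that by (simp add: vec_eq_iff forall_2 vector2_mult)
    finally show ?thesis by simp
  qed
  have "disc a = 0" using D[of 1 0] by simp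
  then have "\<not> invertible (mixed_gram P (mat 1) (\<lambda>_. True) a)" by (simp add: disc_def invertible_det_nz)
  then obtain u where u: "u \<noteq> 0" "mixed_gram P (mat 1) (\<lambda>_. True) a *v u = 0"
    unfolding invertible_left_inverse matrix_left_invertible_ker by blast
  have au: "a \<bullet> P u x = 0" for x
  proof -
    have ucol: "u = u $ 1 *\<^sub>R axis 1 1 + u $ 2 *\<^sub>R axis 2 1 + u $ 3 *\<^sub>R axis 3 1"
      by (simp add: vec_eq_iff forall_3 axis_def)
    have "a \<bullet> P (axis i 1) u = 0" for i
    proof -
      have "0 = (mixed_gram P (mat 1) (\<lambda>_. True) a *v u) $ i" using u(2) by simp
      also have "\<dots> = a \<bullet> P (axis i 1) (u $ 1 *\<^sub>R axis 1 1 + u $ 2 *\<^sub>R axis 2 1 + u $ 3 *\<^sub>R axis 3 1)"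
        by (simp add: mixed_gram_def matrix_vector_mult_def sum_3 column_mat_1 P_simps inner_add_right mult.commute)
      finally show ?thesis using ucol by simp
    qed
    then have "a \<bullet> P u (axis i 1) = 0" for i by (simp add: sym[of u])
    moreover have "x = x $ 1 *\<^sub>R axis 1 1 + x $ 2 *\<^sub>R axis 2 1 + x $ 3 *\<^sub>R axis 3 1"
      by (simp add: vec_eq_iff forall_3 axis_def)
    then have "a \<bullet> P u x = a \<bullet> P u (x $ 1 *\<^sub>R axis 1 1 + x $ 2 *\<^sub>R axis 2 1 + x $ 3 *\<^sub>R axis 3 1)" by simp
    ultimately show ?thesis by (simp add: P_simps inner_add_right)
  qed
  obtain v where uv: "indep2 u v" by (rule exists_indep2[OF u(1)])
  obtain w where M: "det (columns3 u v w) \<noteq> 0" by (rule indep2_complete[OF uv])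
  have buu: "b \<bullet> P u u \<noteq> 0"
  proof
    assume buu: "b \<bullet> P u u = 0"
    have Puu: "P u u = 0" using zero[OF au buu] .
    \<comment> \<open>One linear equation in two unknowns has a nontrivial solution; it gives a
      vector u' independent of \<open>u\<close> with P u u' = 0, since \<open>a\<close> already
      annihilates all values P u x.\<close>
    obtain p r where pr: "p \<noteq> 0 \<or> r \<noteq> 0" "p * (b \<bullet> P u v) + r * (b \<bullet> P u w) = 0"
    proof (cases "b \<bullet> P u w = 0")
      case True
      then show thesis using that[of 0 1] by simp
    next
      case False
      then show thesis using that[of "b \<bullet> P u w" "- (b \<bullet> P u v)"] by (simp add: mult.commute)
    qed
    have "b \<bullet> P u (p *\<^sub>R v + r *\<^sub>R w) = 0" using pr(2) by (simp add: P_simps inner_add_right)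
    then have "P u (p *\<^sub>R v + r *\<^sub>R w) = 0" using zero[OF au] by blast
    then show False using iso[OF columns3_indep2[OF M pr(1)] Puu] by blast
  qed
  define avv avw aww where "avv = a \<bullet> P v v" and "avw = a \<bullet> P v w" and "aww = a \<bullet> P w w"
  define buu' buv buw bvv bvw bww where "buu' = b \<bullet> P u u" and "buv = b \<bullet> P u v" and "buw = b \<bullet> P u w"
    and "bvv = b \<bullet> P v v" and "bvw = b \<bullet> P v w" and "bww = b \<bullet> P w w"
  define k where "k = (det (columns3 u v w))\<^sup>2"
  have "det (mixed_gram P (columns3 u v w) (\<lambda>_. True) (1 *\<^sub>R a + s *\<^sub>R b)) =
     s * buu' * ((avv + s * bvv) * (aww + s * bww) - (avw + s * bvw)\<^sup>2)
     - s * buv * (s * buv * (aww + s * bww) - s * buw * (avw + s * bvw))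
     + s * buw * (s * buv * (avw + s * bvw) - s * buw * (avv + s * bvv))" for s
    unfolding avv_def avw_def aww_def buu'_def buv_def buw_def bvv_def bvw_def bww_def
    by (simp add: det_3 mixed_gram_def inner_add_left au sym[of v u] sym[of w u] sym[of w v] power2_eq_square algebra_simps)
  moreover define R where "R s =
     s * buu' * ((avv + s * bvv) * (aww + s * bww) - (avw + s * bvw)\<^sup>2)
     - s * buv * (s * buv * (aww + s * bww) - s * buw * (avw + s * bvw))
     + s * buw * (s * buv * (avw + s * bvw) - s * buw * (avv + s * bvv))" for s
  ultimately have R: "R s = k * (s * (\<beta> * s + \<gamma> * s\<^sup>2))" for s
    unfolding disc_gram D \<alpha> k_def by simp
  \<comment> \<open>This finite difference isolates the linear coefficient of a polynomial of degree
    at most three: even powers cancel by symmetry and the cubic terms cancel as 16 - 16. The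
    right-hand side of \<open>R\<close> has no linear term.\<close>
  have "12 * (buu' * (avv * aww - avw\<^sup>2)) = 8 * R 1 - 8 * R (-1) - R 2 + R (-2)"
    unfolding R_def by (simp add: power2_eq_square algebra_simps)
  also have "\<dots> = 0" unfolding R by (simp add: algebra_simps)
  finally have "buu' * (avv * aww - avw\<^sup>2) = 0" by simp
  then have sing: "avv * aww = avw * avw" using buu by (simp add: buu'_def power2_eq_square)
  \<comment> \<open>A singular Gram matrix of a . P on v, w has a kernel vector (p, r); then p v + r
    w lies in the kernel of a . P, next to \<open>u\<close>.\<close>
  have "\<not> indep2 (vector [avv, avw] :: real^2) (vector [avw, aww])"
    using sing by (simp add: det2_indep2[symmetric] det_2)
  then obtain p r where pr: "p *\<^sub>R (vector [avv, avw] :: real^2) + r *\<^sub>R vector [avw, aww] = 0" "p \<noteq> 0 \<or> r \<noteq> 0"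
    unfolding indep2_def by blast
  then have pr': "p * avv + r * avw = 0" "p * avw + r * aww = 0" by (simp_all add: vec_eq_iff forall_2)
  define u' where "u' = p *\<^sub>R v + r *\<^sub>R w"
  have u'x: "a \<bullet> P u' x = 0" for x
  proof (rule P_eq_0I[OF M])
    show "a \<bullet> P u' u = 0" using au[of u'] sym[of u u'] by simp
    show "a \<bullet> P u' v = 0" using pr'(1) by (simp add: u'_def P_simps inner_add_right avv_def avw_def sym[of w v])
    show "a \<bullet> P u' w = 0" using pr'(2) by (simp add: u'_def P_simps inner_add_right avw_def aww_def)
  qed
  have "indep2 u u'" unfolding u'_def by (rule columns3_indep2[OF M pr(2)])
  then show False using rank2[OF a0] au u'x by blast
qed

end

lemma plane_expand:
  fixes a y :: "real^2"
  assumes "a \<noteq> 0"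
  defines "b \<equiv> vector [- a $ 2, a $ 1] :: real^2"
  shows "y = ((a \<bullet> y) / (a \<bullet> a)) *\<^sub>R a + ((b \<bullet> y) / (a \<bullet> a)) *\<^sub>R b"
proof -
  have n: "a $ 1 * a $ 1 + a $ 2 * a $ 2 \<noteq> 0"
    using assms(1) by (simp add: vec_eq_iff forall_2 sum_squares_eq_zero_iff)
  show ?thesis
    using n by (simp add: b_def vec_eq_iff forall_2 inner_vec_def sum_2 divide_simps) (auto simp: algebra_simps)
qed

lemma plane_indep2:
  fixes a :: "real^2"
  assumes "a \<noteq> 0"
  shows "indep2 a (vector [- a $ 2, a $ 1] :: real^2)"
proof -
  have "a $ 1 * a $ 1 + a $ 2 * a $ 2 \<noteq> 0"
    using assms(1) by (simp add: vec_eq_iff forall_2 sum_squares_eq_zero_iff)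
  then show ?thesis by (simp add: det2_indep2[symmetric] det_2)
qed

context symmetric_bilinear
begin

text \<open>A cubic is odd, so it takes opposite values at the two ends of a half circle and
  vanishes somewhere on it.\<close>

lemma disc_root: "\<exists>a. a \<noteq> 0 \<and> disc a = 0"
proof -
  let ?e = "axis 1 1 :: real^2" and ?f = "axis 2 1 :: real^2"
  obtain d0 d1 d2 d3 where d: "\<And>r s. disc (r *\<^sub>R ?e + s *\<^sub>R ?f) = d0 * r ^ 3 + d1 * r\<^sup>2 * s + d2 * r * s\<^sup>2 + d3 * s ^ 3"
    using disc_binary_cubic[of ?e ?f] unfolding binary_cubic_def by blast
  define h where "h t = disc (cos t *\<^sub>R ?e + sin t *\<^sub>R ?f)" for t :: real
  have c: "continuous_on {0..pi} h" unfolding h_def d by (intro continuous_intros)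
  have h0: "h 0 = d0" "h pi = - d0" using d[of 1 0] d[of "-1" 0] by (simp_all add: h_def)
  have "\<exists>t. h t = 0"
  proof (cases "d0 \<le> 0")
    case True
    then show ?thesis using IVT'[of h 0 0 pi] c h0 by auto
  next
    case False
    then show ?thesis using IVT2'[of h pi 0 0] c h0 by auto
  qed
  then obtain t where t: "h t = 0" by blast
  have "cos t *\<^sub>R ?e + sin t *\<^sub>R ?f \<noteq> 0"
  proof
    assume "cos t *\<^sub>R ?e + sin t *\<^sub>R ?f = 0"
    then have "cos t = 0" "sin t = 0" by (simp_all add: vec_eq_iff forall_2 axis_def)
    then show False using sin_cos_squared_add[of t] by simp
  qed
  then show ?thesis using t unfolding h_def by blast
qed

text \<open>With a real root on the first axis the cubic is s times a quadratic form, whose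
  coefficient of r^2 is nonzero because the root is simple. Completing the square gives the normal
  form; a negative \<open>e\<close> corresponds to three real roots, a positive one to a single
  one.\<close>

lemma disc_normal_form:
  assumes rank2: "\<And>y u u'. y \<noteq> 0 \<Longrightarrow> indep2 u u' \<Longrightarrow> \<forall>x. y \<bullet> P u x = 0 \<Longrightarrow> \<forall>x. y \<bullet> P u' x = 0 \<Longrightarrow> False"
    and iso: "\<And>u u'. indep2 u u' \<Longrightarrow> P u u = 0 \<Longrightarrow> P u u' = 0 \<Longrightarrow> False"
  obtains N :: "real^2^2" and \<alpha> e :: real where "det N \<noteq> 0" "\<alpha> \<noteq> 0" "e \<noteq> 0"
    "\<And>y. disc y = \<alpha> * ((N *v y) $ 2 * (((N *v y) $ 1)\<^sup>2 + e * ((N *v y) $ 2)\<^sup>2))"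
proof -
  obtain a where a: "a \<noteq> 0" "disc a = 0" using disc_root by blast
  define b where "b = (vector [- a $ 2, a $ 1] :: real^2)"
  have ab: "indep2 a b" unfolding b_def by (rule plane_indep2[OF a(1)])
  obtain d0 d1 d2 d3 where d: "\<And>r s. disc (r *\<^sub>R a + s *\<^sub>R b) = d0 * r ^ 3 + d1 * r\<^sup>2 * s + d2 * r * s\<^sup>2 + d3 * s ^ 3"
    using disc_binary_cubic[of a b] unfolding binary_cubic_def by blast
  have d0: "d0 = 0" using d[of 1 0] a by simp
  have d': "disc (r *\<^sub>R a + s *\<^sub>R b) = s * (d1 * r\<^sup>2 + d2 * r * s + d3 * s\<^sup>2)" for r s
    unfolding d d0 by (simp add: power2_eq_square power3_eq_cube algebra_simps)
  have d1: "d1 \<noteq> 0" by (rule disc_simple_root[OF rank2 iso ab d'])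
  define k where "k = d2 / (2 * d1)"
  define e where "e = d3 / d1 - k\<^sup>2"
  have nf: "disc (r *\<^sub>R a + s *\<^sub>R b) = d1 * (s * ((r + k * s)\<^sup>2 + e * s\<^sup>2))" for r s
  proof -
    have "d2 = 2 * d1 * k" "d3 = d1 * (e + k\<^sup>2)" using d1 by (simp_all add: k_def e_def)
    then show ?thesis unfolding d' by (simp add: power2_eq_square algebra_simps)
  qed
  \<comment> \<open>For e = 0 the cubic would be d1 s (r + k s)^2, with a double root at b - k a;
    simplicity is applied a second time, at that root.\<close>
  have e0: "e \<noteq> 0"
  proof
    assume e: "e = 0"
    have ba: "indep2 (b - k *\<^sub>R a) a"
      unfolding indep2_def
    proof (intro allI impI)
      fix x z assume "x *\<^sub>R (b - k *\<^sub>R a) + z *\<^sub>R a = 0"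
      then have "(z - x * k) *\<^sub>R a + x *\<^sub>R b = 0" by (simp add: algebra_simps)
      from indep2D[OF ab this] show "x = 0 \<and> z = 0" by auto
    qed
    have "disc (r *\<^sub>R (b - k *\<^sub>R a) + s *\<^sub>R a) = s * (0 * r\<^sup>2 + d1 * r * s + 0 * s\<^sup>2)" for r s
    proof -
      have "r *\<^sub>R (b - k *\<^sub>R a) + s *\<^sub>R a = (s - k * r) *\<^sub>R a + r *\<^sub>R b" by (simp add: algebra_simps)
      then show ?thesis unfolding nf e by (simp add: nf e power2_eq_square)
    qed
    from disc_simple_root[OF rank2 iso ba this] show False by simp
  qed
  define n where "n = a \<bullet> a"
  have n: "n \<noteq> 0" using a by (simp add: n_def)
  \<comment> \<open>The rows are the functionals r + k s and s, where r and s are the coordinates of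
    y in the orthogonal basis \<open>a\<close>, \<open>b\<close>; both basis vectors have squared
    length \<open>n\<close>.\<close>
  define N where "N = (vector [(1 / n) *\<^sub>R (a + k *\<^sub>R b), (1 / n) *\<^sub>R b] :: real^2^2)"
  have "indep2 ((1 / n) *\<^sub>R (a + k *\<^sub>R b)) ((1 / n) *\<^sub>R b)"
    unfolding indep2_def
  proof (intro allI impI)
    fix x z assume "x *\<^sub>R (1 / n) *\<^sub>R (a + k *\<^sub>R b) + z *\<^sub>R (1 / n) *\<^sub>R b = 0"
    then have "(x / n) *\<^sub>R a + (x * k / n + z / n) *\<^sub>R b = 0" by (simp add: algebra_simps)
    from indep2D[OF ab this] show "x = 0 \<and> z = 0" using n by auto
  qed
  then have detN: "det N \<noteq> 0" unfolding N_def by (simp add: det2_indep2)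
  have "disc y = d1 * ((N *v y) $ 2 * (((N *v y) $ 1)\<^sup>2 + e * ((N *v y) $ 2)\<^sup>2))" for y
  proof -
    have N2: "(N *v y) $ 2 = (b \<bullet> y) / n" unfolding N_def vector2_mult by simp
    have N1: "(N *v y) $ 1 = (a \<bullet> y) / n + k * ((b \<bullet> y) / n)" unfolding N_def vector2_mult by (simp add: inner_add_left add_divide_distrib)
    have "y = ((a \<bullet> y) / n) *\<^sub>R a + ((b \<bullet> y) / n) *\<^sub>R b"
      unfolding n_def b_def by (rule plane_expand[OF a(1)])
    then have "disc y = disc (((a \<bullet> y) / n) *\<^sub>R a + ((b \<bullet> y) / n) *\<^sub>R b)" by (rule arg_cong)
    then show ?thesis unfolding nf N1 N2 .
  qed
  then show thesis using that detN d1 e0 by blast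
qed

text \<open>At q = 14/3 the relevant power of \<kappa> is (2C/(1 + |disc|))^(2/3). Its superlevel
  sets lie in sublevel sets of the cubic, whose measure is O(\<mu>^(2/3)) uniformly on the whole
  plane; hence a weak L^1 bound independent of R.\<close>

lemma L14_3_estimate:
  assumes rank2: "\<And>y u u'. y \<noteq> 0 \<Longrightarrow> indep2 u u' \<Longrightarrow> \<forall>x. y \<bullet> P u x = 0 \<Longrightarrow> \<forall>x. y \<bullet> P u' x = 0 \<Longrightarrow> False"
    and iso: "\<And>u u'. indep2 u u' \<Longrightarrow> P u u = 0 \<Longrightarrow> P u u' = 0 \<Longrightarrow> False"
  shows "extension_estimate Q (14 / 3)"
proof -
  obtain N :: "real^2^2" and \<alpha> e :: real where N: "det N \<noteq> 0" and \<alpha>: "\<alpha> \<noteq> 0" and e: "e \<noteq> 0"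
    and nf: "\<And>y. disc y = \<alpha> * ((N *v y) $ 2 * (((N *v y) $ 1)\<^sup>2 + e * ((N *v y) $ 2)\<^sup>2))"
    by (rule disc_normal_form[OF rank2 iso], assumption+, rule that)
  obtain C where C: "C > 0"
    "\<And>\<sigma> y x. (norm (phase_kernel (\<lambda>\<xi>. y \<bullet> Q \<xi>) x))\<^sup>2 * \<bar>det (mixed_gram P (mat 1) \<sigma> y)\<bar> \<le> C"
    by (rule phase_kernel_det_bound[OF bil sym diag, of "mat 1"], simp, rule that)
  define \<kappa> where "\<kappa> y = (2 * C / (1 + \<bar>disc y\<bar>)) powr (1 / 2)" for y
  have [measurable]: "(\<lambda>y. (N *v y) $ i) \<in> borel_measurable borel" for i
    unfolding matrix_vector_mul_component by measurable
  have dm[measurable]: "disc \<in> borel_measurable borel" unfolding nf[abs_def] by measurable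
  have pos: "2 * C / (1 + \<bar>disc y\<bar>) > 0" for y using C(1) by (intro divide_pos_pos) auto
  define W where "W = 1 / \<bar>det N\<bar> * ((16 + 8 / sqrt \<bar>e\<bar>) * (2 * C / \<bar>\<alpha>\<bar>) powr (2 / 3))"
  have W: "W > 0" unfolding W_def using N e \<alpha> C(1) by (intro mult_pos_pos add_pos_nonneg) auto
  show ?thesis
  proof (rule extension_estimateI[where \<kappa> = \<kappa>, OF _ _ _ _ _ _ W])
    show "Q \<in> borel_measurable borel" by (rule Q_measurable)
    show "\<kappa> \<in> borel_measurable borel" unfolding \<kappa>_def[abs_def] by measurable
    show "\<kappa> y > 0" for y unfolding \<kappa>_def by (rule powr_gt_zero[THEN iffD2]) (use pos[of y] in linarith)
    show "\<kappa> (- y) = \<kappa> y" for y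
    proof -
      have "N *v (- y) = - (N *v y)" by (rule linear_neg) simp
      then show ?thesis by (simp add: \<kappa>_def nf abs_mult)
    qed
    show "(14 / 3 :: real) > 2" by simp
    show "norm (phase_kernel (\<lambda>\<xi>. y \<bullet> Q \<xi>) x) \<le> \<kappa> y" for x y
    proof (rule power2_le_imp_le)
      define G where "G = (norm (phase_kernel (\<lambda>\<xi>. y \<bullet> Q \<xi>) x))\<^sup>2"
      have "G \<le> C" using C(2)[of y x "\<lambda>i. False"] by (simp add: G_def mixed_gram_def det_3)
      moreover have "G * \<bar>disc y\<bar> \<le> C" using C(2)[of y x "\<lambda>i. True"] by (simp add: G_def disc_def)
      ultimately have "G * (1 + \<bar>disc y\<bar>) \<le> 2 * C" by (simp add: distrib_left)
      then have "G \<le> 2 * C / (1 + \<bar>disc y\<bar>)" by (subst pos_le_divide_eq) auto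
      also have "\<dots> = (\<kappa> y)\<^sup>2"
        unfolding \<kappa>_def powr_half_sqrt[OF less_imp_le[OF pos]] by (rule real_sqrt_pow2[OF less_imp_le[OF pos], symmetric])
      finally show "(norm (phase_kernel (\<lambda>\<xi>. y \<bullet> Q \<xi>) x))\<^sup>2 \<le> (\<kappa> y)\<^sup>2" unfolding G_def .
    qed (simp add: \<kappa>_def)
    fix c :: real assume c: "c > 0"
    \<comment> \<open>The power exceeds \<open>c\<close> only where |disc| < 2C c^(-3/2); division
      by |\<alpha>| passes to the normal form, and \<mu>^(2/3) is a constant times 1/c.\<close>
    define \<mu> where "\<mu> = 2 * C / c powr (3 / 2) / \<bar>\<alpha>\<bar>"
    have \<mu>: "\<mu> > 0" using C(1) c \<alpha> by (simp add: \<mu>_def)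
    let ?A = "{v :: real^2. \<bar>v $ 2 * ((v $ 1)\<^sup>2 + e * (v $ 2)\<^sup>2)\<bar> < \<mu>}"
    have Am: "?A \<in> sets borel" by measurable
    have "{y. \<kappa> y powr ((14 / 3 - 2) / 2) > c} \<subseteq> {y. N *v y \<in> ?A}"
    proof
      fix y assume "y \<in> {y. \<kappa> y powr ((14 / 3 - 2) / 2) > c}"
      then have "c < (2 * C / (1 + \<bar>disc y\<bar>)) powr (2 / 3)" by (simp add: \<kappa>_def powr_powr)
      then have "c powr (3 / 2) < ((2 * C / (1 + \<bar>disc y\<bar>)) powr (2 / 3)) powr (3 / 2)"
        using c by (intro powr_less_mono2) auto
      also have "\<dots> = 2 * C / (1 + \<bar>disc y\<bar>)" 
      proof -
        have "(2 / 3 :: real) * (3 / 2) = 1" by simp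
        then show ?thesis by (simp only: powr_powr powr_one[OF less_imp_le[OF pos]])
      qed
      finally have "(1 + \<bar>disc y\<bar>) * c powr (3 / 2) < 2 * C" by (simp add: pos_less_divide_eq mult.commute)
      moreover have "\<bar>disc y\<bar> * c powr (3 / 2) \<le> (1 + \<bar>disc y\<bar>) * c powr (3 / 2)" by (intro mult_right_mono) auto
      ultimately have "\<bar>disc y\<bar> * c powr (3 / 2) < 2 * C" by linarith
      then have "\<bar>disc y\<bar> < 2 * C / c powr (3 / 2)" using c by (simp add: pos_less_divide_eq)
      moreover define X where "X = (N *v y) $ 2 * (((N *v y) $ 1)\<^sup>2 + e * ((N *v y) $ 2)\<^sup>2)"
      ultimately have "\<bar>X\<bar> * \<bar>\<alpha>\<bar> < 2 * C / c powr (3 / 2)"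
        unfolding nf by (simp add: abs_mult mult.commute)
      then have "\<bar>X\<bar> < \<mu>" unfolding \<mu>_def using \<alpha> by (subst pos_less_divide_eq) auto
      then show "y \<in> {y. N *v y \<in> ?A}" by (simp add: X_def)
    qed
    then have "emeasure lborel {y. \<kappa> y powr ((14 / 3 - 2) / 2) > c} \<le> emeasure lborel {y. N *v y \<in> ?A}"
    proof (rule emeasure_mono)
      have "(*v) N \<in> borel_measurable borel"
        by (intro borel_measurable_continuous_onI linear_continuous_on) simp
      from measurable_sets[OF this Am] show "{y. N *v y \<in> ?A} \<in> sets lborel" by (simp add: vimage_def)
    qed
    also have "\<dots> = ennreal (1 / \<bar>det N\<bar>) * emeasure lborel ?A"
      by (rule emeasure_linear_vimage[OF N Am])
    also have "\<dots> \<le> ennreal (1 / \<bar>det N\<bar>) * ennreal ((16 + 8 / sqrt \<bar>e\<bar>) * \<mu> powr (2 / 3))"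
      by (intro mult_left_mono emeasure_cubic_level e \<mu>) simp
    also have "\<dots> = ennreal (1 / \<bar>det N\<bar> * ((16 + 8 / sqrt \<bar>e\<bar>) * \<mu> powr (2 / 3)))"
      by (rule ennreal_mult'[symmetric]) simp
    also have "\<mu> powr (2 / 3) = (2 * C / \<bar>\<alpha>\<bar>) powr (2 / 3) / c"
    proof -
      have "\<mu> = 2 * C / \<bar>\<alpha>\<bar> / c powr (3 / 2)" by (simp add: \<mu>_def)
      then have "\<mu> powr (2 / 3) = (2 * C / \<bar>\<alpha>\<bar>) powr (2 / 3) / (c powr (3 / 2)) powr (2 / 3)"
        by (simp only: powr_divide)
      also have "(c powr (3 / 2)) powr (2 / 3) = c" unfolding powr_powr using c by simp
      finally show ?thesis .
    qed
    also have "1 / \<bar>det N\<bar> * ((16 + 8 / sqrt \<bar>e\<bar>) * ((2 * C / \<bar>\<alpha>\<bar>) powr (2 / 3) / c)) = W / c"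
      unfolding W_def by simp
    finally show "emeasure lborel {y. \<kappa> y powr ((14 / 3 - 2) / 2) > c} \<le> ennreal (W / c)" .
  qed
qed

end

section \<open>The invariants\<close>

text \<open>The i-th partial derivative of R \<xi> \<xi> at \<xi> is 2 R \<xi> (axis i 1), by
  symmetry of \<open>R\<close>.\<close>

lemma NV_bilinear:
  fixes R :: "real^'d \<Rightarrow> real^'d \<Rightarrow> real^'n"
  assumes R: "bilinear R" and sym: "\<And>u v. R u v = R v u"
  shows "NV (\<lambda>\<xi>. R \<xi> \<xi>) = card {i. \<exists>\<xi>. R \<xi> (axis i 1) \<noteq> 0}"
proof -
  have pd: "partial_derivative i (\<lambda>\<eta>. R \<eta> \<eta> $ j) \<xi> = 2 * R \<xi> (axis i 1) $ j" for i j \<xi>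
  proof -
    let ?e = "axis i 1 :: real^'d"
    have "R (\<xi> + t *\<^sub>R ?e) (\<xi> + t *\<^sub>R ?e) $ j = R \<xi> \<xi> $ j + 2 * R \<xi> ?e $ j * t + R ?e ?e $ j * t\<^sup>2" for t
      using sym[of ?e \<xi>]
      by (simp add: bilinear_ladd[OF R] bilinear_radd[OF R] bilinear_lmul[OF R] bilinear_rmul[OF R] power2_eq_square algebra_simps)
    then have "partial_derivative i (\<lambda>\<eta>. R \<eta> \<eta> $ j) \<xi> = deriv (\<lambda>t. R \<xi> \<xi> $ j + 2 * R \<xi> ?e $ j * t + R ?e ?e $ j * t\<^sup>2) 0"
      unfolding partial_derivative_def by simp
    also have "\<dots> = 2 * R \<xi> ?e $ j"
      by (rule DERIV_imp_deriv) (auto intro!: derivative_eq_intros)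
    finally show ?thesis .
  qed
  have "{i. \<exists>j \<xi>. partial_derivative i (\<lambda>\<eta>. R \<eta> \<eta> $ j) \<xi> \<noteq> 0} = {i. \<exists>\<xi>. R \<xi> (axis i 1) \<noteq> 0}"
    unfolding pd by (auto simp: vec_eq_iff)
  then show ?thesis unfolding NV_def by simp
qed

lemma frak_d_le:
  fixes M :: "real^'d^'d" and M' :: "real^'n^'m"
  assumes "rank M = d'" "rank M' = CARD('m)"
  shows "frak_d TYPE('m) d' Q \<le> NV (\<lambda>\<xi>. M' *v Q (M *v \<xi>))"
proof -
  have "frak_d TYPE('m) d' Q \<le> (INF M' \<in> {M' :: real^'n^'m. rank M' = CARD('m)}. NV (\<lambda>\<xi>. M' *v Q (M *v \<xi>)))"
    unfolding frak_d_def using assms by (intro cINF_lower) auto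
  also have "\<dots> \<le> NV (\<lambda>\<xi>. M' *v Q (M *v \<xi>))"
    using assms by (intro cINF_lower) auto
  finally show ?thesis .
qed

text \<open>An infimum of a nonempty set of naturals is attained. The matrices \<open>M0\<close> and
  \<open>M0'\<close> witness nonemptiness, which matters because \<open>Inf {} = 0\<close>.\<close>

lemma frak_d_attained:
  fixes M0 :: "real^'d^'d" and M0' :: "real^'n^'m"
  assumes "rank M0 = d'" "rank M0' = CARD('m)"
  obtains M :: "real^'d^'d" and M' :: "real^'n^'m" where "rank M = d'" "rank M' = CARD('m)"
    "NV (\<lambda>\<xi>. M' *v Q (M *v \<xi>)) = frak_d TYPE('m) d' Q"
proof -
  let ?I = "\<lambda>M. (\<lambda>M'. NV (\<lambda>\<xi>. M' *v Q (M *v \<xi>))) ` {M' :: real^'n^'m. rank M' = CARD('m)}"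
  have "(\<lambda>M. Inf (?I M)) ` {M :: real^'d^'d. rank M = d'} \<noteq> {}" using assms by auto
  then have "frak_d TYPE('m) d' Q \<in> (\<lambda>M. Inf (?I M)) ` {M :: real^'d^'d. rank M = d'}"
    unfolding frak_d_def by (rule Inf_nat_def1)
  then obtain M :: "real^'d^'d" where M: "rank M = d'" "frak_d TYPE('m) d' Q = Inf (?I M)" by blast
  have "?I M \<noteq> {}" using assms by auto
  then have "Inf (?I M) \<in> ?I M" by (rule Inf_nat_def1)
  then obtain M' :: "real^'n^'m" where "rank M' = CARD('m)" "NV (\<lambda>\<xi>. M' *v Q (M *v \<xi>)) = Inf (?I M)" by force
  then show thesis using that M by simp
qed

lemma rank_row:
  fixes A :: "real^2^1"
  assumes "A \<noteq> 0"
  shows "rank A = CARD(1)"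
proof -
  have "rank A \<le> 1" using rank_bound[of A] by simp
  moreover have "rank A \<noteq> 0" using assms by (simp add: rank_eq_0)
  ultimately show ?thesis by simp
qed

lemma rank_eq_CARD: "det (A :: real^'n^'n) \<noteq> 0 \<Longrightarrow> rank A = CARD('n)"
  by (metis full_rank_injective invertible_det_nz invertible_left_inverse matrix_left_invertible_injective)

lemma det_nz_if_full_rank: "rank (A :: real^'n^'n) = CARD('n) \<Longrightarrow> det A \<noteq> 0"
  by (metis full_rank_injective invertible_det_nz invertible_left_inverse matrix_left_invertible_injective)

lemma indep2_iff_independent: "indep2 u v \<longleftrightarrow> u \<noteq> v \<and> independent {u, v}"
proof
  assume i: "indep2 u v"
  have uv: "u \<noteq> v" using indep2D[OF i, of 1 "-1"] by auto
  have v: "v \<noteq> 0" using indep2D[OF i, of 0 1] by auto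
  have "u \<notin> span {v}"
  proof
    assume "u \<in> span {v}"
    then obtain k where "u = k *\<^sub>R v" by (auto simp: span_singleton)
    then show False using indep2D[OF i, of 1 "- k"] by simp
  qed
  then show "u \<noteq> v \<and> independent {u, v}" using uv v by (simp add: independent_insert)
next
  assume "u \<noteq> v \<and> independent {u, v}"
  then have i: "u \<notin> span {v}" and v: "v \<noteq> 0" by (auto simp: independent_insert split: if_splits)
  show "indep2 u v"
    unfolding indep2_def
  proof (intro allI impI)
    fix \<alpha> \<beta> assume e: "\<alpha> *\<^sub>R u + \<beta> *\<^sub>R v = 0"
    have "\<alpha> = 0"
    proof (rule ccontr)
      assume \<alpha>: "\<alpha> \<noteq> 0"
      have "\<alpha> *\<^sub>R u = (- \<beta>) *\<^sub>R v" using e by (simp add: eq_neg_iff_add_eq_0)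
      then have "(1 / \<alpha>) *\<^sub>R (\<alpha> *\<^sub>R u) = (1 / \<alpha>) *\<^sub>R ((- \<beta>) *\<^sub>R v)" by (rule arg_cong)
      then have "u = (- \<beta> / \<alpha>) *\<^sub>R v" using \<alpha> by simp
      then have "u \<in> span {v}" unfolding span_singleton by blast
      then show False using i by blast
    qed
    then show "\<alpha> = 0 \<and> \<beta> = 0" using e v by simp
  qed
qed

lemma columns3_mult: "columns3 u v w *v t = t $ 1 *\<^sub>R u + t $ 2 *\<^sub>R v + t $ 3 *\<^sub>R w"
  by (simp add: matrix_mult_sum scalar_mult_eq_scaleR sum_3)

text \<open>A zero third column makes any independent pair an admissible matrix of rank 2, so the
  invariant with d' = 2 can be tested on the plane spanned by the pair.\<close>

lemma rank_columns3_0: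
  assumes "indep2 u v"
  shows "rank (columns3 u v 0) = 2"
proof -
  have "range ((*v) (columns3 u v 0)) = span {u, v}"
  proof
    show "range ((*v) (columns3 u v 0)) \<subseteq> span {u, v}"
    proof (rule image_subsetI)
      fix t :: "real^3"
      have "t $ 1 *\<^sub>R u + t $ 2 *\<^sub>R v \<in> span {u, v}"
        by (intro span_add span_mul span_base) simp_all
      then show "columns3 u v 0 *v t \<in> span {u, v}" by (simp add: columns3_mult)
    qed
    show "span {u, v} \<subseteq> range ((*v) (columns3 u v 0))"
    proof
      fix x assume "x \<in> span {u, v}"
      then obtain a b where "x = a *\<^sub>R u + b *\<^sub>R v"
        by (auto simp: span_insert span_singleton algebra_simps)
      then have "x = columns3 u v 0 *v vector [a, b, 0]" by (simp add: columns3_mult)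
      then show "x \<in> range ((*v) (columns3 u v 0))" by blast
    qed
  qed
  moreover have "dim (span {u, v}) = 2"
    using assms unfolding indep2_iff_independent by (simp add: dim_eq_card_independent)
  ultimately show ?thesis by (simp add: rank_dim_range)
qed

text \<open>Turns the number of variables into a count of columns: a column of \<open>M\<close>
  counts unless it is orthogonal to the range of \<open>M\<close> for the transformed pair.\<close>

lemma (in symmetric_bilinear) NV_transform:
  fixes M' :: "real^2^'m"
  shows "NV (\<lambda>\<xi>. M' *v Q (M *v \<xi>)) = card {i. \<exists>\<xi>. M' *v P (M *v \<xi>) (column i M) \<noteq> 0}"
proof -
  define R where "R u v = M' *v P (M *v u) (M *v v)" for u v
  have "bilinear R"
    unfolding bilinear_def R_def
    by (auto intro!: linearI simp: P_simps matrix_vector_right_distrib matrix_vector_mult_scaleR)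
  moreover have "R u v = R v u" for u v by (simp only: R_def sym[of "M *v u"])
  ultimately have "NV (\<lambda>\<xi>. R \<xi> \<xi>) = card {i. \<exists>\<xi>. R \<xi> (axis i 1) \<noteq> 0}" by (rule NV_bilinear)
  then show ?thesis by (simp add: R_def diag matrix_vector_mult_basis)
qed

section \<open>Vectors extracted from the values of the invariants\<close>

context symmetric_bilinear
begin

text \<open>A vector in the common kernel, taken as first column of an invertible matrix, would
  leave at most two variables.\<close>

lemma frak_d_3_2_nondegenerate:
  assumes "frak_d TYPE(2) 3 Q = 3" and u: "u \<noteq> 0"
  shows "\<exists>x. P u x \<noteq> 0"
proof (rule ccontr)
  assume "\<not> (\<exists>x. P u x \<noteq> 0)"
  then have z: "P u x = 0" "P x u = 0" for x using sym[of x u] by auto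
  obtain v where uv: "indep2 u v" by (rule exists_indep2[OF u])
  obtain w where M: "det (columns3 u v w) \<noteq> 0" by (rule indep2_complete[OF uv])
  have "frak_d TYPE(2) 3 Q \<le> NV (\<lambda>\<xi>. (mat 1 :: real^2^2) *v Q (columns3 u v w *v \<xi>))"
    using rank_eq_CARD[OF M] by (intro frak_d_le) (simp_all add: rank_I)
  also have "\<dots> = card {i. \<exists>\<xi>. P (columns3 u v w *v \<xi>) (column i (columns3 u v w)) \<noteq> 0}"
    unfolding NV_transform by simp
  also have "\<dots> \<le> card {2, 3 :: 3}"
  proof (rule card_mono)
    show "{i. \<exists>\<xi>. P (columns3 u v w *v \<xi>) (column i (columns3 u v w)) \<noteq> 0} \<subseteq> {2, 3}"
    proof
      fix i assume "i \<in> {i. \<exists>\<xi>. P (columns3 u v w *v \<xi>) (column i (columns3 u v w)) \<noteq> 0}"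
      then have "i \<noteq> 1" using z by auto
      then show "i \<in> {2, 3}" using exhaust_3[of i] by auto
    qed
  qed simp
  also have "\<dots> \<le> 2" by (simp add: card_insert_if)
  finally show False using assms(1) by simp
qed

lemma row_mult_eq_0_iff: "(A :: real^2^1) *v z = 0 \<longleftrightarrow> A $ 1 \<bullet> z = 0"
  by (simp add: vec_eq_iff matrix_vector_mul_component)

text \<open>A member of the pencil with a kernel of dimension two depends, in a suitable basis, on
  at most one variable.\<close>

lemma frak_d_3_1_rank:
  assumes d: "frak_d TYPE(1) 3 Q = 2" and y: "y \<noteq> 0" and ind: "indep2 u u'"
    and z: "\<forall>x. y \<bullet> P u x = 0" "\<forall>x. y \<bullet> P u' x = 0"
  shows False
proof -
  obtain w where M: "det (columns3 u u' w) \<noteq> 0" by (rule indep2_complete[OF ind])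
  define A where "A = ((\<chi> i. y) :: real^2^1)"
  have A: "A \<noteq> 0" using y by (simp add: A_def vec_eq_iff)
  have "frak_d TYPE(1) 3 Q \<le> NV (\<lambda>\<xi>. A *v Q (columns3 u u' w *v \<xi>))"
    using rank_eq_CARD[OF M] rank_row[OF A] by (intro frak_d_le) simp_all
  also have "\<dots> = card {i. \<exists>\<xi>. y \<bullet> P (columns3 u u' w *v \<xi>) (column i (columns3 u u' w)) \<noteq> 0}"
    unfolding NV_transform row_mult_eq_0_iff by (simp add: A_def)
  also have "\<dots> \<le> card {3 :: 3}"
  proof (rule card_mono)
    show "{i. \<exists>\<xi>. y \<bullet> P (columns3 u u' w *v \<xi>) (column i (columns3 u u' w)) \<noteq> 0} \<subseteq> {3}"
    proof
      fix i assume "i \<in> {i. \<exists>\<xi>. y \<bullet> P (columns3 u u' w *v \<xi>) (column i (columns3 u u' w)) \<noteq> 0}"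
      then obtain \<xi> where \<xi>: "y \<bullet> P (column i (columns3 u u' w)) (columns3 u u' w *v \<xi>) \<noteq> 0"
        using sym by auto
      have "i \<noteq> 1" "i \<noteq> 2" using \<xi> z by auto
      then show "i \<in> {3}" using exhaust_3[of i] by auto
    qed
  qed simp
  finally show False using d by simp
qed

text \<open>On the plane spanned by \<open>u\<close> and \<open>u'\<close> both forms would be
  multiples of the square of the second coordinate, leaving at most one variable.\<close>

lemma frak_d_2_2_isotropic:
  assumes d: "frak_d TYPE(2) 2 Q = 2" and ind: "indep2 u u'" and z: "P u u = 0" "P u u' = 0"
  shows False
proof -
  have z': "P u' u = 0" using z(2) sym[of u' u] by simp
  have "frak_d TYPE(2) 2 Q \<le> NV (\<lambda>\<xi>. (mat 1 :: real^2^2) *v Q (columns3 u u' 0 *v \<xi>))"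
    using rank_columns3_0[OF ind] by (intro frak_d_le) (simp_all add: rank_I)
  also have "\<dots> = card {i. \<exists>\<xi>. P (columns3 u u' 0 *v \<xi>) (column i (columns3 u u' 0)) \<noteq> 0}"
    unfolding NV_transform by simp
  also have "\<dots> \<le> card {2 :: 3}"
  proof (rule card_mono)
    show "{i. \<exists>\<xi>. P (columns3 u u' 0 *v \<xi>) (column i (columns3 u u' 0)) \<noteq> 0} \<subseteq> {2}"
    proof
      fix i assume "i \<in> {i. \<exists>\<xi>. P (columns3 u u' 0 *v \<xi>) (column i (columns3 u u' 0)) \<noteq> 0}"
      then obtain \<xi> :: "real^3" where \<xi>: "P (\<xi> $ 1 *\<^sub>R u + \<xi> $ 2 *\<^sub>R u') (column i (columns3 u u' 0)) \<noteq> 0"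
        by (auto simp: columns3_mult)
      have "i \<noteq> 1" "i \<noteq> 3" using \<xi> z z' by (auto simp: P_simps)
      then show "i \<in> {2}" using exhaust_3[of i] by auto
    qed
  qed simp
  finally show False using d by simp
qed

text \<open>For a minimising pair of matrices the square matrix \<open>M'\<close> is injective, so
  \<open>P\<close> itself vanishes on the range of \<open>M\<close>, a plane; any basis of it will
  do.\<close>

lemma frak_d_2_2_zero_plane:
  assumes d: "frak_d TYPE(2) 2 Q = 0"
  obtains u u' where "indep2 u u'" "P u u = 0" "P u u' = 0" "P u' u' = 0"
proof -
  have "indep2 (axis 1 1 :: real^3) (axis 2 1)"
    unfolding indep2_def by (simp add: vec_eq_iff forall_3 axis_def)
  from rank_columns3_0[OF this] obtain M :: "real^3^3" and M' :: "real^2^2" where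
    M: "rank M = 2" "rank M' = CARD(2)" "NV (\<lambda>\<xi>. M' *v Q (M *v \<xi>)) = frak_d TYPE(2) 2 Q"
    using frak_d_attained[of _ 2 "mat 1 :: real^2^2" Q] rank_I by metis
  have "{i. \<exists>\<xi>. M' *v P (M *v \<xi>) (column i M) \<noteq> 0} = {}"
    using M(3) unfolding NV_transform d by simp
  then have z0: "M' *v P (M *v \<xi>) (column i M) = 0" for i \<xi> by blast
  have inj: "inj ((*v) M')" using M(2) full_rank_injective[of M'] by simp
  have z1: "P (M *v \<xi>) (column i M) = 0" for i \<xi>
    using injD[OF inj, of "P (M *v \<xi>) (column i M)" 0] z0 by simp
  have z2: "P (M *v \<xi>) (M *v \<eta>) = 0" for \<xi> \<eta>
  proof -
    have "M *v \<eta> = \<eta> $ 1 *\<^sub>R column 1 M + \<eta> $ 2 *\<^sub>R column 2 M + \<eta> $ 3 *\<^sub>R column 3 M"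
      by (simp add: matrix_mult_sum scalar_mult_eq_scaleR sum_3)
    then show ?thesis by (simp add: P_simps z1)
  qed
  have "dim (range ((*v) M)) = 2" using M(1) by (simp add: rank_dim_range)
  then obtain B where B: "B \<subseteq> range ((*v) M)" "independent B" "card B = 2"
    using basis_exists[of "range ((*v) M)"] by metis
  then obtain u u' where uu: "B = {u, u'}" "u \<noteq> u'" by (meson card_2_iff)
  then have "indep2 u u'" using B(2) by (simp add: indep2_iff_independent)
  moreover obtain \<xi> \<eta> where "u = M *v \<xi>" "u' = M *v \<eta>" using B(1) uu by auto
  ultimately show thesis using that z2 by blast
qed

text \<open>The row of a minimising \<open>M'\<close> is \<open>a\<close>. A single column of the
  minimising \<open>M\<close> counts; the other two lie in the kernel of a . P, which is therefore a
  form of rank one.\<close>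

lemma frak_d_3_1_one:
  assumes d: "frak_d TYPE(1) 3 Q = 1"
  obtains a u v w where "a \<noteq> 0" "a \<bullet> P u u \<noteq> 0" "indep2 v w" "\<And>x. a \<bullet> P v x = 0" "\<And>x. a \<bullet> P w x = 0"
    "det (columns3 v w u) \<noteq> 0"
proof -
  have "(\<chi> i. axis 1 1) \<noteq> (0 :: real^2^1)" by (simp add: vec_eq_iff axis_def)
  note r1 = rank_row[OF this]
  have r3: "rank (mat 1 :: real^3^3) = 3" by (simp add: rank_I)
  obtain M :: "real^3^3" and M' :: "real^2^1" where
    M: "rank M = 3" "rank M' = CARD(1)" "NV (\<lambda>\<xi>. M' *v Q (M *v \<xi>)) = frak_d TYPE(1) 3 Q"
    by (rule frak_d_attained[OF r3 r1])
  define a where "a = M' $ 1"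
  have detM: "det M \<noteq> 0" using M(1) by (intro det_nz_if_full_rank) simp
  have "card {i. \<exists>\<xi>. a \<bullet> P (M *v \<xi>) (column i M) \<noteq> 0} = 1"
    using M(3) unfolding NV_transform d row_mult_eq_0_iff a_def .
  then obtain k where k: "{i. \<exists>\<xi>. a \<bullet> P (M *v \<xi>) (column i M) \<noteq> 0} = {k}" by (meson card_1_singletonE)
  have surj: "\<exists>\<xi>. x = M *v \<xi>" for x
  proof -
    obtain M1 where "M ** M1 = mat 1" using detM invertible_det_nz[of M] unfolding invertible_def by blast
    then have "x = M *v (M1 *v x)" by (simp add: matrix_vector_mul_assoc)
    then show ?thesis by blast
  qed
  have z: "a \<bullet> P (column i M) x = 0" if "i \<noteq> k" for i x
  proof -
    obtain \<xi> where "x = M *v \<xi>" using surj by blast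
    then have "a \<bullet> P x (column i M) = 0" using k that by blast
    then show ?thesis using sym[of x] by simp
  qed
  have "k \<in> {i. \<exists>\<xi>. a \<bullet> P (M *v \<xi>) (column i M) \<noteq> 0}" using k by simp
  then obtain \<xi> where \<xi>: "a \<bullet> P (M *v \<xi>) (column k M) \<noteq> 0" by blast
  \<comment> \<open>Otherwise column k would pair to zero with every column, and hence not
    count.\<close>
  have kk: "a \<bullet> P (column k M) (column k M) \<noteq> 0"
  proof
    assume 0: "a \<bullet> P (column k M) (column k M) = 0"
    have "a \<bullet> P (column i M) (column k M) = 0" for i using 0 z by (cases "i = k") auto
    moreover have "M *v \<xi> = \<xi> $ 1 *\<^sub>R column 1 M + \<xi> $ 2 *\<^sub>R column 2 M + \<xi> $ 3 *\<^sub>R column 3 M"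
      by (simp add: matrix_mult_sum scalar_mult_eq_scaleR sum_3)
    ultimately show False using \<xi> by (simp add: P_simps inner_add_right)
  qed
  have a0: "a \<noteq> 0" using kk by auto
  obtain i j where ij: "i \<noteq> k" "j \<noteq> k" "det (columns3 (column i M) (column j M) (column k M)) \<noteq> 0"
  proof -
    \<comment> \<open>Cyclic permutations of three columns preserve the determinant, so the counted
      column can be moved to the last place.\<close>
    have M_eq: "det (columns3 (column 1 M) (column 2 M) (column 3 M)) = det M"
      by (simp add: columns3_def transpose_def det_3 column_def)
    have p1: "det (columns3 (column 2 M) (column 3 M) (column 1 M)) = det M"
      by (simp add: columns3_def transpose_def det_3 column_def)
    have p2: "det (columns3 (column 3 M) (column 1 M) (column 2 M)) = det M"
      by (simp add: columns3_def transpose_def det_3 column_def)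
    consider "k = 1" | "k = 2" | "k = 3" using exhaust_3[of k] by blast
    then show thesis
    proof cases
      case 1
      then show thesis using that[of 2 3] detM p1 by simp
    next
      case 2
      then show thesis using that[of 3 1] detM p2 by simp
    next
      case 3
      then show thesis using that[of 1 2] detM M_eq by simp
    qed
  qed
  have "indep2 (column i M) (column j M)"
    using columns3_indep2[OF ij(3), of 1 0] by simp
  then show thesis using that[OF a0 kk _ z[OF ij(1)] z[OF ij(2)] ij(3)] by blast
qed

text \<open>Completing the square: a form of rank one in the pencil yields an orthogonal pair as required by the
  \<open>L\<^sup>6\<close> estimate.\<close>

lemma orthogonal_pair:
  assumes nondeg: "\<And>z. z \<noteq> 0 \<Longrightarrow> \<exists>x. P z x \<noteq> 0"
    and a: "a \<noteq> 0" and au: "a \<bullet> P u u \<noteq> 0" and vw: "indep2 v w"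
    and av: "\<And>x. a \<bullet> P v x = 0" and aw: "\<And>x. a \<bullet> P w x = 0" and M: "det (columns3 v w u) \<noteq> 0"
  obtains m m' where "indep2 m m'" "P m m' = 0" "indep2 (P m m) (P m' m')"
proof -
  define b where "b = (vector [- a $ 2, a $ 1] :: real^2)"
  have zero: "z = 0" if "a \<bullet> z = 0" "b \<bullet> z = 0" for z
    using plane_expand[OF a, of z] that by (simp add: b_def)
  \<comment> \<open>If all three values vanish, so does b . P on the plane of \<open>v\<close> and
    \<open>w\<close>. A combination z of them with b . P z u = 0 is then killed by both
    \<open>a\<close> and \<open>b\<close>, hence lies in the common kernel.\<close>
  have "b \<bullet> P v v \<noteq> 0 \<or> b \<bullet> P w w \<noteq> 0 \<or> b \<bullet> P (v + w) (v + w) \<noteq> 0"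
  proof (rule ccontr)
    assume "\<not> ?thesis"
    then have bz: "b \<bullet> P v v = 0" "b \<bullet> P w w = 0" "b \<bullet> P (v + w) (v + w) = 0" by auto
    have "b \<bullet> P (v + w) (v + w) = b \<bullet> P v v + (b \<bullet> P v w + b \<bullet> P w v) + b \<bullet> P w w"
      by (simp only: P_simps inner_add_right)
    then have bvw: "b \<bullet> P v w = 0" using bz sym[of w v] by simp
    obtain p r where pr: "p \<noteq> 0 \<or> r \<noteq> 0" "p * (b \<bullet> P v u) + r * (b \<bullet> P w u) = 0"
    proof (cases "b \<bullet> P w u = 0")
      case True
      then show thesis using that[of 0 1] by simp
    next
      case False
      then show thesis using that[of "b \<bullet> P w u" "- (b \<bullet> P v u)"] by (simp add: mult.commute)
    qed
    define z where "z = p *\<^sub>R v + r *\<^sub>R w"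
    have az: "a \<bullet> P z x = 0" for x by (simp add: z_def P_simps inner_add_right av aw)
    have bz': "b \<bullet> P z x = 0" for x
    proof (rule P_eq_0I[OF M])
      show "b \<bullet> P z v = 0" "b \<bullet> P z w = 0" using bz bvw sym[of w v] by (simp_all add: z_def P_simps inner_add_right)
      show "b \<bullet> P z u = 0" using pr(2) by (simp add: z_def P_simps inner_add_right)
    qed
    have "P z x = 0" for x using zero[OF az bz'] .
    then have "z = 0" using nondeg by blast
    then show False using indep2D[OF vw] pr(1) unfolding z_def by blast
  qed
  then obtain m' where m': "b \<bullet> P m' m' \<noteq> 0" "m' = v \<or> m' = w \<or> m' = v + w" by blast
  have am': "a \<bullet> P m' x = 0" for x using m'(2) av aw by (auto simp: P_simps inner_add_right)
  \<comment> \<open>Projection of \<open>u\<close> along \<open>m'\<close>, which makes it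
    orthogonal to \<open>m'\<close> for b . P. For a . P this is automatic because \<open>m'\<close>
    is in its kernel, and the value at \<open>u\<close> is kept.\<close>
  define m where "m = u - ((b \<bullet> P u m') / (b \<bullet> P m' m')) *\<^sub>R m'"
  have amm: "a \<bullet> P m m \<noteq> 0"
    using au am' sym[of u m'] by (simp add: m_def P_simps inner_diff_right)
  have orth: "P m m' = 0"
  proof (rule zero)
    show "a \<bullet> P m m' = 0" using am'[of m] sym[of m m'] by simp
    show "b \<bullet> P m m' = 0" using m'(1) by (simp add: m_def P_simps inner_diff_right)
  qed
  have "indep2 m m'"
    unfolding indep2_def
  proof (intro allI impI)
    fix \<alpha> \<beta> assume "\<alpha> *\<^sub>R m + \<beta> *\<^sub>R m' = 0"
    then have "P (\<alpha> *\<^sub>R m + \<beta> *\<^sub>R m') m = 0" "P (\<alpha> *\<^sub>R m + \<beta> *\<^sub>R m') m' = 0" by (simp_all add: P_simps)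
    then have "\<alpha> *\<^sub>R P m m = 0" "\<beta> *\<^sub>R P m' m' = 0" using orth sym[of m' m] by (simp_all add: P_simps)
    then show "\<alpha> = 0 \<and> \<beta> = 0" using amm m'(1) by auto
  qed
  moreover have "indep2 (P m m) (P m' m')"
    unfolding indep2_def
  proof (intro allI impI)
    fix \<alpha> \<beta> assume e: "\<alpha> *\<^sub>R P m m + \<beta> *\<^sub>R P m' m' = 0"
    then have "a \<bullet> (\<alpha> *\<^sub>R P m m + \<beta> *\<^sub>R P m' m') = 0" by simp
    then have "\<alpha> = 0" using am' amm by (simp add: inner_add_right)
    then show "\<alpha> = 0 \<and> \<beta> = 0" using e m'(1) by auto
  qed
  ultimately show thesis using that orth by blast
qed

end

section \<open>Knapp examples\<close>

text \<open>Chebyshev's inequality read backwards; a divergent integral causes no harm because the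
  norm is then infinite.\<close>

lemma Lp_norm_ge:
  fixes F :: "'a::euclidean_space \<Rightarrow> complex"
  assumes D: "D \<in> sets borel" "D \<subseteq> ball z R" and l: "l \<ge> 0" "\<And>w. w \<in> D \<Longrightarrow> l \<le> norm (F w)"
    and d: "emeasure lborel D = ennreal d" "d \<ge> 0" and q: "q > 0"
  shows "ennreal (l * d powr (1 / q)) \<le> Lp_norm q (ball z R) F"
proof -
  define I where "I = (\<integral>\<^sup>+x. ennreal (norm (F x) powr q) \<partial>lebesgue_on (ball z R))"
  have "ennreal (l powr q * d) = ennreal (l powr q) * emeasure lborel D"
    using d by (simp add: ennreal_mult')
  also have "\<dots> = (\<integral>\<^sup>+x. ennreal (l powr q) * indicator D x \<partial>lborel)"
    using D(1) by (subst nn_integral_cmult_indicator) auto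
  also have "\<dots> = (\<integral>\<^sup>+x. ennreal (l powr q) * indicator D x \<partial>lebesgue)"
    by (rule nn_integral_completion[symmetric])
  also have "\<dots> \<le> (\<integral>\<^sup>+x. ennreal (norm (F x) powr q) * indicator (ball z R) x \<partial>lebesgue)"
  proof (rule nn_integral_mono)
    fix x
    show "ennreal (l powr q) * indicator D x \<le> ennreal (norm (F x) powr q) * indicator (ball z R) x"
    proof (cases "x \<in> D")
      case True
      then have "l powr q \<le> norm (F x) powr q" "x \<in> ball z R" using l q D(2) by (auto intro!: powr_mono2)
      then show ?thesis using True by (simp add: ennreal_leI)
    qed simp
  qed
  also have "\<dots> = I" unfolding I_def by (rule nn_integral_restrict_space[symmetric]) simp
  finally have I: "ennreal (l powr q * d) \<le> I" .
  show ?thesis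
  proof (cases "I = \<infinity>")
    case True
    then show ?thesis by (simp add: Lp_norm_def I_def[symmetric])
  next
    case False
    then have "l powr q * d \<le> enn2real I"
      using I d(2) by (metis enn2real_ennreal enn2real_mono infinity_ennreal_def less_top mult_nonneg_nonneg powr_ge_zero)
    then have "(l powr q * d) powr (1 / q) \<le> enn2real I powr (1 / q)"
      using d(2) q by (intro powr_mono2) auto
    moreover have "(l powr q * d) powr (1 / q) = l * d powr (1 / q)"
      using l(1) q by (simp add: powr_mult powr_powr)
    ultimately show ?thesis using False by (simp add: Lp_norm_def I_def[symmetric] ennreal_leI)
  qed
qed

lemma indicator_Lp_space:
  fixes S :: "(real^'d) set"
  assumes S: "S \<in> sets borel" "S \<subseteq> unit_cube" and s: "emeasure lborel S = ennreal s" "s \<ge> 0"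
  shows "(\<lambda>\<xi>. if \<xi> \<in> S then 1 else 0 :: complex) \<in> Lp_space 2 unit_cube"
    and "Lp_norm 2 unit_cube (\<lambda>\<xi>. if \<xi> \<in> S then 1 else 0 :: complex) = ennreal (sqrt s)"
proof -
  let ?f = "\<lambda>\<xi>. if \<xi> \<in> S then 1 else 0 :: complex"
  have "(\<integral>\<^sup>+\<xi>. ennreal (norm (?f \<xi>) powr 2) \<partial>lebesgue_on unit_cube) = (\<integral>\<^sup>+\<xi>. ennreal (norm (?f \<xi>) powr 2) * indicator unit_cube \<xi> \<partial>lebesgue)"
    by (rule nn_integral_restrict_space) (simp add: unit_cube_def)
  also have "\<dots> = (\<integral>\<^sup>+\<xi>. ennreal (norm (?f \<xi>) powr 2) * indicator unit_cube \<xi> \<partial>lborel)"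
    by (rule nn_integral_completion)
  also have "\<dots> = (\<integral>\<^sup>+\<xi>. indicator S \<xi> \<partial>lborel)"
    using S(2) by (intro nn_integral_cong) (auto simp: indicator_def)
  also have "\<dots> = ennreal s" using S(1) s by simp
  finally have I: "(\<integral>\<^sup>+\<xi>. ennreal (norm (?f \<xi>) powr 2) \<partial>lebesgue_on unit_cube) = ennreal s" .
  show n: "Lp_norm 2 unit_cube ?f = ennreal (sqrt s)"
    unfolding Lp_norm_def Let_def I using s(2) by (simp add: powr_half_sqrt)
  have "?f \<in> borel_measurable borel" using S(1) by measurable
  then have "?f \<in> borel_measurable lborel" by simp
  then have "?f \<in> borel_measurable (lebesgue_on unit_cube)"
    by (intro measurable_restrict_space1 measurable_completion)
  then show "?f \<in> Lp_space 2 unit_cube" using n by (simp add: Lp_space_def)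
qed

text \<open>A phase within 1/6 of a period of a constant \<theta> keeps the real part of the rotated
  integrand at least cos(pi/3) = 1/2 on \<open>S\<close>.\<close>

lemma norm_extension_op_indicator_ge:
  fixes S :: "(real^'d) set" and Q :: "real^'d \<Rightarrow> real^'n"
  assumes S[measurable]: "S \<in> sets borel" and cube: "S \<subseteq> unit_cube" and s: "emeasure lborel S = ennreal s" "s \<ge> 0"
    and Q[measurable]: "Q \<in> borel_measurable borel"
    and phase: "\<And>\<xi>. \<xi> \<in> S \<Longrightarrow> \<bar>x \<bullet> \<xi> + y \<bullet> Q \<xi> - \<theta>\<bar> \<le> 1 / 6"
  shows "s / 2 \<le> norm (extension_op Q (\<lambda>\<xi>. if \<xi> \<in> S then 1 else 0) (x, y))"
proof -
  define \<phi> where "\<phi> \<xi> = 2 * pi * (x \<bullet> \<xi> + y \<bullet> Q \<xi>)" for \<xi>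
  have [measurable]: "\<phi> \<in> borel_measurable borel" unfolding \<phi>_def[abs_def] by measurable
  have fin: "emeasure lborel S < \<infinity>" using s by simp
  have Si: "integrable lborel (\<lambda>\<xi>. indicator S \<xi> :: real)" using fin by (intro integrable_real_indicator) auto
  have ex: "exp (2 * of_real pi * \<i> * of_real (x \<bullet> \<xi> + y \<bullet> Q \<xi>)) = cis (\<phi> \<xi>)" for \<xi>
    unfolding \<phi>_def by (simp add: cis_conv_exp mult_ac)
  have "extension_op Q (\<lambda>\<xi>. if \<xi> \<in> S then 1 else 0) (x, y) = (\<integral>\<xi>. cis (\<phi> \<xi>) * (if \<xi> \<in> S then 1 else 0) \<partial>lebesgue_on unit_cube)"
    unfolding extension_op_def prod.case ex ..
  also have "\<dots> = (\<integral>\<xi>. indicator unit_cube \<xi> *\<^sub>R (cis (\<phi> \<xi>) * (if \<xi> \<in> S then 1 else 0)) \<partial>lebesgue)"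
    by (rule integral_restrict_space) (simp add: unit_cube_def)
  also have "\<dots> = (\<integral>\<xi>. indicator S \<xi> *\<^sub>R cis (\<phi> \<xi>) \<partial>lebesgue)"
    using cube by (intro Bochner_Integration.integral_cong) (auto simp: indicator_def)
  also have "\<dots> = (\<integral>\<xi>. indicator S \<xi> *\<^sub>R cis (\<phi> \<xi>) \<partial>lborel)"
    by (rule integral_completion) measurable
  finally have E: "extension_op Q (\<lambda>\<xi>. if \<xi> \<in> S then 1 else 0) (x, y) = (\<integral>\<xi>. indicator S \<xi> *\<^sub>R cis (\<phi> \<xi>) \<partial>lborel)" .
  have ii: "integrable lborel (\<lambda>\<xi>. cis (- (2 * pi * \<theta>)) * (indicator S \<xi> *\<^sub>R cis (\<phi> \<xi>)))"
    by (rule Bochner_Integration.integrable_bound[OF Si]) (auto simp: norm_mult indicator_def)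
  have "s / 2 = (\<integral>\<xi>. indicator S \<xi> * (1 / 2) \<partial>lborel)"
    using s S by (simp add: measure_def)
  also have "\<dots> \<le> (\<integral>\<xi>. Re (cis (- (2 * pi * \<theta>)) * (indicator S \<xi> *\<^sub>R cis (\<phi> \<xi>))) \<partial>lborel)"
  proof (rule integral_mono)
    show "integrable lborel (\<lambda>\<xi>. indicator S \<xi> * (1 / 2 :: real))" using Si by simp
    show "integrable lborel (\<lambda>\<xi>. Re (cis (- (2 * pi * \<theta>)) * (indicator S \<xi> *\<^sub>R cis (\<phi> \<xi>))))" by (rule integrable_Re[OF ii])
    fix \<xi>
    show "indicator S \<xi> * (1 / 2) \<le> Re (cis (- (2 * pi * \<theta>)) * (indicator S \<xi> *\<^sub>R cis (\<phi> \<xi>)))"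
    proof (cases "\<xi> \<in> S")
      case True
      have "Re (cis (- (2 * pi * \<theta>)) * cis (\<phi> \<xi>)) = cos \<bar>2 * pi * (x \<bullet> \<xi> + y \<bullet> Q \<xi> - \<theta>)\<bar>"
        unfolding cis_mult \<phi>_def by (simp add: algebra_simps)
      moreover have "cos (pi / 3) \<le> cos \<bar>2 * pi * (x \<bullet> \<xi> + y \<bullet> Q \<xi> - \<theta>)\<bar>"
      proof (rule cos_monotone_0_pi_le)
        have "2 * pi * \<bar>x \<bullet> \<xi> + y \<bullet> Q \<xi> - \<theta>\<bar> \<le> 2 * pi * (1 / 6)"
          using phase[OF True] by (intro mult_left_mono) auto
        then show "\<bar>2 * pi * (x \<bullet> \<xi> + y \<bullet> Q \<xi> - \<theta>)\<bar> \<le> pi / 3" by (simp add: abs_mult)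
      qed (use pi_gt_zero in auto)
      ultimately show ?thesis using True by (simp add: cos_60)
    qed simp
  qed
  also have "\<dots> = Re (cis (- (2 * pi * \<theta>)) * (\<integral>\<xi>. indicator S \<xi> *\<^sub>R cis (\<phi> \<xi>) \<partial>lborel))"
    using ii by (subst integral_Re) (simp_all only: integral_mult_right_zero)
  also have "\<dots> \<le> norm (cis (- (2 * pi * \<theta>)) * (\<integral>\<xi>. indicator S \<xi> *\<^sub>R cis (\<phi> \<xi>) \<partial>lborel))"
    by (rule complex_Re_le_cmod)
  finally show ?thesis unfolding E by (simp add: norm_mult)
qed

lemma emeasure_cart_box:
  fixes h :: "'n::finite \<Rightarrow> real"
  assumes "\<And>i. h i \<ge> 0"
  shows "{t :: real^'n. \<forall>i. \<bar>t $ i\<bar> \<le> h i} \<in> sets borel"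
    and "emeasure lborel {t :: real^'n. \<forall>i. \<bar>t $ i\<bar> \<le> h i} = ennreal (\<Prod>i\<in>UNIV. 2 * h i)"
proof -
  have eq: "{t :: real^'n. \<forall>i. \<bar>t $ i\<bar> \<le> h i} = cbox (\<chi> i. - h i) (\<chi> i. h i)"
    by (auto simp: mem_box_cart abs_le_iff) (smt (verit))+
  have ne: "cbox (\<chi> i. - h i) (\<chi> i. h i) \<noteq> ({} :: (real^'n) set)"
  proof -
    have "0 \<in> cbox (\<chi> i. - h i) (\<chi> i. h i)" using assms by (simp add: mem_box_cart)
    then show ?thesis by blast
  qed
  show "{t :: real^'n. \<forall>i. \<bar>t $ i\<bar> \<le> h i} \<in> sets borel" unfolding eq by simp
  have "emeasure lborel (cbox (\<chi> i. - h i) (\<chi> i. h i) :: (real^'n) set) = ennreal (measure lborel (cbox (\<chi> i. - h i) (\<chi> i. h i) :: (real^'n) set))"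
    using emeasure_compact_finite[OF compact_cbox, of "\<chi> i. - h i" "\<chi> i. h i"]
    by (intro emeasure_eq_ennreal_measure) (simp add: less_top)
  also have "measure lborel (cbox (\<chi> i. - h i) (\<chi> i. h i) :: (real^'n) set) = (\<Prod>i\<in>UNIV. 2 * h i)"
    using content_cbox_cart[OF ne] by simp
  finally show "emeasure lborel {t :: real^'n. \<forall>i. \<bar>t $ i\<bar> \<le> h i} = ennreal (\<Prod>i\<in>UNIV. 2 * h i)"
    unfolding eq .
qed

lemma emeasure_affine_vimage:
  fixes N :: "real^'n::{finite,wellorder}^'n::_" and A :: "(real^'n::_) set"
  assumes N: "det N \<noteq> 0" and A[measurable]: "A \<in> sets borel"
  shows "emeasure lborel {u. N *v (u + c) \<in> A} = ennreal (1 / \<bar>det N\<bar>) * emeasure lborel A"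
proof -
  have m: "(*v) N \<in> borel_measurable borel"
    by (intro borel_measurable_continuous_onI linear_continuous_on) simp
  have B: "{u. N *v u \<in> A} \<in> sets borel" using measurable_sets[OF m A] by (simp add: vimage_def)
  have "(\<lambda>u. c + u) -` {u. N *v u \<in> A} \<inter> space borel \<in> sets borel"
    by (rule measurable_sets[OF _ B]) simp
  then have C: "{u. N *v (u + c) \<in> A} \<in> sets borel" by (simp add: vimage_def add.commute)
  have "emeasure lborel {u. N *v (u + c) \<in> A} = (\<integral>\<^sup>+u. indicator {u. N *v u \<in> A} (c + u) \<partial>lborel)"
    using C by (subst nn_integral_indicator[symmetric]) (auto simp: indicator_def add.commute simp del: nn_integral_indicator intro!: nn_integral_cong)
  also have "\<dots> = (\<integral>\<^sup>+u. indicator {u. N *v u \<in> A} u \<partial>lborel)"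
    using B by (intro nn_integral_lborel_translation) simp
  also have "\<dots> = emeasure lborel {u. N *v u \<in> A}" using B by simp
  finally show ?thesis unfolding emeasure_linear_vimage[OF N A] .
qed

context symmetric_bilinear
begin

text \<open>Knapp example: the indicator function of an anisotropic box of side lengths \<open>\<delta> ^ \<alpha> i\<close>, centred in the
  cube, has an extension of constant size on a dual set of volume comparable to
  \<open>\<delta> ^ - (\<Sum>i. \<alpha> i) - (\<Sum>k. \<beta> k)\<close>.\<close>

lemma knapp_example:
  fixes M :: "real^3^3" and N :: "real^2^2" and \<alpha> :: "3 \<Rightarrow> nat" and \<beta> :: "2 \<Rightarrow> nat"
  assumes M: "det M \<noteq> 0" and N: "det N \<noteq> 0"
    and vanish: "\<And>i j k. \<alpha> i + \<alpha> j < \<beta> k \<Longrightarrow> N $ k \<bullet> P (column i M) (column j M) = 0"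
  defines "a \<equiv> \<Sum>i\<in>UNIV. \<alpha> i" and "b \<equiv> \<Sum>k\<in>UNIV. \<beta> k"
  obtains s d C where "s > 0" "d > 0" "C \<ge> 1"
    "\<And>\<delta>. 0 < \<delta> \<Longrightarrow> \<delta> \<le> 1 \<Longrightarrow> \<exists>S D. S \<in> sets borel \<and> S \<subseteq> unit_cube \<and> emeasure lborel S = ennreal (s * \<delta> ^ a) \<and>
      D \<in> sets borel \<and> D \<subseteq> ball 0 (C / \<delta> ^ (a + b)) \<and> emeasure lborel D = ennreal (d / \<delta> ^ (a + b)) \<and>
      (\<forall>w\<in>D. s * \<delta> ^ a / 2 \<le> norm (extension_op Q (\<lambda>\<xi>. if \<xi> \<in> S then 1 else 0) w))"
proof -
  obtain M' where M': "M ** M' = mat 1" "M' ** M = mat 1"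
    using M invertible_det_nz[of M] unfolding invertible_def by blast
  have dM': "det M' \<noteq> 0" using M'(2) by (metis det_I det_mul mult_zero_left zero_neq_one)
  have dT: "det (transpose M) \<noteq> 0" using M by (simp add: det_transpose)
  have dNT: "det (transpose N) \<noteq> 0" using N by (simp add: det_transpose)
  then obtain N' where N': "transpose N ** N' = mat 1" "N' ** transpose N = mat 1"
    using invertible_det_nz[of "transpose N"] unfolding invertible_def by blast
  have dN': "det N' \<noteq> 0" using N'(2) by (metis det_I det_mul mult_zero_left zero_neq_one)
  obtain bM where bM: "bM > 0" "\<And>t. norm (M *v t) \<le> bM * norm t" using linear_bounded_pos[of "(*v) M"] by auto
  obtain bT where bT: "bT > 0" "\<And>t. norm (transpose M' *v t) \<le> bT * norm t" using linear_bounded_pos[of "(*v) (transpose M')"] by auto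
  obtain bN where bN: "bN > 0" "\<And>t. norm (transpose N *v t) \<le> bN * norm t" using linear_bounded_pos[of "(*v) (transpose N)"] by auto
  define c where "c = ((\<chi> i. 1 / 2) :: real^3)"
  define m where "m i = column i M" for i
  define B where "B = (\<Sum>k\<in>UNIV. \<Sum>i\<in>UNIV. \<Sum>j\<in>UNIV. \<bar>N $ k \<bullet> P (m i) (m j)\<bar>)"
  have B0: "B \<ge> 0" unfolding B_def by (intro sum_nonneg) auto
  \<comment> \<open>Small enough for the box around the centre \<open>c\<close> to stay in the cube:
    |M t| \<le> 3 bM \<rho> \<le> 1/2.\<close>
  define \<rho> where "\<rho> = min 1 (1 / (6 * bM))"
  have \<rho>: "0 < \<rho>" "\<rho> \<le> 1" "3 * bM * \<rho> \<le> 1 / 2" using bM(1) by (auto simp: \<rho>_def min_def field_simps)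
  \<comment> \<open>The three linear terms of the phase contribute at most 3\<sigma> and the
    quadratic ones at most \<sigma> B; the sum is exactly the admissible 1/6.\<close>
  define \<sigma> where "\<sigma> = 1 / (6 * (3 + B))"
  have \<sigma>: "\<sigma> > 0" "\<sigma> * (3 + B) = 1 / 6" using B0 by (simp_all add: \<sigma>_def)
  define s where "s = 1 / \<bar>det M'\<bar> * (2 * \<rho>) ^ 3"
  define d where "d = 1 / \<bar>det (transpose M)\<bar> * (2 * \<sigma>) ^ 3 * (1 / \<bar>det N'\<bar> * (2 * \<sigma>)\<^sup>2)"
  define bP where "bP = (\<Sum>i\<in>UNIV. norm (P c (m i)))"
  have bP0: "bP \<ge> 0" unfolding bP_def by (intro sum_nonneg) auto
  \<comment> \<open>A crude radius for the dual set. A power of 1/\<delta> is good enough, since the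
    radius is only charged through R^\<epsilon>.\<close>
  define C where "C = 1 + bT * (3 * \<sigma> + 2 * (2 * bN * \<sigma>) * bP) + 2 * bN * \<sigma>"
  show thesis
  proof (rule that[of s d C])
    show "s > 0" unfolding s_def using dM' \<rho> by simp
    show "d > 0" unfolding d_def using dT dN' \<sigma> by simp
    show "C \<ge> 1" unfolding C_def using bT(1) bN(1) \<sigma>(1) bP0 by simp
    fix \<delta> :: real assume \<delta>: "0 < \<delta>" "\<delta> \<le> 1"
    define S where "S = {\<xi>. M' *v (\<xi> + (- c)) \<in> {t. \<forall>i. \<bar>t $ i\<bar> \<le> \<rho> * \<delta> ^ \<alpha> i}}"
    define D2 where "D2 = {y. N' *v y \<in> {t. \<forall>k. \<bar>t $ k\<bar> \<le> \<sigma> / \<delta> ^ \<beta> k}}"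
    \<comment> \<open>Expanding \<open>Q\<close> at \<open>c\<close> adds 2 y . P c (m i) to the
      linear coefficient x . m i of the phase. The dual set is thus a sheared box: at fixed y the
      shear is a translation in x and preserves volume.\<close>
    define D where "D = {p. snd p \<in> D2 \<and> (\<forall>i. \<bar>fst p \<bullet> m i + 2 * (snd p \<bullet> P c (m i))\<bar> \<le> \<sigma> / \<delta> ^ \<alpha> i)}"
    have box1: "\<rho> * \<delta> ^ \<alpha> i \<ge> 0" for i using \<rho> \<delta> by simp
    have box2: "\<sigma> / \<delta> ^ n \<ge> 0" for n using \<sigma> \<delta> by simp
    have Sm: "S \<in> sets borel"
    proof -
      have "(\<lambda>\<xi>. M' *v (\<xi> + (- c))) \<in> borel_measurable borel"
        by (intro borel_measurable_continuous_onI continuous_on_compose2[OF matrix_vector_mult_linear_continuous_on[of UNIV M']] continuous_intros) auto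
      from measurable_sets[OF this emeasure_cart_box(1)[of "\<lambda>i. \<rho> * \<delta> ^ \<alpha> i", OF box1]]
      show ?thesis by (simp add: S_def vimage_def)
    qed
    have prod\<alpha>: "(\<Prod>i\<in>UNIV. 2 * (\<rho> * \<delta> ^ \<alpha> i)) = (2 * \<rho>) ^ 3 * \<delta> ^ a"
      by (simp add: a_def power_sum prod.distrib mult.assoc[symmetric])
    have Se: "emeasure lborel S = ennreal (s * \<delta> ^ a)"
      unfolding S_def emeasure_affine_vimage[OF dM' emeasure_cart_box(1)[OF box1]] emeasure_cart_box(2)[OF box1] prod\<alpha> s_def
      using \<rho> \<delta> by (subst ennreal_mult'[symmetric]) (auto simp: mult.assoc)
    have S_rep: "\<exists>t. \<xi> = c + M *v t \<and> (\<forall>i. \<bar>t $ i\<bar> \<le> \<rho> * \<delta> ^ \<alpha> i)" if "\<xi> \<in> S" for \<xi>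
    proof (intro exI conjI)
      show "\<xi> = c + M *v (M' *v (\<xi> + (- c)))" by (simp add: matrix_vector_mul_assoc M')
      show "\<forall>i. \<bar>(M' *v (\<xi> + (- c))) $ i\<bar> \<le> \<rho> * \<delta> ^ \<alpha> i" using that by (simp add: S_def)
    qed
    have cube: "S \<subseteq> unit_cube"
    proof
      fix \<xi> assume "\<xi> \<in> S"
      then obtain t where t: "\<xi> = c + M *v t" "\<And>i. \<bar>t $ i\<bar> \<le> \<rho> * \<delta> ^ \<alpha> i" using S_rep by blast
      have "\<bar>t $ i\<bar> \<le> \<rho>" for i
      proof -
        have "\<rho> * \<delta> ^ \<alpha> i \<le> \<rho> * 1" using \<rho> \<delta> by (intro mult_left_mono power_le_one) auto
        then show ?thesis using t(2)[of i] by simp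
      qed
      then have "(\<Sum>i\<in>UNIV. \<bar>t $ i\<bar>) \<le> 3 * \<rho>" using sum_bounded_above[of "UNIV :: 3 set" "\<lambda>i. \<bar>t $ i\<bar>" \<rho>] by simp
      then have "norm t \<le> 3 * \<rho>" using norm_le_l1_cart[of t] by linarith
      then have "bM * norm t \<le> bM * (3 * \<rho>)" using bM(1) by simp
      then have n: "norm (M *v t) \<le> 1 / 2" using bM(2)[of t] \<rho>(3) by simp
      have Mt: "\<bar>(M *v t) $ i\<bar> \<le> 1 / 2" for i using component_le_norm_cart[of "M *v t" i] n by linarith
      have "0 \<le> \<xi> $ i \<and> \<xi> $ i \<le> 1" for i using Mt[of i] unfolding t(1) c_def abs_le_iff by auto
      then show "\<xi> \<in> unit_cube" by (simp add: unit_cube_def mem_box_cart)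
    qed
    have D2m: "D2 \<in> sets borel"
    proof -
      have "(\<lambda>y. N' *v y) \<in> borel_measurable borel"
        by (intro borel_measurable_continuous_onI continuous_intros matrix_vector_mult_linear_continuous_on)
      from measurable_sets[OF this emeasure_cart_box(1)[of "\<lambda>k. \<sigma> / \<delta> ^ \<beta> k", OF box2]]
      show ?thesis by (simp add: D2_def vimage_def)
    qed
    have prod\<beta>: "(\<Prod>k\<in>UNIV. 2 * (\<sigma> / \<delta> ^ \<beta> k)) = (2 * \<sigma>)\<^sup>2 / \<delta> ^ b"
      by (simp add: b_def power_sum prod_dividef)
    have prod\<alpha>': "(\<Prod>i\<in>UNIV. 2 * (\<sigma> / \<delta> ^ \<alpha> i)) = (2 * \<sigma>) ^ 3 / \<delta> ^ a"
      by (simp add: a_def power_sum prod_dividef)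
    have D2e: "emeasure lborel D2 = ennreal (1 / \<bar>det N'\<bar> * ((2 * \<sigma>)\<^sup>2 / \<delta> ^ b))"
      unfolding D2_def emeasure_linear_vimage[OF dN' emeasure_cart_box(1)[OF box2]] emeasure_cart_box(2)[OF box2] prod\<beta>
      by (rule ennreal_mult'[symmetric]) simp
    have Dm': "D \<in> sets (borel \<Otimes>\<^sub>M borel)"
    proof -
      note [measurable] = D2m
      have "{p \<in> space (borel \<Otimes>\<^sub>M borel). snd p \<in> D2 \<and> (\<forall>i. \<bar>fst p \<bullet> m i + 2 * (snd p \<bullet> P c (m i))\<bar> \<le> \<sigma> / \<delta> ^ \<alpha> i)} \<in> sets (borel \<Otimes>\<^sub>M borel)"
        unfolding forall_3 by measurable
      then show ?thesis by (simp add: D_def space_pair_measure)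
    qed
    then have Dm: "D \<in> sets borel" by (simp only: borel_prod)
    have slice: "emeasure lborel {x. (x, y) \<in> D} = ennreal (1 / \<bar>det (transpose M)\<bar> * ((2 * \<sigma>) ^ 3 / \<delta> ^ a)) * indicator D2 y" for y
    proof (cases "y \<in> D2")
      case True
      define v where "v = 2 *\<^sub>R (\<chi> i. y \<bullet> P c (axis i 1))"
      have v: "v \<bullet> m i = 2 * (y \<bullet> P c (m i))" for i
        unfolding v_def inner_scaleR_left bilinear_inner_rep[OF bil] ..
      have comp: "(transpose M *v u) $ i = u \<bullet> m i" for u i
        by (simp add: m_def matrix_vector_mult_def transpose_def column_def inner_vec_def mult.commute)
      have "{x. (x, y) \<in> D} = {x. transpose M *v (x + v) \<in> {t. \<forall>i. \<bar>t $ i\<bar> \<le> \<sigma> / \<delta> ^ \<alpha> i}}"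
        unfolding mem_Collect_eq comp inner_add_left v D_def using True by simp
      then have "emeasure lborel {x. (x, y) \<in> D} = ennreal (1 / \<bar>det (transpose M)\<bar>) * ennreal ((2 * \<sigma>) ^ 3 / \<delta> ^ a)"
        by (simp only: emeasure_affine_vimage[OF dT emeasure_cart_box(1)[OF box2]] emeasure_cart_box(2)[OF box2] prod\<alpha>')
      also have "\<dots> = ennreal (1 / \<bar>det (transpose M)\<bar> * ((2 * \<sigma>) ^ 3 / \<delta> ^ a))"
        by (rule ennreal_mult'[symmetric]) simp
      finally show ?thesis using True by simp
    next
      case False
      then show ?thesis by (simp add: D_def)
    qed
    have De: "emeasure lborel D = ennreal (d / \<delta> ^ (a + b))"
    proof -
      have "emeasure lborel D = emeasure (lborel \<Otimes>\<^sub>M lborel) D" by (simp add: lborel_prod)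
      also have "\<dots> = (\<integral>\<^sup>+y. emeasure lborel {x. (x, y) \<in> D} \<partial>lborel)"
        using Dm' by (subst lborel_pair.emeasure_pair_measure_alt2) (auto simp: vimage_def)
      also have "\<dots> = ennreal (1 / \<bar>det (transpose M)\<bar> * ((2 * \<sigma>) ^ 3 / \<delta> ^ a)) * emeasure lborel D2"
        unfolding slice using D2m by (subst nn_integral_cmult_indicator) auto
      also have "\<dots> = ennreal (1 / \<bar>det (transpose M)\<bar> * ((2 * \<sigma>) ^ 3 / \<delta> ^ a) * (1 / \<bar>det N'\<bar> * ((2 * \<sigma>)\<^sup>2 / \<delta> ^ b)))"
        unfolding D2e using \<sigma> \<delta> by (intro ennreal_mult'[symmetric]) simp
      also have "1 / \<bar>det (transpose M)\<bar> * ((2 * \<sigma>) ^ 3 / \<delta> ^ a) * (1 / \<bar>det N'\<bar> * ((2 * \<sigma>)\<^sup>2 / \<delta> ^ b)) = d / \<delta> ^ (a + b)"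
        unfolding d_def power_add by simp
      finally show ?thesis .
    qed
    have powle: "\<sigma> / \<delta> ^ n \<le> \<sigma> / \<delta> ^ (a + b)" if "n \<le> a + b" for n
      using \<sigma> \<delta> that by (intro divide_left_mono power_decreasing) auto
    have \<alpha>le: "\<alpha> i \<le> a + b" for i
      unfolding a_def using member_le_sum[of i UNIV \<alpha>] by simp
    have \<beta>le: "\<beta> k \<le> a + b" for k
      unfolding b_def using member_le_sum[of k UNIV \<beta>] by simp
    have y_rep: "y = transpose N *v (N' *v y)" for y by (simp add: matrix_vector_mul_assoc N')
    have Dball: "D \<subseteq> ball 0 (C / \<delta> ^ (a + b))"
    proof
      fix p assume p: "p \<in> D"
      obtain x y where xy: "p = (x, y)" by (cases p)
      define h where "h = 1 / \<delta> ^ (a + b)"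
      have h: "h > 0" using \<delta> by (simp add: h_def)
      have "\<bar>(N' *v y) $ k\<bar> \<le> \<sigma> * h" for k
      proof -
        have "\<bar>(N' *v y) $ k\<bar> \<le> \<sigma> / \<delta> ^ \<beta> k" using p unfolding xy D_def D2_def by simp
        also have "\<dots> \<le> \<sigma> * h" using powle[OF \<beta>le[of k]] by (simp add: h_def)
        finally show ?thesis .
      qed
      then have "(\<Sum>k\<in>UNIV. \<bar>(N' *v y) $ k\<bar>) \<le> 2 * (\<sigma> * h)"
        using sum_bounded_above[of "UNIV :: 2 set" "\<lambda>k. \<bar>(N' *v y) $ k\<bar>" "\<sigma> * h"] by simp
      then have "norm (N' *v y) \<le> 2 * (\<sigma> * h)" using norm_le_l1_cart[of "N' *v y"] by linarith
      then have "bN * norm (N' *v y) \<le> bN * (2 * (\<sigma> * h))" using bN(1) by simp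
      then have ny: "norm y \<le> 2 * bN * \<sigma> * h" using bN(2)[of "N' *v y"] y_rep[of y] by simp
      have xm: "\<bar>x \<bullet> m i\<bar> \<le> \<sigma> * h + 2 * norm y * norm (P c (m i))" for i
      proof -
        have "\<bar>x \<bullet> m i + 2 * (y \<bullet> P c (m i))\<bar> \<le> \<sigma> * h"
        proof -
          have "\<bar>x \<bullet> m i + 2 * (y \<bullet> P c (m i))\<bar> \<le> \<sigma> / \<delta> ^ \<alpha> i" using p unfolding xy D_def by simp
          also have "\<dots> \<le> \<sigma> * h" using powle[OF \<alpha>le[of i]] by (simp add: h_def)
          finally show ?thesis .
        qed
        moreover have "\<bar>y \<bullet> P c (m i)\<bar> \<le> norm y * norm (P c (m i))" by (rule Cauchy_Schwarz_ineq2)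
        ultimately show ?thesis by linarith
      qed
      have xr: "x = transpose M' *v (\<chi> i. x \<bullet> m i)"
      proof -
        have "(\<chi> i. x \<bullet> m i) = transpose M *v x"
          by (simp add: vec_eq_iff m_def matrix_vector_mult_def transpose_def column_def inner_vec_def mult.commute)
        moreover have "transpose M' ** transpose M = mat 1"
          by (simp add: matrix_transpose_mul[symmetric] M' transpose_mat)
        ultimately show ?thesis by (simp only: matrix_vector_mul_assoc matrix_vector_mul_lid)
      qed
      have "norm (\<chi> i. x \<bullet> m i) \<le> (\<Sum>i\<in>UNIV. \<bar>x \<bullet> m i\<bar>)"
        using norm_le_l1_cart[of "\<chi> i. x \<bullet> m i"] by simp
      also have "\<dots> \<le> (\<Sum>i\<in>UNIV. \<sigma> * h + 2 * norm y * norm (P c (m i)))" by (intro sum_mono xm)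
      also have "\<dots> = 3 * \<sigma> * h + 2 * norm y * bP" by (simp add: bP_def sum.distrib sum_distrib_left)
      also have "\<dots> \<le> 3 * \<sigma> * h + 2 * (2 * bN * \<sigma> * h) * bP"
        using ny bP0 by (intro add_left_mono mult_right_mono mult_left_mono) simp_all
      finally have "norm (\<chi> i. x \<bullet> m i) \<le> 3 * \<sigma> * h + 2 * (2 * bN * \<sigma> * h) * bP" .
      then have "bT * norm (\<chi> i. x \<bullet> m i) \<le> bT * (3 * \<sigma> * h + 2 * (2 * bN * \<sigma> * h) * bP)" using bT(1) by simp
      then have nx: "norm x \<le> bT * (3 * \<sigma> * h + 2 * (2 * bN * \<sigma> * h) * bP)"
        using bT(2)[of "\<chi> i. x \<bullet> m i"] unfolding xr[symmetric] by linarith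
      have "norm p \<le> norm x + norm y" unfolding xy by (rule norm_Pair_le)
      also have "\<dots> \<le> bT * (3 * \<sigma> * h + 2 * (2 * bN * \<sigma> * h) * bP) + 2 * bN * \<sigma> * h" using nx ny by simp
      also have "\<dots> < C * h" unfolding C_def using h by (simp add: algebra_simps)
      finally show "p \<in> ball 0 (C / \<delta> ^ (a + b))" by (simp add: h_def)
    qed
    have lower: "s * \<delta> ^ a / 2 \<le> norm (extension_op Q (\<lambda>\<xi>. if \<xi> \<in> S then 1 else 0) w)" if w: "w \<in> D" for w
    proof -
      obtain x y where xy: "w = (x, y)" by (cases w)
      define \<eta> where "\<eta> = N' *v y"
      have y: "y = \<eta> $ 1 *\<^sub>R N $ 1 + \<eta> $ 2 *\<^sub>R N $ 2"
        using y_rep[of y] unfolding \<eta>_def[symmetric]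
        by (subst (asm) matrix_vector_mult_def) (simp add: vec_eq_iff transpose_def sum_2 mult.commute)
      have y_in: "y \<bullet> z = (\<Sum>k\<in>UNIV. \<eta> $ k * (N $ k \<bullet> z))" for z
        by (subst y) (simp add: inner_add_left sum_2)
      show ?thesis
        unfolding xy
      proof (rule norm_extension_op_indicator_ge[OF Sm cube Se _ Q_measurable])
        show "0 \<le> s * \<delta> ^ a" using \<open>s > 0\<close> \<delta> by simp
        fix \<xi> assume "\<xi> \<in> S"
        then obtain t where t: "\<xi> = c + M *v t" "\<And>i. \<bar>t $ i\<bar> \<le> \<rho> * \<delta> ^ \<alpha> i" using S_rep by blast
        have t': "\<bar>t $ i\<bar> \<le> \<delta> ^ \<alpha> i" for i
        proof -
          have "\<rho> * \<delta> ^ \<alpha> i \<le> 1 * \<delta> ^ \<alpha> i" using \<rho> \<delta> by (intro mult_right_mono) auto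
          then show ?thesis using t(2)[of i] by simp
        qed
        have Mt: "M *v t = (\<Sum>i\<in>UNIV. t $ i *\<^sub>R m i)"
          by (simp add: matrix_mult_sum scalar_mult_eq_scaleR m_def)
        have PMt: "P (M *v t) (M *v t) = (\<Sum>i\<in>UNIV. \<Sum>j\<in>UNIV. (t $ i * t $ j) *\<^sub>R P (m i) (m j))"
          unfolding Mt sum_3 by (simp add: P_simps scaleR_add_right mult.commute add_ac)
        have PcMt: "P c (M *v t) = (\<Sum>i\<in>UNIV. t $ i *\<^sub>R P c (m i))"
          unfolding Mt sum_3 by (simp add: P_simps)
        have "Q \<xi> = P c c + 2 *\<^sub>R P c (M *v t) + P (M *v t) (M *v t)"
          unfolding diag t(1) using sym[of "M *v t" c] by (simp add: P_simps scaleR_2)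
        then have "x \<bullet> \<xi> + y \<bullet> Q \<xi> - (x \<bullet> c + y \<bullet> P c c) = x \<bullet> (M *v t) + 2 * (y \<bullet> P c (M *v t)) + y \<bullet> P (M *v t) (M *v t)"
          unfolding t(1) by (simp add: inner_add_right)
        also have "x \<bullet> (M *v t) + 2 * (y \<bullet> P c (M *v t)) = (\<Sum>i\<in>UNIV. t $ i * (x \<bullet> m i + 2 * (y \<bullet> P c (m i))))"
          unfolding PcMt unfolding Mt sum_3 by (simp add: inner_add_right algebra_simps)
        also have "y \<bullet> P (M *v t) (M *v t) = (\<Sum>k\<in>UNIV. \<Sum>i\<in>UNIV. \<Sum>j\<in>UNIV. \<eta> $ k * (t $ i * t $ j * (N $ k \<bullet> P (m i) (m j))))"
          unfolding y_in PMt by (simp add: inner_sum_right sum_distrib_left)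
        finally have ph: "x \<bullet> \<xi> + y \<bullet> Q \<xi> - (x \<bullet> c + y \<bullet> P c c) = (\<Sum>i\<in>UNIV. t $ i * (x \<bullet> m i + 2 * (y \<bullet> P c (m i)))) +
           (\<Sum>k\<in>UNIV. \<Sum>i\<in>UNIV. \<Sum>j\<in>UNIV. \<eta> $ k * (t $ i * t $ j * (N $ k \<bullet> P (m i) (m j))))" .
        have 1: "\<bar>\<Sum>i\<in>UNIV. t $ i * (x \<bullet> m i + 2 * (y \<bullet> P c (m i)))\<bar> \<le> 3 * \<sigma>"
        proof -
          have "\<bar>t $ i * (x \<bullet> m i + 2 * (y \<bullet> P c (m i)))\<bar> \<le> \<sigma>" for i
          proof -
            have "\<bar>x \<bullet> m i + 2 * (y \<bullet> P c (m i))\<bar> \<le> \<sigma> / \<delta> ^ \<alpha> i" using w by (simp add: xy D_def)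
            then have "\<bar>t $ i\<bar> * \<bar>x \<bullet> m i + 2 * (y \<bullet> P c (m i))\<bar> \<le> \<delta> ^ \<alpha> i * (\<sigma> / \<delta> ^ \<alpha> i)"
              using t'[of i] \<delta> by (intro mult_mono) auto
            then show ?thesis using \<delta> by (simp add: abs_mult)
          qed
          then have "(\<Sum>i\<in>UNIV. \<bar>t $ i * (x \<bullet> m i + 2 * (y \<bullet> P c (m i)))\<bar>) \<le> 3 * \<sigma>"
            using sum_bounded_above[of "UNIV :: 3 set" "\<lambda>i. \<bar>t $ i * (x \<bullet> m i + 2 * (y \<bullet> P c (m i)))\<bar>" \<sigma>] by simp
          then show ?thesis by (rule order_trans[OF sum_abs])
        qed
        have 2: "\<bar>\<Sum>k\<in>UNIV. \<Sum>i\<in>UNIV. \<Sum>j\<in>UNIV. \<eta> $ k * (t $ i * t $ j * (N $ k \<bullet> P (m i) (m j)))\<bar> \<le> \<sigma> * B"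
        proof -
          \<comment> \<open>Either the coefficient vanishes by \<open>vanish\<close>, or \<alpha> i
            + \<alpha> j \<ge> \<beta> k and the size \<delta>^(\<alpha> i + \<alpha> j) of the
            monomial compensates the size \<delta>^(-\<beta> k) of the dual variable.\<close>
          have e: "\<bar>\<eta> $ k * (t $ i * t $ j * (N $ k \<bullet> P (m i) (m j)))\<bar> \<le> \<sigma> * \<bar>N $ k \<bullet> P (m i) (m j)\<bar>" for k i j
          proof (cases "\<alpha> i + \<alpha> j < \<beta> k")
            case True
            then show ?thesis using vanish[OF True] by (simp add: m_def)
          next
            case False
            have \<eta>k: "\<bar>\<eta> $ k\<bar> \<le> \<sigma> / \<delta> ^ \<beta> k" using w by (simp add: xy D_def D2_def \<eta>_def)
            have "\<bar>\<eta> $ k\<bar> * (\<bar>t $ i\<bar> * \<bar>t $ j\<bar>) \<le> (\<sigma> / \<delta> ^ \<beta> k) * (\<delta> ^ \<alpha> i * \<delta> ^ \<alpha> j)"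
              using \<eta>k t'[of i] t'[of j] \<delta> \<sigma> by (intro mult_mono) auto
            also have "\<dots> = (\<sigma> / \<delta> ^ \<beta> k) * \<delta> ^ (\<alpha> i + \<alpha> j)" by (simp add: power_add)
            also have "\<dots> \<le> (\<sigma> / \<delta> ^ \<beta> k) * \<delta> ^ \<beta> k"
              using False \<delta> \<sigma> by (intro mult_left_mono power_decreasing) auto
            also have "\<dots> = \<sigma>" using \<delta> by simp
            finally have "\<bar>\<eta> $ k\<bar> * (\<bar>t $ i\<bar> * \<bar>t $ j\<bar>) * \<bar>N $ k \<bullet> P (m i) (m j)\<bar> \<le> \<sigma> * \<bar>N $ k \<bullet> P (m i) (m j)\<bar>"
              by (rule mult_right_mono) simp
            then show ?thesis by (simp add: abs_mult mult.assoc)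
          qed
          have "\<bar>\<Sum>k\<in>UNIV. \<Sum>i\<in>UNIV. \<Sum>j\<in>UNIV. \<eta> $ k * (t $ i * t $ j * (N $ k \<bullet> P (m i) (m j)))\<bar> \<le>
             (\<Sum>k\<in>UNIV. \<Sum>i\<in>UNIV. \<Sum>j\<in>UNIV. \<bar>\<eta> $ k * (t $ i * t $ j * (N $ k \<bullet> P (m i) (m j)))\<bar>)"
            by (rule order_trans[OF sum_abs sum_mono], rule order_trans[OF sum_abs sum_mono], rule sum_abs)
          also have "\<dots> \<le> (\<Sum>k\<in>UNIV. \<Sum>i\<in>UNIV. \<Sum>j\<in>UNIV. \<sigma> * \<bar>N $ k \<bullet> P (m i) (m j)\<bar>)"
            by (intro sum_mono e)
          also have "\<dots> = \<sigma> * B" unfolding B_def by (simp only: sum_distrib_left)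
          finally show ?thesis .
        qed
        have "\<bar>x \<bullet> \<xi> + y \<bullet> Q \<xi> - (x \<bullet> c + y \<bullet> P c c)\<bar> \<le> 3 * \<sigma> + \<sigma> * B"
          unfolding ph using 1 2 by linarith
        also have "\<dots> = 1 / 6" using \<sigma>(2) by (simp add: algebra_simps)
        finally show "\<bar>x \<bullet> \<xi> + y \<bullet> Q \<xi> - (x \<bullet> c + y \<bullet> P c c)\<bar> \<le> 1 / 6" .
      qed
    qed
    show "\<exists>S D. S \<in> sets borel \<and> S \<subseteq> unit_cube \<and> emeasure lborel S = ennreal (s * \<delta> ^ a) \<and>
      D \<in> sets borel \<and> D \<subseteq> ball 0 (C / \<delta> ^ (a + b)) \<and> emeasure lborel D = ennreal (d / \<delta> ^ (a + b)) \<and>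
      (\<forall>w\<in>D. s * \<delta> ^ a / 2 \<le> norm (extension_op Q (\<lambda>\<xi>. if \<xi> \<in> S then 1 else 0) w))"
      using Sm cube Se Dm Dball De lower by blast
  qed
qed

text \<open>On the Knapp example the estimate compares \<delta>^(a - (a+b)/q) with R^\<epsilon>
  \<delta>^(a/2), where R is of size \<delta>^(-(a+b)). The condition on q says (a + b)/q > a/2, so
  the estimate fails for small \<epsilon> as \<delta> tends to 0.\<close>

lemma knapp_necessary:
  fixes M :: "real^3^3" and N :: "real^2^2" and \<alpha> :: "3 \<Rightarrow> nat" and \<beta> :: "2 \<Rightarrow> nat"
  assumes M: "det M \<noteq> 0" and N: "det N \<noteq> 0"
    and vanish: "\<And>i j k. \<alpha> i + \<alpha> j < \<beta> k \<Longrightarrow> N $ k \<bullet> P (column i M) (column j M) = 0"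
    and a: "a = (\<Sum>i\<in>UNIV. \<alpha> i)" and b: "b = (\<Sum>k\<in>UNIV. \<beta> k)"
    and q: "q \<ge> 1" "q * real a < 2 * (real a + real b)"
  shows "\<not> extension_estimate_eps Q q"
proof
  assume est: "extension_estimate_eps Q q"
  define m where "m = a + b"
  define g where "g = real m / q - real a / 2"
  have g: "g > 0" using q by (simp add: g_def m_def field_simps)
  have m: "m > 0" 
  proof (rule ccontr)
    assume "\<not> m > 0"
    then have "a = 0" "b = 0" by (simp_all add: m_def)
    then show False using q(2) by simp
  qed
  \<comment> \<open>Makes R^\<epsilon> of size \<delta>^(-g/2), which spends half of the gap
    \<open>g\<close>.\<close>
  define \<epsilon> where "\<epsilon> = g / (2 * real m)"
  have \<epsilon>: "\<epsilon> > 0" using g m by (simp add: \<epsilon>_def)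
  obtain s d C where sdC: "s > 0" "d > 0" "C \<ge> 1" and
    ex: "\<And>\<delta>. 0 < \<delta> \<Longrightarrow> \<delta> \<le> 1 \<Longrightarrow> \<exists>S D. S \<in> sets borel \<and> S \<subseteq> unit_cube \<and> emeasure lborel S = ennreal (s * \<delta> ^ a) \<and>
      D \<in> sets borel \<and> D \<subseteq> ball 0 (C / \<delta> ^ m) \<and> emeasure lborel D = ennreal (d / \<delta> ^ m) \<and>
      (\<forall>w\<in>D. s * \<delta> ^ a / 2 \<le> norm (extension_op Q (\<lambda>\<xi>. if \<xi> \<in> S then 1 else 0) w))"
    unfolding m_def a b
  proof (rule knapp_example[of M N \<alpha> \<beta>])
    fix s d C :: real
    assume h: "s > 0" "d > 0" "C \<ge> 1"
      "\<And>\<delta>. 0 < \<delta> \<Longrightarrow> \<delta> \<le> 1 \<Longrightarrow> \<exists>S D. S \<in> sets borel \<and> S \<subseteq> unit_cube \<and> emeasure lborel S = ennreal (s * \<delta> ^ sum \<alpha> UNIV) \<and>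
      D \<in> sets borel \<and> D \<subseteq> ball 0 (C / \<delta> ^ (sum \<alpha> UNIV + sum \<beta> UNIV)) \<and> emeasure lborel D = ennreal (d / \<delta> ^ (sum \<alpha> UNIV + sum \<beta> UNIV)) \<and>
      (\<forall>w\<in>D. s * \<delta> ^ sum \<alpha> UNIV / 2 \<le> norm (extension_op Q (\<lambda>\<xi>. if \<xi> \<in> S then 1 else 0) w))"
    show thesis by (rule that[OF h(1-3)]) (rule h(4)[folded a b, folded m_def])
  qed (use M N vanish in auto)
  obtain K where K: "\<And>R z f. R \<ge> 1 \<Longrightarrow> f \<in> Lp_space 2 unit_cube \<Longrightarrow>
      Lp_norm q (ball z R) (extension_op Q f) \<le> ennreal (K * R powr \<epsilon>) * Lp_norm 2 unit_cube f"
    using est \<epsilon> unfolding extension_estimate_eps_def by blast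
  define L where "L = 2 * \<bar>K\<bar> * C powr \<epsilon> / (sqrt s * d powr (1 / q))"
  have L: "L \<ge> 0" using sdC by (simp add: L_def)
  have key: "\<delta> powr (- (g / 2)) \<le> L" if \<delta>: "0 < \<delta>" "\<delta> \<le> 1" for \<delta>
  proof -
    obtain S D where SD: "S \<in> sets borel" "S \<subseteq> unit_cube" "emeasure lborel S = ennreal (s * \<delta> ^ a)"
      "D \<in> sets borel" "D \<subseteq> ball 0 (C / \<delta> ^ m)" "emeasure lborel D = ennreal (d / \<delta> ^ m)"
      "\<And>w. w \<in> D \<Longrightarrow> s * \<delta> ^ a / 2 \<le> norm (extension_op Q (\<lambda>\<xi>. if \<xi> \<in> S then 1 else 0) w)"
      using ex[OF \<delta>] by blast
    let ?f = "\<lambda>\<xi>. if \<xi> \<in> S then 1 else 0 :: complex"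
    have pos: "s * \<delta> ^ a > 0" "d / \<delta> ^ m > 0" using sdC \<delta> by simp_all
    have R: "C / \<delta> ^ m \<ge> 1"
    proof -
      have "\<delta> ^ m \<le> 1" using \<delta> by (intro power_le_one) auto
      then show ?thesis using sdC(3) \<delta> by (simp add: pos_le_divide_eq)
    qed
    have f: "?f \<in> Lp_space 2 unit_cube" "Lp_norm 2 unit_cube ?f = ennreal (sqrt (s * \<delta> ^ a))"
      using indicator_Lp_space[OF SD(1-3)] pos by simp_all
    have "ennreal ((s * \<delta> ^ a / 2) * (d / \<delta> ^ m) powr (1 / q)) \<le> Lp_norm q (ball 0 (C / \<delta> ^ m)) (extension_op Q ?f)"
      using pos q(1) by (intro Lp_norm_ge[OF SD(4,5) _ SD(7) SD(6)]) auto
    also have "\<dots> \<le> ennreal (K * (C / \<delta> ^ m) powr \<epsilon>) * ennreal (sqrt (s * \<delta> ^ a))"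
      using K[OF R f(1), of 0] unfolding f(2) .
    also have "\<dots> \<le> ennreal (\<bar>K\<bar> * (C / \<delta> ^ m) powr \<epsilon>) * ennreal (sqrt (s * \<delta> ^ a))"
      by (intro mult_right_mono ennreal_leI) auto
    also have "\<dots> = ennreal (\<bar>K\<bar> * (C / \<delta> ^ m) powr \<epsilon> * sqrt (s * \<delta> ^ a))"
      by (rule ennreal_mult'[symmetric]) simp
    finally have "(s * \<delta> ^ a / 2) * (d / \<delta> ^ m) powr (1 / q) \<le> \<bar>K\<bar> * (C / \<delta> ^ m) powr \<epsilon> * sqrt (s * \<delta> ^ a)"
      using pos by (subst (asm) ennreal_le_iff) auto
    then have "(sqrt (s * \<delta> ^ a) * sqrt (s * \<delta> ^ a) / 2) * (d / \<delta> ^ m) powr (1 / q) \<le> \<bar>K\<bar> * (C / \<delta> ^ m) powr \<epsilon> * sqrt (s * \<delta> ^ a)"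
      using pos by simp
    then have "sqrt (s * \<delta> ^ a) * (sqrt (s * \<delta> ^ a) * (d / \<delta> ^ m) powr (1 / q)) \<le> sqrt (s * \<delta> ^ a) * (2 * \<bar>K\<bar> * (C / \<delta> ^ m) powr \<epsilon>)"
      by (simp add: mult_ac del: real_sqrt_mult_self)
    then have "sqrt (s * \<delta> ^ a) * (d / \<delta> ^ m) powr (1 / q) \<le> 2 * \<bar>K\<bar> * (C / \<delta> ^ m) powr \<epsilon>"
      using pos(1) by (subst (asm) mult_le_cancel_left_pos) auto
    also have "sqrt (s * \<delta> ^ a) = sqrt s * \<delta> powr (real a / 2)"
    proof -
      have "sqrt (\<delta> ^ a) = (\<delta> powr real a) powr (1 / 2)" using \<delta> by (simp add: powr_realpow powr_half_sqrt)
      then show ?thesis by (simp add: real_sqrt_mult powr_powr)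
    qed
    also have "(d / \<delta> ^ m) powr (1 / q) = d powr (1 / q) * \<delta> powr (- (real m / q))"
    proof -
      have "(d / \<delta> ^ m) powr (1 / q) = d powr (1 / q) / (\<delta> powr real m) powr (1 / q)" using \<delta> by (simp add: powr_divide powr_realpow)
      then show ?thesis by (simp add: powr_powr powr_minus_divide)
    qed
    also have "(C / \<delta> ^ m) powr \<epsilon> = C powr \<epsilon> * \<delta> powr (- (g / 2))"
    proof -
      have "(C / \<delta> ^ m) powr \<epsilon> = C powr \<epsilon> / (\<delta> powr real m) powr \<epsilon>" using \<delta> by (simp add: powr_divide powr_realpow)
      also have "(\<delta> powr real m) powr \<epsilon> = \<delta> powr (real m * \<epsilon>)" by (rule powr_powr)
      also have "real m * \<epsilon> = g / 2" using m by (simp add: \<epsilon>_def)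
      finally show ?thesis by (simp add: powr_minus_divide)
    qed
    finally have "(sqrt s * d powr (1 / q)) * (\<delta> powr (real a / 2) * \<delta> powr (- (real m / q))) \<le> 2 * \<bar>K\<bar> * C powr \<epsilon> * \<delta> powr (- (g / 2))"
      by (simp only: mult_ac)
    also have "\<delta> powr (real a / 2) * \<delta> powr (- (real m / q)) = \<delta> powr (- (g / 2)) * \<delta> powr (- (g / 2))"
      by (simp add: g_def flip: powr_add)
    finally have "\<delta> powr (- (g / 2)) * ((sqrt s * d powr (1 / q)) * \<delta> powr (- (g / 2))) \<le> \<delta> powr (- (g / 2)) * (2 * \<bar>K\<bar> * C powr \<epsilon>)"
      by (simp only: mult_ac)
    then have "(sqrt s * d powr (1 / q)) * \<delta> powr (- (g / 2)) \<le> 2 * \<bar>K\<bar> * C powr \<epsilon>"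
      using \<delta> by (subst (asm) mult_le_cancel_left_pos) auto
    then show ?thesis unfolding L_def using sdC by (simp add: pos_le_divide_eq mult.commute)
  qed
  \<comment> \<open>The solution of \<open>\<delta> powr (- (g / 2)) = L + 1\<close>, incompatible
    with \<open>key\<close>.\<close>
  define \<delta> where "\<delta> = (L + 1) powr (- (2 / g))"
  have "\<delta> > 0" using L by (simp add: \<delta>_def)
  moreover have "\<delta> \<le> 1"
  proof -
    have "(L + 1) powr (- (2 / g)) \<le> (L + 1) powr 0" using L g by (intro powr_mono) auto
    then show ?thesis using L by (simp add: \<delta>_def)
  qed
  ultimately have "\<delta> powr (- (g / 2)) \<le> L" by (rule key)
  moreover have "\<delta> powr (- (g / 2)) = L + 1"
  proof -
    have "\<delta> powr (- (g / 2)) = (L + 1) powr (- (2 / g) * - (g / 2))" unfolding \<delta>_def by (rule powr_powr)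
    also have "- (2 / g) * - (g / 2) = 1" using g by simp
    finally show ?thesis using L by simp
  qed
  ultimately show False by simp
qed

end

text \<open>The Knapp examples refute even the estimate with an R^\<epsilon> loss; by this
  implication they settle the estimate without loss as well.\<close>

lemma extension_estimate_imp_eps:
  assumes "extension_estimate Q q"
  shows "extension_estimate_eps Q q"
  unfolding extension_estimate_eps_def
proof (intro allI impI)
  fix \<epsilon> :: real assume \<epsilon>: "\<epsilon> > 0"
  obtain C where C: "\<And>R z f. R \<ge> 1 \<Longrightarrow> f \<in> Lp_space 2 unit_cube \<Longrightarrow>
      Lp_norm q (ball z R) (extension_op Q f) \<le> ennreal C * Lp_norm 2 unit_cube f"
    using assms unfolding extension_estimate_def by blast
  have le: "C \<le> \<bar>C\<bar> * R powr \<epsilon>" if "R \<ge> 1" for R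
  proof -
    have "\<bar>C\<bar> * 1 \<le> \<bar>C\<bar> * R powr \<epsilon>" using that \<epsilon> by (intro mult_left_mono ge_one_powr_ge_zero) auto
    then show ?thesis by linarith
  qed
  show "\<exists>C. \<forall>R\<ge>1. \<forall>z. \<forall>f\<in>Lp_space 2 unit_cube.
      Lp_norm q (ball z R) (extension_op Q f) \<le> ennreal (C * R powr \<epsilon>) * Lp_norm 2 unit_cube f"
  proof (intro exI[of _ "\<bar>C\<bar>"] allI impI ballI)
    fix R z and f :: "real^'a \<Rightarrow> complex"
    assume R: "R \<ge> (1 :: real)" and f: "f \<in> Lp_space 2 unit_cube"
    show "Lp_norm q (ball z R) (extension_op Q f) \<le> ennreal (\<bar>C\<bar> * R powr \<epsilon>) * Lp_norm 2 unit_cube f"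
      by (rule order_trans[OF C[OF R f] mult_right_mono[OF ennreal_leI[OF le[OF R]]]]) simp
  qed
qed

section \<open>Scalings that refute the smaller exponents\<close>

context symmetric_bilinear
begin

text \<open>Isotropic parabolic scaling is adapted to every pair of quadratic forms: a = 3 and b = 4
  give the condition 3q < 14.\<close>

lemma not_estimate_generic:
  assumes "q \<ge> 1" "q < 14 / 3"
  shows "\<not> extension_estimate_eps Q q"
  by (rule knapp_necessary[where M = "mat 1" and N = "mat 1" and \<alpha> = "\<lambda>_. 1" and \<beta> = "\<lambda>_. 2" and a = 3 and b = 4])
    (use assms in auto)

text \<open>Both forms vanish on the plane of \<open>u\<close> and \<open>u'\<close>, so only the
  third direction has to be shortened, to \<delta>^2, for both forms to vary by O(\<delta>^2) apart
  from linear terms: 2q < 12.\<close>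

lemma not_estimate_zero_plane:
  assumes uu': "indep2 u u'" and z: "P u u = 0" "P u u' = 0" "P u' u' = 0" and q: "q \<ge> 1" "q < 6"
  shows "\<not> extension_estimate_eps Q q"
proof -
  obtain w where M: "det (columns3 u u' w) \<noteq> 0" by (rule indep2_complete[OF uu'])
  have z': "P u' u = 0" using z(2) sym[of u' u] by simp
  define \<alpha> where "\<alpha> i = (if i = 3 then 2 else 0 :: nat)" for i :: 3
  have van: "\<forall>i j k. \<alpha> i + \<alpha> j < 2 \<longrightarrow> (mat 1 :: real^2^2) $ k \<bullet> P (column i (columns3 u u' w)) (column j (columns3 u u' w)) = 0"
    unfolding forall_3 by (simp add: \<alpha>_def z z')
  show ?thesis
  proof (rule knapp_necessary[where M = "columns3 u u' w" and N = "mat 1" and \<alpha> = \<alpha> and \<beta> = "\<lambda>_. 2" and a = 2 and b = 4])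
    show "2 = (\<Sum>i\<in>UNIV. \<alpha> i)" by (simp add: \<alpha>_def)
  qed (use M van q in auto)
qed

text \<open>One member of the pencil is a multiple of the square of the third coordinate. Shortening
  this coordinate to \<delta> extends the dual set by \<delta>^(-2) in the direction
  \<open>a\<close>, while the other direction is left at unit size: q < 6.\<close>

lemma not_estimate_rank_one:
  assumes a: "a \<noteq> 0" and av: "\<And>x. a \<bullet> P v x = 0" and aw: "\<And>x. a \<bullet> P w x = 0" and M: "det (columns3 v w u) \<noteq> 0"
    and q: "q \<ge> 1" "q < 6"
  shows "\<not> extension_estimate_eps Q q"
proof -
  define N where "N = (vector [a, vector [- a $ 2, a $ 1]] :: real^2^2)"
  have N: "det N \<noteq> 0" unfolding N_def det2_indep2 by (rule plane_indep2[OF a])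
  have s: "a \<bullet> P x v = 0" "a \<bullet> P x w = 0" for x using av[of x] aw[of x] sym[of x v] sym[of x w] by simp_all
  define \<alpha> where "\<alpha> i = (if i = 3 then 1 else 0 :: nat)" for i :: 3
  define \<beta> where "\<beta> k = (if k = 1 then 2 else 0 :: nat)" for k :: 2
  have van: "\<forall>i j k. \<alpha> i + \<alpha> j < \<beta> k \<longrightarrow> N $ k \<bullet> P (column i (columns3 v w u)) (column j (columns3 v w u)) = 0"
    unfolding forall_3 forall_2 by (simp add: \<alpha>_def \<beta>_def N_def av aw s)
  show ?thesis
  proof (rule knapp_necessary[where M = "columns3 v w u" and N = N and \<alpha> = \<alpha> and \<beta> = \<beta> and a = 1 and b = 2])
    show "1 = (\<Sum>i\<in>UNIV. \<alpha> i)" "2 = (\<Sum>k\<in>UNIV. \<beta> k)" by (simp_all add: \<alpha>_def \<beta>_def)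
  qed (use M N van q in auto)
qed

end

lemma mat_1_inner: "(mat 1 :: real^'n^'n) $ k \<bullet> z = z $ k"
proof -
  have "(mat 1 :: real^'n^'n) $ k = axis k 1" by (simp add: vec_eq_iff mat_def axis_def)
  then show ?thesis by (simp add: inner_axis' )
qed

text \<open>With weights 2, 1, 0 for the variables the two forms are homogeneous of weights 3 and 2,
  so a = 3 and b = 5: 3q < 16.\<close>

lemma not_estimate_16_3:
  assumes q: "q \<ge> 1" "q < 16 / 3"
  shows "\<not> extension_estimate_eps (\<lambda>\<xi> :: real^3. vector [\<xi> $ 1 * \<xi> $ 2, (\<xi> $ 2)\<^sup>2 + \<xi> $ 1 * \<xi> $ 3] :: real^2) q"
proof -
  define Q where "Q = (\<lambda>\<xi> :: real^3. vector [\<xi> $ 1 * \<xi> $ 2, (\<xi> $ 2)\<^sup>2 + \<xi> $ 1 * \<xi> $ 3] :: real^2)"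
  define P where "P u v = (vector [(u $ 1 * v $ 2 + u $ 2 * v $ 1) / 2, u $ 2 * v $ 2 + (u $ 1 * v $ 3 + u $ 3 * v $ 1) / 2] :: real^2)"
    for u v :: "real^3"
  interpret symmetric_bilinear P Q
  proof
    show "bilinear P" unfolding bilinear_def
      by (auto intro!: linearI simp: P_def vec_eq_iff forall_2 field_simps)
    show "P u v = P v u" "Q u = P u u" for u v
      by (simp_all add: P_def Q_def vec_eq_iff forall_2 power2_eq_square algebra_simps)
  qed
  define \<alpha> where "\<alpha> i = (if i = 1 then 2 else if i = 2 then 1 else 0 :: nat)" for i :: 3
  define \<beta> where "\<beta> k = (if k = 1 then 3 else 2 :: nat)" for k :: 2
  have van: "\<forall>i j k. \<alpha> i + \<alpha> j < \<beta> k \<longrightarrow> (mat 1 :: real^2^2) $ k \<bullet> P (column i (mat 1)) (column j (mat 1)) = 0"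
    unfolding mat_1_inner column_mat_1 forall_3 forall_2
    by (simp add: \<alpha>_def \<beta>_def P_def axis_def)
  have "\<not> extension_estimate_eps Q q"
  proof (rule knapp_necessary[where M = "mat 1" and N = "mat 1" and \<alpha> = \<alpha> and \<beta> = \<beta> and a = 3 and b = 5])
    show "3 = (\<Sum>i\<in>UNIV. \<alpha> i)" "5 = (\<Sum>k\<in>UNIV. \<beta> k)" by (simp_all add: \<alpha>_def \<beta>_def sum_3 sum_2)
  qed (use van q in auto)
  then show ?thesis by (simp add: Q_def)
qed

text \<open>With weights 1, 0, 1 for the variables the two forms are homogeneous of weights 1 and 2,
  so a = 2 and b = 3: 2q < 10.\<close>

lemma not_estimate_5:
  fixes e :: real
  assumes q: "q \<ge> 1" "q < 5"
  shows "\<not> extension_estimate_eps (\<lambda>\<xi> :: real^3. vector [\<xi> $ 1 * \<xi> $ 2, (\<xi> $ 1)\<^sup>2 + e * (\<xi> $ 3)\<^sup>2] :: real^2) q"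
proof -
  define Q where "Q = (\<lambda>\<xi> :: real^3. vector [\<xi> $ 1 * \<xi> $ 2, (\<xi> $ 1)\<^sup>2 + e * (\<xi> $ 3)\<^sup>2] :: real^2)"
  define P where "P u v = (vector [(u $ 1 * v $ 2 + u $ 2 * v $ 1) / 2, u $ 1 * v $ 1 + e * (u $ 3 * v $ 3)] :: real^2)"
    for u v :: "real^3"
  interpret symmetric_bilinear P Q
  proof
    show "bilinear P" unfolding bilinear_def
      by (auto intro!: linearI simp: P_def vec_eq_iff forall_2 field_simps)
    show "P u v = P v u" "Q u = P u u" for u v
      by (simp_all add: P_def Q_def vec_eq_iff forall_2 power2_eq_square algebra_simps)
  qed
  define \<alpha> where "\<alpha> i = (if i = 2 then 0 else 1 :: nat)" for i :: 3
  define \<beta> where "\<beta> k = (if k = 1 then 1 else 2 :: nat)" for k :: 2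
  have van: "\<forall>i j k. \<alpha> i + \<alpha> j < \<beta> k \<longrightarrow> (mat 1 :: real^2^2) $ k \<bullet> P (column i (mat 1)) (column j (mat 1)) = 0"
    unfolding mat_1_inner column_mat_1 forall_3 forall_2
    by (simp add: \<alpha>_def \<beta>_def P_def axis_def)
  have "\<not> extension_estimate_eps Q q"
  proof (rule knapp_necessary[where M = "mat 1" and N = "mat 1" and \<alpha> = \<alpha> and \<beta> = \<beta> and a = 2 and b = 3])
    show "2 = (\<Sum>i\<in>UNIV. \<alpha> i)" "3 = (\<Sum>k\<in>UNIV. \<beta> k)" by (simp_all add: \<alpha>_def \<beta>_def sum_3 sum_2)
  qed (use van q in auto)
  then show ?thesis by (simp add: Q_def)
qed

section \<open>Assembly of the cases\<close>

theorem theorem7p1: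
  fixes Q :: "real^3 \<Rightarrow> real^2"
  assumes "\<And>j. quadratic_form (\<lambda>\<xi>. Q \<xi> $ j)"
    and "frak_d TYPE(2) 3 Q = 3"
  shows
    "((frak_d TYPE(1) 3 Q, frak_d TYPE(2) 2 Q) \<in> {(1, 1), (1, 2), (2, 0)} \<longrightarrow>
        extension_estimate_eps Q 6 \<and>
        (\<forall>q::real. 1 \<le> q \<and> q < 6 \<longrightarrow> \<not> extension_estimate_eps Q q)) \<and>
     (frak_d TYPE(1) 3 Q = 2 \<and> frak_d TYPE(2) 2 Q = 1 \<longrightarrow>
        (Q = (\<lambda>\<xi>. vector [\<xi> $ 1 * \<xi> $ 2, (\<xi> $ 2)\<^sup>2 + \<xi> $ 1 * \<xi> $ 3]) \<longrightarrow>
           extension_estimate_eps Q (16 / 3) \<and>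
           (\<forall>q::real. 1 \<le> q \<and> q < 16 / 3 \<longrightarrow> \<not> extension_estimate_eps Q q)) \<and>
        (Q = (\<lambda>\<xi>. vector [\<xi> $ 1 * \<xi> $ 2, (\<xi> $ 1)\<^sup>2 + (\<xi> $ 3)\<^sup>2]) \<or>
         Q = (\<lambda>\<xi>. vector [\<xi> $ 1 * \<xi> $ 2, (\<xi> $ 1)\<^sup>2 - (\<xi> $ 3)\<^sup>2]) \<longrightarrow>
           extension_estimate_eps Q 5 \<and>
           (\<forall>q::real. 1 \<le> q \<and> q < 5 \<longrightarrow> \<not> extension_estimate_eps Q q))) \<and>
     (frak_d TYPE(1) 3 Q = 2 \<and> frak_d TYPE(2) 2 Q = 2 \<longrightarrow>
        extension_estimate Q (14 / 3) \<and>
        (\<forall>q::real. 1 \<le> q \<and> q < 14 / 3 \<longrightarrow> \<not> extension_estimate Q q))"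
proof -
  obtain P where P: "bilinear P" "\<And>u v. P u v = P v u" "\<And>u. Q u = P u u"
    by (rule quadratic_polarization[OF assms(1)], rule that)
  interpret symmetric_bilinear P Q by standard (use P in auto)
  note nondeg = frak_d_3_2_nondegenerate[OF assms(2)]
  \<comment> \<open>Covers the pairs (1, 1) and (1, 2); the remaining pair (2, 0) of the first case
    is reached in \<open>two\<close> through its second entry.\<close>
  have one: "extension_estimate_eps Q 6 \<and> (\<forall>q. 1 \<le> q \<and> q < 6 \<longrightarrow> \<not> extension_estimate_eps Q q)"
    if d: "frak_d TYPE(1) 3 Q = 1"
  proof -
    obtain a u v w where h: "a \<noteq> 0" "a \<bullet> P u u \<noteq> 0" "indep2 v w" "\<And>x. a \<bullet> P v x = 0" "\<And>x. a \<bullet> P w x = 0"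
      "det (columns3 v w u) \<noteq> 0"
      using frak_d_3_1_one[OF d] by metis
    obtain m m' where m: "indep2 m m'" "P m m' = 0" "indep2 (P m m) (P m' m')"
      by (rule orthogonal_pair[OF nondeg h])
    show ?thesis
      using L6_estimate_orthogonal[OF m] not_estimate_rank_one[OF h(1,4,5,6)] by blast
  qed
  have two: "extension_estimate_eps Q 6 \<and> (\<forall>q. 1 \<le> q \<and> q < 6 \<longrightarrow> \<not> extension_estimate_eps Q q)"
    if d: "frak_d TYPE(2) 2 Q = 0"
  proof -
    obtain u u' where h: "indep2 u u'" "P u u = 0" "P u u' = 0" "P u' u' = 0"
      by (rule frak_d_2_2_zero_plane[OF d])
    show ?thesis
      using L6_estimate_isotropic[OF h nondeg] not_estimate_zero_plane[OF h] by blast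
  qed
  have five: "extension_estimate_eps Q 5 \<and> (\<forall>q. 1 \<le> q \<and> q < 5 \<longrightarrow> \<not> extension_estimate_eps Q q)"
    if Q: "Q = (\<lambda>\<xi>. vector [\<xi> $ 1 * \<xi> $ 2, (\<xi> $ 1)\<^sup>2 + (\<xi> $ 3)\<^sup>2]) \<or>
         Q = (\<lambda>\<xi>. vector [\<xi> $ 1 * \<xi> $ 2, (\<xi> $ 1)\<^sup>2 - (\<xi> $ 3)\<^sup>2])"
  proof -
    obtain e :: real where e: "\<bar>e\<bar> = 1" "Q = (\<lambda>\<xi>. vector [\<xi> $ 1 * \<xi> $ 2, (\<xi> $ 1)\<^sup>2 + e * (\<xi> $ 3)\<^sup>2])"
      using Q
    proof
      assume "Q = (\<lambda>\<xi>. vector [\<xi> $ 1 * \<xi> $ 2, (\<xi> $ 1)\<^sup>2 + (\<xi> $ 3)\<^sup>2])"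
      then show thesis by (intro that[of 1]) simp_all
    next
      assume "Q = (\<lambda>\<xi>. vector [\<xi> $ 1 * \<xi> $ 2, (\<xi> $ 1)\<^sup>2 - (\<xi> $ 3)\<^sup>2])"
      then show thesis by (intro that[of "-1"]) simp_all
    qed
    show ?thesis unfolding e(2) using L5_estimate[OF e(1)] not_estimate_5 by blast
  qed
  have sixteen: "extension_estimate_eps Q (16 / 3) \<and> (\<forall>q. 1 \<le> q \<and> q < 16 / 3 \<longrightarrow> \<not> extension_estimate_eps Q q)"
    if Q: "Q = (\<lambda>\<xi>. vector [\<xi> $ 1 * \<xi> $ 2, (\<xi> $ 2)\<^sup>2 + \<xi> $ 1 * \<xi> $ 3])"
    unfolding Q using L16_3_estimate not_estimate_16_3 by blast
  have three: "extension_estimate Q (14 / 3) \<and> (\<forall>q. 1 \<le> q \<and> q < 14 / 3 \<longrightarrow> \<not> extension_estimate Q q)"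
    if d: "frak_d TYPE(1) 3 Q = 2" "frak_d TYPE(2) 2 Q = 2"
  proof
    show "extension_estimate Q (14 / 3)"
      by (rule L14_3_estimate) (fact frak_d_3_1_rank[OF d(1)], fact frak_d_2_2_isotropic[OF d(2)])
    show "\<forall>q. 1 \<le> q \<and> q < 14 / 3 \<longrightarrow> \<not> extension_estimate Q q"
      using not_estimate_generic extension_estimate_imp_eps by blast
  qed
  show ?thesis
    using one two three five sixteen by auto
qed

end
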